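(* Let $M$ be a non-zero submodule of $\mathcal O_n^p$ and let $r=\operatorname{rank}(M)$. Then the following conditions are equivalent: (1) $M$ is Newton non-degenerate. (2) $\overline{\mathbf I_r(M_L)}=\overline{\prod_{i\in L}M_i^0}$ for all $L\in\Lambda_M$. (3) $\overline{M_{\{i_1,\dots,i_r\}}}=M_{i_1}^0\oplus\cdots\oplus M_{i_r}^0$ for all $(i_1,\dots,i_r)\in\Lambda_M$. (4) $M$ is integrally decomposable and $M_i$ is Newton non-degenerate for all $i=1,\dots,p$.
   Context: $\mathcal O_n$ is the local ring of analytic function germs $(\mathbb C^n,0)\to\mathbb C$, with fixed coordinates $x_1,\dots,x_n$; $x^{\mathbf k}=x_1^{k_1}\cdots x_n^{k_n}$. Since $\mathcal O_n$ is a domain, every submodule $M\subseteq\mathcal O_n^p$ has a rank (its rank over the fraction field). A submodule $M\subseteq\mathcal O_n^p$ is identified with a matrix whose columns generate it; $\mathbf I_i(M)$ is the ideal generated by its $i\times i$ minors. For non-empty $L\subseteq\{1,\dots,p\}$, $M_L\subseteq\mathcal O_n^{|L|}$ is the projection of $M$ to the components in $L$; $M_i=M_{\{i\}}$ is the ideal generated by the $i$-th row. A submodule $N\subseteq\mathcal O_n^q$ is decomposable if $N=N_1\oplus\cdots\oplus N_q$. For $r=\operatorname{rank}(M)$, $\Lambda_M$ is the set of $(i_1,\dots,i_r)$ with $1\le i_1<\cdots<i_r\le p$ such that some minor of $M$ formed from rows $i_1,\dots,i_r$ is non-zero (regarded also as subsets of $\{1,\dots,p\}$). $M$ is integrally decomposable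 if $\overline{M_L}$ is decomposable for all $L\in\Lambda_M$. Integral closure: with $R=\mathcal O_n$, $h\in R^p$ is integral over $M$ if for every discrete valuation ring or field $V$ between $R$ and its fraction field, the image of $h$ in $V^p$ lies in the $V$-submodule generated by the image of $M$; $\overline M\subseteq R^p$ is the submodule of elements integral over $M$ (for ideals, the usual integral closure). Newton polyhedra: for $f=\sum a_{\mathbf k}x^{\mathbf k}\in\mathcal O_n$, $\operatorname{supp}(f)=\{\mathbf k:a_{\mathbf k}\ne0\}$; for a non-zero ideal $I$, $\operatorname{supp}(I)=\bigcup_{f\in I}\operatorname{supp}(f)$ and $\Gamma_+(I)$ is the convex hull of $\{\mathbf k+\mathbf v:\mathbf k\in\operatorname{supp}(I),\mathbf v\in\mathbb R_{\ge0}^n\}$; $\Gamma_+(0)=\emptyset$. $I^0$ is the ideal generated by all monomials $x^{\mathbf k}$ with $\mathbf k\in\Gamma_+(I)$, and $I^0=0$ if $I=0$. $\Gamma_+(M)=\Gamma_+(M_1)+\cdots+\Gamma_+(M_p)$ (Minkowski sum), and $\mathscr F_c(\Gamma_+(M))$ is its set of compact faces. For compact $\Delta\subseteq\mathbb R^n_{\ge0}$, $f_\Delta$ is the sum of the terms $a_{\mathbf k}x^{\mathbf k}$ of $f$ with $\mathbf k\in\Delta$ ($f_\Delta=0$ if there are none). Newton non-degeneracy of a non-zero $M\subseteq\mathcal O_n^p$ of rank $r$ with $p\times m$ generating matrix $[m_{ij}]$, $p\le m$: if $r=p$, $M$ is Newton non-degenerate when $\{x\in\mathbb C^n:\operatorname{rank}[(m_{ij})_{\Delta_i}(x)]<p\}\subseteq\{x\in\mathbb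 C^n:x_1\cdots x_n=0\}$ for every $\Delta\in\mathscr F_c(\Gamma_+(M))$, where $\Delta=\Delta_1+\cdots+\Delta_p$ with $\Delta_i$ a compact face of $\Gamma_+(M_i)$. If $r<p$, $M$ is Newton non-degenerate when $M_L\subseteq\mathcal O_n^r$ (of rank $r$) is Newton non-degenerate for every $L\in\Lambda_M$. In particular, an ideal $I=(g_1,\dots,g_s)$ is Newton non-degenerate iff $\{x\in\mathbb C^n:(g_1)_\Delta(x)=\cdots=(g_s)_\Delta(x)=0\}\subseteq\{x_1\cdots x_n=0\}$ for all $\Delta\in\mathscr F_c(\Gamma_+(I))$; this condition is vacuously true for the zero ideal, since $\Gamma_+(0)=\emptyset$. *)

theory Defs
  imports
    "HOL-Analysis.Analysis"
    "HOL-Computational_Algebra.Polynomial_Factorial"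
    "Jordan_Normal_Form.Determinant"
    "Jordan_Normal_Form.DL_Rank"
    "Jordan_Normal_Form.DL_Submatrix"
begin

text \<open>
  Both \<^theory>\<open>HOL-Analysis.Finite_Cartesian_Product\<close> and
  \<^theory>\<open>Jordan_Normal_Form.Matrix\<close> use \<open>$\<close>; here it is the latter's \<^const>\<open>vec_index\<close>.
\<close>
unbundle no vec_syntax

section \<open>The ring of analytic germs\<close>

text \<open>
  A germ at the origin of an analytic function in the coordinates indexed by \<open>'n\<close> is
  identified with its Taylor series \<open>\<Sum>k. f k * x^k\<close>, that is, with a power series converging
  absolutely on a polydisc of some radius \<open>r > 0\<close>. Exponents are elements of \<open>nat ^ 'n\<close>.
\<close>

definition total_degree :: "nat ^ 'n \<Rightarrow> nat" where
  "total_degree k = (\<Sum>i\<in>UNIV. vec_nth k i)"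

definition convergent_power_series :: "(nat ^ 'n \<Rightarrow> complex) \<Rightarrow> bool" where
  "convergent_power_series f \<longleftrightarrow>
     (\<exists>r>0. (\<lambda>k. norm (f k) * r ^ total_degree k) summable_on UNIV)"

definition monomial_series :: "nat ^ 'n \<Rightarrow> complex \<Rightarrow> nat ^ 'n \<Rightarrow> complex" where
  "monomial_series k c = (\<lambda>j. if j = k then c else 0)"

definition cauchy_product ::
  "(nat ^ 'n \<Rightarrow> complex) \<Rightarrow> (nat ^ 'n \<Rightarrow> complex) \<Rightarrow> nat ^ 'n \<Rightarrow> complex" where
  "cauchy_product f g k = (\<Sum>(i, j) | i + j = k. f i * g j)"

lemma total_degree_add: "total_degree (i + j) = total_degree i + total_degree j"
  by (simp add: total_degree_def sum.distrib)

lemma finite_vec_le: "finite {i :: nat ^ 'n. \<forall>t. vec_nth i t \<le> b t}"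
proof -
  have "finite (PiE UNIV (\<lambda>t. {..b t}))"
    by (intro finite_PiE) auto
  then have "finite (vec_lambda ` PiE UNIV (\<lambda>t. {..b t}))"
    by (rule finite_imageI)
  moreover have "{i :: nat ^ 'n. \<forall>t. vec_nth i t \<le> b t} \<subseteq> vec_lambda ` PiE UNIV (\<lambda>t. {..b t})"
  proof
    fix i :: "nat ^ 'n" assume i: "i \<in> {i. \<forall>t. vec_nth i t \<le> b t}"
    have "i = vec_lambda (vec_nth i)" by simp
    moreover have "vec_nth i \<in> PiE UNIV (\<lambda>t. {..b t})" using i by auto
    ultimately show "i \<in> vec_lambda ` PiE UNIV (\<lambda>t. {..b t})" by blast
  qed
  ultimately show ?thesis by (rule finite_subset[rotated])
qed

lemma finite_add_eq: "finite {(i, j :: nat ^ 'n). i + j = k}"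
proof -
  let ?B = "{i :: nat ^ 'n. \<forall>t. vec_nth i t \<le> vec_nth k t}"
  have "finite (?B \<times> ?B)"
    by (intro finite_cartesian_product finite_vec_le)
  moreover have "{(i, j :: nat ^ 'n). i + j = k} \<subseteq> ?B \<times> ?B"
    by auto
  ultimately show ?thesis by (rule finite_subset[rotated])
qed

lemma cauchy_product_comm:
  fixes f g :: "nat ^ 'n \<Rightarrow> complex"
  shows "cauchy_product f g = cauchy_product g f"
proof
  fix k :: "nat ^ 'n"
  show "cauchy_product f g k = cauchy_product g f k"
    unfolding cauchy_product_def
    by (rule sum.reindex_bij_witness[of _ prod.swap prod.swap]) (auto simp: add.commute)
qed

lemma cauchy_product_assoc:
  fixes f g h :: "nat ^ 'n \<Rightarrow> complex"
  shows "cauchy_product (cauchy_product f g) h = cauchy_product f (cauchy_product g h)"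
proof
  fix k :: "nat ^ 'n"
  have "cauchy_product (cauchy_product f g) h k =
        (\<Sum>p\<in>{(m, l). m + l = k}. \<Sum>q\<in>{(i, j). i + j = fst p}. f (fst q) * g (snd q) * h (snd p))"
    by (simp add: cauchy_product_def sum_distrib_right case_prod_unfold)
  also have "\<dots> = (\<Sum>(p, q)\<in>Sigma {(m, l). m + l = k} (\<lambda>p. {(i, j). i + j = fst p}).
                     f (fst q) * g (snd q) * h (snd p))"
    by (subst sum.Sigma) (auto intro: finite_add_eq)
  also have "\<dots> = (\<Sum>(p, q)\<in>Sigma {(i, m). i + m = k} (\<lambda>p. {(j, l). j + l = snd p}).
                     f (fst p) * (g (fst q) * h (snd q)))"
    by (rule sum.reindex_bij_witness[of _
          "\<lambda>((i, m), (j, l)). ((i + j, l), (i, j))" "\<lambda>((m, l), (i, j)). ((i, j + l), (j, l))"])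
       (auto simp: add.assoc mult.assoc)
  also have "\<dots> = (\<Sum>p\<in>{(i, m). i + m = k}. \<Sum>q\<in>{(j, l). j + l = snd p}.
                     f (fst p) * (g (fst q) * h (snd q)))"
    by (subst sum.Sigma) (auto intro: finite_add_eq)
  also have "\<dots> = cauchy_product f (cauchy_product g h) k"
    by (simp add: cauchy_product_def sum_distrib_left case_prod_unfold)
  finally show "cauchy_product (cauchy_product f g) h k = cauchy_product f (cauchy_product g h) k" .
qed

lemma cauchy_product_monomial_zero:
  fixes f :: "nat ^ 'n \<Rightarrow> complex"
  shows "cauchy_product (monomial_series 0 c) f = (\<lambda>k. c * f k)"
proof
  fix k :: "nat ^ 'n"
  have "cauchy_product (monomial_series 0 c) f k =
        (\<Sum>(i, j)\<in>{(0 :: nat ^ 'n, k)}. monomial_series 0 c i * f j)"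
    unfolding cauchy_product_def
    by (rule sum.mono_neutral_right) (auto simp: finite_add_eq monomial_series_def split: if_splits)
  then show "cauchy_product (monomial_series 0 c) f k = c * f k"
    by (simp add: monomial_series_def)
qed

lemma convergent_power_series_monomial: "convergent_power_series (monomial_series k c)"
proof -
  have "(\<lambda>j. norm (monomial_series k c j) * 1 ^ total_degree j) summable_on UNIV"
    by (rule finite_nonzero_values_imp_summable_on)
       (auto simp: monomial_series_def intro: finite_subset[of _ "{k}"])
  then show ?thesis
    unfolding convergent_power_series_def by (intro exI[of _ 1]) simp
qed

lemma convergent_power_series_common_radius:
  assumes "convergent_power_series f" "convergent_power_series g"
  obtains r where "r > 0" "(\<lambda>k. norm (f k) * r ^ total_degree k) summable_on UNIV"
    "(\<lambda>k. norm (g k) * r ^ total_degree k) summable_on UNIV"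
proof -
  have shrink: "(\<lambda>k. norm (h k) * r ^ total_degree k) summable_on UNIV"
    if "(\<lambda>k. norm (h k) * s ^ total_degree k) summable_on UNIV" "0 < r" "r \<le> s"
    for h :: "nat ^ 'n \<Rightarrow> complex" and r s
    by (rule summable_on_comparison_test[OF that(1)])
       (use that in \<open>auto intro!: mult_left_mono power_mono\<close>)
  from assms obtain r s where r: "r > 0" "(\<lambda>k. norm (f k) * r ^ total_degree k) summable_on UNIV"
    and s: "s > 0" "(\<lambda>k. norm (g k) * s ^ total_degree k) summable_on UNIV"
    unfolding convergent_power_series_def by blast
  show ?thesis
    by (rule that[of "min r s"]) (use r s in \<open>auto intro: shrink\<close>)
qed

lemma convergent_power_series_add:
  assumes "convergent_power_series f" "convergent_power_series g"
  shows "convergent_power_series (\<lambda>k. f k + g k)"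
proof -
  obtain r where r: "r > 0" "(\<lambda>k. norm (f k) * r ^ total_degree k) summable_on UNIV"
    "(\<lambda>k. norm (g k) * r ^ total_degree k) summable_on UNIV"
    using convergent_power_series_common_radius[OF assms] .
  have "(\<lambda>k. norm (f k) * r ^ total_degree k + norm (g k) * r ^ total_degree k) summable_on UNIV"
    by (intro summable_on_add r)
  then have "(\<lambda>k. norm (f k + g k) * r ^ total_degree k) summable_on UNIV"
    by (rule summable_on_comparison_test)
       (use r(1) in \<open>auto simp flip: distrib_right intro!: mult_right_mono norm_triangle_ineq\<close>)
  then show ?thesis unfolding convergent_power_series_def using r(1) by blast
qed

lemma convergent_power_series_minus:
  "convergent_power_series f \<Longrightarrow> convergent_power_series (\<lambda>k. - f k)"
  by (simp add: convergent_power_series_def)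

lemma convergent_power_series_cauchy_product:
  fixes f g :: "nat ^ 'n \<Rightarrow> complex"
  assumes "convergent_power_series f" "convergent_power_series g"
  shows "convergent_power_series (cauchy_product f g)"
proof -
  obtain r where r: "r > 0" "(\<lambda>k. norm (f k) * r ^ total_degree k) summable_on UNIV"
    "(\<lambda>k. norm (g k) * r ^ total_degree k) summable_on UNIV"
    using convergent_power_series_common_radius[OF assms] .
  define F where "F k = norm (f k) * r ^ total_degree k" for k
  define G where "G k = norm (g k) * r ^ total_degree k" for k
  have nonneg: "F k \<ge> 0" "G k \<ge> 0" for k
    using r(1) by (auto simp: F_def G_def)
  have summable: "F summable_on UNIV" "G summable_on UNIV"
    using r by (simp_all add: F_def[abs_def] G_def[abs_def])
  have "sum (\<lambda>k. norm (cauchy_product f g k) * r ^ total_degree k) T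
          \<le> infsum F UNIV * infsum G UNIV" if "finite T" for T
  proof -
    define P where "P = (\<Union>k\<in>T. {(i, j). i + j = k})"
    have finP: "finite P" unfolding P_def using that by (auto intro: finite_add_eq)
    have "norm (cauchy_product f g k) * r ^ total_degree k
            \<le> (\<Sum>p\<in>{(i, j). i + j = k}. F (fst p) * G (snd p))" for k
    proof -
      have "norm (cauchy_product f g k) \<le> (\<Sum>p\<in>{(i, j). i + j = k}. norm (f (fst p)) * norm (g (snd p)))"
        unfolding cauchy_product_def
        by (rule order.trans[OF norm_sum]) (simp add: case_prod_unfold norm_mult)
      then have "norm (cauchy_product f g k) * r ^ total_degree k
          \<le> (\<Sum>p\<in>{(i, j). i + j = k}. norm (f (fst p)) * norm (g (snd p))) * r ^ total_degree k"
        using r(1) by (intro mult_right_mono) auto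
      also have "\<dots> = (\<Sum>p\<in>{(i, j). i + j = k}. F (fst p) * G (snd p))"
        unfolding sum_distrib_right
        by (rule sum.cong) (auto simp: F_def G_def total_degree_add power_add)
      finally show ?thesis .
    qed
    then have "sum (\<lambda>k. norm (cauchy_product f g k) * r ^ total_degree k) T
        \<le> (\<Sum>k\<in>T. \<Sum>p\<in>{(i, j). i + j = k}. F (fst p) * G (snd p))"
      by (intro sum_mono)
    also have "\<dots> = (\<Sum>p\<in>P. F (fst p) * G (snd p))"
      unfolding P_def using that
      by (subst sum.UNION_disjoint) (auto intro: finite_add_eq)
    also have "\<dots> \<le> (\<Sum>p\<in>fst ` P \<times> snd ` P. F (fst p) * G (snd p))"
      using finP nonneg by (intro sum_mono2) (auto intro: rev_image_eqI)
    also have "\<dots> = sum F (fst ` P) * sum G (snd ` P)"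
      by (simp add: sum_product sum.cartesian_product case_prod_unfold)
    also have "\<dots> \<le> infsum F UNIV * infsum G UNIV"
      using finP nonneg summable
      by (intro mult_mono finite_sum_le_infsum sum_nonneg infsum_nonneg) auto
    finally show ?thesis .
  qed
  then have "(\<lambda>k. norm (cauchy_product f g k) * r ^ total_degree k) summable_on UNIV"
    using r(1) by (intro nonneg_bdd_above_summable_on bdd_aboveI) auto
  then show ?thesis unfolding convergent_power_series_def using r(1) by blast
qed

lemma exists_isolated_sum:
  fixes A B :: "(nat ^ 'n) set"
  assumes "A \<noteq> {}" "B \<noteq> {}"
  shows "\<exists>a\<in>A. \<exists>b\<in>B. \<forall>i\<in>A. \<forall>j\<in>B. i + j = a + b \<longrightarrow> i = a \<and> j = b"
proof -
  define P where "P S F G \<longleftrightarrow> F \<noteq> {} \<and> G \<noteq> {} \<and> F \<subseteq> A \<and> G \<subseteq> B \<and>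
      (\<forall>i\<in>A. \<forall>j\<in>B. \<forall>a\<in>F. \<forall>b\<in>G. i + j = a + b \<longrightarrow> i \<in> F \<and> j \<in> G) \<and>
      (\<forall>t\<in>S. (\<forall>a\<in>F. \<forall>a'\<in>F. vec_nth a t = vec_nth a' t) \<and> (\<forall>b\<in>G. \<forall>b'\<in>G. vec_nth b t = vec_nth b' t))"
    for S :: "'n set" and F G
  have ex: "\<exists>F G. P S F G" for S
  proof (induction S rule: finite_induct[OF finite])
    case 1
    have "P {} A B" unfolding P_def using assms by simp
    then show ?case by blast
  next
    case (2 t S)
    from 2(3) obtain F G where FG: "P S F G" by blast
    have FG1: "F \<noteq> {}" "G \<noteq> {}" "F \<subseteq> A" "G \<subseteq> B"
      using FG unfolding P_def by simp_all
    have FG2: "i \<in> F \<and> j \<in> G"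
      if "i \<in> A" "j \<in> B" "a \<in> F" "b \<in> G" "i + j = a + b" for i j a b
      using FG that unfolding P_def by blast
    have FG3: "(\<forall>a\<in>F. \<forall>a'\<in>F. vec_nth a s = vec_nth a' s) \<and>
        (\<forall>b\<in>G. \<forall>b'\<in>G. vec_nth b s = vec_nth b' s)" if "s \<in> S" for s
      using FG that unfolding P_def by blast
    obtain a0 where a0: "a0 \<in> F" "\<And>a. a \<in> F \<Longrightarrow> vec_nth a0 t \<le> vec_nth a t"
      using FG1(1) ex_has_least_nat[of "\<lambda>a. a \<in> F" _ "\<lambda>a. vec_nth a t"] by blast
    obtain b0 where b0: "b0 \<in> G" "\<And>b. b \<in> G \<Longrightarrow> vec_nth b0 t \<le> vec_nth b t"
      using FG1(2) ex_has_least_nat[of "\<lambda>b. b \<in> G" _ "\<lambda>b. vec_nth b t"] by blast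
    let ?F = "{a \<in> F. vec_nth a t = vec_nth a0 t}" and ?G = "{b \<in> G. vec_nth b t = vec_nth b0 t}"
    have isolated: "i \<in> ?F \<and> j \<in> ?G"
      if "i \<in> A" "j \<in> B" "a \<in> ?F" "b \<in> ?G" "i + j = a + b" for i j a b
    proof -
      have ij: "i \<in> F" "j \<in> G" using FG2[of i j a b] that by auto
      have "vec_nth i t + vec_nth j t = vec_nth a t + vec_nth b t"
        using that(5) by (metis vector_add_component)
      with a0(2)[OF ij(1)] b0(2)[OF ij(2)] that(3,4) ij show ?thesis by auto
    qed
    have agree: "(\<forall>a\<in>?F. \<forall>a'\<in>?F. vec_nth a s = vec_nth a' s) \<and>
        (\<forall>b\<in>?G. \<forall>b'\<in>?G. vec_nth b s = vec_nth b' s)" if "s \<in> insert t S" for s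
    proof (cases "s = t")
      case False
      then have "s \<in> S" using that by simp
      then show ?thesis using FG3[of s] by blast
    qed simp
    have sub: "?F \<noteq> {}" "?G \<noteq> {}" "?F \<subseteq> A" "?G \<subseteq> B"
      using FG1(3,4) a0(1) b0(1) by auto
    have "P (insert t S) ?F ?G"
      unfolding P_def using isolated agree by (intro conjI sub) blast+
    then show ?case by blast
  qed
  obtain F G where FG': "P UNIV F G" using ex by blast
  have FG: "F \<noteq> {}" "G \<noteq> {}" "F \<subseteq> A" "G \<subseteq> B"
      "\<forall>i\<in>A. \<forall>j\<in>B. \<forall>a\<in>F. \<forall>b\<in>G. i + j = a + b \<longrightarrow> i \<in> F \<and> j \<in> G"
      "\<forall>t\<in>UNIV. (\<forall>a\<in>F. \<forall>a'\<in>F. vec_nth a t = vec_nth a' t) \<and> (\<forall>b\<in>G. \<forall>b'\<in>G. vec_nth b t = vec_nth b' t)"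
    using FG' unfolding P_def by - (elim conjE, assumption)+
  then obtain a b where ab: "a \<in> F" "b \<in> G" by blast
  have "a' = a" if "a' \<in> F" for a'
    unfolding Finite_Cartesian_Product.vec_eq_iff using that ab FG(6) by blast
  moreover have "b' = b" if "b' \<in> G" for b'
    unfolding Finite_Cartesian_Product.vec_eq_iff using that ab FG(6) by blast
  ultimately have singletons: "F = {a}" "G = {b}" using ab by blast+
  have "i = a \<and> j = b" if "i \<in> A" "j \<in> B" "i + j = a + b" for i j
    using FG(5)[rule_format, OF that(1,2) ab that(3)] unfolding singletons by simp
  moreover have "a \<in> A" "b \<in> B" using FG(3,4) ab by auto
  ultimately show ?thesis by meson
qed

lemma cauchy_product_eq_0_imp:
  fixes f g :: "nat ^ 'n \<Rightarrow> complex"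
  assumes "cauchy_product f g = (\<lambda>_. 0)"
  shows "f = (\<lambda>_. 0) \<or> g = (\<lambda>_. 0)"
proof (rule ccontr)
  assume "\<not> ?thesis"
  then have "{k. f k \<noteq> 0} \<noteq> {}" "{k. g k \<noteq> 0} \<noteq> {}" by auto
  from exists_isolated_sum[OF this] obtain a where a: "a \<in> {k. f k \<noteq> 0}"
    and "\<exists>b\<in>{k. g k \<noteq> 0}. \<forall>i\<in>{k. f k \<noteq> 0}. \<forall>j\<in>{k. g k \<noteq> 0}.
           i + j = a + b \<longrightarrow> i = a \<and> j = b" ..
  from this(2) obtain b where b: "b \<in> {k. g k \<noteq> 0}"
    and isolated: "\<forall>i\<in>{k. f k \<noteq> 0}. \<forall>j\<in>{k. g k \<noteq> 0}. i + j = a + b \<longrightarrow> i = a \<and> j = b" ..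
  have zero: "f i * g j = 0" if "i + j = a + b" "(i, j) \<noteq> (a, b)" for i j
  proof (rule ccontr)
    assume "f i * g j \<noteq> 0"
    then have "i \<in> {k. f k \<noteq> 0}" "j \<in> {k. g k \<noteq> 0}" by simp_all
    from isolated[rule_format, OF this that(1)] that(2) show False by simp
  qed
  have "cauchy_product f g (a + b) = (\<Sum>p\<in>{(i, j). i + j = a + b}. f (fst p) * g (snd p))"
    by (simp add: cauchy_product_def case_prod_unfold)
  also have "\<dots> = (\<Sum>p\<in>{(a, b)}. f (fst p) * g (snd p))"
  proof (rule sum.mono_neutral_right[OF finite_add_eq])
    show "\<forall>p\<in>{(i, j). i + j = a + b} - {(a, b)}. f (fst p) * g (snd p) = 0"
      using zero by (metis (mono_tags, lifting) DiffE case_prodE fst_conv mem_Collect_eq singletonI snd_conv)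
  qed simp
  finally have "cauchy_product f g (a + b) = f a * g b" by simp
  with assms a b show False by simp
qed

typedef ('n :: finite) germ = "{f :: nat ^ 'n \<Rightarrow> complex. convergent_power_series f}"
  morphisms taylor_coeff Abs_germ
  using convergent_power_series_monomial by blast

setup_lifting type_definition_germ

instantiation germ :: (finite) comm_ring_1
begin

lift_definition zero_germ :: "'a germ" is "\<lambda>_. 0"
  using convergent_power_series_monomial[of 0 0] by (simp add: monomial_series_def)

lift_definition one_germ :: "'a germ" is "monomial_series 0 1"
  by (rule convergent_power_series_monomial)

lift_definition plus_germ :: "'a germ \<Rightarrow> 'a germ \<Rightarrow> 'a germ" is "\<lambda>f g k. f k + g k"
  by (rule convergent_power_series_add)

lift_definition uminus_germ :: "'a germ \<Rightarrow> 'a germ" is "\<lambda>f k. - f k"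
  by (rule convergent_power_series_minus)

lift_definition minus_germ :: "'a germ \<Rightarrow> 'a germ \<Rightarrow> 'a germ" is "\<lambda>f g k. f k - g k"
  using convergent_power_series_add[OF _ convergent_power_series_minus] by simp

lift_definition times_germ :: "'a germ \<Rightarrow> 'a germ \<Rightarrow> 'a germ" is cauchy_product
  by (rule convergent_power_series_cauchy_product)

instance
proof
  fix f g h :: "'a germ"
  show "f * g * h = f * (g * h)" by transfer (rule cauchy_product_assoc)
  show "f * g = g * f" by transfer (rule cauchy_product_comm)
  show "1 * f = f" by transfer (simp add: cauchy_product_monomial_zero)
  show "f + g + h = f + (g + h)" by transfer (simp add: add.assoc)
  show "f + g = g + f" by transfer (simp add: add.commute)
  show "0 + f = f" by transfer simp
  show "- f + f = 0" by transfer simp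
  show "f - g = f + - g" by transfer simp
  show "(f + g) * h = f * h + g * h"
    by transfer (simp add: cauchy_product_def[abs_def] distrib_right sum.distrib case_prod_unfold)
  show "(0 :: 'a germ) \<noteq> 1" by transfer (auto simp: monomial_series_def fun_eq_iff)
qed

end

instance germ :: (finite) idom
proof
  fix f g :: "'a germ"
  have "f = 0 \<or> g = 0" if "f * g = 0"
    using that by transfer (rule cauchy_product_eq_0_imp)
  then show "f \<noteq> 0 \<Longrightarrow> g \<noteq> 0 \<Longrightarrow> f * g \<noteq> 0" by metis
qed

lift_definition germ_monomial :: "nat ^ 'n \<Rightarrow> 'n germ" is "\<lambda>k. monomial_series k 1"
  by (rule convergent_power_series_monomial)

section \<open>Ideals and submodules\<close>

definition generated_ideal :: "'a :: comm_ring_1 set \<Rightarrow> 'a set" where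
  "generated_ideal S = Modules.module.span (*) S"

definition ideal_product :: "'i set \<Rightarrow> ('i \<Rightarrow> 'a :: comm_ring_1 set) \<Rightarrow> 'a set" where
  "ideal_product L I = generated_ideal {\<Prod>i\<in>L. f i | f. \<forall>i\<in>L. f i \<in> I i}"

text \<open>
  Submodules of the free module of rank \<open>p\<close> are sets of vectors in \<^term>\<open>carrier_vec p\<close>; the
  components are numbered \<open>0, \<dots>, p - 1\<close>, so \<open>{1, \<dots>, p}\<close> is rendered by \<^term>\<open>{..<p}\<close>.
\<close>

definition is_submodule :: "nat \<Rightarrow> 'a :: comm_ring_1 vec set \<Rightarrow> bool" where
  "is_submodule p M \<longleftrightarrow> submodule class_ring M (module_vec TYPE('a) p)"

text \<open>An ideal as a submodule of the free module of rank one.\<close>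

definition ideal_vecs :: "'a set \<Rightarrow> 'a vec set" where
  "ideal_vecs I = (\<lambda>f. vec 1 (\<lambda>_. f)) ` I"

definition component :: "'a vec set \<Rightarrow> nat \<Rightarrow> 'a set" where
  "component M i = (\<lambda>h. h $ i) ` M"

text \<open>
  The projection \<open>M\<^sub>L\<close>; \<^term>\<open>pick L j\<close> is the \<open>j\<close>-th smallest element of \<open>L\<close>, counted from \<open>0\<close>.
\<close>

definition projection :: "nat set \<Rightarrow> 'a vec set \<Rightarrow> 'a vec set" where
  "projection L M = (\<lambda>h. vec (card L) (\<lambda>j. h $ pick L j)) ` M"

definition direct_sum :: "nat \<Rightarrow> (nat \<Rightarrow> 'a set) \<Rightarrow> 'a vec set" where
  "direct_sum q N = {h \<in> carrier_vec q. \<forall>j<q. h $ j \<in> N j}"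

definition decomposable :: "nat \<Rightarrow> 'a vec set \<Rightarrow> bool" where
  "decomposable q N \<longleftrightarrow> N = direct_sum q (component N)"

definition generating_matrices :: "nat \<Rightarrow> 'a :: comm_ring_1 vec set \<Rightarrow> 'a mat set" where
  "generating_matrices p M =
     {A. dim_row A = p \<and> p \<le> dim_col A \<and> M = {A *\<^sub>v c | c. c \<in> carrier_vec (dim_col A)}}"

text \<open>
  The ideal generated by the minors of one generating matrix does not depend on that matrix;
  taking the minors of all of them avoids a choice.
\<close>

definition minors_ideal :: "nat \<Rightarrow> nat \<Rightarrow> 'a :: comm_ring_1 vec set \<Rightarrow> 'a set" where
  "minors_ideal i p M = generated_ideal
     {Determinant.det (submatrix A I J) | A I J. A \<in> generating_matrices p M \<and>
        I \<subseteq> {..<dim_row A} \<and> J \<subseteq> {..<dim_col A} \<and> card I = i \<and> card J = i}"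

text \<open>Dimension of the span of \<open>M\<close> over the fraction field.\<close>

definition module_rank :: "nat \<Rightarrow> 'a :: idom vec set \<Rightarrow> nat" where
  "module_rank p M = vectorspace.dim class_ring
     (LinearCombinations.module.span_vs class_ring (module_vec TYPE('a fract) p)
        (map_vec to_fract ` M))"

definition nonzero_minor_rows :: "nat \<Rightarrow> 'a :: idom vec set \<Rightarrow> nat set set" where
  "nonzero_minor_rows p M = {L. L \<subseteq> {..<p} \<and> card L = module_rank p M \<and>
     (\<exists>A\<in>generating_matrices p M. \<exists>J\<subseteq>{..<dim_col A}.
        card J = module_rank p M \<and> Determinant.det (submatrix A L J) \<noteq> 0)}"

section \<open>Integral closure\<close>

definition discrete_valuation :: "('k :: field \<Rightarrow> int) \<Rightarrow> bool" where
  "discrete_valuation v \<longleftrightarrow>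
     (\<forall>x y. x \<noteq> 0 \<longrightarrow> y \<noteq> 0 \<longrightarrow> v (x * y) = v x + v y) \<and>
     (\<forall>x y. x \<noteq> 0 \<longrightarrow> y \<noteq> 0 \<longrightarrow> x + y \<noteq> 0 \<longrightarrow> min (v x) (v y) \<le> v (x + y)) \<and>
     v ` {x. x \<noteq> 0} = UNIV"

text \<open>
  A ring between a domain and its fraction field \<open>K\<close> has fraction field \<open>K\<close>, so it is a discrete
  valuation ring iff it is the valuation ring of a discrete valuation on \<open>K\<close>.
\<close>

definition is_valuation_ring_of :: "('k :: field \<Rightarrow> int) \<Rightarrow> 'k set \<Rightarrow> bool" where
  "is_valuation_ring_of v V \<longleftrightarrow> discrete_valuation v \<and> V = {x. x = 0 \<or> 0 \<le> v x}"

definition is_subfield :: "'k :: field set \<Rightarrow> bool" where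
  "is_subfield V \<longleftrightarrow> 0 \<in> V \<and> 1 \<in> V \<and>
     (\<forall>x\<in>V. \<forall>y\<in>V. x - y \<in> V \<and> x * y \<in> V) \<and> (\<forall>x\<in>V. inverse x \<in> V)"

definition intermediate_rings :: "'a :: idom fract set set" where
  "intermediate_rings =
     {V. range to_fract \<subseteq> V \<and> ((\<exists>v. is_valuation_ring_of v V) \<or> is_subfield V)}"

definition extended_submodule :: "'a :: idom fract set \<Rightarrow> nat \<Rightarrow> 'a vec set \<Rightarrow> 'a fract vec set" where
  "extended_submodule V p M = {w \<in> carrier_vec p. \<exists>S c. finite S \<and> S \<subseteq> M \<and> c ` S \<subseteq> V \<and>
     (\<forall>i<p. w $ i = (\<Sum>m\<in>S. c m * to_fract (m $ i)))}"

definition integral_closure :: "nat \<Rightarrow> 'a :: idom vec set \<Rightarrow> 'a vec set" where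
  "integral_closure p M = {h \<in> carrier_vec p.
     \<forall>V\<in>intermediate_rings. map_vec to_fract h \<in> extended_submodule V p M}"

definition ideal_integral_closure :: "'a :: idom set \<Rightarrow> 'a set" where
  "ideal_integral_closure I = component (integral_closure 1 (ideal_vecs I)) 0"

definition integrally_decomposable :: "nat \<Rightarrow> 'a :: idom vec set \<Rightarrow> bool" where
  "integrally_decomposable p M \<longleftrightarrow>
     (\<forall>L\<in>nonzero_minor_rows p M. decomposable (card L) (integral_closure (card L) (projection L M)))"

section \<open>Newton polyhedra\<close>

definition real_exponent :: "nat ^ 'n \<Rightarrow> real ^ 'n" where
  "real_exponent k = vec_lambda (\<lambda>i. real (vec_nth k i))"

definition ideal_support :: "('n :: finite) germ set \<Rightarrow> (nat ^ 'n) set" where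
  "ideal_support I = (\<Union>f\<in>I. {k. taylor_coeff f k \<noteq> 0})"

definition newton_polyhedron :: "('n :: finite) germ set \<Rightarrow> (real ^ 'n) set" where
  "newton_polyhedron I =
     convex hull {real_exponent k + v | k v. k \<in> ideal_support I \<and> (\<forall>i. 0 \<le> vec_nth v i)}"

definition monomial_closure :: "('n :: finite) germ set \<Rightarrow> 'n germ set" where
  "monomial_closure I = generated_ideal {germ_monomial k | k. real_exponent k \<in> newton_polyhedron I}"

definition module_newton_polyhedron :: "nat \<Rightarrow> ('n :: finite) germ vec set \<Rightarrow> (real ^ 'n) set" where
  "module_newton_polyhedron p M = (\<Sum>i<p. newton_polyhedron (component M i))"

text \<open>\<^const>\<open>face_of\<close> also admits the empty face, which is excluded here.\<close>

definition compact_faces :: "(real ^ 'n) set \<Rightarrow> (real ^ 'n) set set" where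
  "compact_faces P = {D. D face_of P \<and> compact D \<and> D \<noteq> {}}"

text \<open>
  The value \<open>f\<^sub>D(x)\<close>. For compact \<open>D\<close> the sum is finite.
\<close>

definition restricted_eval :: "('n :: finite) germ \<Rightarrow> (real ^ 'n) set \<Rightarrow> complex ^ 'n \<Rightarrow> complex" where
  "restricted_eval f D x =
     (\<Sum>k | real_exponent k \<in> D. taylor_coeff f k * (\<Prod>i\<in>UNIV. vec_nth x i ^ vec_nth k i))"

text \<open>
  The condition for a module of maximal rank \<open>p\<close>. It does not depend on the generating matrix, and
  the decomposition of a face \<open>\<Delta>\<close> into compact faces of the summands is unique.
\<close>

definition newton_nondegenerate_full_rank :: "nat \<Rightarrow> ('n :: finite) germ vec set \<Rightarrow> bool" where
  "newton_nondegenerate_full_rank p M \<longleftrightarrow>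
     (\<exists>A\<in>generating_matrices p M. \<forall>\<Delta>\<in>compact_faces (module_newton_polyhedron p M).
        \<forall>D. (\<forall>i<p. D i \<in> compact_faces (newton_polyhedron (component M i))) \<longrightarrow>
          \<Delta> = (\<Sum>i<p. D i) \<longrightarrow>
          {x. vec_space.rank p
                (mat p (dim_col A) (\<lambda>(i, j). restricted_eval (A $$ (i, j)) (D i) x)) < p}
            \<subseteq> {x. (\<Prod>i\<in>UNIV. vec_nth x i) = 0})"

text \<open>
  The zero submodule counts as Newton non-degenerate, its Newton polyhedron having no faces.
\<close>

definition newton_nondegenerate :: "nat \<Rightarrow> ('n :: finite) germ vec set \<Rightarrow> bool" where
  "newton_nondegenerate p M \<longleftrightarrow>
     M = {0\<^sub>v p} \<or>
     (if module_rank p M = p then newton_nondegenerate_full_rank p M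
      else \<forall>L\<in>nonzero_minor_rows p M.
             newton_nondegenerate_full_rank (module_rank p M) (projection L M))"

end

theory Submission
  imports
    Defs
    "HOL-Analysis.Kronecker_Approximation_Theorem"
    "HOL-Library.Set_Algebras"
    "HOL-Computational_Algebra.Fundamental_Theorem_Algebra"
begin

text \<open>
  Condition (Q) on a projection \<open>N = M\<^sub>L\<close>: for every valuation ring or field \<open>V\<close> between the germs and their
  fraction field, \<open>V N\<close> contains \<open>x^k u\<^sub>i\<close> for all unit vectors \<open>u\<^sub>i\<close> and all \<open>k\<close> in the Newton polyhedron of the
  \<open>i\<close>-th row. By Cramer's rule for a minor of minimal valuation, (Q) says that over every \<open>V\<close> the minors of \<open>N\<close>
  divide all products of such monomials, one from each row, which is (2). It is equivalent to (3) because the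
  ideals \<open>M\<^sub>i\<^sup>0\<close> are integrally closed, and to (4) because an ideal satisfies (Q) iff it is non-degenerate.

  For (1), suppose first that the restrictions to compact faces drop rank at a point \<open>y\<close> of the torus. With weights
  \<open>w\<close> exposing the faces, the order in \<open>X\<close> after \<open>x\<^sub>t \<mapsto> X^(w t) * (y\<^sub>t + X * x\<^sub>t)\<close> is a discrete valuation for which all
  minors are too small. Conversely, if all minors are too small in some \<open>V\<close>, extend the maximal ideals of \<open>V\<close> and of the
  germs to a \<open>\<complex>\<close>-valued place. The row monomials of minimal order at the place span compact faces, and the
  residues of their quotients form a character that extends to a point of the torus, where all restricted
  minors vanish.
\<close>

text \<open>The two halves of the valuative criterion treat \<open>V\<close> differently. When
  \<open>V\<close> is given, only \<open>x \<in> V\<close> or \<open>inverse x \<in> V\<close>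
  matters; but its residue field may be far larger than the complex numbers, and its maximal ideal
  may meet the germs in less than their maximal ideal, so \<open>V\<close> itself yields no point of
  the torus. Hence the passage to a place that refines \<open>V\<close>, is centred at the origin
  and takes complex values. Its value group need not be archimedean; in general a real weight can
  only be found for finitely many exponents, which is why Newton polyhedra are always generated by
  finite sets from Dickson's lemma. When \<open>V\<close> has to be constructed, it must be
  discrete, so the real weights exposing faces are replaced by integral ones. The substitution must
  also be injective to induce a valuation on the fraction field:
  \<open>x\<^sub>t \<mapsto> X^(w t) * y\<^sub>t\<close> may kill nonzero germs, and the
  perturbation \<open>X * x\<^sub>t\<close> prevents this without changing initial coefficients.
  Generating matrices exist because the ring of germs is Noetherian, which comes from a division
  theorem with convergent quotients.\<close>

unbundle no vec_syntax
no_notation Matrix.scalar_prod (infix "\<bullet>" 70)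

section \<open>Places with values in the complex numbers\<close>

text \<open>In the application \<open>\<iota>\<close> sends a complex number to the constant germ,
  seen in the fraction field of the germs.\<close>

locale complex_extension =
  fixes \<iota> :: "complex \<Rightarrow> 'k :: field"
  assumes hom_add: "\<iota> (a + b) = \<iota> a + \<iota> b"
    and hom_mult: "\<iota> (a * b) = \<iota> a * \<iota> b"
    and hom_1 [simp]: "\<iota> 1 = 1"
begin

lemma hom_0 [simp]: "\<iota> 0 = 0"
  using hom_add[of 0 0] by (metis add_cancel_left_left add_0)

lemma hom_minus: "\<iota> (- a) = - \<iota> a"
  using hom_add[of a "- a"] by (simp add: add_eq_0_iff2)

lemma hom_diff: "\<iota> (a - b) = \<iota> a - \<iota> b"
  using hom_add[of a "- b"] by (simp add: hom_minus)

lemma hom_inverse: "a \<noteq> 0 \<Longrightarrow> \<iota> (inverse a) * \<iota> a = 1"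
  by (simp flip: hom_mult)

lemma hom_eq_0_iff [simp]: "\<iota> a = 0 \<longleftrightarrow> a = 0"
  using hom_inverse[of a] by (metis hom_0 mult_zero_right zero_neq_one)

text \<open>A ring with a maximal ideal of residue field \<open>complex\<close> is encoded by the
  ideal alone: if \<open>1\<close> is not in \<open>S\<close>, the constants and \<open>S\<close>
  together span a ring in which \<open>S\<close> is the kernel of a homomorphism onto the complex
  numbers.\<close>

definition nonunital_subalgebra :: "'k set \<Rightarrow> bool" where
  "nonunital_subalgebra S \<longleftrightarrow> 0 \<in> S \<and> (\<forall>x\<in>S. \<forall>y\<in>S. x + y \<in> S \<and> x * y \<in> S) \<and>
     (\<forall>c. \<forall>x\<in>S. \<iota> c * x \<in> S)"

lemma nonunital_subalgebraD:
  assumes "nonunital_subalgebra S"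
  shows "0 \<in> S" "x \<in> S \<Longrightarrow> y \<in> S \<Longrightarrow> x + y \<in> S" "x \<in> S \<Longrightarrow> y \<in> S \<Longrightarrow> x * y \<in> S"
    "x \<in> S \<Longrightarrow> \<iota> c * x \<in> S" "x \<in> S \<Longrightarrow> - x \<in> S" "x \<in> S \<Longrightarrow> y \<in> S \<Longrightarrow> x - y \<in> S"
proof -
  show "0 \<in> S" and *: "x \<in> S \<Longrightarrow> y \<in> S \<Longrightarrow> x + y \<in> S" "x \<in> S \<Longrightarrow> y \<in> S \<Longrightarrow> x * y \<in> S"
    "x \<in> S \<Longrightarrow> \<iota> c * x \<in> S" for x y c
    using assms by (auto simp: nonunital_subalgebra_def)
  show **: "- x \<in> S" if "x \<in> S" for x
    using *(3)[of x "- 1"] that by (simp add: hom_minus)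
  show "x - y \<in> S" if "x \<in> S" "y \<in> S" for x y
    using *(1)[of x "- y"] **[of y] that by simp
qed

definition complex_eval :: "complex poly \<Rightarrow> 'k \<Rightarrow> 'k" where
  "complex_eval q x = fold_coeffs (\<lambda>a b. \<iota> a + x * b) q 0"

lemma complex_eval_0 [simp]: "complex_eval 0 x = 0"
  by (simp add: complex_eval_def)

lemma complex_eval_pCons [simp]: "complex_eval (pCons a q) x = \<iota> a + x * complex_eval q x"
  by (cases "q = 0 \<and> a = 0") (auto simp: complex_eval_def)

lemma complex_eval_add: "complex_eval (p + q) x = complex_eval p x + complex_eval q x"
  by (induction p q rule: poly_induct2) (simp_all add: hom_add algebra_simps)

lemma complex_eval_smult: "complex_eval (Polynomial.smult c q) x = \<iota> c * complex_eval q x"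
  by (induction q) (simp_all add: hom_mult algebra_simps)

lemma complex_eval_mult: "complex_eval (p * q) x = complex_eval p x * complex_eval q x"
  by (induction p) (simp_all add: complex_eval_add complex_eval_smult algebra_simps)

text \<open>This is the ideal that \<open>S\<close> generates after \<open>x\<close> has been
  adjoined to the ring spanned by the constants and \<open>S\<close>.\<close>

definition extended_ideal :: "'k set \<Rightarrow> 'k \<Rightarrow> 'k set" where
  "extended_ideal S x = {poly p x | p. \<forall>i. coeff p i \<in> S}"

context
  fixes S :: "'k set"
  assumes S: "nonunital_subalgebra S"
begin

lemma sum_mem_subalgebra: "(\<And>i. i \<in> A \<Longrightarrow> f i \<in> S) \<Longrightarrow> sum f A \<in> S"
  by (induction A rule: infinite_finite_induct) (auto intro: nonunital_subalgebraD[OF S])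

lemma nonunital_subalgebra_extended_ideal: "nonunital_subalgebra (extended_ideal S x)"
  unfolding nonunital_subalgebra_def
proof (intro conjI ballI allI)
  show "0 \<in> extended_ideal S x"
    unfolding extended_ideal_def by (auto intro!: exI[of _ 0] nonunital_subalgebraD[OF S])
next
  fix a b assume "a \<in> extended_ideal S x" "b \<in> extended_ideal S x"
  then obtain p q where p: "a = poly p x" "\<And>i. coeff p i \<in> S" and q: "b = poly q x" "\<And>i. coeff q i \<in> S"
    by (auto simp: extended_ideal_def)
  have "\<forall>i. coeff (p + q) i \<in> S" "\<forall>i. coeff (p * q) i \<in> S"
    using p q by (auto simp: coeff_mult intro!: sum_mem_subalgebra nonunital_subalgebraD[OF S])
  moreover have "a + b = poly (p + q) x" "a * b = poly (p * q) x"
    using p q by auto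
  ultimately show "a + b \<in> extended_ideal S x" "a * b \<in> extended_ideal S x"
    unfolding extended_ideal_def by blast+
next
  fix a c assume "a \<in> extended_ideal S x"
  then obtain p where p: "a = poly p x" "\<And>i. coeff p i \<in> S"
    by (auto simp: extended_ideal_def)
  have "\<forall>i. coeff (Polynomial.smult (\<iota> c) p) i \<in> S" "\<iota> c * a = poly (Polynomial.smult (\<iota> c) p) x"
    using p by (auto intro!: nonunital_subalgebraD[OF S])
  then show "\<iota> c * a \<in> extended_ideal S x"
    unfolding extended_ideal_def by blast
qed

lemma extended_ideal_mult: "a \<in> extended_ideal S x \<Longrightarrow> x * a \<in> extended_ideal S x"
proof -
  assume "a \<in> extended_ideal S x"
  then obtain p where p: "a = poly p x" "\<And>i. coeff p i \<in> S"
    by (auto simp: extended_ideal_def)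
  have "\<forall>i. coeff (pCons 0 p) i \<in> S" "x * a = poly (pCons 0 p) x"
    using p by (auto simp: coeff_pCons nonunital_subalgebraD[OF S] split: nat.split)
  then show ?thesis unfolding extended_ideal_def by blast
qed

lemma extended_ideal_complex_eval:
  "a \<in> extended_ideal S x \<Longrightarrow> complex_eval q x * a \<in> extended_ideal S x"
proof (induction q)
  case 0
  show ?case using nonunital_subalgebraD(1)[OF nonunital_subalgebra_extended_ideal] by simp
next
  case (pCons c q)
  have "\<iota> c * a + x * (complex_eval q x * a) \<in> extended_ideal S x"
    using pCons nonunital_subalgebraD(2,4)[OF nonunital_subalgebra_extended_ideal] extended_ideal_mult
    by metis
  then show ?case by (simp add: algebra_simps)
qed

lemma subset_extended_ideal: "S \<subseteq> extended_ideal S x"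
proof
  fix a assume "a \<in> S"
  then have "a = poly [:a:] x" "\<forall>i. coeff [:a:] i \<in> S"
    by (auto simp: coeff_pCons nonunital_subalgebraD[OF S] split: nat.split)
  then show "a \<in> extended_ideal S x" unfolding extended_ideal_def by blast
qed

text \<open>
  If \<open>1\<close> is not in the extended ideal \<open>T\<close>, then \<open>x\<close> is congruent to a constant modulo a larger proper ideal:
  the complex polynomials \<open>q\<close> with \<open>q(x) \<in> T\<close> have a common root.
\<close>

lemma exists_constant_residue:
  assumes "1 \<notin> extended_ideal S x"
  obtains c where "\<And>b. 1 - (x - \<iota> c) * complex_eval b x \<notin> extended_ideal S x"
proof (cases "\<exists>q. q \<noteq> 0 \<and> complex_eval q x \<in> extended_ideal S x")
  case False
  \<comment> \<open>No nonzero complex polynomial takes a value in the ideal at \<open>x\<close>, so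
    any constant would do; with \<open>0\<close> the polynomial in question has constant coefficient
    \<open>1\<close>.\<close>
  have "1 - (x - \<iota> 0) * complex_eval b x \<notin> extended_ideal S x" for b
  proof -
    have "1 - (x - \<iota> 0) * complex_eval b x = complex_eval (pCons 1 (- b)) x"
      using complex_eval_smult[of "- 1" b x] by (simp add: hom_minus)
    moreover have "pCons 1 (- b) \<noteq> 0" by simp
    ultimately show ?thesis using False by metis
  qed
  then show ?thesis by (rule that)
next
  case True
  define q where "q = (ARG_MIN degree q. q \<noteq> 0 \<and> complex_eval q x \<in> extended_ideal S x)"
  from True obtain q0 where q0: "q0 \<noteq> 0 \<and> complex_eval q0 x \<in> extended_ideal S x" by blast
  have q: "q \<noteq> 0" "complex_eval q x \<in> extended_ideal S x"
    and min: "\<And>r. r \<noteq> 0 \<Longrightarrow> complex_eval r x \<in> extended_ideal S x \<Longrightarrow> degree q \<le> degree r"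
    using arg_min_natI[of "\<lambda>q. q \<noteq> 0 \<and> complex_eval q x \<in> extended_ideal S x", OF q0]
      arg_min_nat_le[of "\<lambda>q. q \<noteq> 0 \<and> complex_eval q x \<in> extended_ideal S x"]
    unfolding q_def by blast+
  have "degree q \<noteq> 0"
  proof
    assume "degree q = 0"
    then obtain c where c: "q = [:c:]" by (rule degree_eq_zeroE)
    with q have "\<iota> (inverse c) * \<iota> c \<in> extended_ideal S x"
      by (intro nonunital_subalgebraD[OF nonunital_subalgebra_extended_ideal]) simp
    with c q assms show False by (simp add: hom_inverse)
  qed
  then obtain c where "poly q c = 0"
    using fundamental_theorem_of_algebra[of q] by (auto simp: constant_degree)
  then obtain q' where q': "q = [:- c, 1:] * q'"
    by (auto simp: poly_eq_0_iff_dvd elim: dvdE)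
  have "q' \<noteq> 0" "degree q' < degree q"
    using q(1) by (auto simp: q' degree_mult_eq simp del: mult_pCons_left)
  then have notin: "complex_eval q' x \<notin> extended_ideal S x"
    using min[of q'] by auto
  \<comment> \<open>Multiplied by the cofactor \<open>q'(x)\<close>, the element becomes
    \<open>q'(x)\<close> minus a multiple of \<open>q(x)\<close>. If it were in the ideal, so would
    be \<open>q'(x)\<close>, against the minimal degree of \<open>q\<close>.\<close>
  have "1 - (x - \<iota> c) * complex_eval b x \<notin> extended_ideal S x" for b
  proof
    assume "1 - (x - \<iota> c) * complex_eval b x \<in> extended_ideal S x"
    then have "complex_eval q' x * (1 - (x - \<iota> c) * complex_eval b x) \<in> extended_ideal S x"
      by (rule extended_ideal_complex_eval)
    moreover have "complex_eval b x * complex_eval q x \<in> extended_ideal S x"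
      by (rule extended_ideal_complex_eval[OF q(2)])
    ultimately have "complex_eval q' x * (1 - (x - \<iota> c) * complex_eval b x) + complex_eval b x * complex_eval q x
        \<in> extended_ideal S x"
      by (rule nonunital_subalgebraD[OF nonunital_subalgebra_extended_ideal])
    moreover have "complex_eval q x = (x - \<iota> c) * complex_eval q' x"
      unfolding q' complex_eval_mult by (simp add: hom_minus algebra_simps)
    ultimately show False using notin by (simp add: algebra_simps)
  qed
  then show ?thesis by (rule that)
qed

end

text \<open>The relation for \<open>z\<close> eliminates the leading term of the relation for
  \<open>x\<close>. Moving the constant term of \<open>q\<close> to the other side and dividing by
  \<open>1 - coeff q 0\<close> writes \<open>1\<close> as a combination of \<open>z\<close>, ...,
  \<open>z ^ degree q\<close> over \<open>S\<close>; multiplication by \<open>x ^ degree p\<close>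
  turns it into one of lower powers of \<open>x\<close>. The exponents stay nonnegative because
  \<open>degree q \<le> degree p\<close>.\<close>

lemma reduce_degree:
  assumes S: "nonunital_subalgebra S" and inv: "\<And>a. a \<in> S \<Longrightarrow> a / (1 - a) \<in> S" and one: "1 \<notin> S"
    and xz: "x * z = 1"
    and p: "\<forall>i. coeff p i \<in> S" "poly p x = 1"
    and q: "\<forall>i. coeff q i \<in> S" "poly q z = 1"
    and le: "degree q \<le> degree p"
  shows "\<exists>p'. (\<forall>i. coeff p' i \<in> S) \<and> poly p' x = 1 \<and> degree p' < degree p"
proof -
  note D = nonunital_subalgebraD[OF S]
  let ?m = "degree p" and ?n = "degree q"
  have m: "0 < ?m"
  proof (rule ccontr)
    assume "\<not> 0 < ?m"
    then obtain c where "p = [:c:]" by (auto elim: degree_eq_zeroE)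
    with p(2) have "p = [:1:]" by simp
    with p(1)[rule_format, of 0] one show False by simp
  qed
  define q0 where "q0 = coeff q 0"
  define w where "w j = coeff q j / (1 - q0)" for j
  have q0: "q0 \<in> S" "1 - q0 \<noteq> 0" using q(1)[rule_format, of 0] one by (auto simp: q0_def)
  \<comment> \<open>The inverse of \<open>1 - q0\<close> is \<open>1 + q0 / (1 - q0)\<close>, so
    division by it does not leave \<open>S\<close>.\<close>
  have w: "w j \<in> S" for j
  proof -
    have "w j = coeff q j + coeff q j * (q0 / (1 - q0))"
      using q0(2) by (simp add: w_def field_simps)
    also have "\<dots> \<in> S" by (intro D inv q0 q(1)[rule_format])
    finally show ?thesis .
  qed
  have "1 = q0 + (\<Sum>j=1..?n. coeff q j * z ^ j)"
  proof -
    have "1 = (\<Sum>j\<le>?n. coeff q j * z ^ j)" using q(2) by (simp add: poly_altdef)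
    also have "{..?n} = insert 0 {1..?n}" by auto
    finally show ?thesis by (simp add: q0_def)
  qed
  then have "(\<Sum>j=1..?n. coeff q j * z ^ j) = 1 - q0"
    by (simp add: eq_diff_eq add.commute)
  then have ws: "(\<Sum>j=1..?n. w j * z ^ j) = 1"
    using q0(2) by (simp add: w_def flip: sum_divide_distrib)
  define u where "u = coeff p ?m"
  define p' where "p' = (\<Sum>i<?m. monom (coeff p i) i) + (\<Sum>j=1..?n. monom (u * w j) (?m - j))"
  have "\<forall>i. coeff p' i \<in> S"
    using p w unfolding p'_def coeff_add coeff_sum coeff_monom u_def
    by (auto intro!: D sum_mem_subalgebra[OF S])
  moreover have "degree p' < ?m"
  proof -
    have "degree p' \<le> ?m - 1"
      unfolding p'_def using le
      by (intro degree_add_le degree_sum_le) (auto intro!: order.trans[OF degree_monom_le])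
    with m show ?thesis by simp
  qed
  moreover have "poly p' x = 1"
  proof -
    have "poly p' x = (\<Sum>i<?m. coeff p i * x ^ i) + (\<Sum>j=1..?n. u * w j * x ^ (?m - j))"
      by (simp add: p'_def poly_sum poly_monom)
    also have "(\<Sum>j=1..?n. u * w j * x ^ (?m - j)) = (\<Sum>j=1..?n. u * x ^ ?m * (w j * z ^ j))"
    proof (rule sum.cong, rule refl)
      fix j assume "j \<in> {1..?n}"
      then have "x ^ ?m = x ^ (?m - j) * x ^ j" using le by (simp flip: power_add)
      moreover have "x ^ j * z ^ j = 1" using xz by (simp flip: power_mult_distrib)
      ultimately show "u * w j * x ^ (?m - j) = u * x ^ ?m * (w j * z ^ j)"
        by simp
    qed
    also have "\<dots> = u * x ^ ?m" using ws by (simp flip: sum_distrib_left)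
    also have "(\<Sum>i<?m. coeff p i * x ^ i) + u * x ^ ?m = poly p x"
      by (simp add: poly_altdef u_def lessThan_Suc_atMost[symmetric])
    finally show ?thesis using p by simp
  qed
  ultimately show ?thesis by blast
qed

text \<open>If both relations existed, they could be taken of minimal degree, and the one of larger
  degree could still be shortened with the help of the other.\<close>

lemma one_notin_extended_ideal:
  assumes S: "nonunital_subalgebra S" and inv: "\<And>a. a \<in> S \<Longrightarrow> a / (1 - a) \<in> S" and one: "1 \<notin> S"
    and xz: "x * z = 1"
  shows "1 \<notin> extended_ideal S x \<or> 1 \<notin> extended_ideal S z"
proof (rule ccontr)
  define P where "P y p \<longleftrightarrow> (\<forall>i. coeff p i \<in> S) \<and> poly p y = 1" for y and p :: "'k poly"
  define d where "d y = degree (ARG_MIN degree p. P y p)" for y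
  have d: "\<exists>p. P y p \<and> degree p = d y \<and> (\<forall>p'. P y p' \<longrightarrow> d y \<le> degree p')" if "P y p" for y p
    using arg_min_natI[of "P y", OF that] arg_min_nat_le[of "P y"] unfolding d_def by blast
  assume "\<not> ?thesis"
  then obtain p q where "P x p" "P z q" by (auto simp: extended_ideal_def P_def)
  then obtain p q where p: "P x p" "\<And>p'. P x p' \<Longrightarrow> degree p \<le> degree p'"
    and q: "P z q" "\<And>p'. P z p' \<Longrightarrow> degree q \<le> degree p'"
    using d by metis
  show False
  proof (cases "degree q \<le> degree p")
    case True
    then show False
      using reduce_degree[OF S inv one xz, of p q] p q unfolding P_def by (meson leD)
  next
    case False
    then show False
      using reduce_degree[OF S inv one, of z x q p] xz p q unfolding P_def
      by (metis leD mult.commute nle_le)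
  qed
qed

text \<open>
  Chevalley's extension theorem for the homomorphism with kernel \<open>S\<close> from \<open>\<complex> + S\<close> to \<open>\<complex>\<close>.
\<close>

theorem exists_place:
  assumes S: "nonunital_subalgebra S" "1 \<notin> S"
  obtains N where "S \<subseteq> N" "nonunital_subalgebra N" "1 \<notin> N"
    "\<And>x. (\<exists>c. x - \<iota> c \<in> N) \<or> (x \<noteq> 0 \<and> inverse x \<in> N)"
proof -
  let ?A = "{N. S \<subseteq> N \<and> nonunital_subalgebra N \<and> 1 \<notin> N}"
  have "\<exists>N\<in>?A. \<forall>X\<in>?A. N \<subseteq> X \<longrightarrow> X = N"
  proof (rule subset_Zorn_nonempty)
    show "?A \<noteq> {}" using S by auto
  next
    fix C assume C: "C \<noteq> {}" "subset.chain ?A C"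
    then have CA: "C \<subseteq> ?A" and ch: "\<And>X Y. X \<in> C \<Longrightarrow> Y \<in> C \<Longrightarrow> X \<subseteq> Y \<or> Y \<subseteq> X"
      by (auto simp: subset.chain_def subset_chain_def)
    have D: "nonunital_subalgebra X" if "X \<in> C" for X using CA that by auto
    have "nonunital_subalgebra (\<Union> C)"
      unfolding nonunital_subalgebra_def
    proof (intro conjI ballI allI)
      show "0 \<in> \<Union> C" using C(1) D nonunital_subalgebraD(1) by blast
    next
      fix x y assume "x \<in> \<Union> C" "y \<in> \<Union> C"
      then obtain X where "X \<in> C" "x \<in> X" "y \<in> X" using ch by blast
      then show "x + y \<in> \<Union> C" "x * y \<in> \<Union> C" using D nonunital_subalgebraD(2,3) by blast+
    next
      fix c x assume "x \<in> \<Union> C"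
      then show "\<iota> c * x \<in> \<Union> C" using D nonunital_subalgebraD(4) by blast
    qed
    then show "\<Union> C \<in> ?A" using CA C(1) by auto
  qed
  then obtain N where N: "S \<subseteq> N" "nonunital_subalgebra N" "1 \<notin> N"
    and max: "\<And>X. nonunital_subalgebra X \<Longrightarrow> N \<subseteq> X \<Longrightarrow> 1 \<notin> X \<Longrightarrow> X = N"
    by (auto 0 4)
  note D = nonunital_subalgebraD[OF N(2)]
  \<comment> \<open>Localising at the multiplicative set of all \<open>1 - m\<close> with
    \<open>m \<in> N\<close> gives a proper nonunital subalgebra containing \<open>N\<close>; by
    maximality it is \<open>N\<close>.\<close>
  have inv: "a / (1 - a) \<in> N" if a: "a \<in> N" for a
  proof -
    define X where "X = {b / (1 - m) | b m. b \<in> N \<and> m \<in> N}"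
    have ne: "1 - m \<noteq> 0" if "m \<in> N" for m using that N(3) by auto
    have "nonunital_subalgebra X"
      unfolding nonunital_subalgebra_def
    proof (intro conjI ballI allI)
      show "0 \<in> X" unfolding X_def using D(1) by force
    next
      fix x y assume "x \<in> X" "y \<in> X"
      then obtain b m c k where *: "x = b / (1 - m)" "b \<in> N" "m \<in> N" "y = c / (1 - k)" "c \<in> N" "k \<in> N"
        unfolding X_def by blast
      let ?d = "m + k - m * k"
      have d: "?d \<in> N" and "(1 - m) * (1 - k) = 1 - ?d" using * by (auto intro!: D simp: algebra_simps)
      then have "x + y = (b - b * k + (c - c * m)) / (1 - ?d)" "x * y = (b * c) / (1 - ?d)"
        using ne[OF *(3)] ne[OF *(6)] \<open>(1 - m) * (1 - k) = 1 - ?d\<close> unfolding *(1,4)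
        by (simp_all add: add_frac_eq algebra_simps)
      moreover have "b - b * k + (c - c * m) \<in> N" "b * c \<in> N" using * by (auto intro!: D)
      ultimately show "x + y \<in> X" "x * y \<in> X" unfolding X_def using d by blast+
    next
      fix c x assume "x \<in> X"
      then obtain b m where *: "x = b / (1 - m)" "b \<in> N" "m \<in> N" unfolding X_def by blast
      then have "\<iota> c * x = (\<iota> c * b) / (1 - m)" "\<iota> c * b \<in> N" by (auto intro: D)
      with * show "\<iota> c * x \<in> X" unfolding X_def by blast
    qed
    moreover have "N \<subseteq> X" unfolding X_def using D(1) by force
    moreover have "1 \<notin> X"
    proof
      assume "1 \<in> X"
      then obtain b m where *: "1 = b / (1 - m)" "b \<in> N" "m \<in> N" unfolding X_def by blast
      then have "b + m = 1" using ne[of m] by (simp add: field_simps)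
      with D(2) * N(3) show False by metis
    qed
    ultimately have "X = N" by (rule max)
    with a show ?thesis unfolding X_def by blast
  qed
  \<comment> \<open>For the constant \<open>c\<close> found modulo the extended ideal, adding the
    multiples of \<open>x - \<iota> c\<close> by polynomials in \<open>x\<close> keeps it proper. By
    maximality the result is \<open>N\<close>, which therefore contains
    \<open>x - \<iota> c\<close>.\<close>
  have const: "\<exists>c. x - \<iota> c \<in> N" if x: "1 \<notin> extended_ideal N x" for x
  proof -
    note E = nonunital_subalgebraD[OF nonunital_subalgebra_extended_ideal[OF N(2)]]
    obtain c where c: "\<And>b. 1 - (x - \<iota> c) * complex_eval b x \<notin> extended_ideal N x"
      using exists_constant_residue[OF N(2) x] by blast
    define y where "y = x - \<iota> c"
    have y: "y = complex_eval [:- c, 1:] x" by (simp add: y_def hom_minus)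
    define X where "X = {t + y * complex_eval b x | t b. t \<in> extended_ideal N x}"
    have "nonunital_subalgebra X"
      unfolding nonunital_subalgebra_def
    proof (intro conjI ballI allI)
      show "0 \<in> X" unfolding X_def using E(1) complex_eval_0
        by (metis (mono_tags, lifting) add_0 mem_Collect_eq mult_zero_right)
    next
      fix a b assume "a \<in> X" "b \<in> X"
      then obtain s p t q where *: "a = s + y * complex_eval p x" "s \<in> extended_ideal N x"
          "b = t + y * complex_eval q x" "t \<in> extended_ideal N x"
        unfolding X_def by blast
      have "a + b = (s + t) + y * complex_eval (p + q) x"
        using * by (simp add: complex_eval_add algebra_simps)
      then show "a + b \<in> X" unfolding X_def using * E(2) by blast
      have "a * b = (s * t + complex_eval ([:- c, 1:] * q) x * s + complex_eval ([:- c, 1:] * p) x * t)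
          + y * complex_eval ([:- c, 1:] * p * q) x"
        unfolding *(1,3) complex_eval_mult y[symmetric] by (simp add: algebra_simps)
      moreover have "s * t + complex_eval ([:- c, 1:] * q) x * s + complex_eval ([:- c, 1:] * p) x * t
          \<in> extended_ideal N x"
        using * by (intro E extended_ideal_complex_eval[OF N(2)])
      ultimately show "a * b \<in> X" unfolding X_def by blast
    next
      fix d a assume "a \<in> X"
      then obtain s p where *: "a = s + y * complex_eval p x" "s \<in> extended_ideal N x"
        unfolding X_def by blast
      have "\<iota> d * a = \<iota> d * s + y * complex_eval (Polynomial.smult d p) x"
        using * by (simp add: complex_eval_smult algebra_simps)
      then show "\<iota> d * a \<in> X" unfolding X_def using * E(4) by blast
    qed
    moreover have "N \<subseteq> X"
    proof
      fix a assume "a \<in> N"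
      then have "a \<in> extended_ideal N x" using subset_extended_ideal[OF N(2)] by blast
      moreover have "a = a + y * complex_eval 0 x" by simp
      ultimately show "a \<in> X" unfolding X_def by blast
    qed
    moreover have "1 \<notin> X"
    proof
      assume "1 \<in> X"
      then obtain t b where "1 = t + y * complex_eval b x" "t \<in> extended_ideal N x"
        unfolding X_def by blast
      then show False using c[of b] unfolding y_def by (metis add_diff_cancel_right')
    qed
    ultimately have "X = N" by (rule max)
    moreover have "y \<in> X"
    proof -
      have "y = 0 + y * complex_eval 1 x" by (simp add: one_pCons)
      then show ?thesis unfolding X_def using E(1) by blast
    qed
    ultimately show ?thesis unfolding y_def by blast
  qed
  have "(\<exists>c. x - \<iota> c \<in> N) \<or> (x \<noteq> 0 \<and> inverse x \<in> N)" for x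
  proof (cases "x = 0")
    case True
    then have "x - \<iota> 0 \<in> N" using D(1) by simp
    then show ?thesis by blast
  next
    case False
    then consider "1 \<notin> extended_ideal N x" | "1 \<notin> extended_ideal N (inverse x)"
      using one_notin_extended_ideal[OF N(2) inv N(3), of x "inverse x"] by auto
    then show ?thesis
    proof cases
      case 1
      then show ?thesis using const by blast
    next
      case 2
      then obtain c where c: "inverse x - \<iota> c \<in> N" using const by blast
      show ?thesis
      proof (cases "c = 0")
        case True
        then show ?thesis using c False by auto
      next
        case c0: False
        \<comment> \<open>Here \<open>inverse x\<close> is congruent to the nonzero constant
          \<open>c\<close>, that is, it equals \<open>\<iota> c * (1 - n)\<close> with
          \<open>n \<in> N\<close>; hence \<open>x\<close> is congruent to
          \<open>inverse c\<close>.\<close>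
        let ?d = "\<iota> (inverse c)"
        define n where "n = ?d * (\<iota> c - inverse x)"
        have d: "?d * \<iota> c = 1" using hom_inverse[OF c0] .
        have n: "n \<in> N" unfolding n_def using D(4,5) c by (metis minus_diff_eq)
        have "1 - n \<noteq> 0" using n N(3) by auto
        have e: "1 - n = ?d * inverse x" unfolding n_def right_diff_distrib d by simp
        then have "x = ?d * inverse (1 - n)"
          using d False c0 by (simp add: e)
        also have "inverse (1 - n) = 1 + n / (1 - n)" using \<open>1 - n \<noteq> 0\<close> by (simp add: field_simps)
        finally have "x - ?d = ?d * (n / (1 - n))" by (simp add: algebra_simps)
        then show ?thesis using D(4) inv[OF n] by metis
      qed
    qed
  qed
  then show ?thesis using that N by blast
qed

end

section \<open>Characters and linear forms on lattices\<close>

lemma complex_nth_root_exists: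
  fixes a :: complex
  assumes "n > 0"
  shows "\<exists>z. z ^ n = a"
proof (cases "a = 0")
  case True
  then show ?thesis using assms by (intro exI[of _ 0]) simp
next
  case False
  have "exp (Ln a / of_nat n) ^ n = a"
    using False assms by (simp flip: exp_of_nat_mult)
  then show ?thesis by blast
qed

lemma prod_powi_add:
  assumes "\<And>t. (y t :: 'a :: field) \<noteq> 0"
  shows "(\<Prod>t\<in>A. y t powi (d t + e t)) = (\<Prod>t\<in>A. y t powi d t) * (\<Prod>t\<in>A. y t powi e t)"
  using assms by (simp add: power_int_add prod.distrib)

lemma prod_powi_mult:
  "(\<Prod>t\<in>A. (y t :: 'a :: field) powi (m * d t)) = (\<Prod>t\<in>A. y t powi d t) powi m"
proof (induction A rule: infinite_finite_induct)
  case (insert x A)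
  have "y x powi (m * d x) = (y x powi d x) powi m"
    by (simp add: power_int_mult mult.commute[of m])
  then show ?case using insert by (simp add: power_int_mult_distrib)
qed auto

text \<open>The divisibility of \<open>\<complex>\<^sup>*\<close> allows the extension of characters from a subgroup of \<open>\<int>\<^sup>n\<close>.\<close>

lemma extend_character:
  fixes \<Lambda> :: "('n :: finite \<Rightarrow> int) set" and \<chi> :: "('n \<Rightarrow> int) \<Rightarrow> complex"
  assumes zero: "(\<lambda>_. 0) \<in> \<Lambda>"
    and diff: "\<And>d e. d \<in> \<Lambda> \<Longrightarrow> e \<in> \<Lambda> \<Longrightarrow> (\<lambda>t. d t - e t) \<in> \<Lambda>"
    and hom: "\<And>d e. d \<in> \<Lambda> \<Longrightarrow> e \<in> \<Lambda> \<Longrightarrow> \<chi> (\<lambda>t. d t - e t) = \<chi> d / \<chi> e"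
    and nz: "\<And>d. d \<in> \<Lambda> \<Longrightarrow> \<chi> d \<noteq> 0"
  obtains y where "\<And>t. y t \<noteq> 0" "\<And>d. d \<in> \<Lambda> \<Longrightarrow> \<chi> d = (\<Prod>t\<in>UNIV. y t powi d t)"
proof -
  have one: "\<chi> (\<lambda>_. 0) = 1" using hom[OF zero zero] nz[OF zero] by simp
  have neg: "(\<lambda>t. - d t) \<in> \<Lambda> \<and> \<chi> (\<lambda>t. - d t) = inverse (\<chi> d)" if "d \<in> \<Lambda>" for d
    using diff[OF zero that] hom[OF zero that] one by (simp add: divide_inverse)
  have add: "(\<lambda>t. d t + e t) \<in> \<Lambda> \<and> \<chi> (\<lambda>t. d t + e t) = \<chi> d * \<chi> e" if "d \<in> \<Lambda>" "e \<in> \<Lambda>" for d e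
    using diff[of d "\<lambda>t. - e t"] hom[of d "\<lambda>t. - e t"] neg[of e] that by (simp add: divide_inverse)
  have mult: "(\<lambda>t. int m * d t) \<in> \<Lambda> \<and> \<chi> (\<lambda>t. int m * d t) = \<chi> d ^ m" if "d \<in> \<Lambda>" for d m
  proof (induction m)
    case 0
    show ?case using zero one by simp
  next
    case (Suc m)
    have eq: "(\<lambda>t. int (Suc m) * d t) = (\<lambda>t. d t + int m * d t)" by (simp add: algebra_simps)
    show ?case using add[OF that Suc[THEN conjunct1]] Suc unfolding eq by simp
  qed
  have powi: "(\<lambda>t. m * d t) \<in> \<Lambda> \<and> \<chi> (\<lambda>t. m * d t) = \<chi> d powi m" if "d \<in> \<Lambda>" for d m
  proof (cases "m \<ge> 0")
    case True
    then show ?thesis using mult[OF that, of "nat m"] by (simp add: power_int_def)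
  next
    case False
    then have "(\<lambda>t. m * d t) = (\<lambda>t. - (int (nat (- m)) * d t))" by (simp add: algebra_simps)
    then show ?thesis using mult[OF that, of "nat (- m)"] neg[of "\<lambda>t. int (nat (- m)) * d t"] False
      by (simp add: power_int_def power_inverse)
  qed
  \<comment> \<open>Induction over the set \<open>T\<close> of coordinates in which the lattice
    vectors may be nonzero; each stage fixes one more coordinate of \<open>y\<close>.\<close>
  have "\<exists>y. (\<forall>t. y t \<noteq> 0) \<and> (\<forall>d\<in>\<Lambda>. (\<forall>t. t \<notin> T \<longrightarrow> d t = 0) \<longrightarrow> \<chi> d = (\<Prod>t\<in>UNIV. y t powi d t))"
    for T :: "'n set"
  proof (induction T rule: finite_induct[OF finite])
    case 1
    have "\<chi> d = (\<Prod>t\<in>UNIV. 1 powi d t)" if "\<forall>t. t \<notin> {} \<longrightarrow> d t = 0" for d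
    proof -
      have "d = (\<lambda>_. 0)" using that by auto
      then show ?thesis using one by simp
    qed
    then show ?case by (intro exI[of _ "\<lambda>_. 1"]) simp
  next
    case (2 s T)
    then obtain y where y: "\<And>t. y t \<noteq> 0"
      and yT: "\<And>d. d \<in> \<Lambda> \<Longrightarrow> (\<forall>t. t \<notin> T \<longrightarrow> d t = 0) \<Longrightarrow> \<chi> d = (\<Prod>t\<in>UNIV. y t powi d t)"
      by blast
    define H where "H = {d \<in> \<Lambda>. \<forall>t. t \<notin> insert s T \<longrightarrow> d t = 0}"
    show ?case
    proof (cases "\<exists>d\<in>H. d s \<noteq> 0")
      case False
      have "\<chi> d = (\<Prod>t\<in>UNIV. y t powi d t)" if "d \<in> \<Lambda>" "\<forall>t. t \<notin> insert s T \<longrightarrow> d t = 0" for d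
        using that False by (intro yT) (auto simp: H_def)
      then show ?thesis using y by blast
    next
      case True
      have Hneg: "(\<lambda>t. - d t) \<in> H" if "d \<in> H" for d using that neg by (auto simp: H_def)
      have "\<exists>d\<in>H. d s > 0"
      proof -
        from True obtain d where "d \<in> H" "d s \<noteq> 0" by blast
        then show ?thesis using Hneg[of d] by (cases "d s > 0") (auto intro: bexI[of _ "\<lambda>t. - d t"])
      qed
      then obtain d1 where d1: "d1 \<in> H \<and> d1 s > 0" by blast
      \<comment> \<open>The \<open>s\<close>-coordinates of \<open>H\<close> form a nonzero group of
        integers, and \<open>d0\<close> realises its positive generator.\<close>
      define d0 where "d0 = (ARG_MIN (\<lambda>d. nat (d s)) d. d \<in> H \<and> d s > 0)"
      have d0: "d0 \<in> H" "d0 s > 0" and min: "\<And>d. d \<in> H \<Longrightarrow> d s > 0 \<Longrightarrow> d0 s \<le> d s"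
        using arg_min_natI[of "\<lambda>d. d \<in> H \<and> d s > 0" _ "\<lambda>d. nat (d s)", OF d1]
          arg_min_nat_le[of "\<lambda>d. d \<in> H \<and> d s > 0" _ "\<lambda>d. nat (d s)"]
        unfolding d0_def[symmetric] by (auto simp: nat_le_eq_zle)
      \<comment> \<open>The value forced on \<open>z powi d0 s\<close>, where \<open>z\<close> is
        the new coordinate and the others are kept.\<close>
      define A where "A = \<chi> d0 / (\<Prod>t\<in>UNIV-{s}. y t powi d0 t)"
      obtain z where z: "z ^ nat (d0 s) = A"
        using complex_nth_root_exists[of "nat (d0 s)"] d0 by auto
      have prod_nz: "(\<Prod>t\<in>UNIV-{s}. y t powi d0 t) \<noteq> 0" using y by (auto simp: power_int_eq_0_iff)
      have "A \<noteq> 0" using nz d0 prod_nz by (auto simp: A_def H_def)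
      with z d0 have z0: "z \<noteq> 0" by (metis zero_power zero_less_nat_eq)
      define y' where "y' = y(s := z)"
      have y': "y' t \<noteq> 0" for t using y z0 by (simp add: y'_def)
      have split: "(\<Prod>t\<in>UNIV. y' t powi d t) = z powi d s * (\<Prod>t\<in>UNIV-{s}. y t powi d t)" for d
        by (subst prod.remove[of _ s]) (auto simp: y'_def intro!: prod.cong)
      have chi0: "\<chi> d0 = (\<Prod>t\<in>UNIV. y' t powi d0 t)"
      proof -
        have "z powi d0 s = A" using z d0 by (simp add: power_int_def)
        then show ?thesis unfolding split A_def using prod_nz by simp
      qed
      have "\<chi> d = (\<Prod>t\<in>UNIV. y' t powi d t)" if "d \<in> \<Lambda>" "\<forall>t. t \<notin> insert s T \<longrightarrow> d t = 0" for d
      proof -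
        \<comment> \<open>Division with remainder: minimality of \<open>d0 s\<close> makes the
          \<open>s\<close>-coordinate of \<open>d'\<close> vanish, so \<open>d'\<close> falls under
          the induction hypothesis.\<close>
        define m where "m = d s div d0 s"
        define d' where "d' t = d t - m * d0 t" for t
        have md0: "(\<lambda>t. m * d0 t) \<in> \<Lambda>" "\<chi> (\<lambda>t. m * d0 t) = \<chi> d0 powi m" using powi d0 by (auto simp: H_def)
        have d'L: "d' \<in> \<Lambda>" using diff[OF that(1) md0(1)] unfolding d'_def[abs_def] .
        have d'H: "d' \<in> H"
          using d'L that(2) d0(1) by (auto simp: H_def d'_def)
        have "d' s = d s mod d0 s" by (simp add: d'_def m_def minus_div_mult_eq_mod)
        then have "0 \<le> d' s" "d' s < d0 s" using d0 by auto
        then have d's: "d' s = 0" using min[OF d'H] by linarith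
        have "\<chi> d' = (\<Prod>t\<in>UNIV. y t powi d' t)"
          using d'H d's by (intro yT) (auto simp: H_def)
        also have "\<dots> = (\<Prod>t\<in>UNIV. y' t powi d' t)"
          using d's by (intro prod.cong) (auto simp: y'_def)
        finally have d': "\<chi> d' = (\<Prod>t\<in>UNIV. y' t powi d' t)" .
        have eq: "d = (\<lambda>t. d' t + m * d0 t)" by (simp add: d'_def)
        have "\<chi> d = \<chi> d' * \<chi> d0 powi m"
          using add[OF d'L md0(1)] md0(2) eq by metis
        also have "\<dots> = (\<Prod>t\<in>UNIV. y' t powi d' t) * (\<Prod>t\<in>UNIV. y' t powi (m * d0 t))"
          unfolding d' chi0 prod_powi_mult ..
        also have "\<dots> = (\<Prod>t\<in>UNIV. y' t powi d t)"
          using y' by (simp add: prod_powi_add[symmetric] d'_def)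
        finally show ?thesis .
      qed
      then show ?thesis using y' by blast
    qed
  qed
  from this[of UNIV] obtain y where "\<forall>t. y t \<noteq> 0" "\<forall>d\<in>\<Lambda>. \<chi> d = (\<Prod>t\<in>UNIV. y t powi d t)"
    by auto
  then show ?thesis using that by blast
qed

lemma simultaneous_approximation:
  fixes \<theta> :: "'i \<Rightarrow> real"
  assumes "finite I" "\<epsilon> > 0"
  obtains q :: int and p where "q > 0" "\<And>i. i \<in> I \<Longrightarrow> \<bar>of_int q * \<theta> i - of_int (p i)\<bar> < \<epsilon>"
proof -
  obtain N :: nat where N: "N > 0" "1 / real N < \<epsilon>"
    using assms(2) by (metis nat_approx_posE of_nat_0_less_iff zero_less_Suc)
  obtain h where h: "bij_betw h I {..<card I}"
    using assms(1) ex_bij_betw_finite_nat[of I] by (auto simp: atLeast0LessThan)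
  obtain q p where qp: "0 < q" "\<And>i. i < card I \<Longrightarrow> \<bar>of_int q * \<theta> (inv_into I h i) - of_int (p i)\<bar> < 1 / N"
    using Dirichlet_approx_simult[OF N(1), of "card I" "\<lambda>i. \<theta> (inv_into I h i)"] by metis
  have "\<bar>of_int q * \<theta> i - of_int (p (h i))\<bar> < \<epsilon>" if "i \<in> I" for i
  proof -
    have "h i < card I" using bij_betwE[OF h] that by auto
    from qp(2)[OF this] N(2) show ?thesis by (simp add: bij_betw_inv_into_left[OF h that])
  qed
  then show ?thesis using that[of q "\<lambda>i. p (h i)"] qp(1) by blast
qed

definition real_vec :: "('n :: finite \<Rightarrow> int) \<Rightarrow> real ^ 'n" where
  "real_vec d = vec_lambda (\<lambda>t. of_int (d t))"

lemma inner_real_vec: "w \<bullet> real_vec d = (\<Sum>t\<in>UNIV. vec_nth w t * of_int (d t))"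
  by (simp add: real_vec_def inner_vec_def)

lemma inj_real_vec: "inj real_vec"
  by (rule injI) (simp add: real_vec_def vec_lambda_inject fun_eq_iff)

text \<open>The coordinates of \<open>w\<close> are approximated by integers over a common
  denominator so well that each of the finitely many values moves by less than the smallest nonzero
  one. Positive values then stay positive, and a zero value becomes an integer of absolute value
  below \<open>1\<close>, hence stays zero.\<close>

lemma integral_linear_form:
  fixes w :: "real ^ 'n :: finite" and E :: "('n \<Rightarrow> int) set"
  assumes "finite E"
  obtains w' :: "'n \<Rightarrow> int" where "\<And>d. d \<in> E \<Longrightarrow> w \<bullet> real_vec d = 0 \<Longrightarrow> (\<Sum>t\<in>UNIV. w' t * d t) = 0"
    "\<And>d. d \<in> E \<Longrightarrow> w \<bullet> real_vec d > 0 \<Longrightarrow> (\<Sum>t\<in>UNIV. w' t * d t) > 0"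
proof -
  define B where "B = 1 + (\<Sum>d\<in>E. \<Sum>t\<in>UNIV. \<bar>real_of_int (d t)\<bar>)"
  \<comment> \<open>The inserted \<open>1\<close> keeps the minimum defined and caps the error below
    \<open>1\<close>, as integrality requires.\<close>
  define m where "m = Min (insert 1 ((\<lambda>d. \<bar>w \<bullet> real_vec d\<bar>) ` {d \<in> E. w \<bullet> real_vec d \<noteq> 0}))"
  have m: "m > 0" "m \<le> 1" "\<And>d. d \<in> E \<Longrightarrow> w \<bullet> real_vec d \<noteq> 0 \<Longrightarrow> m \<le> \<bar>w \<bullet> real_vec d\<bar>"
    using assms by (auto simp: m_def)
  have B: "B \<ge> 1" unfolding B_def by (simp add: sum_nonneg)
  obtain q w' where q: "q > 0" and w': "\<And>t. \<bar>of_int q * vec_nth w t - of_int (w' t)\<bar> < m / B"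
    using simultaneous_approximation[of "UNIV :: 'n set" "m / B" "vec_nth w"] m B by auto
  have "(w \<bullet> real_vec d = 0 \<longrightarrow> (\<Sum>t\<in>UNIV. w' t * d t) = 0) \<and>
      (w \<bullet> real_vec d > 0 \<longrightarrow> (\<Sum>t\<in>UNIV. w' t * d t) > 0)" if d: "d \<in> E" for d
  proof -
    define a where "a = (\<Sum>t\<in>UNIV. w' t * d t)"
    define S where "S = (\<Sum>t\<in>UNIV. \<bar>real_of_int (d t)\<bar>)"
    have S: "S < B" "0 \<le> S" unfolding B_def S_def using d assms
      by (auto intro!: sum_nonneg less_le_trans[OF less_add_one] simp: add.commute[of 1]
          member_le_sum[of d E "\<lambda>d. \<Sum>t\<in>UNIV. \<bar>real_of_int (d t)\<bar>"])
    have "\<bar>of_int a - of_int q * (w \<bullet> real_vec d)\<bar> = \<bar>\<Sum>t\<in>UNIV. (of_int (w' t) - of_int q * vec_nth w t) * of_int (d t)\<bar>"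
      by (simp add: a_def inner_real_vec sum_distrib_left sum_subtractf algebra_simps)
    also have "\<dots> \<le> (\<Sum>t\<in>UNIV. m / B * \<bar>of_int (d t)\<bar>)"
      using w'
      by (intro order.trans[OF sum_abs] sum_mono, unfold abs_mult abs_minus_commute[of "of_int (w' _)"])
        (intro mult_right_mono less_imp_le abs_ge_zero)
    also have "\<dots> = m * (S / B)" by (simp add: S_def sum_distrib_left sum_divide_distrib)
    also have "\<dots> < m * 1" using S m B by (intro mult_strict_left_mono) auto
    finally have close: "\<bar>of_int a - of_int q * (w \<bullet> real_vec d)\<bar> < m" by simp
    have q1: "real_of_int q \<ge> 1" using q by simp
    have "a = 0" if "w \<bullet> real_vec d = 0"
    proof -
      have "\<bar>real_of_int a\<bar> < 1" using close m that by simp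
      then show ?thesis by linarith
    qed
    moreover have "a > 0" if pos: "w \<bullet> real_vec d > 0"
    proof -
      have "m \<le> 1 * (w \<bullet> real_vec d)" using m(3)[OF d] pos by simp
      also have "\<dots> \<le> of_int q * (w \<bullet> real_vec d)" using pos q1 by (intro mult_right_mono) auto
      finally show "a > 0" using close by linarith
    qed
    ultimately show ?thesis unfolding a_def by blast
  qed
  then show ?thesis using that[of w'] by blast
qed

text \<open>
  Gordan's alternative over the integers: a real dependency between the vectors is approximated
  simultaneously by an integral one.
\<close>

lemma exists_separating_form:
  fixes P U :: "('n :: finite \<Rightarrow> int) set"
  assumes fin: "finite P" "finite U"
    and indep: "\<And>a b. (\<And>p. p \<in> P \<Longrightarrow> 0 \<le> a p) \<Longrightarrow> \<exists>p\<in>P. a p \<noteq> 0 \<Longrightarrow>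
      \<exists>t. (\<Sum>p\<in>P. a p * p t) \<noteq> (\<Sum>u\<in>U. b u * u t)"
  obtains w :: "real ^ 'n" where "\<And>p. p \<in> P \<Longrightarrow> w \<bullet> real_vec p > 0" "\<And>u. u \<in> U \<Longrightarrow> w \<bullet> real_vec u = 0"
proof (cases "P = {}")
  case True
  then show ?thesis using that[of 0] by simp
next
  case False
  let ?C = "convex hull (real_vec ` P)" and ?S = "span (real_vec ` U)"
  have disj: "?S \<inter> ?C = {}"
  proof (rule ccontr)
    assume "?S \<inter> ?C \<noteq> {}"
    then obtain x where x: "x \<in> ?S" "x \<in> ?C" by blast
    from x(2) obtain l' where l': "\<forall>x\<in>real_vec ` P. 0 \<le> l' x" "sum l' (real_vec ` P) = 1" "(\<Sum>x\<in>real_vec ` P. l' x *\<^sub>R x) = x"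
      using fin by (auto simp: convex_hull_finite)
    from x(1) obtain m' where m': "x = (\<Sum>x\<in>real_vec ` U. m' x *\<^sub>R x)"
      using fin by (auto simp: span_finite)
    define l where "l p = l' (real_vec p)" for p
    define m where "m u = m' (real_vec u)" for u
    have inj: "inj_on real_vec A" for A :: "('n \<Rightarrow> int) set" using inj_real_vec by (rule inj_on_subset) simp
    have l: "\<And>p. p \<in> P \<Longrightarrow> 0 \<le> l p" "sum l P = 1"
      using l' by (auto simp: l_def sum.reindex[OF inj] o_def)
    have eq: "(\<Sum>p\<in>P. l p *\<^sub>R real_vec p) = (\<Sum>u\<in>U. m u *\<^sub>R real_vec u)"
      using l'(3) m' by (simp add: l_def m_def sum.reindex[OF inj] o_def)
    \<comment> \<open>Errors below \<open>1 / B\<close> serve two purposes. Since \<open>B\<close>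
      exceeds \<open>card P\<close> and the \<open>l p\<close> add up to \<open>1\<close>, not every
      \<open>a p\<close> can be \<open>0\<close>; since \<open>B\<close> exceeds the sum of all
      entries, the rounded relation fails by less than \<open>1\<close> in each coordinate and so
      holds exactly.\<close>
    define B where "B = 1 + real (card P) + (\<Sum>p\<in>P. \<Sum>t\<in>UNIV. \<bar>real_of_int (p t)\<bar>) + (\<Sum>u\<in>U. \<Sum>t\<in>UNIV. \<bar>real_of_int (u t)\<bar>)"
    have B: "B \<ge> 1 + real (card P)" unfolding B_def by (simp add: sum_nonneg add_nonneg_nonneg)
    obtain q c where q: "q > 0" and c: "\<And>i. i \<in> P <+> U \<Longrightarrow> \<bar>of_int q * case_sum l m i - of_int (c i)\<bar> < 1 / B"
      using simultaneous_approximation[of "P <+> U" "1 / B" "case_sum l m"] B fin by auto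
    define a where "a p = c (Inl p)" for p
    define b where "b u = c (Inr u)" for u
    have a: "\<bar>of_int q * l p - of_int (a p)\<bar> < 1 / B" if "p \<in> P" for p
      using c[OF InlI[OF that]] by (simp add: a_def)
    have b: "\<bar>of_int q * m u - of_int (b u)\<bar> < 1 / B" if "u \<in> U" for u
      using c[OF InrI[OF that]] by (simp add: b_def)
    have B1: "1 / B \<le> 1" using B by simp
    have q1: "real_of_int q \<ge> 1" using q by simp
    have "0 \<le> a p" if "p \<in> P" for p
    proof -
      have "0 \<le> of_int q * l p" using l that q1 by simp
      then have "real_of_int (a p) > -1" using a[OF that] B1 by linarith
      then show ?thesis by linarith
    qed
    moreover have "\<exists>p\<in>P. a p \<noteq> 0"
    proof (rule ccontr)
      assume "\<not> ?thesis"
      then have "of_int q * l p \<le> 1 / B" if "p \<in> P" for p using a[OF that] that by auto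
      then have "(\<Sum>p\<in>P. of_int q * l p) \<le> (\<Sum>p\<in>P. 1 / B)" by (rule sum_mono)
      then have "of_int q \<le> real (card P) / B" using l(2) by (simp flip: sum_distrib_left)
      also have "\<dots> < 1" using B by simp
      finally show False using q1 by simp
    qed
    moreover have "(\<Sum>p\<in>P. a p * p t) = (\<Sum>u\<in>U. b u * u t)" for t
    proof -
      have "(\<Sum>p\<in>P. l p * of_int (p t)) = (\<Sum>u\<in>U. m u * of_int (u t))"
        using arg_cong[OF eq, of "\<lambda>v. vec_nth v t"] by (simp add: real_vec_def)
      then have "real_of_int q * (\<Sum>p\<in>P. l p * of_int (p t)) - real_of_int q * (\<Sum>u\<in>U. m u * of_int (u t)) = 0"
        by simp
      then have "\<bar>real_of_int ((\<Sum>p\<in>P. a p * p t) - (\<Sum>u\<in>U. b u * u t))\<bar> =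
          \<bar>(\<Sum>p\<in>P. (of_int (a p) - of_int q * l p) * of_int (p t)) - (\<Sum>u\<in>U. (of_int (b u) - of_int q * m u) * of_int (u t))\<bar>"
        by (simp add: algebra_simps sum_subtractf sum_distrib_left)
      also have "\<dots> \<le> (\<Sum>p\<in>P. 1 / B * \<bar>of_int (p t)\<bar>) + (\<Sum>u\<in>U. 1 / B * \<bar>of_int (u t)\<bar>)"
        using a b
        by (intro order.trans[OF abs_triangle_ineq4] add_mono order.trans[OF sum_abs] sum_mono;
            unfold abs_mult abs_minus_commute[of "of_int (a _)"] abs_minus_commute[of "of_int (b _)"])
          (intro mult_right_mono less_imp_le abs_ge_zero; simp)+
      also have "\<dots> = ((\<Sum>p\<in>P. \<bar>of_int (p t)\<bar>) + (\<Sum>u\<in>U. \<bar>of_int (u t)\<bar>)) / B"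
        by (simp add: sum_divide_distrib add_divide_distrib)
      also have "\<dots> < 1"
      proof -
        have "(\<Sum>p\<in>P. \<bar>real_of_int (p t)\<bar>) \<le> (\<Sum>p\<in>P. \<Sum>t\<in>UNIV. \<bar>real_of_int (p t)\<bar>)"
             "(\<Sum>p\<in>U. \<bar>real_of_int (p t)\<bar>) \<le> (\<Sum>p\<in>U. \<Sum>t\<in>UNIV. \<bar>real_of_int (p t)\<bar>)"
          by (intro sum_mono member_le_sum[where f = "\<lambda>t. \<bar>real_of_int (_ t)\<bar>"]; simp)+
        moreover have "0 \<le> real (card P)" by simp
        ultimately have "(\<Sum>p\<in>P. \<bar>of_int (p t)\<bar>) + (\<Sum>u\<in>U. \<bar>of_int (u t)\<bar>) < B" unfolding B_def by linarith
        then show ?thesis using B by simp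
      qed
      finally show ?thesis by linarith
    qed
    ultimately show False using indep[of a b] by blast
  qed
  have "closed ?S" "convex ?S" "compact ?C" "convex ?C" "?C \<noteq> {}"
    using fin False by (auto simp: closed_subspace subspace_imp_convex intro!: finite_imp_compact_convex_hull)
  then obtain w b where w: "\<forall>x\<in>?S. w \<bullet> x < b" "\<forall>x\<in>?C. w \<bullet> x > b"
    using separating_hyperplane_closed_compact[of ?S ?C] disj by auto
  have b: "b > 0" using w(1) span_zero by fastforce
  have "w \<bullet> real_vec u = 0" if "u \<in> U" for u
  proof (rule ccontr)
    assume nz: "w \<bullet> real_vec u \<noteq> 0"
    have "(b / (w \<bullet> real_vec u)) *\<^sub>R real_vec u \<in> ?S" using that by (intro span_scale span_base) simp
    then show False using w(1) nz by fastforce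
  qed
  moreover have "w \<bullet> real_vec p > 0" if "p \<in> P" for p
    using w(2)[rule_format, of "real_vec p"] b that by (simp add: hull_inc)
  ultimately show ?thesis using that by blast
qed

section \<open>Division of germs and the basis theorem\<close>

lemma exponent_le_iff: "(a :: nat ^ 'n) \<le> k \<longleftrightarrow> (\<forall>t. vec_nth a t \<le> vec_nth k t)"
  by (rule Finite_Cartesian_Product.less_eq_vec_def)

lemma exponent_le_add [simp]: "(a :: nat ^ 'n) \<le> a + k" "(a :: nat ^ 'n) \<le> k + a"
  by (simp_all add: exponent_le_iff)

lemma exponent_diff_add: "(a :: nat ^ 'n) \<le> k \<Longrightarrow> k - a + a = k"
  by (simp add: exponent_le_iff Finite_Cartesian_Product.vec_eq_iff)

lemma exponent_add_diff [simp]: "(k :: nat ^ 'n) + a - a = k"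
  by (simp add: Finite_Cartesian_Product.vec_eq_iff)

text \<open>Induction over the coordinates that are compared. When \<open>s\<close> is added, the
  old set \<open>E\<close> still serves for every \<open>k\<close> whose \<open>s\<close>-coordinate
  is at least the maximum \<open>m\<close> over \<open>E\<close>; the rest lies in the finitely many
  slices with \<open>s\<close>-coordinate below \<open>m\<close>, each of which contributes its own
  finite set.\<close>

lemma dickson:
  fixes S :: "(nat ^ 'n :: finite) set"
  obtains E where "finite E" "E \<subseteq> S" "\<And>k. k \<in> S \<Longrightarrow> \<exists>e\<in>E. e \<le> k"
proof -
  have "\<exists>E. finite E \<and> E \<subseteq> S \<and> (\<forall>k\<in>S. \<exists>e\<in>E. \<forall>t\<in>T. vec_nth e t \<le> vec_nth k t)"
    for T :: "'n set" and S :: "(nat ^ 'n) set"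
  proof (induction T arbitrary: S rule: finite_induct[OF finite])
    case 1
    show ?case
    proof (cases "S = {}")
      case False
      then obtain s where "s \<in> S" by blast
      then show ?thesis by (intro exI[of _ "{s}"]) auto
    qed auto
  next
    case (2 s T)
    obtain E where E: "finite E" "E \<subseteq> S" "\<forall>k\<in>S. \<exists>e\<in>E. \<forall>t\<in>T. vec_nth e t \<le> vec_nth k t"
      using "2.IH"[of S] by blast
    have "\<forall>c. \<exists>E'. finite E' \<and> E' \<subseteq> {k\<in>S. vec_nth k s = c} \<and>
        (\<forall>k\<in>{k\<in>S. vec_nth k s = c}. \<exists>e\<in>E'. \<forall>t\<in>T. vec_nth e t \<le> vec_nth k t)"
      using "2.IH" by blast
    from choice[OF this] obtain F where *: "\<forall>c. finite (F c) \<and> F c \<subseteq> {k\<in>S. vec_nth k s = c} \<and>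
        (\<forall>k\<in>{k\<in>S. vec_nth k s = c}. \<exists>e\<in>F c. \<forall>t\<in>T. vec_nth e t \<le> vec_nth k t)" ..
    have F: "finite (F c)" "F c \<subseteq> {k\<in>S. vec_nth k s = c}" "F c \<subseteq> S"
      "k \<in> S \<Longrightarrow> vec_nth k s = c \<Longrightarrow> \<exists>e\<in>F c. \<forall>t\<in>T. vec_nth e t \<le> vec_nth k t" for c k
      using *[rule_format, of c] by blast+
    define m where "m = Max ((\<lambda>e. vec_nth e s) ` E)"
    have m: "vec_nth e s \<le> m" if "e \<in> E" for e
      unfolding m_def using E(1) that by (intro Max_ge) auto
    let ?E = "E \<union> (\<Union>c<m. F c)"
    have "\<exists>e\<in>?E. \<forall>t\<in>insert s T. vec_nth e t \<le> vec_nth k t" if k: "k \<in> S" for k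
    proof (cases "m \<le> vec_nth k s")
      case True
      from E(3) k obtain e where "e \<in> E" "\<forall>t\<in>T. vec_nth e t \<le> vec_nth k t" by blast
      then show ?thesis using m[of e] True by (intro bexI[of _ e]) auto
    next
      case False
      from F(4)[OF k refl] obtain e where e: "e \<in> F (vec_nth k s)" "\<forall>t\<in>T. vec_nth e t \<le> vec_nth k t" by blast
      then have "vec_nth e s = vec_nth k s" using F(2) by auto
      then show ?thesis using e False by (intro bexI[of _ e]) auto
    qed
    moreover have "finite ?E" "?E \<subseteq> S" using E F(1,3) by blast+
    ultimately show ?case by blast
  qed
  from this[of S UNIV] obtain E where "finite E \<and> E \<subseteq> S \<and>
    (\<forall>k\<in>S. \<exists>e\<in>E. \<forall>t\<in>UNIV. vec_nth e t \<le> vec_nth k t)" ..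
  then show ?thesis by (intro that[of E]) (auto simp: exponent_le_iff)
qed

section \<open>A multiplicative weight on exponents and the weighted norms\<close>

lemma exists_prime_injection: "\<exists>p :: 'n :: finite \<Rightarrow> nat. inj p \<and> (\<forall>t. prime (p t))"
proof -
  obtain B :: "nat set" where B: "finite B" "card B = CARD('n)" "B \<subseteq> {p. prime p}"
    using infinite_arbitrarily_large[OF primes_infinite] by blast
  then obtain p :: "'n \<Rightarrow> nat" where p: "bij_betw p UNIV B"
    using finite_same_card_bij[of "UNIV :: 'n set" B] by auto
  have "inj p" using p by (rule bij_betw_imp_inj_on)
  moreover have "prime (p t)" for t
  proof -
    have "p t \<in> B" using p by (rule bij_betw_apply) simp
    then show ?thesis using B(3) by blast
  qed
  ultimately show ?thesis by (intro exI[of _ p]) simp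
qed

definition coordinate_prime :: "'n :: finite \<Rightarrow> nat" where
  "coordinate_prime = (SOME p. inj p \<and> (\<forall>t. prime (p t)))"

lemma coordinate_prime: "inj (coordinate_prime :: 'n :: finite \<Rightarrow> nat)" "prime (coordinate_prime t)"
  using someI_ex[OF exists_prime_injection] by (auto simp: coordinate_prime_def)

text \<open>
  By unique factorisation the multiplicative weight \<open>prime_weight\<close> orders the monomials linearly;
  the weighted norms \<open>\<Sum>k. norm (f k) / prime_weight k ^ s\<close> play the role of norms on polydiscs.
\<close>

definition prime_weight :: "nat ^ 'n :: finite \<Rightarrow> nat" where
  "prime_weight k = (\<Prod>t\<in>UNIV. coordinate_prime t ^ vec_nth k t)"

lemma prime_weight_add: "prime_weight (j + k) = prime_weight j * prime_weight k"
  by (simp add: prime_weight_def power_add prod.distrib)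

lemma prime_weight_0 [simp]: "prime_weight 0 = 1"
  by (simp add: prime_weight_def)

lemma prime_weight_pos: "prime_weight k > 0"
  unfolding prime_weight_def by (intro prod_pos) (simp add: prime_gt_0_nat[OF coordinate_prime(2)])

lemma inj_prime_weight: "inj (prime_weight :: nat ^ 'n :: finite \<Rightarrow> nat)"
proof (rule injI)
  fix j k :: "nat ^ 'n" assume eq: "prime_weight j = prime_weight k"
  have "multiplicity (coordinate_prime t) (prime_weight k) = vec_nth k t" for k :: "nat ^ 'n" and t
  proof -
    let ?p = "inv_into UNIV (coordinate_prime :: 'n \<Rightarrow> nat)"
    have "prime_weight k = (\<Prod>p\<in>range (coordinate_prime :: 'n \<Rightarrow> nat). p ^ vec_nth k (?p p))"
      by (simp add: prime_weight_def prod.reindex coordinate_prime(1))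
    then show ?thesis
      using multiplicity_prod_prime_powers[of "range (coordinate_prime :: 'n \<Rightarrow> nat)" "coordinate_prime t" "\<lambda>p. vec_nth k (?p p)"]
      using inv_into_f_f[OF coordinate_prime(1), of t] coordinate_prime(2) by auto
  qed
  then show "j = k" using eq by (metis Finite_Cartesian_Product.vec_eq_iff)
qed

lemma two_power_le_prime_weight: "2 ^ total_degree k \<le> prime_weight k"
  unfolding prime_weight_def total_degree_def power_sum
  using coordinate_prime(2) by (intro prod_mono) (auto intro!: power_mono prime_ge_2_nat)

lemma prime_weight_le_power:
  "\<exists>P>0. \<forall>k :: nat ^ 'n :: finite. prime_weight k \<le> P ^ total_degree k"
proof -
  define P where "P = Max (range (coordinate_prime :: 'n \<Rightarrow> nat))"
  have "coordinate_prime t \<le> P" for t :: 'n by (simp add: P_def)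
  moreover from this[of undefined] have "P > 0"
    using prime_gt_0_nat[OF coordinate_prime(2)] by (metis order.strict_trans2)
  moreover have "prime_weight k \<le> P ^ total_degree k" for k :: "nat ^ 'n"
    unfolding prime_weight_def total_degree_def power_sum
    by (intro prod_mono) (auto intro!: power_mono calculation)
  ultimately show ?thesis by blast
qed

lemma finite_prime_weight_le: "finite {k :: nat ^ 'n :: finite. prime_weight k \<le> n}"
proof (rule finite_subset[OF _ finite_vec_le[of "\<lambda>_. n"]], clarify)
  fix k :: "nat ^ 'n" and t assume "prime_weight k \<le> n"
  have "vec_nth k t \<le> total_degree k" unfolding total_degree_def by (rule member_le_sum) auto
  also have "\<dots> \<le> 2 ^ total_degree k" by (rule less_imp_le[OF less_exp])
  also have "\<dots> \<le> n" using two_power_le_prime_weight[of k] \<open>prime_weight k \<le> n\<close> by simp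
  finally show "vec_nth k t \<le> n" .
qed

lemma weighted_summable_mono:
  fixes f :: "nat ^ 'n :: finite \<Rightarrow> complex"
  assumes "(\<lambda>k. norm (f k) / real (prime_weight k) ^ s) summable_on UNIV" "s \<le> s'"
  shows "(\<lambda>k. norm (f k) / real (prime_weight k) ^ s') summable_on UNIV"
  using assms(1)
proof (rule summable_on_comparison_test)
  fix k :: "nat ^ 'n"
  have "real (prime_weight k) ^ s \<le> real (prime_weight k) ^ s'"
    using prime_weight_pos[of k] assms(2) by (intro power_increasing) auto
  then show "norm (f k) / real (prime_weight k) ^ s' \<le> norm (f k) / real (prime_weight k) ^ s"
    using prime_weight_pos[of k] by (intro divide_left_mono) auto
qed auto

text \<open>Dividing by \<open>prime_weight k ^ s\<close> is evaluating on the polydisc whose radius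
  in direction \<open>t\<close> is the \<open>s\<close>-th power of
  \<open>1 / coordinate_prime t\<close>. The bounds of the weight by powers of \<open>2\<close> and
  of the largest prime compare it with polydiscs of a single radius.\<close>

lemma convergent_power_series_iff_weighted:
  fixes f :: "nat ^ 'n :: finite \<Rightarrow> complex"
  shows "convergent_power_series f \<longleftrightarrow> (\<exists>s. (\<lambda>k. norm (f k) / real (prime_weight k) ^ s) summable_on UNIV)"
proof
  assume "convergent_power_series f"
  then obtain r where r: "r > 0" "(\<lambda>k. norm (f k) * r ^ total_degree k) summable_on UNIV"
    by (auto simp: convergent_power_series_def)
  obtain s where s: "1 / r \<le> 2 ^ s"
    using real_arch_pow[of 2 "1 / r"] by (auto intro: less_imp_le)
  have "norm (f k) / real (prime_weight k) ^ s \<le> norm (f k) * r ^ total_degree k" for k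
  proof -
    have "(1 / r) ^ total_degree k \<le> (2 ^ s) ^ total_degree k" using s r by (intro power_mono) auto
    also have "\<dots> = (2 ^ total_degree k) ^ s" by (simp flip: power_mult add: mult.commute)
    also have "\<dots> \<le> real (prime_weight k) ^ s"
      using two_power_le_prime_weight[of k] by (intro power_mono) (auto simp flip: of_nat_le_iff)
    finally have "1 / real (prime_weight k) ^ s \<le> 1 / (1 / r) ^ total_degree k"
      using r(1) prime_weight_pos[of k] by (intro divide_left_mono) auto
    also have "\<dots> = r ^ total_degree k" by (simp add: power_one_over)
    finally have "1 / real (prime_weight k) ^ s \<le> r ^ total_degree k" .
    then have "norm (f k) * (1 / real (prime_weight k) ^ s) \<le> norm (f k) * r ^ total_degree k"
      by (intro mult_left_mono) auto
    then show ?thesis by simp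
  qed
  then have "(\<lambda>k. norm (f k) / real (prime_weight k) ^ s) summable_on UNIV"
    by (intro summable_on_comparison_test[OF r(2)]) auto
  then show "\<exists>s. (\<lambda>k. norm (f k) / real (prime_weight k) ^ s) summable_on UNIV" ..
next
  assume "\<exists>s. (\<lambda>k. norm (f k) / real (prime_weight k) ^ s) summable_on UNIV"
  then obtain s where s: "(\<lambda>k. norm (f k) / real (prime_weight k) ^ s) summable_on UNIV" ..
  obtain P :: nat where P: "P > 0" "\<And>k :: nat ^ 'n. prime_weight k \<le> P ^ total_degree k"
    using prime_weight_le_power by blast
  define r where "r = 1 / real P ^ s"
  have "norm (f k) * r ^ total_degree k \<le> norm (f k) / real (prime_weight k) ^ s" for k
  proof -
    have "real (prime_weight k) ^ s \<le> (real P ^ total_degree k) ^ s"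
      using P(2)[of k] by (intro power_mono) (auto simp flip: of_nat_power)
    then have "real (prime_weight k) ^ s \<le> (real P ^ s) ^ total_degree k"
      by (simp flip: power_mult add: mult.commute)
    then have "1 / (real P ^ s) ^ total_degree k \<le> 1 / real (prime_weight k) ^ s"
      using prime_weight_pos[of k] P(1) by (intro divide_left_mono) auto
    then have "norm (f k) * (1 / (real P ^ s) ^ total_degree k) \<le> norm (f k) * (1 / real (prime_weight k) ^ s)"
      by (intro mult_left_mono) auto
    then show ?thesis by (simp add: r_def power_one_over)
  qed
  then have "(\<lambda>k. norm (f k) * r ^ total_degree k) summable_on UNIV"
    using P by (intro summable_on_comparison_test[OF s]) (auto simp: r_def)
  then show "convergent_power_series f"
    unfolding convergent_power_series_def using P by (intro exI[of _ r]) (auto simp: r_def)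
qed

lemma convergent_power_series_shift:
  fixes f :: "nat ^ 'n :: finite \<Rightarrow> complex"
  assumes "convergent_power_series f"
  shows "convergent_power_series (\<lambda>k. if P k then f (k + a) else 0)"
proof -
  obtain r where r: "r > 0" "(\<lambda>k. norm (f k) * r ^ total_degree k) summable_on UNIV"
    using assms by (auto simp: convergent_power_series_def)
  have "(\<lambda>k. norm (f k) * r ^ total_degree k) summable_on range (\<lambda>k. k + a)"
    using r(2) by (rule summable_on_subset) simp
  then have "((\<lambda>k. norm (f k) * r ^ total_degree k) \<circ> (\<lambda>k. k + a)) summable_on UNIV"
    by (subst (asm) summable_on_reindex) (auto intro: injI)
  then have "(\<lambda>k. inverse (r ^ total_degree a) * (norm (f (k + a)) * r ^ total_degree (k + a))) summable_on UNIV"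
    by (intro summable_on_cmult_right) (simp add: o_def)
  then have "(\<lambda>k. norm (if P k then f (k + a) else 0) * r ^ total_degree k) summable_on UNIV"
    by (rule summable_on_comparison_test)
      (use r(1) in \<open>auto simp: total_degree_add power_add field_simps\<close>)
  then show ?thesis unfolding convergent_power_series_def using r(1) by blast
qed

lemma convergent_power_series_restrict:
  "convergent_power_series f \<Longrightarrow> convergent_power_series (\<lambda>k. if P k then f k else 0)"
  using convergent_power_series_shift[of f P 0] unfolding add_0_right .

lemma cauchy_product_monomial:
  fixes f :: "nat ^ 'n :: finite \<Rightarrow> complex"
  shows "cauchy_product f (monomial_series a c) k = (if a \<le> k then c * f (k - a) else 0)"
proof (cases "a \<le> k")
  case True
  have "cauchy_product f (monomial_series a c) k =
        (\<Sum>(i, j)\<in>{(k - a, a)}. f i * monomial_series a c j)"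
    unfolding cauchy_product_def
    by (rule sum.mono_neutral_right)
      (use True in \<open>auto simp: finite_add_eq monomial_series_def exponent_diff_add split: if_splits\<close>)
  then show ?thesis using True by (simp add: monomial_series_def)
next
  case False
  then have "f i * monomial_series a c j = 0" if "i + j = k" for i j
    using that by (auto simp: monomial_series_def)
  then show ?thesis using False by (auto simp: cauchy_product_def intro!: sum.neutral)
qed

section \<open>Division of germs and its consequences\<close>

lemma taylor_coeff_sum: "taylor_coeff (sum f A) k = (\<Sum>i\<in>A. taylor_coeff (f i) k)"
  by (induction A rule: infinite_finite_induct) (simp_all add: zero_germ.rep_eq plus_germ.rep_eq)

lemma germ_eqI: "(\<And>k. taylor_coeff f k = taylor_coeff g k) \<Longrightarrow> f = g"
  by (metis ext taylor_coeff_inject)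

lemma taylor_coeff_Abs: "convergent_power_series f \<Longrightarrow> taylor_coeff (Abs_germ f) = f"
  by (simp add: Abs_germ_inverse)

lemma taylor_coeff_convergent: "convergent_power_series (taylor_coeff f)"
  using taylor_coeff[of f] by simp

text \<open>Well-founded recursion for an operator whose value at \<open>x\<close> only looks at
  arguments of smaller measure, stated as a plain fixed point equation.\<close>

lemma wellfounded_fixpoint:
  fixes \<mu> :: "'a \<Rightarrow> nat"
  assumes "\<And>g h x. (\<And>y. \<mu> y < \<mu> x \<Longrightarrow> g y = h y) \<Longrightarrow> \<Phi> g x = \<Phi> h x"
  obtains g where "\<And>x. g x = \<Phi> g x"
proof -
  define g where "g = wfrec (Wellfounded.measure \<mu>) \<Phi>"
  have "g x = \<Phi> g x" for x
  proof -
    have "g x = \<Phi> (cut g (Wellfounded.measure \<mu>) x) x"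
      unfolding g_def by (rule wfrec) simp
    also have "\<dots> = \<Phi> g x" by (rule assms) (simp add: cut_apply)
    finally show ?thesis .
  qed
  then show ?thesis by (rule that)
qed

text \<open>All exponents of \<open>f\<close> weigh at least \<open>prime_weight a + 1\<close>. So
  each increase of \<open>s\<close> by one shrinks the norm of \<open>f\<close>, relative to that of
  the monomial with exponent \<open>a\<close>, by the fixed factor
  \<open>\<rho> < 1\<close>.\<close>

lemma small_tail:
  fixes f :: "nat ^ 'n :: finite \<Rightarrow> complex"
  assumes "convergent_power_series f" "\<epsilon> > 0" and lead: "\<And>k. f k \<noteq> 0 \<Longrightarrow> prime_weight a < prime_weight k"
  obtains s0 where "\<And>s. s \<ge> s0 \<Longrightarrow> (\<lambda>k. norm (f k) / real (prime_weight k) ^ s) summable_on UNIV"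
    "\<And>s. s \<ge> s0 \<Longrightarrow> real (prime_weight a) ^ s * (\<Sum>\<^sub>\<infinity>k. norm (f k) / real (prime_weight k) ^ s) \<le> \<epsilon>"
proof -
  obtain s1 where s1: "(\<lambda>k. norm (f k) / real (prime_weight k) ^ s1) summable_on UNIV"
    using assms(1) by (auto simp: convergent_power_series_iff_weighted)
  define C where "C = real (prime_weight a) ^ s1 * (\<Sum>\<^sub>\<infinity>k. norm (f k) / real (prime_weight k) ^ s1)"
  define \<rho> where "\<rho> = real (prime_weight a) / real (prime_weight a + 1)"
  have \<rho>: "0 < \<rho>" "\<rho> < 1" using prime_weight_pos[of a] by (auto simp: \<rho>_def)
  have "(\<lambda>n. C * \<rho> ^ n) \<longlonglongrightarrow> C * 0" using \<rho> by (intro tendsto_intros LIMSEQ_power_zero) auto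
  then have "eventually (\<lambda>n. C * \<rho> ^ n < \<epsilon>) sequentially" using assms(2) by (intro order_tendstoD) auto
  then obtain n0 where n0: "\<And>n. n \<ge> n0 \<Longrightarrow> C * \<rho> ^ n < \<epsilon>" by (auto simp: eventually_sequentially)
  show ?thesis
  proof (rule that[of "s1 + n0"])
    fix s assume s: "s \<ge> s1 + n0"
    show summ: "(\<lambda>k. norm (f k) / real (prime_weight k) ^ s) summable_on UNIV"
      using s by (intro weighted_summable_mono[OF s1]) auto
    let ?W = "\<lambda>k. real (prime_weight k)"
    have "norm (f k) / ?W k ^ s \<le> (\<rho> ^ (s - s1) * (?W a ^ s1 / ?W a ^ s)) * (norm (f k) / ?W k ^ s1)" for k
    proof (cases "f k = 0")
      case False
      then have "prime_weight a + 1 \<le> prime_weight k" using lead[of k] by simp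
      then have *: "real (prime_weight a + 1) \<le> ?W k" by (simp only: of_nat_le_iff)
      then have "1 / ?W k \<le> 1 / real (prime_weight a + 1)" by (intro divide_left_mono) auto
      then have "(1 / ?W k) ^ (s - s1) \<le> (1 / real (prime_weight a + 1)) ^ (s - s1)" by (intro power_mono) auto
      also have "\<dots> = (\<rho> / ?W a) ^ (s - s1)" using prime_weight_pos[of a] by (simp add: \<rho>_def)
      finally have le: "norm (f k) / ?W k ^ s1 * (1 / ?W k) ^ (s - s1) \<le> norm (f k) / ?W k ^ s1 * (\<rho> / ?W a) ^ (s - s1)"
        by (intro mult_left_mono) auto
      have split: "?W k ^ s = ?W k ^ s1 * ?W k ^ (s - s1)" "?W a ^ s = ?W a ^ s1 * ?W a ^ (s - s1)"
        using s by (simp_all flip: power_add)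
      have "norm (f k) / ?W k ^ s = norm (f k) / ?W k ^ s1 * (1 / ?W k) ^ (s - s1)"
        by (simp add: split power_one_over)
      also note le
      also have "norm (f k) / ?W k ^ s1 * (\<rho> / ?W a) ^ (s - s1) =
          (\<rho> ^ (s - s1) * (?W a ^ s1 / ?W a ^ s)) * (norm (f k) / ?W k ^ s1)"
        using prime_weight_pos[of a] by (simp add: split power_divide mult_ac)
      finally show ?thesis .
    qed simp
    then have "(\<Sum>\<^sub>\<infinity>k. norm (f k) / ?W k ^ s) \<le> (\<Sum>\<^sub>\<infinity>k. (\<rho> ^ (s - s1) * (?W a ^ s1 / ?W a ^ s)) * (norm (f k) / ?W k ^ s1))"
      by (intro infsum_mono summ summable_on_cmult_right s1)
    also have "\<dots> = (\<rho> ^ (s - s1) * (?W a ^ s1 / ?W a ^ s)) * (\<Sum>\<^sub>\<infinity>k. norm (f k) / ?W k ^ s1)"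
      by (rule infsum_cmult_right')
    finally have "?W a ^ s * (\<Sum>\<^sub>\<infinity>k. norm (f k) / ?W k ^ s) \<le>
        ?W a ^ s * ((\<rho> ^ (s - s1) * (?W a ^ s1 / ?W a ^ s)) * (\<Sum>\<^sub>\<infinity>k. norm (f k) / ?W k ^ s1))"
      by (intro mult_left_mono) auto
    also have "\<dots> = C * \<rho> ^ (s - s1)"
      using prime_weight_pos[of a] by (simp add: C_def)
    also have "\<dots> < \<epsilon>" using n0 s by simp
    finally show "?W a ^ s * (\<Sum>\<^sub>\<infinity>k. norm (f k) / ?W k ^ s) \<le> \<epsilon>" by simp
  qed
qed

text \<open>
  Grauert's division theorem. The remainder and the quotients are read off the solution \<open>G\<close> of
  \<open>G = f - T G\<close>, where \<open>T\<close> is triangular for the weight and contracts a weighted norm.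
\<close>

theorem germ_division:
  fixes F :: "'i \<Rightarrow> 'n :: finite germ" and a :: "'i \<Rightarrow> nat ^ 'n" and f :: "'n germ"
  assumes "finite I"
    and lc: "\<And>i. i \<in> I \<Longrightarrow> taylor_coeff (F i) (a i) = 1"
    and lead: "\<And>i k. i \<in> I \<Longrightarrow> taylor_coeff (F i) k \<noteq> 0 \<Longrightarrow> k \<noteq> a i \<Longrightarrow> prime_weight (a i) < prime_weight k"
  obtains q rem where "f = (\<Sum>i\<in>I. q i * F i) + rem"
    "\<And>i k. i \<in> I \<Longrightarrow> taylor_coeff rem k \<noteq> 0 \<Longrightarrow> \<not> a i \<le> k"
proof -
  let ?W = "\<lambda>k. real (prime_weight k)"
  have W: "?W k > 0" for k :: "nat ^ 'n" using prime_weight_pos[of k] by simp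
  define S where "S = {k. \<exists>i\<in>I. a i \<le> k}"
  \<comment> \<open>Each exponent divisible by some leading exponent is assigned to a single index;
    this decides which quotient receives it.\<close>
  define c where "c k = (SOME i. i \<in> I \<and> a i \<le> k)" for k
  have c: "c k \<in> I \<and> a (c k) \<le> k" if "k \<in> S" for k
    unfolding c_def by (rule someI_ex) (use that in \<open>auto simp: S_def\<close>)
  define tail where "tail i k = (if k \<noteq> a i then taylor_coeff (F i) k else 0)" for i k
  have tail_conv: "convergent_power_series (tail i)" for i
    unfolding tail_def by (intro convergent_power_series_restrict taylor_coeff_convergent)
  have tail_lead: "prime_weight (a i) < prime_weight k" if "i \<in> I" "tail i k \<noteq> 0" for i k
    using lead that by (auto simp: tail_def split: if_splits)
  \<comment> \<open>\<open>Q G i\<close> is the part of \<open>G\<close> assigned to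
    \<open>i\<close>, divided by the leading monomial, and \<open>T G\<close> is what the tails of
    the \<open>F i\<close> add to the products with these quotients.\<close>
  define Q where "Q G i u = (if c (u + a i) = i then G (u + a i) else 0)" for G :: "nat ^ 'n \<Rightarrow> complex" and i u
  define T where "T G k = (\<Sum>i\<in>I. cauchy_product (Q G i) (tail i) k)" for G k
  have "\<exists>G. \<forall>k. G k = taylor_coeff f k - T G k"
  proof -
    have local: "T G k = T H k" if "\<And>j. prime_weight j < prime_weight k \<Longrightarrow> G j = H j" for G H k
    proof -
      have "Q G i u * tail i b = Q H i u * tail i b" if "i \<in> I" "u + b = k" for i u b
      proof (cases "tail i b = 0")
        case False
        then have "prime_weight (u + a i) < prime_weight (u + b)"
          using tail_lead[OF that(1)] prime_weight_pos[of u] by (simp add: prime_weight_add)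
        then show ?thesis using \<open>\<And>j. prime_weight j < prime_weight k \<Longrightarrow> G j = H j\<close> that(2)
          by (simp add: Q_def)
      qed simp
      then show ?thesis
        unfolding T_def cauchy_product_def by (intro sum.cong refl) auto
    qed
    have "taylor_coeff f k - T G k = taylor_coeff f k - T H k"
      if "\<And>j. prime_weight j < prime_weight k \<Longrightarrow> G j = H j" for G H k
      using local[OF that] by simp
    from wellfounded_fixpoint[of prime_weight "\<lambda>G k. taylor_coeff f k - T G k", OF this]
    show ?thesis by metis
  qed
  then obtain G where G: "\<And>k. G k = taylor_coeff f k - T G k" by blast
  obtain s where sf: "(\<lambda>k. norm (taylor_coeff f k) / ?W k ^ s) summable_on UNIV"
    and st: "\<And>i. i \<in> I \<Longrightarrow> (\<lambda>k. norm (tail i k) / ?W k ^ s) summable_on UNIV"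
    and small: "\<And>i. i \<in> I \<Longrightarrow> ?W (a i) ^ s * (\<Sum>\<^sub>\<infinity>k. norm (tail i k) / ?W k ^ s) \<le> 1/2"
  proof -
    obtain sf where sf: "(\<lambda>k. norm (taylor_coeff f k) / ?W k ^ sf) summable_on UNIV"
      using taylor_coeff_convergent[of f] by (auto simp: convergent_power_series_iff_weighted)
    have "\<forall>i\<in>I. \<exists>s0. \<forall>s\<ge>s0. (\<lambda>k. norm (tail i k) / ?W k ^ s) summable_on UNIV \<and>
        ?W (a i) ^ s * (\<Sum>\<^sub>\<infinity>k. norm (tail i k) / ?W k ^ s) \<le> 1/2"
    proof
      fix i assume i: "i \<in> I"
      obtain s0 where "\<And>s. s \<ge> s0 \<Longrightarrow> (\<lambda>k. norm (tail i k) / ?W k ^ s) summable_on UNIV"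
          "\<And>s. s \<ge> s0 \<Longrightarrow> ?W (a i) ^ s * (\<Sum>\<^sub>\<infinity>k. norm (tail i k) / ?W k ^ s) \<le> 1/2"
        using small_tail[OF tail_conv, of "1/2" i "a i"] tail_lead[OF i] by auto
      then show "\<exists>s0. \<forall>s\<ge>s0. (\<lambda>k. norm (tail i k) / ?W k ^ s) summable_on UNIV \<and>
        ?W (a i) ^ s * (\<Sum>\<^sub>\<infinity>k. norm (tail i k) / ?W k ^ s) \<le> 1/2" by blast
    qed
    from bchoice[OF this] obtain s0 where "\<forall>i\<in>I. \<forall>s\<ge>s0 i. (\<lambda>k. norm (tail i k) / ?W k ^ s) summable_on UNIV \<and>
        ?W (a i) ^ s * (\<Sum>\<^sub>\<infinity>k. norm (tail i k) / ?W k ^ s) \<le> 1/2" ..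
    then have s0: "(\<lambda>k. norm (tail i k) / ?W k ^ s) summable_on UNIV"
      "?W (a i) ^ s * (\<Sum>\<^sub>\<infinity>k. norm (tail i k) / ?W k ^ s) \<le> 1/2" if "i \<in> I" "s \<ge> s0 i" for i s
      using that by blast+
    have ge: "sf + sum s0 I \<ge> s0 i" if "i \<in> I" for i
      using member_le_sum[OF that, of s0] assms(1) by simp
    show ?thesis
    proof (rule that[of "sf + sum s0 I"])
      show "(\<lambda>k. norm (taylor_coeff f k) / ?W k ^ (sf + sum s0 I)) summable_on UNIV"
        by (rule weighted_summable_mono[OF sf]) simp
    qed (rule s0(1)[OF _ ge] s0(2)[OF _ ge], assumption, assumption)+
  qed
  \<comment> \<open>The convergence of \<open>G\<close> is not yet known. Finite partial norms can
    be subtracted from both sides of an estimate \<open>nrm n \<le> C + nrm n / 2\<close>, and the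
    bound \<open>2 * C\<close> does not depend on \<open>n\<close>.\<close>
  define nrm where "nrm n = (\<Sum>k | prime_weight k \<le> n. norm (G k) / ?W k ^ s)" for n
  define C where "C = (\<Sum>\<^sub>\<infinity>k. norm (taylor_coeff f k) / ?W k ^ s)"
  have "nrm n \<le> 2 * C" for n
  proof -
    let ?F = "{k :: nat ^ 'n. prime_weight k \<le> n}"
    note fin = finite_prime_weight_le[of n]
    \<comment> \<open>The sets \<open>X i\<close> are disjoint, so a factor \<open>1/2\<close> for
      each index separately yields a factor \<open>1/2\<close> for \<open>T\<close> as a
      whole.\<close>
    define X where "X i = {j \<in> ?F. c j = i \<and> a i \<le> j}" for i
    have "(\<Sum>k\<in>?F. norm (cauchy_product (Q G i) (tail i) k) / ?W k ^ s) \<le> 1/2 * (\<Sum>j\<in>X i. norm (G j) / ?W j ^ s)"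
      if i: "i \<in> I" for i
    proof -
      let ?t = "\<lambda>b. norm (tail i b) / ?W b ^ s"
      let ?g = "\<lambda>u. norm (Q G i u) / ?W u ^ s"
      \<comment> \<open>Zero products are discarded on purpose: if \<open>tail i b\<close> is
        nonzero, then \<open>u + a i\<close> weighs less than \<open>u + b\<close>, so the entries
        of \<open>G\<close> that occur stay within the weight bound \<open>n\<close>.\<close>
      define Y where "Y = (\<Union>k\<in>?F. {(u, b). u + b = k \<and> Q G i u * tail i b \<noteq> 0})"
      have finY: "finite Y" unfolding Y_def
        by (intro finite_UN_I fin) (auto intro: finite_subset[OF _ finite_add_eq])
      have "norm (cauchy_product (Q G i) (tail i) k) / ?W k ^ s
          \<le> (\<Sum>p\<in>{(u, b). u + b = k \<and> Q G i u * tail i b \<noteq> 0}. ?g (fst p) * ?t (snd p))" for k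
      proof -
        have "cauchy_product (Q G i) (tail i) k =
            (\<Sum>p\<in>{(u, b). u + b = k \<and> Q G i u * tail i b \<noteq> 0}. Q G i (fst p) * tail i (snd p))"
          unfolding cauchy_product_def case_prod_unfold
          by (rule sum.mono_neutral_right) (use finite_add_eq[of k] in \<open>auto simp: case_prod_unfold\<close>)
        then have "norm (cauchy_product (Q G i) (tail i) k) / ?W k ^ s \<le>
            (\<Sum>p\<in>{(u, b). u + b = k \<and> Q G i u * tail i b \<noteq> 0}. norm (Q G i (fst p) * tail i (snd p))) / ?W k ^ s"
          using W by (auto intro!: divide_right_mono norm_sum)
        also have "\<dots> = (\<Sum>p\<in>{(u, b). u + b = k \<and> Q G i u * tail i b \<noteq> 0}. ?g (fst p) * ?t (snd p))"
          unfolding sum_divide_distrib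
          by (rule sum.cong) (auto simp: norm_mult prime_weight_add power_mult_distrib)
        finally show ?thesis .
      qed
      then have "(\<Sum>k\<in>?F. norm (cauchy_product (Q G i) (tail i) k) / ?W k ^ s)
          \<le> (\<Sum>k\<in>?F. \<Sum>p\<in>{(u, b). u + b = k \<and> Q G i u * tail i b \<noteq> 0}. ?g (fst p) * ?t (snd p))"
        by (intro sum_mono)
      also have "\<dots> = (\<Sum>p\<in>Y. ?g (fst p) * ?t (snd p))"
        unfolding Y_def using fin
        by (subst sum.UNION_disjoint) (auto intro: finite_subset[OF _ finite_add_eq])
      also have "\<dots> \<le> (\<Sum>p\<in>fst ` Y \<times> snd ` Y. ?g (fst p) * ?t (snd p))"
        using finY by (intro sum_mono2) (auto intro: rev_image_eqI)
      also have "\<dots> = sum ?g (fst ` Y) * sum ?t (snd ` Y)"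
        by (simp add: sum_product sum.cartesian_product case_prod_unfold)
      also have "sum ?t (snd ` Y) \<le> (\<Sum>\<^sub>\<infinity>b. ?t b)"
        using finY by (intro finite_sum_le_infsum st i) auto
      also have "sum ?g (fst ` Y) = (\<Sum>j\<in>(\<lambda>u. u + a i) ` fst ` Y. norm (G j) / ?W j ^ s) * ?W (a i) ^ s"
      proof -
        have "?g u = norm (G (u + a i)) / ?W (u + a i) ^ s * ?W (a i) ^ s" if "u \<in> fst ` Y" for u
        proof -
          from that have "Q G i u \<noteq> 0" by (auto simp: Y_def)
          then have "Q G i u = G (u + a i)" by (auto simp: Q_def split: if_splits)
          then show ?thesis using W[of "a i"] by (simp add: prime_weight_add power_mult_distrib)
        qed
        then show ?thesis
          by (subst sum.reindex) (auto simp: sum_distrib_right intro!: inj_onI sum.cong)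
      qed
      also have "(\<Sum>j\<in>(\<lambda>u. u + a i) ` fst ` Y. norm (G j) / ?W j ^ s) \<le> (\<Sum>j\<in>X i. norm (G j) / ?W j ^ s)"
      proof (rule sum_mono2)
        show "finite (X i)" unfolding X_def using fin by (rule finite_subset[rotated]) auto
        show "(\<lambda>u. u + a i) ` fst ` Y \<subseteq> X i"
        proof clarify
          fix u b assume "(u, b) \<in> Y"
          then have *: "prime_weight (u + b) \<le> n" "Q G i u \<noteq> 0" "tail i b \<noteq> 0" by (auto simp: Y_def)
          have "prime_weight (u + a i) \<le> prime_weight (u + b)"
            using tail_lead[OF i *(3)] by (simp add: prime_weight_add)
          moreover have "c (u + a i) = i" using *(2) by (auto simp: Q_def split: if_splits)
          ultimately show "fst (u, b) + a i \<in> X i" using * by (simp add: X_def)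
        qed
      qed auto
      finally have "(\<Sum>k\<in>?F. norm (cauchy_product (Q G i) (tail i) k) / ?W k ^ s)
          \<le> (\<Sum>j\<in>X i. norm (G j) / ?W j ^ s) * (?W (a i) ^ s * (\<Sum>\<^sub>\<infinity>b. ?t b))"
        by (simp add: mult_left_mono mult_right_mono sum_nonneg infsum_nonneg mult.assoc)
      also have "\<dots> \<le> (\<Sum>j\<in>X i. norm (G j) / ?W j ^ s) * (1/2)"
        using small[OF i] by (intro mult_left_mono sum_nonneg) auto
      finally show ?thesis by simp
    qed
    then have *: "(\<Sum>i\<in>I. \<Sum>k\<in>?F. norm (cauchy_product (Q G i) (tail i) k) / ?W k ^ s)
        \<le> (\<Sum>i\<in>I. 1/2 * (\<Sum>j\<in>X i. norm (G j) / ?W j ^ s))"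
      by (intro sum_mono)
    have "(\<Sum>i\<in>I. \<Sum>j\<in>X i. norm (G j) / ?W j ^ s) = (\<Sum>j\<in>(\<Union>i\<in>I. X i). norm (G j) / ?W j ^ s)"
      using assms(1) fin by (subst sum.UNION_disjoint) (auto simp: X_def)
    also have "\<dots> \<le> nrm n"
      unfolding nrm_def using fin by (intro sum_mono2) (auto simp: X_def)
    finally have X: "(\<Sum>i\<in>I. \<Sum>j\<in>X i. norm (G j) / ?W j ^ s) \<le> nrm n" .
    have "nrm n \<le> (\<Sum>k\<in>?F. norm (taylor_coeff f k) / ?W k ^ s + (\<Sum>i\<in>I. norm (cauchy_product (Q G i) (tail i) k) / ?W k ^ s))"
      unfolding nrm_def
    proof (rule sum_mono)
      fix k :: "nat ^ 'n"
      have "norm (G k) \<le> norm (taylor_coeff f k) + norm (T G k)"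
        by (subst G) (rule norm_triangle_ineq4)
      also have "norm (T G k) \<le> (\<Sum>i\<in>I. norm (cauchy_product (Q G i) (tail i) k))"
        unfolding T_def by (rule norm_sum)
      finally have "norm (G k) / ?W k ^ s \<le> (norm (taylor_coeff f k) + (\<Sum>i\<in>I. norm (cauchy_product (Q G i) (tail i) k))) / ?W k ^ s"
        using W[of k] by (intro divide_right_mono) auto
      then show "norm (G k) / ?W k ^ s \<le> norm (taylor_coeff f k) / ?W k ^ s + (\<Sum>i\<in>I. norm (cauchy_product (Q G i) (tail i) k) / ?W k ^ s)"
        by (simp add: add_divide_distrib sum_divide_distrib)
    qed
    also have "\<dots> = (\<Sum>k\<in>?F. norm (taylor_coeff f k) / ?W k ^ s) +
        (\<Sum>i\<in>I. \<Sum>k\<in>?F. norm (cauchy_product (Q G i) (tail i) k) / ?W k ^ s)"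
      unfolding sum.distrib by (subst (2) sum.swap) (rule refl)
    also have "(\<Sum>k\<in>?F. norm (taylor_coeff f k) / ?W k ^ s) \<le> C"
      unfolding C_def using fin by (intro finite_sum_le_infsum sf) auto
    finally have "nrm n \<le> C + 1/2 * (\<Sum>i\<in>I. \<Sum>j\<in>X i. norm (G j) / ?W j ^ s)"
      using * by (simp add: sum_distrib_left)
    with X show ?thesis by linarith
  qed
  have G_conv: "convergent_power_series G"
  proof -
    have "(\<lambda>k. norm (G k) / ?W k ^ s) summable_on UNIV"
    proof (rule nonneg_bdd_above_summable_on)
      show "bdd_above (sum (\<lambda>k. norm (G k) / ?W k ^ s) ` {F. F \<subseteq> UNIV \<and> finite F})"
      proof (rule bdd_aboveI, clarify)
        fix F :: "(nat ^ 'n) set" assume F: "finite F"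
        have "sum (\<lambda>k. norm (G k) / ?W k ^ s) F \<le> nrm (sum prime_weight F)"
          unfolding nrm_def using F
          by (intro sum_mono2 finite_prime_weight_le) (auto intro: member_le_sum)
        also have "\<dots> \<le> 2 * C" by fact
        finally show "sum (\<lambda>k. norm (G k) / ?W k ^ s) F \<le> 2 * C" .
      qed
    qed auto
    then show ?thesis by (auto simp: convergent_power_series_iff_weighted)
  qed
  define q where "q i = Abs_germ (Q G i)" for i
  define rem where "rem = Abs_germ (\<lambda>k. if k \<notin> S then G k else 0)"
  have q: "taylor_coeff (q i) = Q G i" for i
    unfolding q_def Q_def by (intro taylor_coeff_Abs convergent_power_series_shift G_conv)
  have rem: "taylor_coeff rem = (\<lambda>k. if k \<notin> S then G k else 0)"
    unfolding rem_def by (intro taylor_coeff_Abs convergent_power_series_restrict G_conv)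
  have "f = (\<Sum>i\<in>I. q i * F i) + rem"
  proof (rule germ_eqI)
    fix k
    have Fi: "taylor_coeff (F i) = (\<lambda>k. tail i k + monomial_series (a i) 1 k)" if "i \<in> I" for i
      using lc[OF that] by (auto simp: tail_def monomial_series_def)
    have "taylor_coeff (q i * F i) k = cauchy_product (Q G i) (tail i) k + (if i = c k \<and> a i \<le> k then G k else 0)"
      if i: "i \<in> I" for i
    proof -
      have "taylor_coeff (q i * F i) k = cauchy_product (Q G i) (\<lambda>k. tail i k + monomial_series (a i) 1 k) k"
        by (simp add: times_germ.rep_eq q Fi[OF i])
      also have "\<dots> = cauchy_product (Q G i) (tail i) k + cauchy_product (Q G i) (monomial_series (a i) 1) k"
        by (simp add: cauchy_product_def distrib_left sum.distrib case_prod_unfold)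
      finally show ?thesis by (auto simp: cauchy_product_monomial Q_def exponent_diff_add)
    qed
    then have "(\<Sum>i\<in>I. taylor_coeff (q i * F i) k) = T G k + (\<Sum>i\<in>I. if i = c k \<and> a i \<le> k then G k else 0)"
      by (simp add: T_def sum.distrib)
    also have "(\<Sum>i\<in>I. if i = c k \<and> a i \<le> k then G k else 0) = (if k \<in> S then G k else 0)"
    proof (cases "k \<in> S")
      case True
      have "(\<Sum>i\<in>I. if i = c k \<and> a i \<le> k then G k else 0) = (\<Sum>i\<in>I. if i = c k then G k else 0)"
        using c[OF True] by (intro sum.cong) auto
      then show ?thesis using True c[OF True] assms(1) by (simp add: sum.delta)
    next
      case False
      then show ?thesis by (auto simp: S_def intro!: sum.neutral)
    qed
    finally show "taylor_coeff f k = taylor_coeff ((\<Sum>i\<in>I. q i * F i) + rem) k"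
      using G[of k] by (auto simp: taylor_coeff_sum plus_germ.rep_eq rem)
  qed
  moreover have "\<not> a i \<le> k" if "i \<in> I" "taylor_coeff rem k \<noteq> 0" for i k
    using that by (auto simp: rem S_def split: if_splits)
  ultimately show ?thesis by (rule that)
qed


lemma exponent_0_le [simp]: "(0 :: nat ^ 'n) \<le> k"
  by (simp add: exponent_le_iff)

lemma prime_weight_eq_iff: "prime_weight j = prime_weight k \<longleftrightarrow> j = k"
  by (rule inj_eq[OF inj_prime_weight])

text \<open>After scaling, the leading exponent of \<open>f\<close> is \<open>0\<close>. Every
  exponent lies above \<open>0\<close>, so division of \<open>1\<close> by \<open>f\<close> leaves
  no remainder.\<close>

lemma germ_unit:
  fixes f :: "'n :: finite germ"
  assumes "taylor_coeff f 0 \<noteq> 0"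
  shows "f dvd 1"
proof -
  define c where "c = Abs_germ (monomial_series 0 (inverse (taylor_coeff f 0)) :: nat ^ 'n \<Rightarrow> complex)"
  have c: "taylor_coeff c = monomial_series 0 (inverse (taylor_coeff f 0))"
    unfolding c_def by (intro taylor_coeff_Abs convergent_power_series_monomial)
  have cf: "taylor_coeff (c * f) k = inverse (taylor_coeff f 0) * taylor_coeff f k" for k
    by (simp add: times_germ.rep_eq c cauchy_product_monomial_zero)
  have lead: "prime_weight (0 :: nat ^ 'n) < prime_weight k" if "k \<noteq> 0" for k :: "nat ^ 'n"
    using prime_weight_pos[of k] prime_weight_eq_iff[of k 0] that by simp
  obtain q rem where eq: "1 = (\<Sum>i\<in>{()}. q i * (c * f)) + rem"
    and rem: "\<And>i k. i \<in> {()} \<Longrightarrow> taylor_coeff rem k \<noteq> 0 \<Longrightarrow> \<not> 0 \<le> k"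
  proof (rule germ_division[of "{()}" "\<lambda>_. c * f" "\<lambda>_. 0" 1])
    show "taylor_coeff (c * f) 0 = 1" using assms by (simp add: cf)
    show "prime_weight 0 < prime_weight k" if "k \<noteq> 0" for k :: "nat ^ 'n" using that lead[of k] by simp
  qed (simp, rule that)
  have "taylor_coeff rem k = 0" for k
    using rem[of "()" k] exponent_0_le[of k] by fastforce
  then have "rem = 0" by (intro germ_eqI) (simp add: zero_germ.rep_eq)
  with eq have "1 = q () * (c * f)" by simp
  also have "\<dots> = f * (q () * c)" by (simp only: mult_ac)
  finally show ?thesis by (rule dvdI)
qed

text \<open>A standard basis: Dickson's lemma selects finitely many leading exponents that divide
  all others. The remainder of an element of the ideal lies in the ideal but has no exponent above a
  selected one, so it has no leading exponent and is zero.\<close>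

theorem germ_ideal_finitely_generated:
  fixes I :: "'n :: finite germ set"
  assumes zero: "0 \<in> I" and add: "\<And>f g. f \<in> I \<Longrightarrow> g \<in> I \<Longrightarrow> f + g \<in> I"
    and mult: "\<And>f g. f \<in> I \<Longrightarrow> g * f \<in> I"
  obtains S where "finite S" "S \<subseteq> I" "\<And>f. f \<in> I \<Longrightarrow> \<exists>c. f = (\<Sum>g\<in>S. c g * g)"
proof -
  define lead where "lead f a \<longleftrightarrow> taylor_coeff f a = 1 \<and>
      (\<forall>k. taylor_coeff f k \<noteq> 0 \<longrightarrow> k \<noteq> a \<longrightarrow> prime_weight a < prime_weight k)" for f :: "'n germ" and a
  define A where "A = {a. \<exists>f\<in>I. lead f a}"
  have leadI: "\<exists>a\<in>A. taylor_coeff f a \<noteq> 0" if "f \<in> I" "f \<noteq> 0" for f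
  proof -
    from that(2) have "\<exists>k. taylor_coeff f k \<noteq> 0" by (metis germ_eqI zero_germ.rep_eq)
    then obtain a where a: "taylor_coeff f a \<noteq> 0"
      "\<And>k. taylor_coeff f k \<noteq> 0 \<Longrightarrow> prime_weight a \<le> prime_weight k"
      using ex_has_least_nat[of "\<lambda>k. taylor_coeff f k \<noteq> 0" _ prime_weight] by (elim exE) blast
    define c where "c = Abs_germ (monomial_series 0 (inverse (taylor_coeff f a)) :: nat ^ 'n \<Rightarrow> complex)"
    have c: "taylor_coeff c = monomial_series 0 (inverse (taylor_coeff f a))"
      unfolding c_def by (intro taylor_coeff_Abs convergent_power_series_monomial)
    have cf: "taylor_coeff (c * f) k = inverse (taylor_coeff f a) * taylor_coeff f k" for k
      by (simp add: times_germ.rep_eq c cauchy_product_monomial_zero)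
    have "lead (c * f) a"
      unfolding lead_def using a by (auto simp: cf prime_weight_eq_iff le_less)
    then have "a \<in> A" unfolding A_def using mult[OF that(1)] by blast
    with a show ?thesis by blast
  qed
  obtain E where E: "finite E" "E \<subseteq> A" "\<And>k. k \<in> A \<Longrightarrow> \<exists>e\<in>E. e \<le> k"
    by (rule dickson[of A], rule that)
  have "\<forall>e\<in>E. \<exists>f. f \<in> I \<and> lead f e" using E(2) by (auto simp: A_def)
  then obtain F where F: "\<And>e. e \<in> E \<Longrightarrow> F e \<in> I \<and> lead (F e) e" by metis
  have sum_mem: "(\<And>i. i \<in> X \<Longrightarrow> h i \<in> I) \<Longrightarrow> sum h X \<in> I" for h :: "nat ^ 'n \<Rightarrow> 'n germ" and X
    by (induction X rule: infinite_finite_induct) (auto intro: zero add)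
  have "\<exists>c. f = (\<Sum>g\<in>F ` E. c g * g)" if f: "f \<in> I" for f
  proof -
    obtain q rem where q: "f = (\<Sum>e\<in>E. q e * F e) + rem"
      "\<And>e k. e \<in> E \<Longrightarrow> taylor_coeff rem k \<noteq> 0 \<Longrightarrow> \<not> e \<le> k"
    proof (rule germ_division[of E F "\<lambda>e. e" f])
      show "taylor_coeff (F e) e = 1" if "e \<in> E" for e using F[OF that] unfolding lead_def by blast
      show "prime_weight e < prime_weight k" if "e \<in> E" "taylor_coeff (F e) k \<noteq> 0" "k \<noteq> e" for e k
        using F[OF that(1)] that(2,3) unfolding lead_def by blast
    qed (rule E(1), rule that)
    have "f + (-1) * (\<Sum>e\<in>E. q e * F e) \<in> I"
      using F by (intro add f mult sum_mem) auto
    then have "rem \<in> I" using q(1) by simp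
    have "rem = 0"
    proof (rule ccontr)
      assume "rem \<noteq> 0"
      from leadI[OF \<open>rem \<in> I\<close> this] obtain k where k: "k \<in> A" "taylor_coeff rem k \<noteq> 0" ..
      from E(3)[OF k(1)] obtain e where "e \<in> E" "e \<le> k" ..
      with q(2)[OF this(1) k(2)] show False by simp
    qed
    then have "f = (\<Sum>e\<in>E. q e * F e)" using q by simp
    also have "\<dots> = (\<Sum>g\<in>F ` E. \<Sum>e\<in>{e\<in>E. F e = g}. q e * F e)"
      by (rule sum.image_gen[OF E(1)])
    also have "\<dots> = (\<Sum>g\<in>F ` E. (\<Sum>e\<in>{e\<in>E. F e = g}. q e) * g)"
      by (intro sum.cong refl) (simp add: sum_distrib_right)
    finally show ?thesis by (intro exI[of _ "\<lambda>g. \<Sum>e\<in>{e\<in>E. F e = g}. q e"])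
  qed
  moreover have "finite (F ` E)" "F ` E \<subseteq> I" using E F by auto
  ultimately show ?thesis using that by blast
qed

section \<open>Monomials and constants\<close>

lemma ring_module: "Modules.module ((*) :: 'a :: comm_ring_1 \<Rightarrow> 'a \<Rightarrow> 'a)"
  by unfold_locales (simp_all add: algebra_simps)

lemma generated_ideal_base: "a \<in> S \<Longrightarrow> a \<in> generated_ideal S"
  unfolding generated_ideal_def by (rule module.span_base[OF ring_module])

lemma generated_ideal_induct:
  assumes "a \<in> generated_ideal S" "P 0" "\<And>c x y. x \<in> S \<Longrightarrow> P y \<Longrightarrow> P (c * x + y)"
  shows "P a"
  using module.span_induct_alt[OF ring_module assms(1)[unfolded generated_ideal_def], of P] assms(2,3) by simp

lemma generated_ideal_closed:
  "0 \<in> generated_ideal S" "a \<in> generated_ideal S \<Longrightarrow> b \<in> generated_ideal S \<Longrightarrow> a + b \<in> generated_ideal S"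
  "a \<in> generated_ideal S \<Longrightarrow> c * a \<in> generated_ideal S"
  unfolding generated_ideal_def
  using module.span_zero[OF ring_module] module.span_add[OF ring_module] module.span_scale[OF ring_module] by auto

lemma generated_ideal_sum:
  "(\<And>i. i \<in> A \<Longrightarrow> f i \<in> generated_ideal S) \<Longrightarrow> sum f A \<in> generated_ideal S"
  unfolding generated_ideal_def by (rule module.span_sum[OF ring_module])

lift_definition const_germ :: "complex \<Rightarrow> 'n :: finite germ" is "monomial_series 0"
  by (rule convergent_power_series_monomial)

lemma taylor_coeff_const_germ: "taylor_coeff (const_germ c) k = (if k = 0 then c else 0)"
  by (simp add: const_germ.rep_eq monomial_series_def)

lemma taylor_coeff_const_mult [simp]: "taylor_coeff (const_germ c * f) k = c * taylor_coeff f k"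
  by (simp add: times_germ.rep_eq const_germ.rep_eq cauchy_product_monomial_zero)

lemma taylor_coeff_simps [simp]:
  "taylor_coeff (f + g) k = taylor_coeff f k + taylor_coeff g k"
  "taylor_coeff (f - g) k = taylor_coeff f k - taylor_coeff g k"
  "taylor_coeff (- f) k = - taylor_coeff f k"
  "taylor_coeff 0 k = 0"
  by (simp_all add: plus_germ.rep_eq minus_germ.rep_eq uminus_germ.rep_eq zero_germ.rep_eq)

lemma taylor_coeff_1: "taylor_coeff 1 k = (if k = 0 then 1 else 0)"
  by (simp add: one_germ.rep_eq monomial_series_def)

lemma const_germ_hom:
  "const_germ (a + b) = const_germ a + (const_germ b :: 'n :: finite germ)"
  "const_germ (a * b) = const_germ a * (const_germ b :: 'n :: finite germ)"
  "const_germ 1 = (1 :: 'n :: finite germ)" "const_germ 0 = (0 :: 'n :: finite germ)"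
  by (rule germ_eqI, simp add: taylor_coeff_const_germ taylor_coeff_1)+

lemma const_germ_sum: "const_germ (sum f A) = (\<Sum>i\<in>A. const_germ (f i) :: 'n :: finite germ)"
  by (induction A rule: infinite_finite_induct) (simp_all add: const_germ_hom)

lemma const_germ_power: "const_germ (a ^ m) = (const_germ a :: 'n :: finite germ) ^ m"
  by (induction m) (simp_all add: const_germ_hom)

lemma const_germ_prod: "const_germ (prod f A) = (\<Prod>i\<in>A. const_germ (f i) :: 'n :: finite germ)"
  by (induction A rule: infinite_finite_induct) (simp_all add: const_germ_hom)

lemma taylor_coeff_mult_0: "taylor_coeff (f * g) 0 = taylor_coeff f 0 * taylor_coeff (g :: 'n :: finite germ) 0"
proof -
  have "{(i, j). i + j = (0 :: nat ^ 'n)} = {(0, 0)}"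
    by (auto simp: Finite_Cartesian_Product.vec_eq_iff)
  then show ?thesis by (simp add: times_germ.rep_eq cauchy_product_def)
qed

lemma taylor_coeff_monomial: "taylor_coeff (germ_monomial a) k = (if k = a then 1 else 0)"
  by (simp add: germ_monomial.rep_eq monomial_series_def)

lemma taylor_coeff_mult_monomial:
  "taylor_coeff (f * germ_monomial a) k = (if a \<le> k then taylor_coeff f (k - a) else 0)"
  by (simp add: times_germ.rep_eq germ_monomial.rep_eq cauchy_product_monomial)

lemma germ_monomial_add: "germ_monomial (j + k) = germ_monomial j * germ_monomial (k :: nat ^ 'n :: finite)"
proof (rule germ_eqI)
  fix m :: "nat ^ 'n"
  have "k \<le> m \<and> m - k = j \<longleftrightarrow> m = j + k" using exponent_diff_add[of k m] by auto
  then show "taylor_coeff (germ_monomial (j + k)) m = taylor_coeff (germ_monomial j * germ_monomial k) m"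
    by (auto simp: taylor_coeff_mult_monomial taylor_coeff_monomial)
qed

lemma germ_monomial_0 [simp]: "germ_monomial 0 = 1"
  by (rule germ_eqI) (simp add: taylor_coeff_monomial taylor_coeff_1)

lemma germ_monomial_sum: "germ_monomial (sum f A) = (\<Prod>i\<in>A. germ_monomial (f i))"
  by (induction A rule: infinite_finite_induct) (simp_all add: germ_monomial_add)

lemma germ_monomial_nonzero [simp]: "germ_monomial k \<noteq> 0"
  by (metis taylor_coeff_monomial taylor_coeff_simps(4) zero_neq_one)

lemma germ_monomial_scale: "germ_monomial (vec_lambda (\<lambda>t. m * vec_nth k t)) = germ_monomial k ^ m"
proof (induction m)
  case 0
  have "(vec_lambda (\<lambda>t. 0 * vec_nth k t)) = 0" by (simp add: Finite_Cartesian_Product.vec_eq_iff)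
  then show ?case by simp
next
  case (Suc m)
  have "(vec_lambda (\<lambda>t. Suc m * vec_nth k t)) = k + (vec_lambda (\<lambda>t. m * vec_nth k t))"
    by (simp add: Finite_Cartesian_Product.vec_eq_iff)
  then show ?case using Suc by (simp add: germ_monomial_add)
qed

lemma germ_monomial_expansion: "germ_monomial k = (\<Prod>t\<in>UNIV. germ_monomial (axis t 1) ^ vec_nth k t)"
proof -
  have "k = (\<Sum>t\<in>UNIV. (vec_lambda (\<lambda>s. vec_nth k t * vec_nth (axis t 1) s)))"
    by (simp add: Finite_Cartesian_Product.vec_eq_iff axis_def if_distrib[of "\<lambda>x. _ * x"] sum.delta cong: if_cong)
  then have "germ_monomial k = germ_monomial (\<Sum>t\<in>UNIV. (vec_lambda (\<lambda>s. vec_nth k t * vec_nth (axis t 1) s)))"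
    by (rule arg_cong)
  also have "\<dots> = (\<Prod>t\<in>UNIV. germ_monomial (axis t 1) ^ vec_nth k t)"
    unfolding germ_monomial_sum germ_monomial_scale ..
  finally show ?thesis .
qed

text \<open>Division by the monomials themselves. At an exponent of the remainder all products
  \<open>q e * germ_monomial e\<close> have coefficient zero, so it would be an exponent of
  \<open>f\<close> lying above no \<open>e\<close>.\<close>

lemma germ_in_monomial_ideal:
  fixes f :: "'n :: finite germ"
  assumes "finite E" "\<And>k. taylor_coeff f k \<noteq> 0 \<Longrightarrow> \<exists>e\<in>E. e \<le> k"
  obtains q where "f = (\<Sum>e\<in>E. q e * germ_monomial e)"
proof -
  obtain q rem where q: "f = (\<Sum>e\<in>E. q e * germ_monomial e) + rem"
    and rem: "\<And>e k. e \<in> E \<Longrightarrow> taylor_coeff rem k \<noteq> 0 \<Longrightarrow> \<not> e \<le> k"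
  proof (rule germ_division[of E germ_monomial "\<lambda>e. e" f])
    show "taylor_coeff (germ_monomial i) i = 1" for i :: "nat ^ 'n"
      by (simp add: taylor_coeff_monomial)
    show "prime_weight i < prime_weight k" if "taylor_coeff (germ_monomial i) k \<noteq> 0" "k \<noteq> i" for i k :: "nat ^ 'n"
      using that by (simp add: taylor_coeff_monomial)
  qed (rule assms(1), rule that)
  have "taylor_coeff rem k = 0" for k
  proof (rule ccontr)
    assume nz: "taylor_coeff rem k \<noteq> 0"
    have "taylor_coeff (\<Sum>e\<in>E. q e * germ_monomial e) k = 0"
      unfolding taylor_coeff_sum using rem[OF _ nz] by (intro sum.neutral) (simp add: taylor_coeff_mult_monomial)
    then have "taylor_coeff f k \<noteq> 0" using nz q by simp
    from assms(2)[OF this] obtain e where "e \<in> E" "e \<le> k" ..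
    with rem[OF this(1) nz] show False by simp
  qed
  then have "rem = 0" by (intro germ_eqI) simp
  with q have "f = (\<Sum>e\<in>E. q e * germ_monomial e)" by simp
  then show ?thesis by (rule that)
qed


section \<open>Weighted substitutions\<close>

definition weighted_degree :: "('n :: finite \<Rightarrow> nat) \<Rightarrow> nat ^ 'n \<Rightarrow> nat" where
  "weighted_degree w k = (\<Sum>t\<in>UNIV. w t * vec_nth k t)"

lemma weighted_degree_add: "weighted_degree w (j + k) = weighted_degree w j + weighted_degree w k"
  by (simp add: weighted_degree_def distrib_left sum.distrib)

lemma weighted_degree_0 [simp]: "weighted_degree w 0 = 0"
  by (simp add: weighted_degree_def)

lemma weighted_degree_sum: "weighted_degree w (sum f A) = (\<Sum>i\<in>A. weighted_degree w (f i))"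
  by (induction A rule: infinite_finite_induct) (simp_all add: weighted_degree_add)

lemma weighted_degree_axis: "weighted_degree w (axis t m) = w t * m"
  by (simp add: weighted_degree_def axis_def if_distrib[of "\<lambda>x. _ * x"] sum.delta' cong: if_cong)

lemma total_degree_axis: "total_degree (axis t m) = m"
  by (simp add: total_degree_def axis_def sum.delta')

lemma total_degree_le_imp_eq:
  assumes "j \<le> k" "total_degree k \<le> total_degree j"
  shows "j = (k :: nat ^ 'n :: finite)"
proof -
  have "total_degree (k - j) + total_degree j = total_degree k"
    using exponent_diff_add[OF assms(1)] by (metis total_degree_add)
  then have "total_degree (k - j) = 0" using assms(2) by simp
  then have "k - j = 0" by (simp add: total_degree_def Finite_Cartesian_Product.vec_eq_iff)
  then show ?thesis using exponent_diff_add[OF assms(1)] by simp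
qed

text \<open>
  The substitution \<open>x\<^sub>t \<mapsto> X^(w t) * (c\<^sub>t + u\<^sub>t * X^s)\<close>, where \<open>u\<^sub>t\<close> are the coordinates of the
  coefficient ring. For \<open>s = 0\<close>, \<open>c = 0\<close> the order in \<open>X\<close> is the monomial valuation with weights \<open>w\<close>; for
  \<open>s = 1\<close> it also detects the vanishing of initial forms at the point \<open>c\<close>.
\<close>

locale weighted_substitution =
  fixes w :: "'n :: finite \<Rightarrow> nat" and c :: "'n \<Rightarrow> complex" and s :: nat
  assumes w_pos: "\<And>t. w t > 0"
begin

definition factor :: "'n \<Rightarrow> 'n germ fps" where
  "factor t = fps_const (const_germ (c t)) + fps_const (germ_monomial (axis t 1)) * fps_X ^ s"

definition power_series :: "nat ^ 'n \<Rightarrow> 'n germ fps" where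
  "power_series k = (\<Prod>t\<in>UNIV. (fps_X ^ w t * factor t) ^ vec_nth k t)"

text \<open>Since the weights are positive, only finitely many monomials contribute to a given power
  of \<open>X\<close>; no question of convergence arises.\<close>

definition subst :: "'n germ \<Rightarrow> 'n germ fps" where
  "subst f = Abs_fps (\<lambda>b. \<Sum>k | weighted_degree w k \<le> b. const_germ (taylor_coeff f k) * fps_nth (power_series k) b)"

lemma finite_weighted_degree_le: "finite {k. weighted_degree w k \<le> b}"
proof (rule finite_subset[OF _ finite_vec_le[of "\<lambda>_. b"]], clarify)
  fix k :: "nat ^ 'n" and t assume b: "weighted_degree w k \<le> b"
  have "vec_nth k t \<le> w t * vec_nth k t" using w_pos[of t] by simp
  also have "\<dots> \<le> weighted_degree w k" unfolding weighted_degree_def by (rule member_le_sum) auto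
  finally show "vec_nth k t \<le> b" using b by simp
qed

text \<open>Expanding the image of a monomial gives \<open>X ^ d\<close> times a polynomial in the
  \<open>u\<^sub>t * X ^ s\<close> whose top term is \<open>u ^ k\<close> with coefficient
  \<open>1\<close>. The predicate records exactly this coupling between the power of
  \<open>X\<close> and the exponent in \<open>u\<close>; it serves to show that the substitution is
  injective.\<close>

definition leading_form :: "nat \<Rightarrow> nat ^ 'n \<Rightarrow> 'n germ fps \<Rightarrow> bool" where
  "leading_form d k h \<longleftrightarrow>
     (\<forall>b j. taylor_coeff (fps_nth h b) j \<noteq> 0 \<longrightarrow> b = d + s * total_degree j \<and> j \<le> k) \<and>
     taylor_coeff (fps_nth h (d + s * total_degree k)) k = 1"

lemma leading_formD:
  assumes "leading_form d k h"
  shows "taylor_coeff (fps_nth h b) j \<noteq> 0 \<Longrightarrow> b = d + s * total_degree j"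
    "taylor_coeff (fps_nth h b) j \<noteq> 0 \<Longrightarrow> j \<le> k"
    "taylor_coeff (fps_nth h (d + s * total_degree k)) k = 1"
  using assms unfolding leading_form_def by blast+

text \<open>The exponents of the factors are bounded by \<open>k\<close> and \<open>k'\<close>, so
  \<open>k + k'\<close> arises from this pair only and nothing can cancel the top term.\<close>

lemma leading_form_mult:
  assumes h: "leading_form d k h" "leading_form d' k' h'"
  shows "leading_form (d + d') (k + k') (h * h')"
proof -
  have coeff: "taylor_coeff (fps_nth (h * h') b) j =
      (\<Sum>a=0..b. \<Sum>p\<in>{(i, l). i + l = j}. taylor_coeff (fps_nth h a) (fst p) * taylor_coeff (fps_nth h' (b - a)) (snd p))" for b j
    by (simp add: fps_mult_nth taylor_coeff_sum times_germ.rep_eq cauchy_product_def case_prod_unfold)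
  have supp: "b = d + d' + s * total_degree j \<and> j \<le> k + k'" if nz: "taylor_coeff (fps_nth (h * h') b) j \<noteq> 0" for b j
  proof -
    from nz[unfolded coeff] obtain a p where ap: "a \<in> {0..b}" "p \<in> {(i, l). i + l = j}"
      "taylor_coeff (fps_nth h a) (fst p) * taylor_coeff (fps_nth h' (b - a)) (snd p) \<noteq> 0"
      by (meson sum.not_neutral_contains_not_neutral)
    then have nz': "taylor_coeff (fps_nth h a) (fst p) \<noteq> 0" "taylor_coeff (fps_nth h' (b - a)) (snd p) \<noteq> 0" by auto
    note D = leading_formD(1,2)[OF h(1) nz'(1)] leading_formD(1,2)[OF h(2) nz'(2)]
    have j: "j = fst p + snd p" using ap(2) by auto
    have "b = a + (b - a)" using ap(1) by simp
    also have "\<dots> = d + d' + s * total_degree j"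
      using D(1,3) by (simp add: j total_degree_add distrib_left)
    finally show ?thesis using D(2,4) by (auto simp: j exponent_le_iff intro: add_mono)
  qed
  let ?b = "d + d' + s * total_degree (k + k')"
  let ?a = "d + s * total_degree k"
  let ?f = "\<lambda>a p. taylor_coeff (fps_nth h a) (fst p) * taylor_coeff (fps_nth h' (?b - a)) (snd p)"
  have b: "?b - ?a = d' + s * total_degree k'" by (simp add: total_degree_add distrib_left)
  have only: "a = ?a \<and> p = (k, k')" if "a \<in> {0..?b}" "p \<in> {(i, l). i + l = k + k'}" "?f a p \<noteq> 0" for a p
  proof -
    from that(3) have nz': "taylor_coeff (fps_nth h a) (fst p) \<noteq> 0" "taylor_coeff (fps_nth h' (?b - a)) (snd p) \<noteq> 0" by auto
    note D = leading_formD(1,2)[OF h(1) nz'(1)] leading_formD(1,2)[OF h(2) nz'(2)]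
    have "fst p + snd p = k + k'" using that(2) by auto
    then have *: "vec_nth (fst p + snd p) t = vec_nth (k + k') t" for t by simp
    have "vec_nth (fst p) t = vec_nth k t \<and> vec_nth (snd p) t = vec_nth k' t" for t
      using *[of t] D(2,4)[unfolded exponent_le_iff, THEN spec, of t] by simp
    then have "fst p = k" "snd p = k'" by (auto simp: Finite_Cartesian_Product.vec_eq_iff)
    then show ?thesis using D(1) by (auto intro: prod_eqI)
  qed
  have "taylor_coeff (fps_nth (h * h') ?b) (k + k') = (\<Sum>a\<in>{?a}. \<Sum>p\<in>{(i, l). i + l = k + k'}. ?f a p)"
    unfolding coeff
  proof (rule sum.mono_neutral_right)
    show "\<forall>a\<in>{0..?b} - {?a}. (\<Sum>p\<in>{(i, l). i + l = k + k'}. ?f a p) = 0"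
      using only by (intro ballI sum.neutral) blast
  qed (auto simp: total_degree_add distrib_left)
  also have "\<dots> = (\<Sum>p\<in>{(i, l). i + l = k + k'}. ?f ?a p)" by simp
  also have "\<dots> = (\<Sum>p\<in>{(k, k')}. ?f ?a p)"
  proof (rule sum.mono_neutral_right[OF finite_add_eq])
    have "?a \<in> {0..?b}" by (simp add: total_degree_add distrib_left)
    then show "\<forall>p\<in>{(i, l). i + l = k + k'} - {(k, k')}. ?f ?a p = 0"
      using only by blast
  qed auto
  also have "\<dots> = 1" using leading_formD(3)[OF h(1)] leading_formD(3)[OF h(2)] by (simp add: b)
  finally show ?thesis unfolding leading_form_def using supp by blast
qed

lemma leading_form_1: "leading_form 0 0 1"
  by (auto simp: leading_form_def taylor_coeff_1 total_degree_def split: if_splits)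

lemma leading_form_power: "leading_form d k h \<Longrightarrow> leading_form (m * d) (vec_lambda (\<lambda>t. m * vec_nth k t)) (h ^ m)"
proof (induction m)
  case 0
  have "(vec_lambda (\<lambda>t. 0 * vec_nth k t)) = 0" by (simp add: Finite_Cartesian_Product.vec_eq_iff)
  then show ?case using leading_form_1 by simp
next
  case (Suc m)
  have "(vec_lambda (\<lambda>t. Suc m * vec_nth k t)) = k + (vec_lambda (\<lambda>t. m * vec_nth k t))"
    by (simp add: Finite_Cartesian_Product.vec_eq_iff)
  then show ?case using leading_form_mult[OF Suc.prems Suc.IH[OF Suc.prems]] by simp
qed

lemma leading_form_prod:
  "finite A \<Longrightarrow> (\<And>t. t \<in> A \<Longrightarrow> leading_form (d t) (k t) (h t)) \<Longrightarrow>
    leading_form (\<Sum>t\<in>A. d t) (\<Sum>t\<in>A. k t) (\<Prod>t\<in>A. h t)"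
  by (induction A rule: finite_induct) (simp_all add: leading_form_1 leading_form_mult)

lemma leading_form_factor: "leading_form (w t) (axis t 1) (fps_X ^ w t * factor t)"
proof -
  have nth: "fps_nth (fps_X ^ w t * factor t) b =
      (if b = w t then const_germ (c t) else 0) + (if b = w t + s then germ_monomial (axis t 1) else 0)" for b
    by (auto simp: factor_def fps_X_power_mult_nth fps_X_power_mult_right_nth)
  have ne: "axis t (1 :: nat) \<noteq> 0" by (simp add: Finite_Cartesian_Product.vec_eq_iff axis_def)
  have "b = w t + s * total_degree j \<and> j \<le> axis t 1"
    if nz: "taylor_coeff (fps_nth (fps_X ^ w t * factor t) b) j \<noteq> 0" for b j
  proof (cases "j = 0")
    case True
    then have "b = w t" using nz ne by (auto simp: nth taylor_coeff_monomial split: if_splits)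
    then show ?thesis using True by (simp add: total_degree_def)
  next
    case False
    then have "b = w t + s" "j = axis t 1" using nz
      by (auto simp: nth taylor_coeff_monomial taylor_coeff_const_germ split: if_splits)
    then show ?thesis by (simp add: total_degree_axis)
  qed
  moreover have "taylor_coeff (fps_nth (fps_X ^ w t * factor t) (w t + s * total_degree (axis t (1 :: nat)))) (axis t 1) = 1"
    using ne by (auto simp: nth total_degree_axis taylor_coeff_monomial taylor_coeff_const_germ)
  ultimately show ?thesis unfolding leading_form_def by blast
qed

lemma leading_form_power_series: "leading_form (weighted_degree w k) k (power_series k)"
proof -
  have "leading_form (\<Sum>t\<in>UNIV. vec_nth k t * w t) (\<Sum>t\<in>UNIV. (vec_lambda (\<lambda>r. vec_nth k t * vec_nth (axis t 1) r))) (power_series k)"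
    unfolding power_series_def by (intro leading_form_prod leading_form_power leading_form_factor) simp
  moreover have "(\<Sum>t\<in>UNIV. (vec_lambda (\<lambda>r. vec_nth k t * vec_nth (axis t 1) r))) = k"
    by (simp add: Finite_Cartesian_Product.vec_eq_iff axis_def if_distrib[of "\<lambda>x. _ * x"] sum.delta cong: if_cong)
  ultimately show ?thesis by (simp add: weighted_degree_def mult.commute)
qed

lemma power_series_nth_less: "b < weighted_degree w k \<Longrightarrow> fps_nth (power_series k) b = 0"
  using leading_formD(1)[OF leading_form_power_series, of k b] by (intro germ_eqI) (metis not_add_less1 taylor_coeff_simps(4))

lemma power_series_add: "power_series (j + k) = power_series j * power_series k"
  by (simp add: power_series_def power_add prod.distrib)

lemma power_series_0 [simp]: "power_series 0 = 1"
  by (simp add: power_series_def)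

section \<open>The substitution is an injective ring homomorphism\<close>

lemma subst_nth_eq:
  assumes "b \<le> m"
  shows "fps_nth (subst f) b = (\<Sum>k | weighted_degree w k \<le> m. const_germ (taylor_coeff f k) * fps_nth (power_series k) b)"
proof -
  have "(\<Sum>k | weighted_degree w k \<le> b. const_germ (taylor_coeff f k) * fps_nth (power_series k) b) =
      (\<Sum>k | weighted_degree w k \<le> m. const_germ (taylor_coeff f k) * fps_nth (power_series k) b)"
    using assms by (intro sum.mono_neutral_left finite_weighted_degree_le) (auto intro: power_series_nth_less)
  then show ?thesis by (simp add: subst_def)
qed

lemma subst_add: "subst (f + g) = subst f + subst g"
  by (rule fps_ext) (simp add: subst_def const_germ_hom distrib_right sum.distrib)

lemma subst_mult: "subst (f * g) = subst f * subst g"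
proof (rule fps_ext)
  fix b
  let ?F = "{k. weighted_degree w k \<le> b}"
  note fin = finite_weighted_degree_le[of b]
  let ?h = "\<lambda>p. const_germ (taylor_coeff f (fst p) * taylor_coeff g (snd p)) * fps_nth (power_series (fst p + snd p)) b"
  have "fps_nth (subst (f * g)) b = (\<Sum>m\<in>?F. \<Sum>p\<in>{(i, j). i + j = m}. ?h p)"
    by (auto simp: subst_def times_germ.rep_eq cauchy_product_def const_germ_sum sum_distrib_right
        case_prod_unfold intro!: sum.cong)
  also have "\<dots> = (\<Sum>p\<in>(\<Union>m\<in>?F. {(i, j). i + j = m}). ?h p)"
    using fin by (subst sum.UNION_disjoint) (auto intro: finite_add_eq)
  \<comment> \<open>Pairs whose sum has weighted degree above \<open>b\<close> contribute nothing to
    the coefficient of \<open>X ^ b\<close>, so the sum may be extended to a full square, over which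
    it factors.\<close>
  also have "\<dots> = (\<Sum>p\<in>?F \<times> ?F. ?h p)"
  proof (rule sum.mono_neutral_left)
    show "finite (?F \<times> ?F)" using fin by simp
    show "(\<Union>m\<in>?F. {(i, j). i + j = m}) \<subseteq> ?F \<times> ?F" by (auto simp: weighted_degree_add)
    show "\<forall>p\<in>?F \<times> ?F - (\<Union>m\<in>?F. {(i, j). i + j = m}). ?h p = 0"
      by (auto intro!: power_series_nth_less)
  qed
  also have "\<dots> = (\<Sum>p\<in>?F \<times> ?F. \<Sum>a=0..b. (const_germ (taylor_coeff f (fst p)) * fps_nth (power_series (fst p)) a) *
      (const_germ (taylor_coeff g (snd p)) * fps_nth (power_series (snd p)) (b - a)))"
    by (intro sum.cong refl) (simp add: power_series_add fps_mult_nth const_germ_hom sum_distrib_left mult_ac)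
  also have "\<dots> = (\<Sum>a=0..b. \<Sum>p\<in>?F \<times> ?F. (const_germ (taylor_coeff f (fst p)) * fps_nth (power_series (fst p)) a) *
      (const_germ (taylor_coeff g (snd p)) * fps_nth (power_series (snd p)) (b - a)))"
    by (rule sum.swap)
  also have "\<dots> = (\<Sum>a=0..b. fps_nth (subst f) a * fps_nth (subst g) (b - a))"
    by (intro sum.cong refl)
      (simp add: subst_nth_eq[of _ b] sum_product sum.cartesian_product case_prod_unfold)
  finally show "fps_nth (subst (f * g)) b = fps_nth (subst f * subst g) b"
    by (simp add: fps_mult_nth)
qed

lemma subst_monomial: "subst (germ_monomial k) = power_series k"
proof (rule fps_ext)
  fix b
  have "fps_nth (subst (germ_monomial k)) b = (\<Sum>j | weighted_degree w j \<le> b. if j = k then fps_nth (power_series k) b else 0)"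
    unfolding subst_def fps_nth_Abs_fps by (intro sum.cong) (auto simp: taylor_coeff_monomial const_germ_hom)
  also have "\<dots> = fps_nth (power_series k) b"
    using finite_weighted_degree_le[of b] power_series_nth_less[of b k] by (simp add: sum.delta not_le)
  finally show "fps_nth (subst (germ_monomial k)) b = fps_nth (power_series k) b" .
qed

lemma subst_1: "subst 1 = 1"
  using subst_monomial[of 0] by simp

text \<open>Among the exponents of \<open>f\<close> of one weighted degree, let \<open>k0\<close>
  have the largest total degree. In the coefficient of \<open>X\<close> to the power
  \<open>weighted_degree w k0 + s * total_degree k0\<close>, the monomial with exponent
  \<open>k0\<close> comes only from terms of the same weighted degree with exponent at least
  \<open>k0\<close>, hence from \<open>k0\<close> itself.\<close>

lemma subst_nonzero:
  assumes "f \<noteq> 0"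
  shows "subst f \<noteq> 0"
proof -
  obtain k1 where k1: "taylor_coeff f k1 \<noteq> 0" using assms by (metis germ_eqI taylor_coeff_simps(4))
  define K where "K = {k. weighted_degree w k = weighted_degree w k1 \<and> taylor_coeff f k \<noteq> 0}"
  have finK: "finite K" unfolding K_def
    by (rule finite_subset[OF _ finite_weighted_degree_le[of "weighted_degree w k1"]]) auto
  have "k1 \<in> K" using k1 by (simp add: K_def)
  then have "Max (total_degree ` K) \<in> total_degree ` K" using finK by (intro Max_in) auto
  then obtain k0 where k0: "k0 \<in> K" "total_degree k0 = Max (total_degree ` K)" by auto
  have max: "total_degree k \<le> total_degree k0" if "k \<in> K" for k using finK that k0(2) by simp
  let ?b = "weighted_degree w k0 + s * total_degree k0"
  have "taylor_coeff (fps_nth (subst f) ?b) k0 =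
      (\<Sum>k | weighted_degree w k \<le> ?b. taylor_coeff f k * taylor_coeff (fps_nth (power_series k) ?b) k0)"
    by (simp add: subst_def taylor_coeff_sum)
  also have "\<dots> = (\<Sum>k\<in>{k0}. taylor_coeff f k * taylor_coeff (fps_nth (power_series k) ?b) k0)"
  proof (rule sum.mono_neutral_right[OF finite_weighted_degree_le])
    show "\<forall>k\<in>{k. weighted_degree w k \<le> ?b} - {k0}. taylor_coeff f k * taylor_coeff (fps_nth (power_series k) ?b) k0 = 0"
    proof (intro ballI, rule ccontr)
      fix k assume k: "k \<in> {k. weighted_degree w k \<le> ?b} - {k0}"
        and "taylor_coeff f k * taylor_coeff (fps_nth (power_series k) ?b) k0 \<noteq> 0"
      then have nz: "taylor_coeff f k \<noteq> 0" "taylor_coeff (fps_nth (power_series k) ?b) k0 \<noteq> 0" by auto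
      note D = leading_formD(1,2)[OF leading_form_power_series nz(2)]
      have "k \<in> K" using D(1) nz(1) k0(1) by (auto simp: K_def)
      then have "k0 = k" using D(2) max by (intro total_degree_le_imp_eq)
      then show False using k by simp
    qed
  qed auto
  also have "\<dots> = taylor_coeff f k0"
    using leading_formD(3)[OF leading_form_power_series] by simp
  also have "\<dots> \<noteq> 0" using k0 by (simp add: K_def)
  finally show ?thesis by auto
qed

lemma power_series_nth_leading:
  "fps_nth (power_series k) (weighted_degree w k) = (\<Prod>t\<in>UNIV. fps_nth (factor t) 0 ^ vec_nth k t)"
proof -
  have "power_series k = fps_X ^ weighted_degree w k * (\<Prod>t\<in>UNIV. factor t ^ vec_nth k t)"
    by (simp add: power_series_def power_mult_distrib prod.distrib weighted_degree_def power_sum power_mult)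
  then have "fps_nth (power_series k) (weighted_degree w k) = fps_nth (\<Prod>t\<in>UNIV. factor t ^ vec_nth k t) 0"
    by (simp add: fps_X_power_mult_nth)
  also have "fps_nth (\<Prod>t\<in>A. factor t ^ vec_nth k t) 0 = (\<Prod>t\<in>A. fps_nth (factor t) 0 ^ vec_nth k t)" for A
    by (induction A rule: infinite_finite_induct) (simp_all add: fps_nth_power_0)
  finally show ?thesis .
qed

lemma subst_nth_less:
  assumes "\<And>k. taylor_coeff f k \<noteq> 0 \<Longrightarrow> m \<le> weighted_degree w k" "b < m"
  shows "fps_nth (subst f) b = 0"
  unfolding subst_def fps_nth_Abs_fps
proof (rule sum.neutral, clarify)
  fix k assume "weighted_degree w k \<le> b"
  then have "taylor_coeff f k = 0" using assms(1)[of k] assms(2) by fastforce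
  then show "const_germ (taylor_coeff f k) * fps_nth (power_series k) b = 0" by (simp add: const_germ_hom)
qed

lemma subst_nth_initial:
  assumes "\<And>k. taylor_coeff f k \<noteq> 0 \<Longrightarrow> m \<le> weighted_degree w k"
  shows "fps_nth (subst f) m =
    (\<Sum>k | weighted_degree w k = m. const_germ (taylor_coeff f k) * (\<Prod>t\<in>UNIV. fps_nth (factor t) 0 ^ vec_nth k t))"
proof -
  have "fps_nth (subst f) m = (\<Sum>k | weighted_degree w k = m. const_germ (taylor_coeff f k) * fps_nth (power_series k) m)"
    unfolding subst_def fps_nth_Abs_fps
  proof (rule sum.mono_neutral_right[OF finite_weighted_degree_le])
    show "\<forall>k\<in>{k. weighted_degree w k \<le> m} - {k. weighted_degree w k = m}.
        const_germ (taylor_coeff f k) * fps_nth (power_series k) m = 0"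
    proof (intro ballI)
      fix k assume "k \<in> {k. weighted_degree w k \<le> m} - {k. weighted_degree w k = m}"
      then have "weighted_degree w k < m" by auto
      then have "taylor_coeff f k = 0" using assms[of k] by fastforce
      then show "const_germ (taylor_coeff f k) * fps_nth (power_series k) m = 0" by (simp add: const_germ_hom)
    qed
  qed auto
  also have "\<dots> = (\<Sum>k | weighted_degree w k = m. const_germ (taylor_coeff f k) * (\<Prod>t\<in>UNIV. fps_nth (factor t) 0 ^ vec_nth k t))"
    using power_series_nth_leading by (intro sum.cong) auto
  finally show ?thesis .
qed

definition val :: "'n germ \<Rightarrow> nat" where
  "val f = subdegree (subst f)"

lemma val_mult: "f \<noteq> 0 \<Longrightarrow> g \<noteq> 0 \<Longrightarrow> val (f * g) = val f + val g"
  unfolding val_def subst_mult using subst_nonzero by simp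

lemma val_add:
  assumes "f + g \<noteq> 0"
  shows "min (val f) (val g) \<le> val (f + g)"
  unfolding val_def
  using subdegree_add_ge'[of "subst f" "subst g"] subst_nonzero[OF assms] unfolding subst_add[symmetric] by simp

lemma val_monomial:
  assumes "\<And>t. fps_nth (factor t) 0 \<noteq> 0"
  shows "val (germ_monomial k) = weighted_degree w k"
proof -
  have "fps_nth (power_series k) (weighted_degree w k) \<noteq> 0"
    unfolding power_series_nth_leading using assms by simp
  then show ?thesis unfolding val_def subst_monomial
    by (intro subdegreeI) (auto intro: power_series_nth_less)
qed

end

section \<open>Discrete valuations on the fraction field\<close>

lemma int_subgroup_cyclic:
  fixes H :: "int set"
  assumes diff: "\<And>x y. x \<in> H \<Longrightarrow> y \<in> H \<Longrightarrow> x - y \<in> H" and "z \<in> H" "z > 0"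
  obtains g where "g > 0" "H = range (\<lambda>m. g * m)"
proof -
  have zero: "0 \<in> H" using diff[OF assms(2) assms(2)] by simp
  have neg: "- x \<in> H" if "x \<in> H" for x using diff[OF zero that] by simp
  have add: "x + y \<in> H" if "x \<in> H" "y \<in> H" for x y using diff[OF that(1) neg[OF that(2)]] by simp
  define g where "g = int (LEAST n. n > 0 \<and> int n \<in> H)"
  have "nat z > 0 \<and> int (nat z) \<in> H" using assms by simp
  then have "(LEAST n. n > 0 \<and> int n \<in> H) > 0 \<and> int (LEAST n. n > 0 \<and> int n \<in> H) \<in> H"
    by (rule LeastI)
  then have g: "g > 0" "g \<in> H" by (auto simp: g_def)
  have min: "g \<le> x" if "x \<in> H" "x > 0" for x
    using Least_le[of "\<lambda>n. n > 0 \<and> int n \<in> H" "nat x"] that by (simp add: g_def)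
  have mult_nat: "g * int n \<in> H" for n
  proof (induction n)
    case (Suc n)
    then show ?case using add[OF g(2) Suc] by (simp add: algebra_simps)
  qed (simp add: zero)
  have mult: "g * m \<in> H" for m
    using mult_nat[of "nat m"] neg[OF mult_nat[of "nat (- m)"]] by (cases "m \<ge> 0") auto
  have "x \<in> range (\<lambda>m. g * m)" if "x \<in> H" for x
  proof -
    have "x mod g \<in> H" using diff[OF that mult[of "x div g"]] by (simp add: minus_mult_div_eq_mod)
    moreover have "0 \<le> x mod g" "x mod g < g" using g by auto
    ultimately have "x mod g = 0" using min[of "x mod g"] by linarith
    then have "x = g * (x div g)" using mult_div_mod_eq[of g x] by simp
    then show ?thesis by (rule range_eqI)
  qed
  then have "H \<subseteq> range (\<lambda>m. g * m)" by (rule subsetI)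
  moreover have "range (\<lambda>m. g * m) \<subseteq> H" using mult by (intro image_subsetI)
  ultimately have "H = range (\<lambda>m. g * m)" by (rule equalityI)
  with g(1) show ?thesis by (rule that)
qed

lemma fract_cases: obtains a b :: "'a :: idom" where "b \<noteq> 0" "q = Fract a b"
  by (cases q) auto

lemma Fract_0 [simp]: "Fract 0 b = (0 :: 'a :: idom fract)"
  by (cases "b = 0") (simp_all add: Zero_fract_def eq_fract)

lemma Fract_nonzero: "a \<noteq> 0 \<Longrightarrow> b \<noteq> 0 \<Longrightarrow> Fract a b \<noteq> (0 :: 'a :: idom fract)"
  unfolding Zero_fract_def by (simp add: eq_fract del: Fract_0)

text \<open>A discrete valuation must have all integers as values, whereas the values of
  \<open>u\<close> may share a common factor. The differences of values form a nonzero subgroup of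
  the integers, and the valuation is divided by its positive generator \<open>g\<close>.\<close>

lemma exists_discrete_valuation_ring:
  fixes u :: "'a :: idom \<Rightarrow> nat"
  assumes mult: "\<And>a b. a \<noteq> 0 \<Longrightarrow> b \<noteq> 0 \<Longrightarrow> u (a * b) = u a + u b"
    and add: "\<And>a b. a \<noteq> 0 \<Longrightarrow> b \<noteq> 0 \<Longrightarrow> a + b \<noteq> 0 \<Longrightarrow> min (u a) (u b) \<le> u (a + b)"
    and nontriv: "t \<noteq> 0" "u t > 0"
  obtains V where "V \<in> intermediate_rings"
    "\<And>a b. a \<noteq> 0 \<Longrightarrow> b \<noteq> 0 \<Longrightarrow> Fract a b \<in> V \<longleftrightarrow> u b \<le> u a"
proof -
  define v0 where "v0 q = (SOME n. \<exists>a b. a \<noteq> 0 \<and> b \<noteq> 0 \<and> q = Fract a b \<and> n = int (u a) - int (u b))" for q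
  have v0: "v0 (Fract a b) = int (u a) - int (u b)" if "a \<noteq> 0" "b \<noteq> 0" for a b
  proof -
    have "\<exists>n c d. c \<noteq> 0 \<and> d \<noteq> 0 \<and> Fract a b = Fract c d \<and> n = int (u c) - int (u d)"
      using that by (intro exI[of _ "int (u a) - int (u b)"] exI[of _ a] exI[of _ b]) simp
    from someI_ex[OF this, folded v0_def] obtain c d where
      cd: "c \<noteq> 0" "d \<noteq> 0" "Fract a b = Fract c d" "v0 (Fract a b) = int (u c) - int (u d)"
      by (elim exE conjE)
    then have "a * d = c * b" using that by (simp add: eq_fract)
    then have "u a + u d = u c + u b" using mult[of a d] mult[of c b] that cd by simp
    then show ?thesis using cd(4) by simp
  qed
  define H where "H = {int (u a) - int (u b) | a b. a \<noteq> 0 \<and> b \<noteq> 0}"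
  have "u (1 :: 'a) = 0" using mult[of 1 1] by simp
  then have tH: "int (u t) \<in> H" unfolding H_def using nontriv
    by (intro CollectI exI[of _ t] exI[of _ 1]) simp
  have diff: "x - y \<in> H" if xy: "x \<in> H" "y \<in> H" for x y
  proof -
    from xy obtain a b c d where "a \<noteq> 0" "b \<noteq> 0" "c \<noteq> 0" "d \<noteq> 0"
      "x = int (u a) - int (u b)" "y = int (u c) - int (u d)"
      unfolding H_def by (elim CollectE exE conjE)
    then show ?thesis unfolding H_def
      by (intro CollectI exI[of _ "a * d"] exI[of _ "b * c"]) (simp add: mult)
  qed
  obtain g where g: "g > 0" "H = range (\<lambda>m. g * m)"
  proof (rule int_subgroup_cyclic[OF _ tH])
    show "0 < int (u t)" using nontriv by simp
  qed (rule diff, assumption, assumption, rule that)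
  define v where "v q = v0 q div g" for q
  have gv: "g * v (Fract a b) = int (u a) - int (u b)" if "a \<noteq> 0" "b \<noteq> 0" for a b
  proof -
    have "int (u a) - int (u b) \<in> range (\<lambda>m. g * m)"
      unfolding g(2)[symmetric] H_def using that by blast
    then have "g dvd v0 (Fract a b)" using v0[OF that] by auto
    then show ?thesis using v0[OF that] by (simp add: v_def)
  qed
  have "discrete_valuation v"
    unfolding discrete_valuation_def
  proof (intro conjI allI impI)
    fix x y :: "'a fract" assume nz: "x \<noteq> 0" "y \<noteq> 0"
    obtain a b where x: "b \<noteq> 0" "x = Fract a b" by (rule fract_cases)
    obtain c d where y: "d \<noteq> 0" "y = Fract c d" by (rule fract_cases)
    have ac: "a \<noteq> 0" "c \<noteq> 0" using nz x y by auto
    have "g * v (x * y) = g * (v x + v y)"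
      using x y ac gv[of a b] gv[of c d] gv[of "a * c" "b * d"] by (simp add: mult distrib_left)
    then show "v (x * y) = v x + v y" using g by simp
    assume "x + y \<noteq> 0"
    have xy: "x + y = Fract (a * d + c * b) (b * d)" using x y by simp
    then have s: "a * d + c * b \<noteq> 0" using \<open>x + y \<noteq> 0\<close> by auto
    have u: "u (a * d) = u a + u d" "u (c * b) = u c + u b" "u (b * d) = u b + u d"
      using ac x y by (simp_all add: mult)
    have "min (u (a * d)) (u (c * b)) \<le> u (a * d + c * b)"
      using add[OF _ _ s] ac x y by simp
    then have *: "u a + u d \<le> u (a * d + c * b) \<or> u c + u b \<le> u (a * d + c * b)"
      unfolding u min_le_iff_disj .
    have "g * v (x + y) = int (u (a * d + c * b)) - int (u b + u d)"
      using gv[OF s, of "b * d"] x(1) y(1) unfolding xy u by simp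
    moreover have "g * v x = int (u a) - int (u b)" "g * v y = int (u c) - int (u d)"
      using gv[OF ac(1) x(1)] gv[OF ac(2) y(1)] x(2) y(2) by simp_all
    ultimately have "g * v x \<le> g * v (x + y) \<or> g * v y \<le> g * v (x + y)" using * by linarith
    then show "min (v x) (v y) \<le> v (x + y)"
      unfolding min_le_iff_disj mult_le_cancel_left_pos[OF g(1)] .
  next
    show "v ` {x. x \<noteq> 0} = UNIV"
    proof (rule UNIV_eq_I[symmetric])
      fix m :: int
      have "g * m \<in> H" using g by simp
      then obtain a b where ab: "a \<noteq> 0" "b \<noteq> 0" "g * m = int (u a) - int (u b)"
        unfolding H_def by (elim CollectE exE conjE)
      then have "g * v (Fract a b) = g * m" using gv[OF ab(1,2)] by simp
      then have "v (Fract a b) = m" using g(1) by simp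
      moreover have "Fract a b \<noteq> 0" using ab(1,2) by (rule Fract_nonzero)
      ultimately show "m \<in> v ` {x. x \<noteq> 0}" by blast
    qed
  qed
  define V where "V = {x. x = 0 \<or> 0 \<le> v x}"
  have iff: "Fract a b \<in> V \<longleftrightarrow> u b \<le> u a" if "a \<noteq> 0" "b \<noteq> 0" for a b
  proof -
    have "Fract a b \<noteq> 0" using that by (rule Fract_nonzero)
    then have "Fract a b \<in> V \<longleftrightarrow> 0 \<le> g * v (Fract a b)" using g by (simp add: V_def zero_le_mult_iff)
    then show ?thesis using gv[OF that] by simp
  qed
  have "to_fract a \<in> V" for a :: 'a
  proof (cases "a = 0")
    case False
    then show ?thesis using iff[OF False, of 1] \<open>u 1 = 0\<close> by (simp add: to_fract_def)
  qed (simp add: V_def)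
  then have "V \<in> intermediate_rings"
    unfolding intermediate_rings_def is_valuation_ring_of_def using \<open>discrete_valuation v\<close> V_def by blast
  then show ?thesis using iff by (rule that)
qed


section \<open>Newton polyhedra and their compact faces\<close>

definition orthant :: "(real ^ 'n :: finite) set" where
  "orthant = {v. \<forall>i. 0 \<le> vec_nth v i}"

lemma orthant_closed:
  "0 \<in> orthant" "u \<in> orthant \<Longrightarrow> v \<in> orthant \<Longrightarrow> u + v \<in> orthant"
  "r \<ge> 0 \<Longrightarrow> v \<in> orthant \<Longrightarrow> r *\<^sub>R v \<in> orthant"
  "r \<ge> 0 \<Longrightarrow> axis t r \<in> orthant"
  by (auto simp: orthant_def axis_def)

lemma inner_orthant_nonneg: "(\<And>t. vec_nth w t \<ge> 0) \<Longrightarrow> v \<in> orthant \<Longrightarrow> w \<bullet> v \<ge> 0"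
  by (auto simp: orthant_def inner_vec_def intro!: sum_nonneg)

lemma inner_orthant_pos:
  assumes "\<And>t. vec_nth w t > 0" "v \<in> orthant" "v \<noteq> 0"
  shows "w \<bullet> v > 0"
proof -
  obtain t where "vec_nth v t \<noteq> 0" using assms(3) by (auto simp: Finite_Cartesian_Product.vec_eq_iff)
  then have "0 < vec_nth w t * vec_nth v t" using assms(1)[of t] assms(2) by (simp add: orthant_def less_le)
  also have "\<dots> \<le> (\<Sum>t\<in>UNIV. vec_nth w t * vec_nth v t)"
  proof (rule member_le_sum)
    show "0 \<le> vec_nth w x * vec_nth v x" for x
      using assms(1)[of x] assms(2) by (simp add: orthant_def less_imp_le)
  qed auto
  finally show ?thesis by (simp add: inner_vec_def)
qed

lemma orthant_plus: "orthant + orthant = (orthant :: (real ^ 'n :: finite) set)"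
proof
  show "orthant + orthant \<subseteq> (orthant :: (real ^ 'n) set)"
    by (auto simp: set_plus_def intro: orthant_closed)
  have "0 + v \<in> orthant + orthant" if "v \<in> orthant" for v :: "real ^ 'n"
    using that by (intro set_plus_intro orthant_closed)
  then show "orthant \<subseteq> orthant + (orthant :: (real ^ 'n) set)" by auto
qed

section \<open>Faces of convex hulls and of orthant hulls\<close>

lemma face_complement_convex:
  fixes S :: "'a :: euclidean_space set"
  assumes "T face_of S" "convex S"
  shows "convex (S - T)"
  unfolding convex_contains_open_segment
proof (intro ballI subsetI)
  fix a b x assume ab: "a \<in> S - T" "b \<in> S - T" and x: "x \<in> open_segment a b"
  then have "x \<in> S" using assms(2) unfolding convex_contains_open_segment by blast
  moreover have "x \<notin> T" using face_ofD[OF assms(1) x] ab by blast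
  ultimately show "x \<in> S - T" by simp
qed

text \<open>The union of \<open>convex hull (G \<inter> T)\<close> with the complement of
  \<open>T\<close> in the hull is convex, because a segment from \<open>T\<close> to a point outside
  leaves \<open>T\<close> at once. It contains \<open>G\<close>, so it is the whole hull.\<close>

lemma face_of_hull_eq:
  fixes G :: "'a :: euclidean_space set"
  assumes "T face_of (convex hull G)"
  shows "T = convex hull (G \<inter> T)"
proof
  let ?S = "convex hull G" and ?C = "convex hull (G \<inter> T)"
  have T: "T \<subseteq> ?S" "convex T" using assms by (auto simp: face_of_def)
  show CT: "?C \<subseteq> T" using T(2) by (intro hull_minimal) auto
  have diff: "convex (?S - T)" by (intro face_complement_convex assms convex_convex_hull)
  have mix: "x \<in> ?S - T" if "x \<in> open_segment a b" "a \<in> T" "b \<in> ?S - T" for x a b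
  proof -
    have "x \<in> ?S"
      using that T(1) convex_contains_open_segment[of ?S] by auto
    moreover have "x \<notin> T"
    proof
      assume "x \<in> T"
      then have "b \<in> T" using face_ofD[OF assms that(1)] that T(1) by blast
      then show False using that by simp
    qed
    ultimately show ?thesis by simp
  qed
  have "\<forall>a\<in>?C \<union> (?S - T). \<forall>b\<in>?C \<union> (?S - T). open_segment a b \<subseteq> ?C \<union> (?S - T)"
  proof (intro ballI subsetI)
    fix a b x assume ab: "a \<in> ?C \<union> (?S - T)" "b \<in> ?C \<union> (?S - T)" and x: "x \<in> open_segment a b"
    consider "a \<in> ?C" "b \<in> ?C" | "a \<in> ?S - T" "b \<in> ?S - T" | "a \<in> T" "b \<in> ?S - T" | "b \<in> T" "a \<in> ?S - T"
      using ab CT by blast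
    then show "x \<in> ?C \<union> (?S - T)"
    proof cases
      case 1
      then have "x \<in> ?C" using x convex_convex_hull[of "G \<inter> T"] by (auto simp: convex_contains_open_segment)
      then show ?thesis by simp
    next
      case 2
      then have "x \<in> ?S - T" using x diff unfolding convex_contains_open_segment[of "?S - T"] by blast
      then show ?thesis by simp
    next
      case 3
      then show ?thesis using mix[OF x] by simp
    next
      case 4
      then show ?thesis using mix[of x b a] x by (simp add: open_segment_commute)
    qed
  qed
  then have "convex (?C \<union> (?S - T))" unfolding convex_contains_open_segment[of "?C \<union> (?S - T)"] .
  moreover have "G \<subseteq> ?C \<union> (?S - T)" by (auto intro: hull_inc)
  ultimately have "?S \<subseteq> ?C \<union> (?S - T)" by (intro hull_minimal)
  then show "T \<subseteq> ?C" using T(1) by blast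
qed

text \<open>The shape of a Newton polyhedron, allowed for arbitrary real generators so that
  Minkowski sums of Newton polyhedra are included.\<close>

definition orthant_hull :: "(real ^ 'n :: finite) set \<Rightarrow> (real ^ 'n) set" where
  "orthant_hull E = convex hull (E + orthant)"

lemma orthant_hull_inc: "e \<in> E \<Longrightarrow> v \<in> orthant \<Longrightarrow> e + v \<in> orthant_hull E"
  unfolding orthant_hull_def by (intro hull_inc set_plus_intro)

lemma orthant_hull_base: "e \<in> E \<Longrightarrow> e \<in> orthant_hull E"
  using orthant_hull_inc[of e E 0] by (simp add: orthant_closed)

lemma convex_orthant_hull: "convex (orthant_hull E)"
  by (simp add: orthant_hull_def)

lemma orthant_hull_plus_orthant:
  fixes E :: "(real ^ 'n :: finite) set"
  shows "orthant_hull E + orthant = orthant_hull E"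
proof -
  have "convex (orthant :: (real ^ 'n) set)" by (auto simp: convex_def orthant_def)
  then have "convex hull (orthant :: (real ^ 'n) set) = orthant" by (rule convex_hull_eq[THEN iffD2])
  then have "orthant_hull E + orthant = convex hull ((E + orthant) + orthant)"
    unfolding orthant_hull_def convex_hull_set_plus[of "E + orthant" orthant] by simp
  then show ?thesis unfolding orthant_hull_def add.assoc orthant_plus .
qed

lemma orthant_hull_add: "z \<in> orthant_hull E \<Longrightarrow> v \<in> orthant \<Longrightarrow> z + v \<in> orthant_hull E"
  using orthant_hull_plus_orthant[of E] set_plus_intro by blast

lemma orthant_hull_ge:
  assumes "\<And>t. vec_nth w t \<ge> 0" "\<And>e. e \<in> E \<Longrightarrow> m \<le> w \<bullet> e" "z \<in> orthant_hull E"
  shows "m \<le> w \<bullet> z"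
proof -
  have "orthant_hull E \<subseteq> {z. m \<le> w \<bullet> z}"
    unfolding orthant_hull_def
  proof (rule hull_minimal)
    show "E + orthant \<subseteq> {z. m \<le> w \<bullet> z}"
    proof
      fix z assume "z \<in> E + orthant"
      then obtain e v where "z = e + v" "e \<in> E" "v \<in> orthant" by (rule set_plus_elim)
      then show "z \<in> {z. m \<le> w \<bullet> z}"
        using assms(2)[of e] inner_orthant_nonneg[OF assms(1), of v] by (simp add: inner_add_right)
    qed
    show "convex {z. m \<le> w \<bullet> z}" using convex_halfspace_ge[of m w] by simp
  qed
  then show ?thesis using assms(3) by blast
qed

text \<open>A point \<open>z + v\<close> of the face would be interior to the segments from
  \<open>z\<close> to points arbitrarily far along the ray; the face would contain those endpoints
  and be unbounded.\<close>

lemma bounded_face_no_ray: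
  assumes F: "F face_of orthant_hull E" "bounded F" and z: "z \<in> orthant_hull E" and v: "v \<in> orthant" "v \<noteq> 0"
  shows "z + v \<notin> F"
proof
  assume zv: "z + v \<in> F"
  \<comment> \<open>The summand \<open>2\<close> keeps \<open>z + v\<close> strictly between the
    endpoints for every \<open>s \<ge> 0\<close>; \<open>s\<close> is fixed afterwards so as to
    exceed the bound \<open>B\<close>.\<close>
  have ray: "z + (s + 2) *\<^sub>R v \<in> F" if "s \<ge> 0" for s
  proof -
    have "z + v = (1 - 1 / (s + 2)) *\<^sub>R z + (1 / (s + 2)) *\<^sub>R (z + (s + 2) *\<^sub>R v)"
    proof -
      have "(1 / (s + 2)) *\<^sub>R ((s + 2) *\<^sub>R v) = v" using that by simp
      then show ?thesis by (simp only: scaleR_add_right scaleR_diff_left scaleR_one) simp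
    qed
    moreover have "0 < 1 / (s + 2)" "1 / (s + 2) < 1" using that by auto
    moreover have "z \<noteq> z + (s + 2) *\<^sub>R v" using that v by simp
    ultimately have "z + v \<in> open_segment z (z + (s + 2) *\<^sub>R v)"
      unfolding in_segment by blast
    moreover have "z + (s + 2) *\<^sub>R v \<in> orthant_hull E"
      using that v z by (intro orthant_hull_add orthant_closed) auto
    ultimately show ?thesis using face_ofD[OF F(1) _ z _ zv] by blast
  qed
  obtain B where B: "\<And>x. x \<in> F \<Longrightarrow> norm x \<le> B" using F(2) by (auto simp: bounded_iff)
  define s where "s = (\<bar>B\<bar> + norm z) / norm v"
  have s: "s \<ge> 0" by (simp add: s_def)
  have "(s + 2) * norm v = norm ((s + 2) *\<^sub>R v)" using s by simp
  also have "\<dots> \<le> norm (z + (s + 2) *\<^sub>R v) + norm z"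
    using norm_triangle_ineq4[of "z + (s + 2) *\<^sub>R v" z] by simp
  also have "\<dots> \<le> B + norm z" using B[OF ray[OF s]] by simp
  also have "\<dots> \<le> s * norm v" using v by (simp add: s_def)
  finally have "2 * norm v \<le> 0" using s by (simp add: algebra_simps)
  then show False using v by simp
qed

text \<open>A face of the hull is spanned by the generators it contains. A generator
  \<open>e + v\<close> with \<open>v \<noteq> 0\<close> cannot lie in a bounded face, so only points
  of \<open>E\<close> remain.\<close>

lemma compact_face_eq_hull:
  assumes F: "F face_of orthant_hull E" "bounded F"
  shows "F = convex hull (E \<inter> F)"
proof -
  have "(E + orthant) \<inter> F = E \<inter> F"
  proof
    show "(E + orthant) \<inter> F \<subseteq> E \<inter> F"
    proof
      fix x assume x: "x \<in> (E + orthant) \<inter> F"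
      then obtain e v where ev: "x = e + v" "e \<in> E" "v \<in> orthant" by (auto elim: set_plus_elim)
      then have "v = 0" using bounded_face_no_ray[OF F orthant_hull_base[OF ev(2)] ev(3)] x by auto
      then show "x \<in> E \<inter> F" using x ev by simp
    qed
    have "e \<in> E + orthant" if "e \<in> E" for e
      using set_plus_intro[OF that orthant_closed(1)] by simp
    then show "E \<inter> F \<subseteq> (E + orthant) \<inter> F" by blast
  qed
  moreover have "F = convex hull ((E + orthant) \<inter> F)"
    using F(1) unfolding orthant_hull_def by (rule face_of_hull_eq)
  ultimately show ?thesis by argo
qed

text \<open>Positive weights strictly increase along every nonzero direction of the orthant. The
  minimum is therefore attained only on the hull of finitely many points of \<open>E\<close>, which
  makes the face compact.\<close>

lemma supporting_face:
  fixes w :: "real ^ 'n :: finite"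
  assumes w: "\<And>t. vec_nth w t > 0" and E: "finite E" "e0 \<in> E" "w \<bullet> e0 = m" "\<And>e. e \<in> E \<Longrightarrow> m \<le> w \<bullet> e"
  shows "{z \<in> orthant_hull E. w \<bullet> z = m} \<in> compact_faces (orthant_hull E)"
    "{z \<in> orthant_hull E. w \<bullet> z = m} = convex hull {e \<in> E. w \<bullet> e = m}"
proof -
  let ?F = "{z \<in> orthant_hull E. w \<bullet> z = m}"
  have F: "?F = orthant_hull E \<inter> {z. w \<bullet> z = m}" by auto
  have ge: "w \<bullet> z \<ge> m" if "z \<in> orthant_hull E" for z
    using orthant_hull_ge[OF less_imp_le[OF w] E(4) that] .
  have face: "?F face_of orthant_hull E"
    unfolding F using convex_orthant_hull ge by (rule face_of_Int_supporting_hyperplane_ge)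
  have gens: "(E + orthant) \<inter> ?F = {e \<in> E. w \<bullet> e = m}"
  proof
    show "(E + orthant) \<inter> ?F \<subseteq> {e \<in> E. w \<bullet> e = m}"
    proof
      fix x assume x: "x \<in> (E + orthant) \<inter> ?F"
      then obtain e v where ev: "x = e + v" "e \<in> E" "v \<in> orthant" by (auto elim: set_plus_elim)
      have "w \<bullet> v \<le> 0" using x ev E(4)[OF ev(2)] by (simp add: inner_add_right)
      then have "v = 0" using inner_orthant_pos[OF w ev(3)] by (cases "v = 0") simp_all
      then show "x \<in> {e \<in> E. w \<bullet> e = m}" using x ev by simp
    qed
    have "e \<in> E + orthant" if "e \<in> E" for e
      using set_plus_intro[OF that orthant_closed(1)] by simp
    then show "{e \<in> E. w \<bullet> e = m} \<subseteq> (E + orthant) \<inter> ?F" using orthant_hull_base by blast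
  qed
  have "?F = convex hull ((E + orthant) \<inter> ?F)"
    using face unfolding orthant_hull_def by (rule face_of_hull_eq)
  then show hull: "?F = convex hull {e \<in> E. w \<bullet> e = m}" unfolding gens .
  have "compact (convex hull {e \<in> E. w \<bullet> e = m})"
    using E(1) by (intro finite_imp_compact_convex_hull) simp
  then have "compact ?F" unfolding hull .
  moreover have "e0 \<in> ?F" using E(2,3) orthant_hull_base[of e0 E] by simp
  then have "?F \<noteq> {}" by (metis empty_iff)
  ultimately show "?F \<in> compact_faces (orthant_hull E)"
    unfolding compact_faces_def by (intro CollectI conjI face)
qed

text \<open>
  Compact faces are exposed by positive weights: the tangent directions at a relative interior point \<open>z\<close>
  of the face are separated from the directions leaving the face.
\<close>

lemma expose_compact_face:
  fixes E :: "(real ^ 'n :: finite) set"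
  assumes "finite E" "D \<in> compact_faces (orthant_hull E)"
  obtains w m where "\<And>t. vec_nth w t > 0" "\<And>z. z \<in> orthant_hull E \<Longrightarrow> m \<le> w \<bullet> z"
    "D = {z \<in> orthant_hull E. w \<bullet> z = m}"
proof -
  have face: "D face_of orthant_hull E" and comp: "compact D" and ne: "D \<noteq> {}"
    using assms(2) by (auto simp: compact_faces_def)
  have bdd: "bounded D" using comp by (rule compact_imp_bounded)
  have sub: "D \<subseteq> orthant_hull E" and conv: "convex D" using face by (auto simp: face_of_def)
  obtain z where z: "z \<in> rel_interior D" using rel_interior_eq_empty[OF conv] ne by blast
  have zD: "z \<in> D" using z rel_interior_subset by blast
  define U where "U = (\<lambda>d. d - z) ` (E \<inter> D)"
  \<comment> \<open>The unit vectors are included to make the separating weight positive in every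
    coordinate.\<close>
  define P where "P = (\<lambda>e. e - z) ` (E - D) \<union> (\<lambda>t. axis t 1) ` (UNIV :: 'n set)"
  have fin: "finite U" "finite P" using assms(1) by (auto simp: U_def P_def)
  \<comment> \<open>With half a step, the point for \<open>p = e - z\<close> is interior to the
    segment from \<open>z\<close> to \<open>e\<close>, where the defining property of a face
    applies.\<close>
  have Pout: "z + (1/2) *\<^sub>R p \<in> orthant_hull E - D" if "p \<in> P" for p
  proof -
    consider e where "e \<in> E - D" "p = e - z" | t where "p = axis t 1" using \<open>p \<in> P\<close> by (auto simp: P_def)
    then show ?thesis
    proof cases
      case 1
      have "z + (1/2) *\<^sub>R p = (1 - 1/2) *\<^sub>R z + (1/2) *\<^sub>R e"
      proof -
        have "(1/2) *\<^sub>R z + (1/2) *\<^sub>R z = z" unfolding scaleR_add_left[symmetric] by simp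
        then show ?thesis unfolding 1(2) by (simp add: scaleR_diff_right algebra_simps)
      qed
      moreover have "z \<noteq> e" using 1 zD by auto
      ultimately have seg: "z + (1/2) *\<^sub>R p \<in> open_segment z e" unfolding in_segment by (intro conjI exI[of _ "1/2"]) auto
      have eE: "e \<in> orthant_hull E" using 1 orthant_hull_base by blast
      have "z + (1/2) *\<^sub>R p \<in> orthant_hull E"
        using seg sub zD eE convex_orthant_hull[of E, unfolded convex_contains_open_segment] by blast
      moreover have "z + (1/2) *\<^sub>R p \<notin> D"
      proof
        assume "z + (1/2) *\<^sub>R p \<in> D"
        then have "e \<in> D" using face_ofD[OF face seg _ eE] sub zD by blast
        then show False using 1 by simp
      qed
      ultimately show ?thesis by simp
    next
      case 2
      have v: "(1/2) *\<^sub>R p \<in> orthant" "(1/2) *\<^sub>R p \<noteq> 0"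
        using 2 by (auto intro!: orthant_closed)
      then show ?thesis using sub zD bounded_face_no_ray[OF face bdd _ v] orthant_hull_add by blast
    qed
  qed
  have diff: "convex (orthant_hull E - D)" by (intro face_complement_convex face convex_orthant_hull)
  have hullP: "z + (1/2) *\<^sub>R p \<in> orthant_hull E - D" if "p \<in> convex hull P" for p
  proof -
    have "convex ((\<lambda>p. z + (1/2) *\<^sub>R p) -` (orthant_hull E - D))"
    proof (rule convexI, unfold vimage_eq)
      fix x y :: "real ^ 'n" and u v :: real
      assume "z + (1/2) *\<^sub>R x \<in> orthant_hull E - D" "z + (1/2) *\<^sub>R y \<in> orthant_hull E - D" "0 \<le> u" "0 \<le> v" "u + v = 1"
      then have "u *\<^sub>R (z + (1/2) *\<^sub>R x) + v *\<^sub>R (z + (1/2) *\<^sub>R y) \<in> orthant_hull E - D"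
        using convexD[OF diff] by blast
      also have "u *\<^sub>R (z + (1/2) *\<^sub>R x) + v *\<^sub>R (z + (1/2) *\<^sub>R y) = (u + v) *\<^sub>R z + (1/2) *\<^sub>R (u *\<^sub>R x + v *\<^sub>R y)"
        by (simp add: algebra_simps)
      finally show "z + (1/2) *\<^sub>R (u *\<^sub>R x + v *\<^sub>R y) \<in> orthant_hull E - D" using \<open>u + v = 1\<close> by simp
    qed
    moreover have "P \<subseteq> (\<lambda>p. z + (1/2) *\<^sub>R p) -` (orthant_hull E - D)"
      using Pout by (intro subsetI vimageI2)
    ultimately have "convex hull P \<subseteq> (\<lambda>p. z + (1/2) *\<^sub>R p) -` (orthant_hull E - D)" by (intro hull_minimal)
    then show ?thesis using that by blast
  qed
  have aff: "z + u \<in> affine hull D" if "u \<in> span U" for u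
  proof -
    have "Real_Vector_Spaces.subspace ((\<lambda>x. x - z) ` (affine hull D))"
      by (intro affine_diffs_subspace_subtract affine_affine_hull hull_inc zD)
    moreover have "U \<subseteq> (\<lambda>x. x - z) ` (affine hull D)"
      unfolding U_def by (intro image_mono) (auto intro: hull_inc)
    ultimately have "span U \<subseteq> (\<lambda>x. x - z) ` (affine hull D)" by (intro span_minimal)
    then show ?thesis using that by auto
  qed
  have disj: "span U \<inter> convex hull P = {}"
  proof (rule ccontr)
    assume "span U \<inter> convex hull P \<noteq> {}"
    then obtain u where u: "u \<in> span U" "u \<in> convex hull P" by blast
    define x where "x = z + (1/2) *\<^sub>R u"
    have x: "x \<in> orthant_hull E" "x \<notin> D" using hullP[OF u(2)] by (auto simp: x_def)
    have "x \<in> affine hull D" unfolding x_def using u(1) by (intro aff span_scale)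
    \<comment> \<open>As \<open>z\<close> is relatively interior, the segment from \<open>x\<close>
      to \<open>z\<close> can be prolonged inside \<open>D\<close>. Then \<open>z\<close> lies
      strictly between a point of \<open>D\<close> and \<open>x\<close>, which forces
      \<open>x\<close> into the face.\<close>
    then obtain e where e: "e > 1" "(1 - e) *\<^sub>R x + e *\<^sub>R z \<in> D"
      using z convex_rel_interior_iff2[OF conv ne, of z] by blast
    let ?q = "(1 - e) *\<^sub>R x + e *\<^sub>R z"
    have "x \<noteq> z" using x(2) zD by auto
    have "z = (1 - (e - 1) / e) *\<^sub>R ?q + ((e - 1) / e) *\<^sub>R x"
    proof -
      have "1 - (e - 1) / e = 1 / e" using e(1) by (simp add: field_simps)
      moreover have "(1 / e) *\<^sub>R ?q = z - ((e - 1) / e) *\<^sub>R x"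
      proof -
        have "(1 / e) * (1 - e) = - ((e - 1) / e)" using e(1) by (simp add: field_simps)
        then show ?thesis using e(1) by (simp add: scaleR_add_right)
      qed
      ultimately show ?thesis by simp
    qed
    moreover have "?q \<noteq> x" using e(2) x(2) by auto
    moreover have "0 < (e - 1) / e" "(e - 1) / e < 1" using e(1) by auto
    ultimately have "z \<in> open_segment ?q x" unfolding in_segment by blast
    then have "x \<in> D" using face_ofD[OF face _ _ x(1) zD] e(2) sub by blast
    with x(2) show False by simp
  qed
  have "closed (span U)" "convex (span U)" "compact (convex hull P)" "convex hull P \<noteq> {}"
    using fin by (auto simp: closed_subspace subspace_imp_convex P_def intro!: finite_imp_compact_convex_hull)
  then obtain w b where w: "\<forall>x\<in>span U. w \<bullet> x < b" "\<forall>x\<in>convex hull P. w \<bullet> x > b"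
    using separating_hyperplane_closed_compact[of "span U" "convex hull P"] disj by auto
  have b: "b > 0" using w(1) span_zero by fastforce
  have wU: "w \<bullet> u = 0" if "u \<in> U" for u
  proof (rule ccontr)
    assume nz: "w \<bullet> u \<noteq> 0"
    have "(b / (w \<bullet> u)) *\<^sub>R u \<in> span U" using that by (intro span_scale span_base)
    then show False using w(1) nz by fastforce
  qed
  have wP: "w \<bullet> p > 0" if "p \<in> P" for p
    using w(2)[rule_format, of p] b that by (simp add: hull_inc)
  have pos: "vec_nth w t > 0" for t
    using wP[of "axis t 1"] by (simp add: P_def inner_axis)
  define m where "m = w \<bullet> z"
  have mE: "w \<bullet> e = m" if "e \<in> E \<inter> D" for e
    using wU[of "e - z"] that by (simp add: U_def m_def inner_diff_right)
  have mE': "w \<bullet> e > m" if "e \<in> E - D" for e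
    using wP[of "e - z"] that by (simp add: P_def m_def inner_diff_right)
  have hullD: "D = convex hull (E \<inter> D)" using compact_face_eq_hull[OF face bdd] .
  have "convex hull (E \<inter> D) \<noteq> {}" by (subst hullD[symmetric]) (rule ne)
  then obtain e0 where e0: "e0 \<in> E \<inter> D" by (auto simp only: convex_hull_eq_empty)
  have ge: "m \<le> w \<bullet> e" if "e \<in> E" for e using mE[of e] mE'[of e] that by (cases "e \<in> D") auto
  have "{z \<in> orthant_hull E. w \<bullet> z = m} = convex hull {e \<in> E. w \<bullet> e = m}"
    using supporting_face(2)[OF pos assms(1), of e0 m] e0 mE ge by auto
  also have "{e \<in> E. w \<bullet> e = m} = E \<inter> D" using mE mE' by force
  finally have "D = {z \<in> orthant_hull E. w \<bullet> z = m}" by (rule trans[OF hullD sym])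
  from pos orthant_hull_ge[OF less_imp_le[OF pos] ge] this show ?thesis by (rule that)
qed

section \<open>Lattice points of Newton polyhedra and integral weights\<close>

lemma real_exponent_add: "real_exponent (j + k) = real_exponent j + real_exponent k"
  by (simp add: real_exponent_def Finite_Cartesian_Product.vec_eq_iff)

lemma real_exponent_orthant: "real_exponent k \<in> orthant"
  by (simp add: real_exponent_def orthant_def)

lemma real_exponent_le:
  assumes "j \<le> k"
  obtains i where "real_exponent k = real_exponent j + real_exponent i" "k = i + j"
proof -
  have "k = (k - j) + j" using exponent_diff_add[OF assms] by simp
  then have "real_exponent k = real_exponent j + real_exponent (k - j)"
    by (metis add.commute real_exponent_add)
  with \<open>k = (k - j) + j\<close> show ?thesis by (intro that)
qed

lemma inner_real_exponent: "inner w (real_exponent k) = (\<Sum>t\<in>UNIV. vec_nth w t * real (vec_nth k t))"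
  by (simp add: real_exponent_def inner_vec_def)

lemma newton_polyhedron_eq: "newton_polyhedron I = orthant_hull (real_exponent ` ideal_support I)"
proof -
  have "{real_exponent k + v | k v. k \<in> ideal_support I \<and> (\<forall>i. 0 \<le> vec_nth v i)} =
      real_exponent ` ideal_support I + orthant"
    by (auto simp: set_plus_def orthant_def)
  then show ?thesis by (simp add: newton_polyhedron_def orthant_hull_def)
qed

lemma newton_polyhedron_up: "real_exponent j \<in> newton_polyhedron I \<Longrightarrow> j \<le> k \<Longrightarrow> real_exponent k \<in> newton_polyhedron I"
  by (elim real_exponent_le) (simp add: newton_polyhedron_eq orthant_hull_add real_exponent_orthant)

lemma support_in_newton_polyhedron:
  "f \<in> I \<Longrightarrow> taylor_coeff f k \<noteq> 0 \<Longrightarrow> real_exponent k \<in> newton_polyhedron I"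
  unfolding newton_polyhedron_eq by (intro orthant_hull_base) (auto simp: ideal_support_def)

text \<open>Dickson's lemma is applied to all lattice points of the polyhedron, not only to the
  support, so that one finite set generates the polyhedron and also decides by divisibility which
  exponents lie in it.\<close>

lemma newton_generators:
  fixes I :: "'n :: finite germ set"
  obtains E where "finite E" "newton_polyhedron I = orthant_hull (real_exponent ` E)"
    "\<And>k. real_exponent k \<in> newton_polyhedron I \<longleftrightarrow> (\<exists>e\<in>E. e \<le> k)"
proof -
  define S where "S = {k. real_exponent k \<in> newton_polyhedron I}"
  obtain E where E: "finite E" "E \<subseteq> S" "\<And>k. k \<in> S \<Longrightarrow> \<exists>e\<in>E. e \<le> k" by (rule dickson[of S], rule that)
  have iff: "real_exponent k \<in> newton_polyhedron I \<longleftrightarrow> (\<exists>e\<in>E. e \<le> k)" for k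
  proof
    assume "real_exponent k \<in> newton_polyhedron I"
    then show "\<exists>e\<in>E. e \<le> k" using E(3)[of k] by (simp add: S_def)
  next
    assume "\<exists>e\<in>E. e \<le> k"
    then obtain e where "e \<in> E" "e \<le> k" ..
    then show "real_exponent k \<in> newton_polyhedron I" using E(2) newton_polyhedron_up by (auto simp: S_def)
  qed
  have "newton_polyhedron I \<subseteq> orthant_hull (real_exponent ` E)"
    unfolding newton_polyhedron_eq orthant_hull_def[of "_ ` ideal_support I"]
  proof (rule hull_minimal, rule subsetI)
    fix z assume "z \<in> real_exponent ` ideal_support I + orthant"
    then obtain k v where k: "z = real_exponent k + v" "k \<in> ideal_support I" "v \<in> orthant"
      by (auto elim!: set_plus_elim)
    then have "real_exponent k \<in> newton_polyhedron I"
      unfolding newton_polyhedron_eq by (intro orthant_hull_base) simp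
    then obtain e where e: "e \<in> E" "e \<le> k" using iff by auto
    from e(2) obtain i where "real_exponent k = real_exponent e + real_exponent i" by (rule real_exponent_le)
    then have "z = real_exponent e + (real_exponent i + v)" using k by simp
    then show "z \<in> orthant_hull (real_exponent ` E)"
      using e(1) k(3) by (simp add: orthant_hull_inc orthant_closed real_exponent_orthant)
  qed (rule convex_orthant_hull)
  moreover have "orthant_hull (real_exponent ` E) \<subseteq> newton_polyhedron I"
    unfolding orthant_hull_def[of "_ ` E"]
  proof (rule hull_minimal, rule subsetI)
    fix z assume "z \<in> real_exponent ` E + orthant"
    then obtain e v where "z = real_exponent e + v" "e \<in> E" "v \<in> orthant" by (auto elim!: set_plus_elim)
    then show "z \<in> newton_polyhedron I"
      using E(2) unfolding newton_polyhedron_eq S_def by (auto intro: orthant_hull_add)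
  qed (simp add: newton_polyhedron_def)
  ultimately have "newton_polyhedron I = orthant_hull (real_exponent ` E)" by (rule equalityI)
  with E(1) show ?thesis using iff by (rule that)
qed

lemma newton_polyhedron_nonempty:
  assumes "f \<in> I" "f \<noteq> 0"
  obtains k where "real_exponent k \<in> newton_polyhedron I"
proof -
  obtain k where "taylor_coeff f k \<noteq> 0" using assms(2) by (metis germ_eqI taylor_coeff_simps(4))
  then show ?thesis by (intro that[OF support_in_newton_polyhedron[OF assms(1)]])
qed

text \<open>The integral linear form is required to have the right sign on the differences of
  exponents in \<open>E\<close>, which preserves their order, and on the unit vectors, which keeps
  the weights positive.\<close>

lemma integral_weights:
  fixes E :: "(nat ^ 'n :: finite) set" and w :: "real ^ 'n"
  assumes "finite E" "\<And>t. vec_nth w t > 0"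
  obtains w' :: "'n \<Rightarrow> nat" where "\<And>t. w' t > 0"
    "\<And>e e'. e \<in> E \<Longrightarrow> e' \<in> E \<Longrightarrow> inner w (real_exponent e) = inner w (real_exponent e') \<Longrightarrow> weighted_degree w' e = weighted_degree w' e'"
    "\<And>e e'. e \<in> E \<Longrightarrow> e' \<in> E \<Longrightarrow> inner w (real_exponent e) < inner w (real_exponent e') \<Longrightarrow> weighted_degree w' e < weighted_degree w' e'"
proof -
  define diff where "diff e e' = (\<lambda>t. int (vec_nth e' t) - int (vec_nth e t))" for e e' :: "nat ^ 'n"
  define unit where "unit s = (\<lambda>t. if t = s then 1 else (0 :: int))" for s :: 'n
  define A where "A = case_prod diff ` (E \<times> E) \<union> range unit"
  have "finite A" using assms(1) by (simp add: A_def)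
  then obtain v where v: "\<And>d. d \<in> A \<Longrightarrow> inner w (real_vec d) = 0 \<Longrightarrow> (\<Sum>t\<in>UNIV. v t * d t) = 0"
    "\<And>d. d \<in> A \<Longrightarrow> inner w (real_vec d) > 0 \<Longrightarrow> (\<Sum>t\<in>UNIV. v t * d t) > 0"
    using integral_linear_form[of A w] by metis
  have vpos: "v s > 0" for s
  proof -
    have "inner w (real_vec (unit s)) = vec_nth w s"
      by (simp add: inner_real_vec unit_def if_distrib[of of_int] if_distrib[of "\<lambda>x. _ * x"] cong: if_cong)
    then have "(\<Sum>t\<in>UNIV. v t * unit s t) > 0" using v(2)[of "unit s"] assms(2)[of s] by (simp add: A_def)
    then show ?thesis by (simp add: unit_def if_distrib[of "\<lambda>x. _ * x"] cong: if_cong)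
  qed
  define w' where "w' t = nat (v t)" for t
  have wd: "int (weighted_degree w' e') - int (weighted_degree w' e) = (\<Sum>t\<in>UNIV. v t * diff e e' t)" for e e'
  proof -
    have "int (w' t) = v t" for t using vpos[of t] by (simp add: w'_def)
    then show ?thesis by (simp add: weighted_degree_def diff_def right_diff_distrib sum_subtractf)
  qed
  have inner: "inner w (real_vec (diff e e')) = inner w (real_exponent e') - inner w (real_exponent e)" for e e'
    by (simp add: inner_real_vec diff_def inner_real_exponent right_diff_distrib sum_subtractf)
  show ?thesis
  proof (rule that[of w'])
    show "w' t > 0" for t using vpos[of t] by (simp add: w'_def)
    fix e e' assume "e \<in> E" "e' \<in> E"
    then have d: "diff e e' \<in> A" by (auto simp: A_def)
    show "weighted_degree w' e = weighted_degree w' e'" if "inner w (real_exponent e) = inner w (real_exponent e')"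
      using v(1)[OF d] wd[of e' e] inner[of e e'] that by simp
    show "weighted_degree w' e < weighted_degree w' e'" if "inner w (real_exponent e) < inner w (real_exponent e')"
      using v(2)[OF d] wd[of e' e] inner[of e e'] that by simp
  qed
qed

lemma weighted_degree_le: "j \<le> k \<Longrightarrow> weighted_degree w j \<le> weighted_degree w k"
  unfolding weighted_degree_def exponent_le_iff by (intro sum_mono mult_le_mono2) simp

lemma weighted_degree_less:
  assumes "\<And>t. w t > 0" "j \<le> k" "j \<noteq> k"
  shows "weighted_degree w j < weighted_degree w k"
proof -
  obtain t where t: "vec_nth j t \<noteq> vec_nth k t" using assms(3) by (auto simp: Finite_Cartesian_Product.vec_eq_iff)
  show ?thesis
    unfolding weighted_degree_def
  proof (rule sum_strict_mono_ex1)
    show "\<forall>x\<in>UNIV. w x * vec_nth j x \<le> w x * vec_nth k x" using assms(2) by (simp add: exponent_le_iff)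
    have "vec_nth j t < vec_nth k t" using assms(2) t by (simp add: exponent_le_iff less_le)
    then show "\<exists>a\<in>UNIV. w a * vec_nth j a < w a * vec_nth k a" using assms(1)[of t] by (intro bexI[of _ t]) simp_all
  qed simp
qed

text \<open>A compact hull plus the closed orthant is closed, so a linear form separates the
  exponent from the polyhedron. It is nonnegative because the polyhedron contains rays in all
  coordinate directions; a small multiple of the total degree makes it positive, and finally it is
  made integral.\<close>

lemma separating_weights:
  fixes I :: "'n :: finite germ set"
  assumes "real_exponent k \<notin> newton_polyhedron I"
  obtains w :: "'n \<Rightarrow> nat" where "\<And>t. w t > 0"
    "\<And>j. real_exponent j \<in> newton_polyhedron I \<Longrightarrow> weighted_degree w k < weighted_degree w j"
proof -
  obtain E where E: "finite E" "newton_polyhedron I = orthant_hull (real_exponent ` E)"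
    "\<And>k. real_exponent k \<in> newton_polyhedron I \<longleftrightarrow> (\<exists>e\<in>E. e \<le> k)"
    by (rule newton_generators[of I], rule that)
  show ?thesis
  proof (cases "E = {}")
    case True
    show ?thesis by (rule that[of "\<lambda>_. 1"]) (use True E(3) in auto)
  next
    case False
    have conv: "convex (orthant :: (real ^ 'n) set)" by (auto simp: convex_def orthant_def)
    have "closed (\<Inter>i. {v :: real ^ 'n. 0 \<le> vec_nth v i})"
      by (intro closed_INT ballI closed_halfspace_component_ge_cart)
    also have "(\<Inter>i. {v :: real ^ 'n. 0 \<le> vec_nth v i}) = orthant" by (auto simp: orthant_def)
    finally have "closed (orthant :: (real ^ 'n) set)" .
    moreover have "compact (convex hull (real_exponent ` E))"
      using E(1) by (intro finite_imp_compact_convex_hull finite_imageI)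
    ultimately have "closed (\<Union>x\<in>convex hull (real_exponent ` E). \<Union>y\<in>orthant. {x + y})"
      by (intro compact_closed_sums)
    moreover have "(\<Union>x\<in>convex hull (real_exponent ` E). \<Union>y\<in>orthant. {x + y}) = newton_polyhedron I"
      unfolding E(2) orthant_hull_def convex_hull_set_plus convex_hull_eq[THEN iffD2, OF conv]
      by (auto simp: set_plus_def)
    ultimately have "closed (newton_polyhedron I)" by simp
    moreover have "convex (newton_polyhedron I)" by (simp add: newton_polyhedron_def)
    ultimately obtain a b where ab: "inner a (real_exponent k) < b" "\<And>z. z \<in> newton_polyhedron I \<Longrightarrow> b < inner a z"
      using separating_hyperplane_closed_point[of "newton_polyhedron I" "real_exponent k"] assms by metis
    have a: "vec_nth a t \<ge> 0" for t
    proof (rule ccontr)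
      assume neg: "\<not> vec_nth a t \<ge> 0"
      obtain e where e: "e \<in> E" using False by blast
      define c where "c = inner a (real_exponent e)"
      \<comment> \<open>Far enough along the axis for a negative coordinate of \<open>a\<close> to
        bring the value down to at most \<open>b\<close>.\<close>
      define s where "s = max 0 ((b - c) / vec_nth a t)"
      have "real_exponent e + axis t s \<in> newton_polyhedron I"
        unfolding E(2) using e by (intro orthant_hull_inc orthant_closed) (auto simp: s_def)
      then have "b < inner a (real_exponent e + axis t s)" by (rule ab(2))
      also have "\<dots> = c + vec_nth a t * s" by (simp add: inner_add_right inner_axis c_def)
      also have "vec_nth a t * s \<le> b - c"
      proof -
        have "vec_nth a t * s \<le> vec_nth a t * ((b - c) / vec_nth a t)"
          using neg unfolding s_def by (intro mult_left_mono_neg) auto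
        then show ?thesis using neg by simp
      qed
      finally show False by simp
    qed
    \<comment> \<open>\<open>inner 1\<close> of an exponent is its total degree. The perturbation by
      \<open>\<epsilon>\<close> raises the value at \<open>k\<close> by
      \<open>\<epsilon> * (N - 1)\<close>, which is less than the gap \<open>\<epsilon> * N\<close>
      to \<open>b\<close>.\<close>
    define N where "N = 1 + inner 1 (real_exponent k)"
    have N: "N \<ge> 1" unfolding N_def by (simp add: inner_real_exponent sum_nonneg)
    define \<epsilon> where "\<epsilon> = (b - inner a (real_exponent k)) / N"
    have \<epsilon>: "\<epsilon> > 0" using ab(1) N by (simp add: \<epsilon>_def)
    define w where "w = a + \<epsilon> *\<^sub>R (1 :: real ^ 'n)"
    have wpos: "vec_nth w t > 0" for t using a[of t] \<epsilon> by (simp add: w_def)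
    have wk: "inner w (real_exponent k) < b"
    proof -
      have "inner w (real_exponent k) = inner a (real_exponent k) + \<epsilon> * (N - 1)"
        by (simp add: w_def N_def inner_add_left)
      also have "\<dots> < inner a (real_exponent k) + \<epsilon> * N" using \<epsilon> by simp
      also have "\<dots> = b" using N by (simp add: \<epsilon>_def)
      finally show ?thesis .
    qed
    have we: "b < inner w (real_exponent e)" if "e \<in> E" for e
    proof -
      have "b < inner a (real_exponent e)" using ab(2) E(3)[of e] that by blast
      also have "\<dots> \<le> inner w (real_exponent e)"
      proof -
        have "0 \<le> inner 1 (real_exponent e)" by (simp add: inner_real_exponent sum_nonneg)
        then show ?thesis using \<epsilon> by (simp add: w_def inner_add_left)
      qed
      finally show ?thesis .
    qed
    obtain w' :: "'n \<Rightarrow> nat" where w': "\<And>t. w' t > 0"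
      "\<And>e e'. e \<in> insert k E \<Longrightarrow> e' \<in> insert k E \<Longrightarrow> inner w (real_exponent e) = inner w (real_exponent e') \<Longrightarrow> weighted_degree w' e = weighted_degree w' e'"
      "\<And>e e'. e \<in> insert k E \<Longrightarrow> e' \<in> insert k E \<Longrightarrow> inner w (real_exponent e) < inner w (real_exponent e') \<Longrightarrow> weighted_degree w' e < weighted_degree w' e'"
    proof (rule integral_weights[of "insert k E" w])
      show "finite (insert k E)" using E(1) by simp
    qed (rule wpos, rule that)
    show ?thesis
    proof (rule that[of w'])
      show "w' t > 0" for t by (rule w'(1))
      fix j assume "real_exponent j \<in> newton_polyhedron I"
      then obtain e where e: "e \<in> E" "e \<le> j" using E(3) by blast
      have "weighted_degree w' k < weighted_degree w' e"
        using e(1) wk we[OF e(1)] by (intro w'(3)) auto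
      also have "\<dots> \<le> weighted_degree w' j" using e(2) by (rule weighted_degree_le)
      finally show "weighted_degree w' k < weighted_degree w' j" .
    qed
  qed
qed

section \<open>Faces of Minkowski sums\<close>

lemma compact_set_plus: "compact S \<Longrightarrow> compact T \<Longrightarrow> compact (S + T :: 'a :: real_normed_vector set)"
proof -
  assume "compact S" "compact T"
  moreover have "S + T = (\<Union>x\<in>S. \<Union>y\<in>T. {x + y})" by (auto simp: set_plus_def)
  ultimately show ?thesis by (simp add: compact_sums')
qed

lemma compact_set_sum:
  "(\<And>i. i \<in> A \<Longrightarrow> compact (S i)) \<Longrightarrow> compact (\<Sum>i\<in>A. S i :: 'a :: real_normed_vector set)"
  by (induction A rule: infinite_finite_induct) (simp_all add: compact_set_plus set_zero)

text \<open>The minimum of \<open>inner w\<close> over a Minkowski sum is the sum of the minima, and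
  a sum attains it only if every summand does.\<close>

lemma sum_supporting_faces:
  fixes P :: "nat \<Rightarrow> (real ^ 'n :: finite) set"
  assumes D: "\<And>i. i < p \<Longrightarrow> D i = {z \<in> P i. inner w z = m i}" "\<And>i. i < p \<Longrightarrow> D i \<in> compact_faces (P i)"
    and P: "\<And>i. i < p \<Longrightarrow> convex (P i)" "\<And>i z. i < p \<Longrightarrow> z \<in> P i \<Longrightarrow> m i \<le> inner w z"
  shows "(\<Sum>i<p. D i) \<in> compact_faces (\<Sum>i<p. P i)"
proof -
  let ?m = "\<Sum>i<p. m i"
  have alt: "(\<Sum>i<p. S i) = {sum s {..<p} | s. \<forall>i\<in>{..<p}. s i \<in> S i}" for S :: "nat \<Rightarrow> (real ^ 'n) set"
    by (rule set_sum_alt) simp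
  have eq: "(\<Sum>i<p. D i) = (\<Sum>i<p. P i) \<inter> {z. inner w z = ?m}"
  proof
    show "(\<Sum>i<p. D i) \<subseteq> (\<Sum>i<p. P i) \<inter> {z. inner w z = ?m}"
    proof
      fix z assume "z \<in> (\<Sum>i<p. D i)"
      then obtain s where s: "z = sum s {..<p}" "\<forall>i\<in>{..<p}. s i \<in> D i" unfolding alt by auto
      then have "\<forall>i\<in>{..<p}. s i \<in> P i \<and> inner w (s i) = m i" using D(1) by auto
      then show "z \<in> (\<Sum>i<p. P i) \<inter> {z. inner w z = ?m}"
        unfolding alt s(1) by (auto simp: inner_sum_right)
    qed
    show "(\<Sum>i<p. P i) \<inter> {z. inner w z = ?m} \<subseteq> (\<Sum>i<p. D i)"
    proof
      fix z assume z: "z \<in> (\<Sum>i<p. P i) \<inter> {z. inner w z = ?m}"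
      then obtain s where s: "z = sum s {..<p}" "\<forall>i\<in>{..<p}. s i \<in> P i" unfolding alt by auto
      have "(\<Sum>i<p. inner w (s i)) = ?m" using z s by (simp add: inner_sum_right)
      then have "(\<Sum>i<p. inner w (s i) - m i) = 0" by (simp add: sum_subtractf)
      moreover have "0 \<le> inner w (s i) - m i" if "i \<in> {..<p}" for i using P(2) s(2) that by simp
      ultimately have "\<forall>i\<in>{..<p}. inner w (s i) - m i = 0" by (subst (asm) sum_nonneg_eq_0_iff) auto
      then have "\<forall>i\<in>{..<p}. s i \<in> D i" using s(2) D(1) by simp
      then show "z \<in> (\<Sum>i<p. D i)" unfolding alt s(1) by blast
    qed
  qed
  have "(\<Sum>i<p. D i) face_of (\<Sum>i<p. P i)"
    unfolding eq
  proof (rule face_of_Int_supporting_hyperplane_ge)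
    show "convex (\<Sum>i<p. P i)" using P(1) by (intro convex_set_sum) simp
    fix z assume "z \<in> (\<Sum>i<p. P i)"
    then obtain s where s: "z = sum s {..<p}" "\<forall>i\<in>{..<p}. s i \<in> P i" unfolding alt by auto
    show "?m \<le> inner w z" unfolding s(1) inner_sum_right using P(2) s(2) by (intro sum_mono) simp
  qed
  moreover have "compact (\<Sum>i<p. D i)" using D(2) by (intro compact_set_sum) (simp add: compact_faces_def)
  moreover have "(\<Sum>i<p. D i) \<noteq> {}"
  proof -
    have "\<forall>i\<in>{..<p}. \<exists>z. z \<in> D i" using D(2) by (auto simp: compact_faces_def)
    from bchoice[OF this] obtain s where "\<forall>i\<in>{..<p}. s i \<in> D i" ..
    then have "sum s {..<p} \<in> (\<Sum>i<p. D i)" unfolding alt by blast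
    then show ?thesis by blast
  qed
  ultimately show ?thesis unfolding compact_faces_def by simp
qed

text \<open>The copies of the orthant merge into one, since
  \<open>orthant + orthant = orthant\<close>. At least one summand is required: the empty Minkowski
  sum is the single point \<open>0\<close>.\<close>

lemma orthant_hull_sum:
  "(\<Sum>i<Suc p. orthant_hull (E i)) = orthant_hull (\<Sum>i<Suc p. E i)"
proof -
  have "(\<Sum>i<Suc p. E i + orthant) = (\<Sum>i<Suc p. E i) + orthant"
  proof (induction p)
    case (Suc p)
    have "(\<Sum>i<Suc (Suc p). E i + orthant) = (\<Sum>i<Suc p. E i) + orthant + (E (Suc p) + orthant)"
      unfolding sum.lessThan_Suc[of _ "Suc p"] Suc ..
    also have "\<dots> = (\<Sum>i<Suc p. E i) + E (Suc p) + (orthant + orthant)"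
      by (simp only: ac_simps)
    finally show ?case unfolding orthant_plus sum.lessThan_Suc[of _ "Suc p"] .
  qed simp
  then show ?thesis unfolding orthant_hull_def by (simp only: convex_hull_set_sum[symmetric])
qed

lemma finite_set_sum: "(\<And>i. i \<in> A \<Longrightarrow> finite (S i)) \<Longrightarrow> finite (\<Sum>i\<in>A. S i :: 'a :: comm_monoid_add set)"
  by (induction A rule: infinite_finite_induct) (simp_all add: finite_set_plus set_zero)

text \<open>
  The positive weights exposing a compact face of a Minkowski sum expose its summands: by compactness of
  the summands, Minkowski addition can be cancelled.
\<close>

lemma expose_summands:
  fixes P :: "nat \<Rightarrow> (real ^ 'n :: finite) set"
  assumes P: "\<And>i. i < p \<Longrightarrow> P i = orthant_hull (E i)" "\<And>i. i < p \<Longrightarrow> finite (E i)" "p > 0"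
    and D: "\<And>i. i < p \<Longrightarrow> D i \<in> compact_faces (P i)" "(\<Sum>i<p. D i) \<in> compact_faces (\<Sum>i<p. P i)"
  obtains w m where "\<And>t. vec_nth w t > 0" "\<And>i z. i < p \<Longrightarrow> z \<in> P i \<Longrightarrow> m i \<le> inner w z"
    "\<And>i. i < p \<Longrightarrow> D i = {z \<in> P i. inner w z = m i}"
proof -
  obtain q where q: "p = Suc q" using P(3) by (cases p) auto
  have "(\<Sum>i<p. P i) = (\<Sum>i<p. orthant_hull (E i))" using P(1) by (intro sum.cong) simp_all
  then have PE: "(\<Sum>i<p. P i) = orthant_hull (\<Sum>i<p. E i)" unfolding q orthant_hull_sum .
  obtain w M where "\<And>t. vec_nth w t > 0" "\<And>z. z \<in> orthant_hull (\<Sum>i<p. E i) \<Longrightarrow> M \<le> inner w z"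
    "(\<Sum>i<p. D i) = {z \<in> orthant_hull (\<Sum>i<p. E i). inner w z = M}"
  proof (rule expose_compact_face)
    show "finite (\<Sum>i<p. E i)" using P(2) by (intro finite_set_sum) simp
    show "(\<Sum>i<p. D i) \<in> compact_faces (orthant_hull (\<Sum>i<p. E i))" using D(2) unfolding PE .
  qed (rule that)
  note w = this[folded PE]
  have alt: "(\<Sum>i<p. S i) = {sum s {..<p} | s. \<forall>i\<in>{..<p}. s i \<in> S i}" for S :: "nat \<Rightarrow> (real ^ 'n) set"
    by (rule set_sum_alt) simp
  have DP: "D i \<subseteq> P i" "compact (D i)" "convex (D i)" "D i \<noteq> {}" if "i < p" for i
    using D(1)[OF that] by (auto simp: compact_faces_def face_of_def)
  have upd: "sum (s(i := z)) {..<p} = z + sum s ({..<p} - {i})" if "i < p" for s :: "nat \<Rightarrow> real ^ 'n" and i z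
    using that by (subst sum.remove[of _ i]) (auto intro!: sum.cong)
  have "\<forall>i\<in>{..<p}. \<exists>z. z \<in> D i" using DP(4) by blast
  from bchoice[OF this] obtain d where d: "\<forall>i\<in>{..<p}. d i \<in> D i" ..
  define m where "m i = inner w (d i)" for i
  have dsum: "inner w (sum d {..<p}) = M" using w(3) d unfolding alt[of D] by blast
  \<comment> \<open>Exchanging the \<open>i\<close>-th summand of one point of the face, with all
    others kept, isolates the behaviour of \<open>inner w\<close> on \<open>P i\<close>.\<close>
  have ge: "m i \<le> inner w z" if i: "i < p" and z: "z \<in> P i" for i z
  proof -
    have "\<forall>j\<in>{..<p}. (d(i := z)) j \<in> P j" using d z DP(1) by auto
    then have "sum (d(i := z)) {..<p} \<in> (\<Sum>i<p. P i)" unfolding alt by blast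
    then have "M \<le> inner w (sum (d(i := z)) {..<p})" by (rule w(2))
    moreover have "inner w (sum d {..<p}) = inner w (d i) + inner w (sum d ({..<p} - {i}))"
      using i by (subst sum.remove[of _ i]) (auto simp: inner_add_right)
    ultimately show ?thesis using dsum unfolding upd[OF i] by (simp add: inner_add_right m_def)
  qed
  have sub: "D i \<subseteq> {z \<in> P i. inner w z = m i}" if i: "i < p" for i
  proof
    fix z assume z: "z \<in> D i"
    have "\<forall>j\<in>{..<p}. (d(i := z)) j \<in> D j" using d z by auto
    then have "sum (d(i := z)) {..<p} \<in> (\<Sum>i<p. D i)" unfolding alt by blast
    then have "inner w (sum (d(i := z)) {..<p}) = M" unfolding w(3) by simp
    moreover have "inner w (sum d {..<p}) = inner w (d i) + inner w (sum d ({..<p} - {i}))"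
      using i by (subst sum.remove[of _ i]) (auto simp: inner_add_right)
    ultimately have "inner w z = m i" using dsum unfolding upd[OF i] by (simp add: inner_add_right m_def)
    then show "z \<in> {z \<in> P i. inner w z = m i}" using z DP(1)[OF i] by blast
  qed
  have "{z \<in> P i. inner w z = m i} \<subseteq> D i" if i: "i < p" for i
  proof (rule subsetI, rule ccontr)
    fix f assume f: "f \<in> {z \<in> P i. inner w z = m i}" "f \<notin> D i"
    have "closed (D i)" using DP(2)[OF i] by (rule compact_imp_closed)
    then obtain a b where ab: "inner a f < b" "\<And>x. x \<in> D i \<Longrightarrow> b < inner a x"
      using separating_hyperplane_closed_point[OF DP(3)[OF i] _ f(2)] by metis
    \<comment> \<open>The stray point \<open>f\<close> is combined with minimisers of
      \<open>inner a\<close> on the other compact summands. The sum lies in the sum of the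
      \<open>D j\<close> and so has a second decomposition there; but each summand of that one is at
      least as large for \<open>inner a\<close>, and the \<open>i\<close>-th is strictly
      larger.\<close>
    have "\<forall>j\<in>{..<p}. \<exists>y. y \<in> D j \<and> (\<forall>x\<in>D j. inner a y \<le> inner a x)"
    proof
      fix j assume "j \<in> {..<p}"
      then have j: "j < p" by simp
      have "continuous_on (D j) (\<lambda>x. inner a x)" by (intro continuous_intros)
      from continuous_attains_inf[OF DP(2)[OF j] DP(4)[OF j] this]
      show "\<exists>y. y \<in> D j \<and> (\<forall>x\<in>D j. inner a y \<le> inner a x)" by blast
    qed
    from bchoice[OF this] obtain y where y: "\<forall>j\<in>{..<p}. y j \<in> D j \<and> (\<forall>x\<in>D j. inner a (y j) \<le> inner a x)" ..
    have "\<forall>j\<in>{..<p}. (y(i := f)) j \<in> P j \<and> inner w ((y(i := f)) j) = m j"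
      using y f(1) sub by auto
    then have "sum (y(i := f)) {..<p} \<in> (\<Sum>i<p. P i) \<and> inner w (sum (y(i := f)) {..<p}) = (\<Sum>j<p. m j)"
      unfolding alt inner_sum_right by (auto intro!: sum.cong)
    moreover have "(\<Sum>j<p. m j) = M" using dsum by (simp add: m_def inner_sum_right)
    ultimately have "sum (y(i := f)) {..<p} \<in> (\<Sum>i<p. D i)" unfolding w(3) by simp
    then obtain x where x: "sum (y(i := f)) {..<p} = sum x {..<p}" "\<forall>j\<in>{..<p}. x j \<in> D j"
      unfolding alt by auto
    have "inner a f + (\<Sum>j\<in>{..<p} - {i}. inner a (y j)) = inner a (sum x {..<p})"
      unfolding x(1)[symmetric] upd[OF i] by (simp add: inner_add_right inner_sum_right)
    also have "\<dots> = inner a (x i) + (\<Sum>j\<in>{..<p} - {i}. inner a (x j))"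
      using i by (subst sum.remove[of _ i]) (auto simp: inner_add_right inner_sum_right)
    finally have "inner a f + (\<Sum>j\<in>{..<p} - {i}. inner a (y j)) = inner a (x i) + (\<Sum>j\<in>{..<p} - {i}. inner a (x j))" .
    moreover have "(\<Sum>j\<in>{..<p} - {i}. inner a (y j)) \<le> (\<Sum>j\<in>{..<p} - {i}. inner a (x j))"
      using x(2) y by (intro sum_mono) auto
    moreover have "b < inner a (x i)" using ab(2) x(2) i by auto
    ultimately show False using ab(1) by linarith
  qed
  then have "D i = {z \<in> P i. inner w z = m i}" if "i < p" for i using sub[OF that] that by (intro equalityI)
  with w(1) ge show ?thesis by (rule that)
qed

text \<open>The exposing weights are made integral on finitely many generators only. This suffices:
  any other exponent of the polyhedron is a proper multiple of a generator, so positive weights of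
  either kind give it a strictly larger degree and keep it off the face.\<close>

lemma expose_newton_faces:
  fixes I :: "nat \<Rightarrow> 'n :: finite germ set"
  assumes p: "p > 0"
    and D: "\<And>i. i < p \<Longrightarrow> D i \<in> compact_faces (newton_polyhedron (I i))"
      "(\<Sum>i<p. D i) \<in> compact_faces (\<Sum>i<p. newton_polyhedron (I i))"
  obtains w :: "'n \<Rightarrow> nat" and d where "\<And>t. w t > 0"
    "\<And>i. i < p \<Longrightarrow> real_exponent (d i) \<in> D i"
    "\<And>i. i < p \<Longrightarrow> D i \<subseteq> newton_polyhedron (I i)"
    "\<And>i k. i < p \<Longrightarrow> real_exponent k \<in> newton_polyhedron (I i) \<Longrightarrow> weighted_degree w (d i) \<le> weighted_degree w k"
    "\<And>i k. i < p \<Longrightarrow> real_exponent k \<in> newton_polyhedron (I i) \<Longrightarrow>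
      weighted_degree w k = weighted_degree w (d i) \<longleftrightarrow> real_exponent k \<in> D i"
proof -
  have "\<exists>E. \<forall>i. finite (E i) \<and> newton_polyhedron (I i) = orthant_hull (real_exponent ` E i) \<and>
      (\<forall>k. real_exponent k \<in> newton_polyhedron (I i) \<longleftrightarrow> (\<exists>e\<in>E i. e \<le> k))"
    by (rule choice, rule allI, rule newton_generators) blast
  then obtain E where E: "\<And>i. finite (E i)" "\<And>i. newton_polyhedron (I i) = orthant_hull (real_exponent ` E i)"
    "\<And>i k. real_exponent k \<in> newton_polyhedron (I i) \<longleftrightarrow> (\<exists>e\<in>E i. e \<le> k)"
    by metis
  obtain w m where w: "\<And>t. vec_nth w t > 0" "\<And>i z. i < p \<Longrightarrow> z \<in> newton_polyhedron (I i) \<Longrightarrow> m i \<le> inner w z"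
    "\<And>i. i < p \<Longrightarrow> D i = {z \<in> newton_polyhedron (I i). inner w z = m i}"
  proof (rule expose_summands[of p "\<lambda>i. newton_polyhedron (I i)" "\<lambda>i. real_exponent ` E i" D])
    show "newton_polyhedron (I i) = orthant_hull (real_exponent ` E i)" for i by (rule E(2))
    show "finite (real_exponent ` E i)" for i using E(1) by simp
    show "D i \<in> compact_faces (newton_polyhedron (I i))" if "i < p" for i using that by (rule D(1))
  qed (rule p, rule D(2), rule that)
  have "\<forall>i\<in>{..<p}. \<exists>d. d \<in> E i \<and> real_exponent d \<in> D i"
  proof
    fix i assume "i \<in> {..<p}"
    then have i: "i < p" by simp
    have "D i face_of orthant_hull (real_exponent ` E i)" "bounded (D i)" and ne: "D i \<noteq> {}"
      using D(1)[OF i] unfolding E(2) by (auto simp: compact_faces_def compact_imp_bounded)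
    from compact_face_eq_hull[OF this(1,2)] have "convex hull (real_exponent ` E i \<inter> D i) \<noteq> {}"
      using ne by argo
    then show "\<exists>d. d \<in> E i \<and> real_exponent d \<in> D i" by auto
  qed
  from bchoice[OF this] obtain d where d: "\<forall>i\<in>{..<p}. d i \<in> E i \<and> real_exponent (d i) \<in> D i" ..
  define A where "A = (\<Union>i<p. E i)"
  have finA: "finite A" using E(1) by (simp add: A_def)
  obtain w' :: "'n \<Rightarrow> nat" where w': "\<And>t. w' t > 0"
    "\<And>e e'. e \<in> A \<Longrightarrow> e' \<in> A \<Longrightarrow> inner w (real_exponent e) = inner w (real_exponent e') \<Longrightarrow> weighted_degree w' e = weighted_degree w' e'"
    "\<And>e e'. e \<in> A \<Longrightarrow> e' \<in> A \<Longrightarrow> inner w (real_exponent e) < inner w (real_exponent e') \<Longrightarrow> weighted_degree w' e < weighted_degree w' e'"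
    by (rule integral_weights[OF finA w(1)], rule that)
  have EA: "e \<in> A" if "i < p" "e \<in> E i" for i e using that by (auto simp: A_def)
  have EN: "real_exponent e \<in> newton_polyhedron (I i)" if "e \<in> E i" for e i using E(3) that by auto
  have wd: "inner w (real_exponent (d i)) = m i" if "i < p" for i using d w(3) that by auto
  have wE: "weighted_degree w' (d i) \<le> weighted_degree w' e \<and>
      (weighted_degree w' e = weighted_degree w' (d i) \<longleftrightarrow> real_exponent e \<in> D i)" if i: "i < p" and e: "e \<in> E i" for i e
  proof (cases "inner w (real_exponent e) = m i")
    case True
    then have "real_exponent e \<in> D i" using w(3)[OF i] EN[OF e] by simp
    moreover have "weighted_degree w' e = weighted_degree w' (d i)"
      using True wd[OF i] d i EA[OF i] e by (intro w'(2)) auto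
    ultimately show ?thesis by simp
  next
    case False
    then have "real_exponent e \<notin> D i" using w(3)[OF i] by simp
    moreover have "m i < inner w (real_exponent e)" using w(2)[OF i EN[OF e]] False by simp
    then have "weighted_degree w' (d i) < weighted_degree w' e"
      using wd[OF i] d i EA[OF i] e by (intro w'(3)) auto
    ultimately show ?thesis by simp
  qed
  have main: "weighted_degree w' (d i) \<le> weighted_degree w' k \<and>
      (weighted_degree w' k = weighted_degree w' (d i) \<longleftrightarrow> real_exponent k \<in> D i)"
    if i: "i < p" and k: "real_exponent k \<in> newton_polyhedron (I i)" for i k
  proof -
    obtain e where e: "e \<in> E i" "e \<le> k" using k E(3) by blast
    show ?thesis
    proof (cases "e = k")
      case True
      then show ?thesis using wE[OF i e(1)] by simp
    next
      case False
      have "weighted_degree w' e < weighted_degree w' k" by (rule weighted_degree_less[OF w'(1) e(2) False])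
      then have lt: "weighted_degree w' (d i) < weighted_degree w' k" using wE[OF i e(1)] by simp
      from e(2) obtain j where j: "real_exponent k = real_exponent e + real_exponent j" "k = j + e" by (rule real_exponent_le)
      have "real_exponent j \<noteq> 0"
      proof
        assume "real_exponent j = 0"
        then have "j = 0" by (simp add: real_exponent_def Finite_Cartesian_Product.vec_eq_iff)
        then show False using j(2) False by simp
      qed
      then have "inner w (real_exponent j) > 0" by (intro inner_orthant_pos w(1) real_exponent_orthant)
      then have "m i < inner w (real_exponent k)" using w(2)[OF i EN[OF e(1)]]
        unfolding j(1) inner_add_right by linarith
      then have "real_exponent k \<notin> D i" using w(3)[OF i] by simp
      with lt show ?thesis by simp
    qed
  qed
  show ?thesis
  proof (rule that[of w' d])
    show "D i \<subseteq> newton_polyhedron (I i)" if "i < p" for i using w(3)[OF that] by blast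
  qed (use w'(1) d main in auto)
qed

section \<open>Minors, rank and valuation rings\<close>

text \<open>With entries given by a function of the indices, choosing rows and columns is
  composition with index functions, which may permute or repeat.\<close>

abbreviation fun_det :: "nat \<Rightarrow> (nat \<Rightarrow> nat \<Rightarrow> 'a :: comm_ring_1) \<Rightarrow> 'a" where
  "fun_det n F \<equiv> Determinant.det (Matrix.mat n n (\<lambda>(i, j). F i j))"

lemma fun_det_cong:
  "(\<And>i j. i < n \<Longrightarrow> j < n \<Longrightarrow> F i j = G i j) \<Longrightarrow> fun_det n F = fun_det n G"
  by (intro arg_cong[of _ _ Determinant.det] eq_matI) auto

lemma mat_mult_vec_index:
  "i < n \<Longrightarrow> (Matrix.mat n m (\<lambda>(i, j). F i j) *\<^sub>v v) $ i = (\<Sum>j<dim_vec v. F i j * v $ j)" if "dim_vec v = m"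
  using that by (auto simp: Matrix.scalar_prod_def lessThan_atLeast0 intro!: sum.cong)

lemma fun_det_eq_0_iff:
  fixes F :: "nat \<Rightarrow> nat \<Rightarrow> 'a :: field"
  shows "fun_det n F = 0 \<longleftrightarrow> (\<exists>c. (\<exists>j<n. c j \<noteq> 0) \<and> (\<forall>i<n. (\<Sum>j<n. F i j * c j) = 0))"
proof
  assume "fun_det n F = 0"
  then obtain v where v: "v \<in> carrier_vec n" "v \<noteq> 0\<^sub>v n" "Matrix.mat n n (\<lambda>(i, j). F i j) *\<^sub>v v = 0\<^sub>v n"
    using det_0_iff_vec_prod_zero_field[of "Matrix.mat n n (\<lambda>(i, j). F i j)" n] by auto
  have "(\<Sum>j<n. F i j * v $ j) = 0" if "i < n" for i
    using arg_cong[OF v(3), of "\<lambda>u. u $ i"] that v(1) by (simp add: mat_mult_vec_index del: index_mult_mat_vec)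
  moreover have "\<exists>j<n. v $ j \<noteq> 0"
  proof (rule ccontr)
    assume "\<not> ?thesis"
    then have "v = 0\<^sub>v n" using v(1) by (intro eq_vecI) auto
    with v(2) show False by simp
  qed
  ultimately show "\<exists>c. (\<exists>j<n. c j \<noteq> 0) \<and> (\<forall>i<n. (\<Sum>j<n. F i j * c j) = 0)"
    by (intro exI[of _ "\<lambda>j. v $ j"]) simp
next
  assume "\<exists>c. (\<exists>j<n. c j \<noteq> 0) \<and> (\<forall>i<n. (\<Sum>j<n. F i j * c j) = 0)"
  then obtain c j where c: "j < n" "c j \<noteq> 0" "\<forall>i<n. (\<Sum>j<n. F i j * c j) = 0" by (elim exE conjE)
  let ?v = "Matrix.vec n c"
  have "?v \<noteq> 0\<^sub>v n"
  proof
    assume "?v = 0\<^sub>v n"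
    then have "?v $ j = 0\<^sub>v n $ j" by simp
    with c show False by simp
  qed
  moreover have "Matrix.mat n n (\<lambda>(i, j). F i j) *\<^sub>v ?v = 0\<^sub>v n"
    using c(3) by (intro eq_vecI) (simp_all add: mat_mult_vec_index del: index_mult_mat_vec)
  ultimately have "\<exists>v. v \<in> carrier_vec n \<and> v \<noteq> 0\<^sub>v n \<and> Matrix.mat n n (\<lambda>(i, j). F i j) *\<^sub>v v = 0\<^sub>v n"
    by (intro exI[of _ ?v]) simp
  then show "fun_det n F = 0"
    using det_0_iff_vec_prod_zero_field[of "Matrix.mat n n (\<lambda>(i, j). F i j)" n] by simp
qed

lemma fun_det_solve:
  fixes F :: "nat \<Rightarrow> nat \<Rightarrow> 'a :: field"
  assumes "fun_det n F \<noteq> 0"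
  obtains c where "\<And>i. i < n \<Longrightarrow> (\<Sum>j<n. F i j * c j) = y i"
proof -
  define A where "A = Matrix.mat n n (\<lambda>(i, j). F i j)"
  have A: "A \<in> carrier_mat n n" by (simp add: A_def)
  have d: "Determinant.det A \<noteq> 0" using assms by (simp add: A_def)
  define v where "v = inverse (Determinant.det A) \<cdot>\<^sub>v (adj_mat A *\<^sub>v Matrix.vec n y)"
  have v: "v \<in> carrier_vec n" using adj_mat(1)[OF A] by (simp add: v_def)
  have adj: "adj_mat A *\<^sub>v Matrix.vec n y \<in> carrier_vec n"
    using adj_mat(1)[OF A] by simp
  have "A *\<^sub>v v = inverse (Determinant.det A) \<cdot>\<^sub>v (A *\<^sub>v (adj_mat A *\<^sub>v Matrix.vec n y))"
    unfolding v_def by (rule mult_mat_vec[OF A adj])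
  also have "A *\<^sub>v (adj_mat A *\<^sub>v Matrix.vec n y) = (A * adj_mat A) *\<^sub>v Matrix.vec n y"
    using A adj_mat(1)[OF A] by (intro assoc_mult_mat_vec[symmetric]) auto
  also have "\<dots> = (Determinant.det A \<cdot>\<^sub>m 1\<^sub>m n) *\<^sub>v Matrix.vec n y" unfolding adj_mat(2)[OF A] ..
  also have "\<dots> = Determinant.det A \<cdot>\<^sub>v Matrix.vec n y"
    by (intro eq_vecI) (simp_all add: row_smult)
  finally have "A *\<^sub>v v = Matrix.vec n y" using d by (simp add: smult_smult_assoc)
  then have Av: "(A *\<^sub>v v) $ i = y i" if "i < n" for i using that by simp
  have "(\<Sum>j<n. F i j * v $ j) = y i" if "i < n" for i
    using Av[OF that] that v unfolding A_def by (simp add: mat_mult_vec_index del: index_mult_mat_vec)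
  then show ?thesis by (rule that)
qed

lemma fun_det_cramer:
  fixes F :: "nat \<Rightarrow> nat \<Rightarrow> 'a :: comm_ring_1"
  assumes "\<And>i. i < n \<Longrightarrow> (\<Sum>j<n. F i j * c j) = y i" "k < n"
  shows "fun_det n (\<lambda>i j. if j = k then y i else F i j) = c k * fun_det n F"
proof -
  let ?A = "Matrix.mat n n (\<lambda>(i, j). F i j)"
  have "?A *\<^sub>v Matrix.vec n c = Matrix.vec n y"
    using assms(1) by (intro eq_vecI) (simp_all add: mat_mult_vec_index del: index_mult_mat_vec)
  then have "Determinant.det (replace_col ?A (Matrix.vec n y) k) = c k * fun_det n F"
    using cramer_lemma_mat[of ?A n "Matrix.vec n c" k] assms(2) by simp
  moreover have "replace_col ?A (Matrix.vec n y) k = Matrix.mat n n (\<lambda>(i, j). if j = k then y i else F i j)"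
    by (rule eq_matI) (auto simp: replace_col_def)
  ultimately show ?thesis by simp
qed

text \<open>Reordering changes a determinant only by a sign, but only its non-vanishing matters
  here. A kernel vector is carried from one ordering to the other, so no permutation has to be
  constructed.\<close>

lemma fun_det_reindex:
  fixes F :: "'i \<Rightarrow> 'j \<Rightarrow> 'a :: field"
  assumes f: "f ` {..<n} = f' ` {..<n}" and g: "inj_on g {..<n}" "inj_on g' {..<n}" "g ` {..<n} = g' ` {..<n}"
    and nz: "fun_det n (\<lambda>i j. F (f i) (g j)) \<noteq> 0"
  shows "fun_det n (\<lambda>i j. F (f' i) (g' j)) \<noteq> 0"
proof
  assume "fun_det n (\<lambda>i j. F (f' i) (g' j)) = 0"
  then obtain c j0 where c: "j0 < n" "c j0 \<noteq> 0" "\<forall>i<n. (\<Sum>j<n. F (f' i) (g' j) * c j) = 0"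
    unfolding fun_det_eq_0_iff by (elim exE conjE)
  define d where "d x = c (inv_into {..<n} g' x)" for x
  have d: "d (g' j) = c j" if "j < n" for j
    using g(2) that by (simp add: d_def)
  have *: "(\<Sum>j<n. F x (g j) * d (g j)) = (\<Sum>j<n. F x (g' j) * c j)" for x
  proof -
    have "(\<Sum>j<n. F x (g j) * d (g j)) = (\<Sum>y\<in>g ` {..<n}. F x y * d y)"
      by (simp add: sum.reindex[OF g(1)])
    also have "\<dots> = (\<Sum>j<n. F x (g' j) * d (g' j))"
      unfolding g(3) by (simp add: sum.reindex[OF g(2)])
    finally show ?thesis using d by simp
  qed
  have "(\<Sum>j<n. F (f i) (g j) * d (g j)) = 0" if "i < n" for i
  proof -
    have "f i \<in> f' ` {..<n}" using f that by blast
    then obtain i' where "i' < n" "f i = f' i'" by auto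
    then show ?thesis using c(3) by (simp add: *)
  qed
  moreover have "\<exists>j<n. d (g j) \<noteq> 0"
  proof -
    have "g' j0 \<in> g ` {..<n}" using g(3) c(1) by blast
    then obtain j where "j < n" "g j = g' j0" by auto
    then show ?thesis using d[OF c(1)] c(2) by auto
  qed
  ultimately have "\<exists>c. (\<exists>j<n. c j \<noteq> 0) \<and> (\<forall>i<n. (\<Sum>j<n. F (f i) (g j) * c j) = 0)"
    by (intro exI[of _ "\<lambda>j. d (g j)"]) blast
  then show False using nz unfolding fun_det_eq_0_iff by blast
qed

lemma fun_det_nonzero_inj:
  fixes F :: "'i \<Rightarrow> 'j \<Rightarrow> 'a :: comm_ring_1"
  assumes "fun_det n (\<lambda>i j. F (f i) (g j)) \<noteq> 0"
  shows "inj_on f {..<n}" "inj_on g {..<n}"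
proof -
  let ?A = "Matrix.mat n n (\<lambda>(i, j). F (f i) (g j))"
  show "inj_on f {..<n}"
  proof (rule inj_onI, rule ccontr)
    fix a b assume "a \<in> {..<n}" "b \<in> {..<n}" "f a = f b" "a \<noteq> b"
    then have "Determinant.det ?A = 0"
      by (intro det_identical_rows[of ?A n a b]) (auto intro!: eq_vecI)
    with assms show False by simp
  qed
  show "inj_on g {..<n}"
  proof (rule inj_onI, rule ccontr)
    fix a b assume "a \<in> {..<n}" "b \<in> {..<n}" "g a = g b" "a \<noteq> b"
    then have "Determinant.det ?A = 0"
      by (intro det_identical_cols[of ?A n a b]) (auto intro!: eq_vecI)
    with assms show False by simp
  qed
qed

lemma pick_bij:
  assumes "finite L"
  shows "inj_on (pick L) {..<card L}" "pick L ` {..<card L} = L"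
proof -
  show inj: "inj_on (pick L) {..<card L}"
  proof (rule linorder_inj_onI)
    fix x y assume "x < y" "x \<in> {..<card L}" "y \<in> {..<card L}"
    then have "pick L x < pick L y" using pick_mono[of y L x] by simp
    then show "pick L x \<noteq> pick L y" by simp
  qed auto
  have "pick L ` {..<card L} \<subseteq> L" using pick_in_set by blast
  moreover have "card (pick L ` {..<card L}) = card L" using inj by (simp add: card_image)
  ultimately show "pick L ` {..<card L} = L" using assms by (intro card_subset_eq)
qed


text \<open>The columns of a nonzero minor of maximal size span.\<close>

lemma exists_maximal_minor:
  fixes W :: "'a :: field vec set"
  assumes W: "W \<subseteq> carrier_vec n"
    and s0: "0 < s0" "fun_det s0 (\<lambda>a b. g0 b $ f0 a) \<noteq> 0" "\<And>a. a < s0 \<Longrightarrow> f0 a < n" "\<And>b. b < s0 \<Longrightarrow> g0 b \<in> W"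
  obtains s f g where "s0 \<le> s" "fun_det s (\<lambda>a b. g b $ f a) \<noteq> 0" "\<And>a. a < s \<Longrightarrow> f a < n" "\<And>b. b < s \<Longrightarrow> g b \<in> W"
    "f 0 = f0 0"
    "vectorspace.dim class_ring (LinearCombinations.module.span_vs class_ring (module_vec TYPE('a) n) W) = s"
proof -
  \<comment> \<open>The row \<open>f0 0\<close> is kept while the minor grows; this later puts a
    prescribed row into a maximal nonzero minor.\<close>
  define P where "P s \<longleftrightarrow> (\<exists>f g. fun_det s (\<lambda>a b. g b $ f a) \<noteq> 0 \<and> (\<forall>a<s. f a < n) \<and> (\<forall>b<s. g b \<in> W) \<and> f 0 = f0 0)" for s
  have P0: "P s0" unfolding P_def using s0(3,4)
    by (intro exI[of _ f0] exI[of _ g0] conjI allI impI s0(2) refl)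
  have bound: "s \<le> n" if "P s" for s
  proof -
    from that obtain f g where *: "fun_det s (\<lambda>a b. g b $ f a) \<noteq> 0" "\<forall>a<s. f a < n"
      "\<forall>b<s. g b \<in> W" "f 0 = f0 0"
      unfolding P_def by (elim exE conjE)
    have "inj_on f {..<s}" using fun_det_nonzero_inj(1)[of s "\<lambda>i v. v $ i" f g] *(1) by simp
    then have "card {..<s} \<le> card {..<n}" by (rule card_inj_on_le) (use *(2) in auto)
    then show ?thesis by simp
  qed
  define s where "s = (GREATEST s. P s)"
  have Ps: "P s" unfolding s_def using P0 bound by (rule GreatestI_nat)
  have max: "s' \<le> s" if "P s'" for s' unfolding s_def using that bound by (rule Greatest_le_nat)
  from Ps obtain f g where fg: "fun_det s (\<lambda>a b. g b $ f a) \<noteq> 0" "\<forall>a<s. f a < n" "\<forall>b<s. g b \<in> W" "f 0 = f0 0"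
    unfolding P_def by (elim exE conjE)
  have s: "0 < s" "s0 \<le> s" using max[OF P0] s0(1) by auto
  have dimg: "dim_vec (g b) = n" if "b < s" for b using fg(3) W that by auto
  have comb: "\<exists>c. \<forall>l<n. (\<Sum>b<s. g b $ l * c b) = x $ l" if x: "x \<in> W" for x
  proof -
    obtain c where c: "\<And>a. a < s \<Longrightarrow> (\<Sum>b<s. g b $ f a * c b) = x $ f a"
      using fun_det_solve[OF fg(1), of "\<lambda>a. x $ f a"] by metis
    have "(\<Sum>b<s. g b $ l * c b) = x $ l" if l: "l < n" for l
    proof -
      \<comment> \<open>The coefficients \<open>c\<close> were found from the rows \<open>f\<close>
        alone. Bordering the minor by row \<open>l\<close> and column \<open>x\<close> gives
        determinant zero by maximality; the resulting kernel vector has nonzero last entry and is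
        proportional to \<open>c\<close> extended by \<open>-1\<close>, so \<open>c\<close> also
        works in row \<open>l\<close>.\<close>
      let ?f = "f(s := l)" and ?g = "g(s := x)"
      have "fun_det (Suc s) (\<lambda>a b. ?g b $ ?f a) = 0"
      proof (rule ccontr)
        assume "fun_det (Suc s) (\<lambda>a b. ?g b $ ?f a) \<noteq> 0"
        moreover have "\<forall>a<Suc s. ?f a < n" "\<forall>b<Suc s. ?g b \<in> W" "?f 0 = f0 0"
          using fg x l s by (auto simp: less_Suc_eq)
        ultimately have "P (Suc s)" unfolding P_def by (intro exI[of _ ?f] exI[of _ ?g] conjI)
        from max[OF this] show False by simp
      qed
      then obtain d j where d: "j < Suc s" "d j \<noteq> 0" "\<forall>i<Suc s. (\<Sum>j<Suc s. ?g j $ ?f i * d j) = 0"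
        unfolding fun_det_eq_0_iff by (elim exE conjE)
      have row: "(\<Sum>b<s. g b $ f a * d b) + x $ f a * d s = 0" if "a < s" for a
        using d(3)[rule_format, of a] that by simp
      have rowl: "(\<Sum>b<s. g b $ l * d b) + x $ l * d s = 0"
        using d(3)[rule_format, of s] by simp
      have ker: "e b = 0" if "\<And>a. a < s \<Longrightarrow> (\<Sum>b<s. g b $ f a * e b) = 0" "b < s" for e b
      proof (rule ccontr)
        assume "e b \<noteq> 0"
        then have "\<exists>c. (\<exists>j<s. c j \<noteq> 0) \<and> (\<forall>i<s. (\<Sum>j<s. g j $ f i * c j) = 0)"
          using that by (intro exI[of _ e]) blast
        then show False using fg(1) unfolding fun_det_eq_0_iff by blast
      qed
      have ds: "d s \<noteq> 0"
      proof
        assume 0: "d s = 0"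
        have "(\<Sum>b<s. g b $ f a * d b) = 0" if "a < s" for a using row[OF that] 0 by simp
        then have "d b = 0" if "b < s" for b by (rule ker[OF _ that])
        then show False using d(1,2) 0 by (auto simp: less_Suc_eq)
      qed
      have "c b * d s + d b = 0" if b: "b < s" for b
      proof (rule ker[of "\<lambda>b. c b * d s + d b", OF _ b])
        fix a assume a: "a < s"
        have "(\<Sum>b<s. g b $ f a * (c b * d s + d b)) = (\<Sum>b<s. g b $ f a * c b) * d s + (\<Sum>b<s. g b $ f a * d b)"
          by (simp add: distrib_left sum.distrib sum_distrib_right mult.assoc)
        then show "(\<Sum>b<s. g b $ f a * (c b * d s + d b)) = 0" using c[OF a] row[OF a] by (simp add: add.commute)
      qed
      then have "d b = - (c b * d s)" if "b < s" for b using that by (simp add: eq_neg_iff_add_eq_0 add.commute)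
      then have "(\<Sum>b<s. g b $ l * d b) = - ((\<Sum>b<s. g b $ l * c b) * d s)"
        by (simp add: sum_distrib_right sum_negf mult.assoc)
      then have "(x $ l - (\<Sum>b<s. g b $ l * c b)) * d s = 0" using rowl by (simp add: algebra_simps)
      then show ?thesis using ds by simp
    qed
    then show ?thesis by blast
  qed
  interpret vec_space "TYPE('a)" n .
  define C where "C = Matrix.mat n s (\<lambda>(i, j). g j $ i)"
  have C: "C \<in> carrier_mat n s" by (simp add: C_def)
  have colC: "col C b = g b" if "b < s" for b
    using that dimg[OF that] by (intro eq_vecI) (auto simp: C_def)
  have inj: "inj_on g {..<s}" using fun_det_nonzero_inj(2)[of s "\<lambda>i v. v $ i" f g] fg(1) by simp
  have setC: "set (cols C) = g ` {..<s}" using colC C by (auto simp: cols_def)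
  have dist: "distinct (cols C)"
    unfolding distinct_conv_nth
  proof (intro allI impI)
    fix a b assume "a < length (cols C)" "b < length (cols C)" "a \<noteq> b"
    then show "cols C ! a \<noteq> cols C ! b" using C colC inj by (auto simp: inj_on_def)
  qed
  have sub: "set (cols C) \<subseteq> W" using setC fg(3) by auto
  have BV: "set (cols C) \<subseteq> carrier_vec n" using sub W by (rule subset_trans)
  have indep: "\<not> lin_dep (set (cols C))"
  proof
    assume "lin_dep (set (cols C))"
    then obtain v where v: "v \<in> carrier_vec s" "v \<noteq> 0\<^sub>v s" "C *\<^sub>v v = 0\<^sub>v n"
      using lin_depE[OF C _ dist] by metis
    have Cv: "(\<Sum>j<s. g j $ i * v $ j) = 0" if "i < n" for i
      using arg_cong[OF v(3), of "\<lambda>u. u $ i"] that v(1) unfolding C_def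
      by (simp add: mat_mult_vec_index del: index_mult_mat_vec)
    have "\<exists>j<s. v $ j \<noteq> 0"
    proof (rule ccontr)
      assume "\<not> ?thesis"
      then have "v = 0\<^sub>v s" using v(1) by (intro eq_vecI) auto
      with v(2) show False by simp
    qed
    moreover have "\<forall>i<s. (\<Sum>j<s. g j $ f i * v $ j) = 0"
    proof (intro allI impI)
      fix i assume "i < s"
      then have "f i < n" using fg(2) by simp
      then show "(\<Sum>j<s. g j $ f i * v $ j) = 0" by (rule Cv)
    qed
    ultimately have "\<exists>c. (\<exists>j<s. c j \<noteq> 0) \<and> (\<forall>i<s. (\<Sum>j<s. g j $ f i * c j) = 0)"
      by (intro exI[of _ "\<lambda>j. v $ j"] conjI)
    then show False using fg(1) unfolding fun_det_eq_0_iff by blast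
  qed
  have "W \<subseteq> span (set (cols C))"
  proof
    fix x assume x: "x \<in> W"
    from comb[OF x] obtain c where c: "\<forall>l<n. (\<Sum>b<s. g b $ l * c b) = x $ l" ..
    define h where "h u = c (inv_into {..<s} g u)" for u
    have "h (col C b) = c b" if "b < s" for b using inj that by (simp add: h_def colC)
    then have "Matrix.vec s (\<lambda>i. h (col C i)) = Matrix.vec s c" by (intro eq_vecI) auto
    then have "C *\<^sub>v Matrix.vec s c = lincomb h (set (cols C))"
      using mat_mult_eq_lincomb[OF C dist, of h] by simp
    moreover have "C *\<^sub>v Matrix.vec s c = x"
    proof (rule eq_vecI)
      show "dim_vec (C *\<^sub>v Matrix.vec s c) = dim_vec x" using x W by (auto simp: C_def)
      fix i assume "i < dim_vec x"
      then have "i < n" using x W by auto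
      then show "(C *\<^sub>v Matrix.vec s c) $ i = x $ i"
        using c unfolding C_def by (simp add: mat_mult_vec_index del: index_mult_mat_vec)
    qed
    moreover have "lincomb h (set (cols C)) \<in> span (set (cols C))"
      unfolding span_def
      by (rule CollectI, rule exI[of _ h], rule exI[of _ "set (cols C)"]) (simp add: class_ring_simps)
    ultimately show "x \<in> span (set (cols C))" by metis
  qed
  then have "span W \<subseteq> span (set (cols C))"
    by (rule span_is_subset[OF _ span_is_submodule[OF BV]])
  moreover have "span (set (cols C)) \<subseteq> span W" using sub by (rule span_is_monotone)
  ultimately have sp: "span W = span (set (cols C))" by (rule equalityI)
  have "maximal (set (cols C)) (\<lambda>T. T \<subseteq> set (cols C) \<and> \<not> lin_dep T)"
    using indep by (auto simp: maximal_def)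
  then have dim: "vectorspace.dim class_ring (span_vs (set (cols C))) = card (set (cols C))"
    by (rule dim_span[OF BV finite_set])
  have cardC: "card (set (cols C)) = s" unfolding setC using inj by (simp add: card_image)
  have "vectorspace.dim class_ring (span_vs W) = s" unfolding sp dim cardC ..
  from s(2) fg(1) fg(2,3)[rule_format] fg(4) this show ?thesis by (rule that[of s g f])
qed

text \<open>Only these properties are used of a given discrete valuation ring or field; the rings of
  the places built later have them too, without being discrete.\<close>

definition valuation_subring :: "'k :: field set \<Rightarrow> bool" where
  "valuation_subring V \<longleftrightarrow> 1 \<in> V \<and> (\<forall>x\<in>V. \<forall>y\<in>V. x - y \<in> V \<and> x * y \<in> V) \<and> (\<forall>x. x \<in> V \<or> inverse x \<in> V)"

lemma discrete_valuation_ring_subring: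
  assumes "discrete_valuation v"
  shows "valuation_subring {x. x = 0 \<or> 0 \<le> v x}"
proof -
  have mult: "v (x * y) = v x + v y" if "x \<noteq> 0" "y \<noteq> 0" for x y
    using assms that by (simp add: discrete_valuation_def)
  have add: "min (v x) (v y) \<le> v (x + y)" if "x \<noteq> 0" "y \<noteq> 0" "x + y \<noteq> 0" for x y
    using assms that by (simp add: discrete_valuation_def)
  have v1: "v 1 = 0" using mult[of 1 1] by simp
  have "v (- 1) = 0" using mult[of "- 1" "- 1"] v1 by simp
  then have neg: "v (- x) = v x" if "x \<noteq> 0" for x using mult[of "- 1" x] that by simp
  have inv: "v (inverse x) = - v x" if "x \<noteq> 0" for x using mult[of x "inverse x"] that v1 by simp
  show ?thesis
    unfolding valuation_subring_def
  proof (intro conjI ballI allI)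
    fix x y assume x: "x \<in> {x. x = 0 \<or> 0 \<le> v x}" and y: "y \<in> {x. x = 0 \<or> 0 \<le> v x}"
    show "x * y \<in> {x. x = 0 \<or> 0 \<le> v x}" using x y mult[of x y] by (cases "x = 0"; cases "y = 0") simp_all
    show "x - y \<in> {x. x = 0 \<or> 0 \<le> v x}"
    proof (cases "x = 0 \<or> y = 0 \<or> x - y = 0")
      case True
      then show ?thesis using x y neg[of y] by (cases "x = 0"; cases "y = 0") simp_all
    next
      case False
      then have "min (v x) (v (- y)) \<le> v (x + - y)" by (intro add) auto
      then show ?thesis using x y neg[of y] False by (auto simp: min_def split: if_splits)
    qed
  next
    fix x
    show "x \<in> {x. x = 0 \<or> 0 \<le> v x} \<or> inverse x \<in> {x. x = 0 \<or> 0 \<le> v x}"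
      using inv[of x] by (cases "x = 0") auto
  qed (simp add: v1)
qed

lemma intermediate_ringsD:
  assumes "V \<in> intermediate_rings"
  shows "valuation_subring V" "to_fract a \<in> V"
proof -
  show "to_fract a \<in> V" using assms by (auto simp: intermediate_rings_def)
  from assms consider v where "is_valuation_ring_of v V" | "is_subfield V" "range to_fract \<subseteq> V"
    by (auto simp: intermediate_rings_def)
  then show "valuation_subring V"
  proof cases
    case 1
    then show ?thesis using discrete_valuation_ring_subring[of v] by (simp add: is_valuation_ring_of_def)
  next
    case 2
    \<comment> \<open>A subfield that contains the domain contains all fractions, so the field case
      is just \<open>V = UNIV\<close>.\<close>
    have "x \<in> V" for x
    proof -
      obtain a b where "b \<noteq> 0" "x = Fract a b" by (rule fract_cases)
      then have "x = to_fract a * inverse (to_fract b)" by (simp add: to_fract_def)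
      moreover have "to_fract a \<in> V" "inverse (to_fract b) \<in> V" using 2 by (auto simp: is_subfield_def)
      ultimately show ?thesis using 2(1) by (simp add: is_subfield_def)
    qed
    then show ?thesis by (simp add: valuation_subring_def)
  qed
qed

section \<open>Linear algebra over a valuation subring\<close>

context
  fixes V :: "'k :: field set"
  assumes V: "valuation_subring V"
begin

lemma valuation_subring_closed:
  "1 \<in> V" "0 \<in> V" "x \<in> V \<Longrightarrow> y \<in> V \<Longrightarrow> x + y \<in> V" "x \<in> V \<Longrightarrow> - x \<in> V"
  "x \<in> V \<Longrightarrow> y \<in> V \<Longrightarrow> x - y \<in> V" "x \<in> V \<Longrightarrow> y \<in> V \<Longrightarrow> x * y \<in> V" "x \<in> V \<or> inverse x \<in> V"
proof -
  have D: "1 \<in> V" "\<And>x y. x \<in> V \<Longrightarrow> y \<in> V \<Longrightarrow> x - y \<in> V" "\<And>x y. x \<in> V \<Longrightarrow> y \<in> V \<Longrightarrow> x * y \<in> V"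
    "\<And>x. x \<in> V \<or> inverse x \<in> V"
    using V unfolding valuation_subring_def by simp_all
  show 0: "0 \<in> V" using D(2)[OF D(1) D(1)] by simp
  have neg: "- x \<in> V" if "x \<in> V" for x using D(2)[OF 0 that] by simp
  then show "x \<in> V \<Longrightarrow> - x \<in> V" .
  show "x + y \<in> V" if "x \<in> V" "y \<in> V" using D(2)[OF that(1) neg[OF that(2)]] by simp
  show "1 \<in> V" "x \<in> V \<Longrightarrow> y \<in> V \<Longrightarrow> x - y \<in> V" "x \<in> V \<Longrightarrow> y \<in> V \<Longrightarrow> x * y \<in> V" "x \<in> V \<or> inverse x \<in> V"
    by (rule D; assumption)+
qed

lemma valuation_subring_sum: "(\<And>i. i \<in> A \<Longrightarrow> f i \<in> V) \<Longrightarrow> sum f A \<in> V"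
  by (induction A rule: infinite_finite_induct) (simp_all add: valuation_subring_closed)

lemma valuation_subring_prod: "(\<And>i. i \<in> A \<Longrightarrow> f i \<in> V) \<Longrightarrow> prod f A \<in> V"
  by (induction A rule: infinite_finite_induct) (simp_all add: valuation_subring_closed)

lemma valuation_subring_fun_det:
  assumes "\<And>i j. i < n \<Longrightarrow> j < n \<Longrightarrow> F i j \<in> V"
  shows "fun_det n F \<in> V"
proof -
  have "fun_det n F = (\<Sum>q | q permutes {0..<n}. signof q * (\<Prod>i = 0..<n. Matrix.mat n n (\<lambda>(i, j). F i j) $$ (i, q i)))"
    by (rule det_def') simp
  also have "\<dots> \<in> V"
  proof (intro valuation_subring_sum valuation_subring_closed(6) valuation_subring_prod)
    fix q i assume q: "q \<in> {q. q permutes {0..<n}}"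
    show "signof q \<in> V" by (auto simp: sign_def valuation_subring_closed)
    assume i: "i \<in> {0..<n}"
    then have "q i < n" using q permutes_in_image[of q "{0..<n}" i] by simp
    then show "Matrix.mat n n (\<lambda>(i, j). F i j) $$ (i, q i) \<in> V" using i assms by simp
  qed
  finally show ?thesis .
qed

lemma valuation_divide_trans: "x / y \<in> V \<Longrightarrow> y / z \<in> V \<Longrightarrow> y \<noteq> 0 \<Longrightarrow> x / z \<in> V"
  using valuation_subring_closed(6)[of "x / y" "y / z"] by simp

lemma valuation_minimal:
  "finite S \<Longrightarrow> S \<noteq> {} \<Longrightarrow> 0 \<notin> S \<Longrightarrow> \<exists>y\<in>S. \<forall>x\<in>S. x / y \<in> V"
proof (induction S rule: finite_ne_induct)
  case (singleton x)
  then show ?case by (auto simp: valuation_subring_closed)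
next
  case (insert x S)
  then obtain y where y: "y \<in> S" "\<forall>x\<in>S. x / y \<in> V" by auto
  have nz: "x \<noteq> 0" "y \<noteq> 0" using insert.prems y(1) by auto
  consider "x / y \<in> V" | "y / x \<in> V" using valuation_subring_closed(7)[of "x / y"] by (auto simp: divide_simps)
  then show ?case
  proof cases
    case 1
    then show ?thesis using y by (intro bexI[of _ y]) auto
  next
    case 2
    have "z / x \<in> V" if "z \<in> S" for z
      by (rule valuation_divide_trans[OF _ 2 nz(2)]) (use y(2) that in blast)
    then show ?thesis using nz by (intro bexI[of _ x]) (auto simp: valuation_subring_closed)
  qed
qed

definition in_col_span :: "nat \<Rightarrow> nat \<Rightarrow> (nat \<Rightarrow> nat \<Rightarrow> 'k) \<Rightarrow> (nat \<Rightarrow> 'k) \<Rightarrow> bool" where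
  "in_col_span r m a y \<longleftrightarrow> (\<exists>c. (\<forall>j<m. c j \<in> V) \<and> (\<forall>i<r. (\<Sum>j<m. a i j * c j) = y i))"

lemma in_col_spanI: "(\<And>j. j < m \<Longrightarrow> c j \<in> V) \<Longrightarrow> (\<And>i. i < r \<Longrightarrow> (\<Sum>j<m. a i j * c j) = y i) \<Longrightarrow> in_col_span r m a y"
  unfolding in_col_span_def by (intro exI[of _ c]) simp

lemma in_col_spanE:
  assumes "in_col_span r m a y"
  obtains c where "\<And>j. j < m \<Longrightarrow> c j \<in> V" "\<And>i. i < r \<Longrightarrow> (\<Sum>j<m. a i j * c j) = y i"
proof -
  from assms obtain c where "(\<forall>j<m. c j \<in> V) \<and> (\<forall>i<r. (\<Sum>j<m. a i j * c j) = y i)"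
    unfolding in_col_span_def ..
  then show ?thesis by (intro that[of c]) simp_all
qed

lemma in_col_span_col: "k < m \<Longrightarrow> in_col_span r m a (\<lambda>i. a i k)"
  by (rule in_col_spanI[of m "\<lambda>j. if j = k then 1 else 0"])
    (auto simp: valuation_subring_closed if_distrib[of "\<lambda>x. _ * x"] sum.delta cong: if_cong)

lemma in_col_span_trans:
  assumes "in_col_span r m a y" "\<And>j. j < m \<Longrightarrow> in_col_span r q b (\<lambda>i. a i j)"
  shows "in_col_span r q b y"
proof -
  obtain c where c: "\<And>j. j < m \<Longrightarrow> c j \<in> V" "\<And>i. i < r \<Longrightarrow> (\<Sum>j<m. a i j * c j) = y i"
    by (rule in_col_spanE[OF assms(1)], rule that)
  have "\<forall>j\<in>{..<m}. \<exists>d. (\<forall>k<q. d k \<in> V) \<and> (\<forall>i<r. (\<Sum>k<q. b i k * d k) = a i j)"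
    using assms(2) by (simp add: in_col_span_def)
  from bchoice[OF this] obtain d where d: "\<forall>j\<in>{..<m}. (\<forall>k<q. d j k \<in> V) \<and> (\<forall>i<r. (\<Sum>k<q. b i k * d j k) = a i j)" ..
  show ?thesis
  proof (rule in_col_spanI[of q "\<lambda>k. \<Sum>j<m. d j k * c j"])
    fix k assume "k < q"
    then show "(\<Sum>j<m. d j k * c j) \<in> V"
      using c(1) d by (intro valuation_subring_sum valuation_subring_closed(6)) auto
  next
    fix i assume i: "i < r"
    have "(\<Sum>k<q. b i k * (\<Sum>j<m. d j k * c j)) = (\<Sum>k<q. \<Sum>j<m. b i k * d j k * c j)"
      by (simp add: sum_distrib_left mult.assoc)
    also have "\<dots> = (\<Sum>j<m. \<Sum>k<q. b i k * d j k * c j)" by (rule sum.swap)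
    also have "\<dots> = (\<Sum>j<m. (\<Sum>k<q. b i k * d j k) * c j)" by (simp add: sum_distrib_right)
    also have "\<dots> = (\<Sum>j<m. a i j * c j)" using d i by (intro sum.cong) auto
    finally show "(\<Sum>k<q. b i k * (\<Sum>j<m. d j k * c j)) = y i" using c(2)[OF i] by simp
  qed
qed

lemma fun_det_mult:
  "fun_det r (\<lambda>i k. \<Sum>j<r. F i j * G j k) = fun_det r F * fun_det r (G :: nat \<Rightarrow> nat \<Rightarrow> 'k)"
proof -
  have "Matrix.mat r r (\<lambda>(i, k). \<Sum>j<r. F i j * G j k) = Matrix.mat r r (\<lambda>(i, j). F i j) * Matrix.mat r r (\<lambda>(i, j). G i j)"
    by (rule eq_matI) (auto simp: Matrix.scalar_prod_def lessThan_atLeast0)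
  then show ?thesis by (simp add: det_mult[of _ r])
qed

text \<open>The coefficients that express the columns of \<open>u\<close> by those of
  \<open>F\<close> form a square matrix over \<open>V\<close>, and \<open>d\<close> is its
  determinant.\<close>

lemma fun_det_in_span:
  assumes "\<And>k. k < r \<Longrightarrow> in_col_span r r F (\<lambda>i. u i k)"
  obtains d where "d \<in> V" "fun_det r u = fun_det r F * d"
proof -
  have "\<forall>k\<in>{..<r}. \<exists>c. (\<forall>j<r. c j \<in> V) \<and> (\<forall>i<r. (\<Sum>j<r. F i j * c j) = u i k)"
    using assms by (simp add: in_col_span_def)
  from bchoice[OF this] obtain c where c: "\<forall>k\<in>{..<r}. (\<forall>j<r. c k j \<in> V) \<and> (\<forall>i<r. (\<Sum>j<r. F i j * c k j) = u i k)" ..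
  have "fun_det r u = fun_det r (\<lambda>i k. \<Sum>j<r. F i j * c k j)"
    using c by (intro fun_det_cong) simp
  also have "\<dots> = fun_det r F * fun_det r (\<lambda>j k. c k j)" by (rule fun_det_mult)
  finally have "fun_det r u = fun_det r F * fun_det r (\<lambda>j k. c k j)" .
  moreover have "fun_det r (\<lambda>j k. c k j) \<in> V" using c by (intro valuation_subring_fun_det) simp
  ultimately show ?thesis by (rule that[rotated])
qed

text \<open>Cramer's rule for a nonzero minor of minimal valuation.\<close>

lemma minimal_minor:
  fixes a :: "nat \<Rightarrow> nat \<Rightarrow> 'k"
  assumes "\<And>b. b < r \<Longrightarrow> g0 b < m" "fun_det r (\<lambda>i b. a i (g0 b)) \<noteq> 0"
  obtains g where "\<And>b. b < r \<Longrightarrow> g b < m" "fun_det r (\<lambda>i b. a i (g b)) \<noteq> 0"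
    "\<And>g'. (\<And>b. b < r \<Longrightarrow> g' b < m) \<Longrightarrow> fun_det r (\<lambda>i b. a i (g' b)) / fun_det r (\<lambda>i b. a i (g b)) \<in> V"
    "\<And>k. k < m \<Longrightarrow> in_col_span r r (\<lambda>i b. a i (g b)) (\<lambda>i. a i k)"
proof -
  let ?D = "\<lambda>g. fun_det r (\<lambda>i b. a i (g b))"
  define S where "S = ?D ` (PiE {..<r} (\<lambda>_. {..<m})) - {0}"
  have restrict: "?D g = ?D (restrict g {..<r})" for g by (rule fun_det_cong) simp
  have mem: "?D g \<in> S" if "\<And>b. b < r \<Longrightarrow> g b < m" "?D g \<noteq> 0" for g
  proof -
    have "restrict g {..<r} \<in> PiE {..<r} (\<lambda>_. {..<m})" using that(1) by simp
    then have "?D g \<in> ?D ` PiE {..<r} (\<lambda>_. {..<m})" by (subst restrict[of g]) (rule imageI)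
    moreover have "?D g \<notin> {0}" using that(2) by simp
    ultimately show ?thesis unfolding S_def by (rule DiffI)
  qed
  have "finite S" unfolding S_def by (intro finite_Diff finite_imageI finite_PiE) auto
  moreover have "?D g0 \<in> S" using assms by (rule mem)
  then have "S \<noteq> {}" by force
  moreover have "0 \<notin> S" by (simp add: S_def)
  ultimately have "\<exists>y\<in>S. \<forall>x\<in>S. x / y \<in> V" by (rule valuation_minimal)
  then obtain y where y: "y \<in> S" "\<forall>x\<in>S. x / y \<in> V" ..
  from y(1) obtain g where g: "g \<in> PiE {..<r} (\<lambda>_. {..<m})" "y = ?D g" "y \<noteq> 0" unfolding S_def by blast
  have gm: "g b < m" if "b < r" for b using PiE_mem[OF g(1)] that by simp
  have min: "?D g' / ?D g \<in> V" if "\<And>b. b < r \<Longrightarrow> g' b < m" for g'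
  proof (cases "?D g' = 0")
    case True
    then show ?thesis by (simp add: valuation_subring_closed)
  next
    case False
    then show ?thesis using mem[OF that False] y(2) g(2) by blast
  qed
  have "in_col_span r r (\<lambda>i b. a i (g b)) (\<lambda>i. a i k)" if k: "k < m" for k
  proof -
    obtain c where c: "\<And>i. i < r \<Longrightarrow> (\<Sum>j<r. a i (g j) * c j) = a i k"
    proof (rule fun_det_solve)
      show "?D g \<noteq> 0" using g by simp
    qed (rule that)
    have "c b \<in> V" if b: "b < r" for b
    proof -
      have "c b * ?D g = fun_det r (\<lambda>i j. if j = b then a i k else a i (g j))"
        by (rule fun_det_cramer[OF c b, symmetric])
      \<comment> \<open>Cramer's numerator is again one of the minors compared, because the choice
        functions may list columns in any order and with repetitions.\<close>
      also have "\<dots> = ?D (g(b := k))" by (rule fun_det_cong) simp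
      finally have "c b = ?D (g(b := k)) / ?D g" using g(2,3) by (simp add: divide_simps)
      then show ?thesis using min[of "g(b := k)"] gm k by simp
    qed
    then show ?thesis by (rule in_col_spanI[OF _ c])
  qed
  note span = this
  have nz: "?D g \<noteq> 0" using g by simp
  show ?thesis
  proof (rule that[of g])
    show "?D g' / ?D g \<in> V" if "\<And>b. b < r \<Longrightarrow> g' b < m" for g' using that by (rule min)
  qed (rule gm nz span, assumption?)+
qed

end


section \<open>Extension of modules and ideals to a valuation ring\<close>

lemma extended_submodule_iff:
  fixes A :: "'a :: idom mat"
  assumes V: "valuation_subring V" "\<And>a. to_fract a \<in> V" and A: "A \<in> carrier_mat r m"
    and N: "N = {A *\<^sub>v c | c. c \<in> carrier_vec m}"
  shows "w \<in> extended_submodule V r N \<longleftrightarrow> w \<in> carrier_vec r \<and>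
    in_col_span V r m (\<lambda>i j. to_fract (A $$ (i, j))) (\<lambda>i. w $ i)"
proof
  have Ac: "(A *\<^sub>v c) $ i = (\<Sum>j<m. A $$ (i, j) * c $ j)" if "c \<in> carrier_vec m" "i < r" for c i
    using A that by (auto simp: Matrix.scalar_prod_def lessThan_atLeast0 intro!: sum.cong)
  assume "w \<in> extended_submodule V r N"
  then obtain S c where w: "w \<in> carrier_vec r" and S: "finite S" "S \<subseteq> N" "c ` S \<subseteq> V"
    and sum: "\<forall>i<r. w $ i = (\<Sum>v\<in>S. c v * to_fract (v $ i))"
    unfolding extended_submodule_def by (elim CollectE conjE exE)
  have "\<forall>v\<in>S. \<exists>d. d \<in> carrier_vec m \<and> v = A *\<^sub>v d" using S(2) unfolding N by blast
  from bchoice[OF this] obtain d where d: "\<forall>v\<in>S. d v \<in> carrier_vec m \<and> v = A *\<^sub>v d v" ..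
  have "in_col_span V r m (\<lambda>i j. to_fract (A $$ (i, j))) (\<lambda>i. w $ i)"
  proof (rule in_col_spanI[OF V(1), of m "\<lambda>j. \<Sum>v\<in>S. c v * to_fract (d v $ j)"])
    show "(\<Sum>v\<in>S. c v * to_fract (d v $ j)) \<in> V" for j
      using S(3) V(2) by (intro valuation_subring_sum[OF V(1)] valuation_subring_closed(6)[OF V(1)]) auto
    fix i assume i: "i < r"
    have "(\<Sum>j<m. to_fract (A $$ (i, j)) * (\<Sum>v\<in>S. c v * to_fract (d v $ j)))
        = (\<Sum>v\<in>S. \<Sum>j<m. c v * to_fract (A $$ (i, j) * d v $ j))"
      unfolding sum_distrib_left by (subst sum.swap) (simp add: mult_ac)
    also have "\<dots> = (\<Sum>v\<in>S. c v * to_fract (v $ i))"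
    proof (rule sum.cong[OF refl])
      fix v assume "v \<in> S"
      then have v: "d v \<in> carrier_vec m" "v = A *\<^sub>v d v" using d by auto
      have "v $ i = (\<Sum>j<m. A $$ (i, j) * d v $ j)" by (subst v(2)) (rule Ac[OF v(1) i])
      then show "(\<Sum>j<m. c v * to_fract (A $$ (i, j) * d v $ j)) = c v * to_fract (v $ i)"
        by (simp add: sum_distrib_left to_fract_sum)
    qed
    finally show "(\<Sum>j<m. to_fract (A $$ (i, j)) * (\<Sum>v\<in>S. c v * to_fract (d v $ j))) = w $ i"
      using sum i by simp
  qed
  with w show "w \<in> carrier_vec r \<and> in_col_span V r m (\<lambda>i j. to_fract (A $$ (i, j))) (\<lambda>i. w $ i)" ..
next
  assume "w \<in> carrier_vec r \<and> in_col_span V r m (\<lambda>i j. to_fract (A $$ (i, j))) (\<lambda>i. w $ i)"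
  then have w: "w \<in> carrier_vec r" and sp: "in_col_span V r m (\<lambda>i j. to_fract (A $$ (i, j))) (\<lambda>i. w $ i)" by auto
  obtain c where c: "\<And>j. j < m \<Longrightarrow> c j \<in> V" "\<And>i. i < r \<Longrightarrow> (\<Sum>j<m. to_fract (A $$ (i, j)) * c j) = w $ i"
    by (rule in_col_spanE[OF V(1) sp], rule that)
  let ?S = "col A ` {..<m}"
  \<comment> \<open>Distinct indices may give the same column, whereas
    \<open>extended_submodule\<close> allows one coefficient per vector; the coefficients of equal
    columns are added.\<close>
  define c' where "c' v = (\<Sum>j\<in>{j\<in>{..<m}. col A j = v}. c j)" for v
  have "?S \<subseteq> N"
  proof
    fix v assume "v \<in> ?S"
    then obtain j where j: "j < m" "v = col A j" by auto
    have "A *\<^sub>v unit_vec m j = col A j" using A j(1) by (intro eq_vecI) auto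
    then show "v \<in> N" unfolding N using j by (intro CollectI exI[of _ "unit_vec m j"]) simp
  qed
  moreover have "c' ` ?S \<subseteq> V"
    unfolding c'_def using c(1) by (auto intro!: valuation_subring_sum[OF V(1)])
  moreover have "\<forall>i<r. w $ i = (\<Sum>v\<in>?S. c' v * to_fract (v $ i))"
  proof (intro allI impI)
    fix i assume i: "i < r"
    have "w $ i = (\<Sum>j<m. to_fract (A $$ (i, j)) * c j)" using c(2)[OF i] by simp
    also have "\<dots> = (\<Sum>v\<in>?S. \<Sum>j\<in>{j\<in>{..<m}. col A j = v}. to_fract (A $$ (i, j)) * c j)"
      by (rule sum.image_gen) simp
    also have "\<dots> = (\<Sum>v\<in>?S. c' v * to_fract (v $ i))"
      unfolding c'_def sum_distrib_right using A i by (intro sum.cong refl) (auto simp: mult.commute)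
    finally show "w $ i = (\<Sum>v\<in>?S. c' v * to_fract (v $ i))" .
  qed
  ultimately show "w \<in> extended_submodule V r N"
    unfolding extended_submodule_def using w
    by (intro CollectI conjI exI[of _ ?S] exI[of _ c']) auto
qed

text \<open>Membership of \<open>h\<close> in the ideal that \<open>S\<close> generates over
  \<open>V\<close>: in a valuation ring a finite combination is already a multiple of its term of
  least valuation, so a single \<open>g\<close> suffices.\<close>

definition dominated :: "'a :: idom fract set \<Rightarrow> 'a set \<Rightarrow> 'a \<Rightarrow> bool" where
  "dominated V S h \<longleftrightarrow> h = 0 \<or> (\<exists>g\<in>S. g \<noteq> 0 \<and> to_fract h / to_fract g \<in> V)"

lemma dominated_trans:
  assumes "valuation_subring V" "dominated V S h" "\<And>g. g \<in> S \<Longrightarrow> dominated V T g"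
  shows "dominated V T h"
proof (cases "h = 0")
  case False
  then obtain g where g: "g \<in> S" "g \<noteq> 0" "to_fract h / to_fract g \<in> V" using assms(2) by (auto simp: dominated_def)
  then obtain f where f: "f \<in> T" "f \<noteq> 0" "to_fract g / to_fract f \<in> V" using assms(3)[OF g(1)] by (auto simp: dominated_def)
  have "to_fract h / to_fract f \<in> V"
    using valuation_divide_trans[OF assms(1) g(3) f(3)] g(2) by simp
  then show ?thesis using f by (auto simp: dominated_def)
qed (simp add: dominated_def)

lemma dominated_base: "valuation_subring V \<Longrightarrow> h \<in> S \<Longrightarrow> dominated V S h"
  by (cases "h = 0") (auto simp: dominated_def valuation_subring_closed intro!: bexI[of _ h])

lemma dominated_add:
  assumes V: "valuation_subring V" and "dominated V S g" "dominated V S h"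
  shows "dominated V S (g + h)"
proof -
  note C = valuation_subring_closed[OF V]
  consider "g = 0" | "h = 0" | "g \<noteq> 0" "h \<noteq> 0" by blast
  then show ?thesis
  proof cases
    case 3
    then obtain x y where x: "x \<in> S" "x \<noteq> 0" "to_fract g / to_fract x \<in> V"
      and y: "y \<in> S" "y \<noteq> 0" "to_fract h / to_fract y \<in> V"
      using assms(2,3) by (auto simp: dominated_def)
    consider "to_fract x / to_fract y \<in> V" | "to_fract y / to_fract x \<in> V"
      using C(7)[of "to_fract x / to_fract y"] by (auto simp: divide_simps)
    then show ?thesis
    proof cases
      case 1
      have "to_fract g / to_fract y \<in> V" using valuation_divide_trans[OF V x(3) 1] x(2) by simp
      then have "to_fract (g + h) / to_fract y \<in> V" using C(3) y(3) by (simp add: add_divide_distrib)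
      then show ?thesis using y by (auto simp: dominated_def)
    next
      case 2
      have "to_fract h / to_fract x \<in> V" using valuation_divide_trans[OF V y(3) 2] y(2) by simp
      then have "to_fract (g + h) / to_fract x \<in> V" using C(3) x(3) by (simp add: add_divide_distrib)
      then show ?thesis using x by (auto simp: dominated_def)
    qed
  qed (use assms in simp_all)
qed

lemma dominated_generated_ideal:
  assumes V: "valuation_subring V" "\<And>a. to_fract a \<in> V" and h: "h \<in> generated_ideal S"
  shows "dominated V S h"
  using h
proof (rule generated_ideal_induct)
  show "dominated V S 0" by (simp add: dominated_def)
  fix c x y assume x: "x \<in> S" and y: "dominated V S y"
  have "dominated V S (c * x)"
  proof (cases "c * x = 0")
    case False
    then have "to_fract (c * x) / to_fract x \<in> V" using V(2)[of c] by simp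
    then show ?thesis using x False by (auto simp: dominated_def)
  qed (simp add: dominated_def)
  then show "dominated V S (c * x + y)" using y by (rule dominated_add[OF V(1)])
qed

text \<open>A \<open>V\<close>-combination of finitely many elements is divisible by the nonzero one
  of least valuation, and an element of the generated ideal is in turn divisible by a single
  generator. So the valuative definition of the closure reduces to domination by \<open>S\<close>
  itself.\<close>

lemma ideal_integral_closure_iff:
  fixes S :: "'a :: idom set"
  shows "h \<in> ideal_integral_closure (generated_ideal S) \<longleftrightarrow> (\<forall>V\<in>intermediate_rings. dominated V S h)"
proof -
  let ?I = "generated_ideal S" and ?v = "\<lambda>f. Matrix.vec 1 (\<lambda>_. f)"
  have ext: "map_vec to_fract (?v h) \<in> extended_submodule V 1 (ideal_vecs ?I) \<longleftrightarrow> dominated V S h"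
    if "V \<in> intermediate_rings" for V
  proof
    note V = intermediate_ringsD[OF that]
    assume "map_vec to_fract (?v h) \<in> extended_submodule V 1 (ideal_vecs ?I)"
    then obtain T c where T: "finite T" "T \<subseteq> ideal_vecs ?I" "c ` T \<subseteq> V"
      and sum: "\<forall>i<1. map_vec to_fract (?v h) $ i = (\<Sum>v\<in>T. c v * to_fract (v $ i))"
      unfolding extended_submodule_def by (elim CollectE conjE exE)
    have h: "to_fract h = (\<Sum>v\<in>T. c v * to_fract (v $ 0))" using sum by simp
    have v0: "v $ 0 \<in> ?I" if "v \<in> T" for v using T(2) that by (auto simp: ideal_vecs_def)
    show "dominated V S h"
    proof (cases "h = 0")
      case False
      let ?Z = "(\<lambda>v. to_fract (v $ 0)) ` {v \<in> T. v $ 0 \<noteq> 0}"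
      have "?Z \<noteq> {}"
      proof
        assume "?Z = {}"
        then have "to_fract h = 0" unfolding h by (intro sum.neutral) auto
        with False show False by simp
      qed
      moreover have "finite ?Z" "0 \<notin> ?Z" using T(1) by auto
      ultimately have "\<exists>y\<in>?Z. \<forall>x\<in>?Z. x / y \<in> V" using valuation_minimal[OF V(1)] by blast
      then obtain u where u: "u \<in> T" "u $ 0 \<noteq> 0" "\<forall>x\<in>?Z. x / to_fract (u $ 0) \<in> V" by blast
      have "to_fract h / to_fract (u $ 0) = (\<Sum>v\<in>T. c v * (to_fract (v $ 0) / to_fract (u $ 0)))"
        unfolding h by (simp add: sum_divide_distrib)
      also have "\<dots> \<in> V"
      proof (intro valuation_subring_sum[OF V(1)] valuation_subring_closed(6)[OF V(1)])
        fix v assume v: "v \<in> T"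
        then show "c v \<in> V" using T(3) by blast
        show "to_fract (v $ 0) / to_fract (u $ 0) \<in> V"
          using u(3) v by (cases "v $ 0 = 0") (auto simp: valuation_subring_closed[OF V(1)])
      qed
      finally have "dominated V ?I h" using u v0 by (auto simp: dominated_def)
      then show ?thesis by (rule dominated_trans[OF V(1)]) (rule dominated_generated_ideal[OF V])
    qed (simp add: dominated_def)
  next
    note V = intermediate_ringsD[OF that]
    assume d: "dominated V S h"
    show "map_vec to_fract (?v h) \<in> extended_submodule V 1 (ideal_vecs ?I)"
    proof (cases "h = 0")
      case True
      then show ?thesis unfolding extended_submodule_def
        by (intro CollectI conjI exI[of _ "{}"] exI[of _ "\<lambda>_. 0"]) auto
    next
      case False
      then obtain g where g: "g \<in> S" "g \<noteq> 0" "to_fract h / to_fract g \<in> V" using d by (auto simp: dominated_def)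
      have "?v g \<in> ideal_vecs ?I" using generated_ideal_base[OF g(1)] by (auto simp: ideal_vecs_def)
      then show ?thesis unfolding extended_submodule_def using g
        by (intro CollectI conjI exI[of _ "{?v g}"] exI[of _ "\<lambda>_. to_fract h / to_fract g"]) auto
    qed
  qed
  have "h \<in> ideal_integral_closure ?I \<longleftrightarrow> ?v h \<in> integral_closure 1 (ideal_vecs ?I)"
  proof
    assume "h \<in> ideal_integral_closure ?I"
    then obtain u where u: "u \<in> integral_closure 1 (ideal_vecs ?I)" "h = u $ 0"
      by (auto simp: ideal_integral_closure_def component_def)
    then have "u = ?v h" by (intro eq_vecI) (auto simp: integral_closure_def)
    with u(1) show "?v h \<in> integral_closure 1 (ideal_vecs ?I)" by simp
  next
    assume "?v h \<in> integral_closure 1 (ideal_vecs ?I)"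
    then have "?v h $ 0 \<in> ideal_integral_closure ?I"
      unfolding ideal_integral_closure_def component_def by (rule imageI)
    then show "h \<in> ideal_integral_closure ?I" by simp
  qed
  then show ?thesis using ext by (auto simp: integral_closure_def)
qed

lemma ideal_integral_closure_eq_iff:
  fixes S T :: "'a :: idom set"
  shows "ideal_integral_closure (generated_ideal S) = ideal_integral_closure (generated_ideal T) \<longleftrightarrow>
    (\<forall>V\<in>intermediate_rings. (\<forall>h\<in>S. dominated V T h) \<and> (\<forall>h\<in>T. dominated V S h))"
proof
  assume eq: "ideal_integral_closure (generated_ideal S) = ideal_integral_closure (generated_ideal T)"
  have "\<forall>h\<in>S. \<forall>V\<in>intermediate_rings. dominated V T h"
  proof
    fix h assume "h \<in> S"
    then have "h \<in> ideal_integral_closure (generated_ideal S)"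
      unfolding ideal_integral_closure_iff using dominated_base intermediate_ringsD(1) by blast
    then show "\<forall>V\<in>intermediate_rings. dominated V T h" unfolding eq ideal_integral_closure_iff .
  qed
  moreover have "\<forall>h\<in>T. \<forall>V\<in>intermediate_rings. dominated V S h"
  proof
    fix h assume "h \<in> T"
    then have "h \<in> ideal_integral_closure (generated_ideal T)"
      unfolding ideal_integral_closure_iff using dominated_base intermediate_ringsD(1) by blast
    then show "\<forall>V\<in>intermediate_rings. dominated V S h" unfolding eq[symmetric] ideal_integral_closure_iff .
  qed
  ultimately show "\<forall>V\<in>intermediate_rings. (\<forall>h\<in>S. dominated V T h) \<and> (\<forall>h\<in>T. dominated V S h)" by blast
next
  assume *: "\<forall>V\<in>intermediate_rings. (\<forall>h\<in>S. dominated V T h) \<and> (\<forall>h\<in>T. dominated V S h)"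
  have "dominated V S h \<longleftrightarrow> dominated V T h" if V: "V \<in> intermediate_rings" for V h
  proof
    show "dominated V T h" if "dominated V S h"
      by (rule dominated_trans[OF intermediate_ringsD(1)[OF V] that]) (use * V in blast)
    show "dominated V S h" if "dominated V T h"
      by (rule dominated_trans[OF intermediate_ringsD(1)[OF V] that]) (use * V in blast)
  qed
  note iff = this
  have "h \<in> ideal_integral_closure (generated_ideal S) \<longleftrightarrow> h \<in> ideal_integral_closure (generated_ideal T)" for h
    unfolding ideal_integral_closure_iff by (rule ball_cong[OF refl iff])
  then show "ideal_integral_closure (generated_ideal S) = ideal_integral_closure (generated_ideal T)"
    by (intro equalityI subsetI) simp_all
qed

section \<open>Determinants under ring homomorphisms and row scaling\<close>

lemma fun_det_hom: "comm_ring_hom h \<Longrightarrow> fun_det n (\<lambda>i j. h (F i j)) = h (fun_det n F)"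
proof -
  assume h: "comm_ring_hom h"
  have "Matrix.mat n n (\<lambda>(i, j). h (F i j)) = map_mat h (Matrix.mat n n (\<lambda>(i, j). F i j))"
    by (rule eq_matI) auto
  then show ?thesis using comm_ring_hom.hom_det[OF h] by metis
qed

lemma fun_det_leibniz:
  "fun_det n F = (\<Sum>q | q permutes {0..<n}. signof q * (\<Prod>i<n. F i (q i)))"
proof -
  have "fun_det n F = (\<Sum>q | q permutes {0..<n}. signof q * (\<Prod>i = 0..<n. Matrix.mat n n (\<lambda>(i, j). F i j) $$ (i, q i)))"
    by (rule det_def') simp
  also have "\<dots> = (\<Sum>q | q permutes {0..<n}. signof q * (\<Prod>i<n. F i (q i)))"
  proof (intro sum.cong refl arg_cong2[of _ _ _ _ "(*)"])
    fix q assume "q \<in> {q. q permutes {0..<n}}"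
    then have "q i < n" if "i < n" for i using that permutes_in_image[of q "{0..<n}" i] by simp
    then show "(\<Prod>i = 0..<n. Matrix.mat n n (\<lambda>(i, j). F i j) $$ (i, q i)) = (\<Prod>i<n. F i (q i))"
      unfolding lessThan_atLeast0 by (intro prod.cong refl) simp
  qed
  finally show ?thesis .
qed

lemma fun_det_scale_rows: "fun_det n (\<lambda>i j. c i * F i j) = (\<Prod>i<n. c i) * fun_det n F"
  unfolding fun_det_leibniz by (simp add: prod.distrib sum_distrib_left mult_ac)

lemma to_fract_hom: "comm_ring_hom (to_fract :: 'a :: idom \<Rightarrow> 'a fract)"
  by unfold_locales simp_all

text \<open>The dichotomy \<open>place\<close> makes the elements with a residue a valuation ring of
  the field, with maximal ideal \<open>N\<close> and residue field \<open>complex\<close>.\<close>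

locale place = complex_extension \<iota> for \<iota> :: "complex \<Rightarrow> 'k :: field" +
  fixes N :: "'k set"
  assumes N: "nonunital_subalgebra N" and one: "1 \<notin> N"
    and place: "\<And>x. (\<exists>c. x - \<iota> c \<in> N) \<or> (x \<noteq> 0 \<and> inverse x \<in> N)"
begin

text \<open>A relation rather than a function, because elements outside the ring of the place have
  no residue.\<close>

definition residue :: "'k \<Rightarrow> complex \<Rightarrow> bool" where
  "residue x c \<longleftrightarrow> x - \<iota> c \<in> N"

lemma const_notin: "c \<noteq> 0 \<Longrightarrow> \<iota> c \<notin> N"
  using nonunital_subalgebraD(4)[OF N, of "\<iota> c" "inverse c"] one by (auto simp: hom_inverse)

lemma residue_0_iff: "residue x 0 \<longleftrightarrow> x \<in> N"
  by (simp add: residue_def)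

lemma residue_const: "residue (\<iota> c) c"
  using nonunital_subalgebraD(1)[OF N] by (simp add: residue_def)

lemma residue_1: "residue 1 1"
  using residue_const[of 1] by simp

lemma residue_add: "residue x c \<Longrightarrow> residue y d \<Longrightarrow> residue (x + y) (c + d)"
  using nonunital_subalgebraD(2)[OF N, of "x - \<iota> c" "y - \<iota> d"] by (simp add: residue_def hom_add algebra_simps)

lemma residue_mult:
  assumes "residue x c" "residue y d"
  shows "residue (x * y) (c * d)"
proof -
  have "(x - \<iota> c) * (y - \<iota> d) + (\<iota> c * (y - \<iota> d) + \<iota> d * (x - \<iota> c)) \<in> N"
    using assms nonunital_subalgebraD(2,3,4)[OF N] unfolding residue_def by simp
  then show ?thesis by (simp add: residue_def hom_mult algebra_simps)
qed

lemma residue_unique: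
  assumes "residue x c" "residue x d"
  shows "c = d"
proof (rule ccontr)
  assume "c \<noteq> d"
  have "(x - \<iota> d) - (x - \<iota> c) \<in> N"
    using nonunital_subalgebraD(6)[OF N, of "x - \<iota> d" "x - \<iota> c"] assms unfolding residue_def by simp
  then have "\<iota> (c - d) \<in> N" by (simp add: hom_diff)
  with const_notin[of "c - d"] \<open>c \<noteq> d\<close> show False by simp
qed

lemma residue_inverse:
  assumes "residue x c" "c \<noteq> 0"
  shows "residue (inverse x) (inverse c)"
proof -
  have x: "x \<noteq> 0" using residue_unique[OF assms(1), of 0] assms(2) residue_0_iff nonunital_subalgebraD(1)[OF N] by auto
  have "\<exists>d. inverse x - \<iota> d \<in> N"
  proof (rule ccontr)
    assume "\<not> ?thesis"
    then have "x \<in> N" using place[of "inverse x"] by auto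
    then show False using residue_unique[OF assms(1)] assms(2) residue_0_iff by blast
  qed
  then obtain d where d: "residue (inverse x) d" by (auto simp: residue_def)
  have "residue 1 (c * d)" using residue_mult[OF assms(1) d] x by simp
  then have "c * d = 1" using residue_unique[OF _ residue_1] by simp
  then have "d = inverse c" using assms(2) by (simp add: field_simps)
  then show ?thesis using d by simp
qed

lemma residue_sum: "(\<And>i. i \<in> A \<Longrightarrow> residue (f i) (c i)) \<Longrightarrow> residue (sum f A) (sum c A)"
  by (induction A rule: infinite_finite_induct) (simp_all add: residue_add residue_0_iff nonunital_subalgebraD(1)[OF N])

lemma residue_prod: "(\<And>i. i \<in> A \<Longrightarrow> residue (f i) (c i)) \<Longrightarrow> residue (prod f A) (prod c A)"
  by (induction A rule: infinite_finite_induct) (simp_all add: residue_mult residue_1)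

lemma residue_power: "residue x c \<Longrightarrow> residue (x ^ n) (c ^ n)"
  by (induction n) (simp_all add: residue_mult residue_1)

lemma residue_powi: "residue x c \<Longrightarrow> c \<noteq> 0 \<Longrightarrow> residue (x powi n) (c powi n)"
  unfolding power_int_def using residue_power residue_inverse by auto

lemma residue_minus: "residue x c \<Longrightarrow> residue (- x) (- c)"
  using residue_mult[OF residue_const[of "- 1"], of x c] by (simp add: hom_minus)

lemma residue_fun_det:
  assumes "\<And>i j. i < n \<Longrightarrow> j < n \<Longrightarrow> residue (F i j) (c i j)"
  shows "residue (fun_det n F) (fun_det n c)"
  unfolding fun_det_leibniz
proof (intro residue_sum residue_mult residue_prod)
  fix q i assume q: "q \<in> {q. q permutes {0..<n}}"
  show "residue (signof q) (signof q)"
    using residue_1 residue_minus[OF residue_1] by (auto simp: sign_def)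
  assume "i \<in> {..<n}"
  then show "residue (F i (q i)) (c i (q i))"
    using assms q permutes_in_image[of q "{0..<n}" i] by simp
qed

definition place_ring :: "'k set" where
  "place_ring = {x. \<exists>c. residue x c}"

lemma place_ringI: "residue x c \<Longrightarrow> x \<in> place_ring"
  by (auto simp: place_ring_def)

lemma place_ring_mult: "x \<in> place_ring \<Longrightarrow> y \<in> N \<Longrightarrow> x * y \<in> N"
proof -
  assume "x \<in> place_ring" "y \<in> N"
  then obtain c where "residue x c" "residue y 0" by (auto simp: place_ring_def residue_0_iff)
  from residue_mult[OF this] show ?thesis by (simp add: residue_0_iff)
qed

lemma place_ring_valuation_subring: "valuation_subring place_ring"
  unfolding valuation_subring_def
proof (intro conjI ballI allI)
  show "1 \<in> place_ring" using residue_1 by (rule place_ringI)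
next
  fix x y assume "x \<in> place_ring" "y \<in> place_ring"
  then obtain c d where cd: "residue x c" "residue y d" by (auto simp: place_ring_def)
  show "x * y \<in> place_ring" using residue_mult[OF cd] by (rule place_ringI)
  show "x - y \<in> place_ring" using residue_add[OF cd(1) residue_minus[OF cd(2)]] by (auto intro: place_ringI)
next
  fix x
  show "x \<in> place_ring \<or> inverse x \<in> place_ring" using place[of x] by (auto simp: place_ring_def residue_def intro: exI[of _ 0])
qed

lemma place_ring_cases:
  assumes "x \<in> place_ring"
  obtains "x \<in> N" | c where "c \<noteq> 0" "residue x c"
proof -
  from assms obtain c where c: "residue x c" by (auto simp: place_ring_def)
  show ?thesis
  proof (cases "c = 0")
    case True
    then show ?thesis using c residue_0_iff that(1) by simp
  next
    case False
    then show ?thesis using c by (rule that(2))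
  qed
qed

end

text \<open>
  The order of the Laurent monomials at a place is realised by a real weight on finitely many exponents.
\<close>

locale monomial_place = place \<iota> N for \<iota> :: "complex \<Rightarrow> 'k :: field" and N +
  fixes x :: "'n :: finite \<Rightarrow> 'k"
  assumes x_nonzero: "\<And>t. x t \<noteq> 0" and x_N: "\<And>t. x t \<in> N"
begin

definition laurent :: "('n \<Rightarrow> int) \<Rightarrow> 'k" where
  "laurent d = (\<Prod>t\<in>UNIV. x t powi d t)"

lemma laurent_nonzero [simp]: "laurent d \<noteq> 0"
  using x_nonzero by (simp add: laurent_def)

lemma laurent_0 [simp]: "laurent (\<lambda>_. 0) = 1"
  by (simp add: laurent_def)

lemma laurent_add: "laurent (\<lambda>t. d t + e t) = laurent d * laurent e"
  unfolding laurent_def using x_nonzero by (rule prod_powi_add)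

lemma laurent_mult: "laurent (\<lambda>t. m * d t) = laurent d powi m"
  unfolding laurent_def by (rule prod_powi_mult)

lemma laurent_diff: "laurent (\<lambda>t. d t - e t) = laurent d / laurent e"
  using laurent_add[of "\<lambda>t. d t - e t" e] by (simp add: field_simps)

lemma laurent_sum: "laurent (\<lambda>t. \<Sum>p\<in>A. a p * p t) = (\<Prod>p\<in>A. laurent p powi a p)"
  by (induction A rule: infinite_finite_induct) (simp_all add: laurent_add laurent_mult)

lemma laurent_unit: "laurent (\<lambda>s. if s = t then 1 else 0) = x t"
proof -
  have "laurent (\<lambda>s. if s = t then 1 else 0) = (\<Prod>s\<in>UNIV. if s = t then x s else 1)"
    unfolding laurent_def by (intro prod.cong) auto
  then show ?thesis by simp
qed

lemma exists_residue_point: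
  obtains y where "\<And>t. y t \<noteq> (0 :: complex)"
    "\<And>d c. residue (laurent d) c \<Longrightarrow> c \<noteq> 0 \<Longrightarrow> c = (\<Prod>t\<in>UNIV. y t powi d t)"
proof -
  define \<Lambda> where "\<Lambda> = {d. \<exists>c. c \<noteq> 0 \<and> residue (laurent d) c}"
  define ch where "ch d = (THE c. residue (laurent d) c)" for d
  have ch: "ch d = c" if "residue (laurent d) c" for d c
    unfolding ch_def using that residue_unique by (intro the_equality)
  have diff: "residue (laurent (\<lambda>t. d t - e t)) (c / c')" if "residue (laurent d) c" "residue (laurent e) c'" "c' \<noteq> 0" for d e c c'
    using residue_mult[OF that(1) residue_inverse[OF that(2,3)]] by (simp add: laurent_diff divide_inverse)
  obtain y where y: "\<And>t. y t \<noteq> 0" "\<And>d. d \<in> \<Lambda> \<Longrightarrow> ch d = (\<Prod>t\<in>UNIV. y t powi d t)"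
  proof (rule extend_character[of \<Lambda> ch])
    show "(\<lambda>_. 0) \<in> \<Lambda>" unfolding \<Lambda>_def using residue_1 by (intro CollectI exI[of _ 1]) simp
  next
    fix d e assume "d \<in> \<Lambda>" "e \<in> \<Lambda>"
    then obtain c c' where c: "residue (laurent d) c" "c \<noteq> 0" "residue (laurent e) c'" "c' \<noteq> 0" by (auto simp: \<Lambda>_def)
    from diff[OF c(1,3,4)] c show "(\<lambda>t. d t - e t) \<in> \<Lambda>" unfolding \<Lambda>_def
      by (intro CollectI exI[of _ "c / c'"]) simp
    show "ch (\<lambda>t. d t - e t) = ch d / ch e" using ch[OF diff[OF c(1,3,4)]] ch[OF c(1)] ch[OF c(3)] by simp
  next
    fix d assume "d \<in> \<Lambda>"
    then obtain c where "residue (laurent d) c" "c \<noteq> 0" by (auto simp: \<Lambda>_def)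
    then show "ch d \<noteq> 0" using ch by simp
  qed (rule that)
  show ?thesis
  proof (rule that[of y])
    show "y t \<noteq> 0" for t by (rule y(1))
    fix d c assume c: "residue (laurent d) c" "c \<noteq> 0"
    then have "d \<in> \<Lambda>" by (auto simp: \<Lambda>_def)
    from y(2)[OF this] ch[OF c(1)] show "c = (\<Prod>t\<in>UNIV. y t powi d t)" by simp
  qed
qed

text \<open>An integral relation forbidden by Gordan's alternative would, after forming Laurent
  monomials, equate an element of \<open>N\<close> with one of nonzero residue: on the left some
  factor in \<open>N\<close> has a positive exponent, on the right all factors are units. Only
  finitely many exponents are treated, since the value group may be non-archimedean.\<close>

lemma exists_weight:
  assumes "finite P" "finite U" "\<And>p. p \<in> P \<Longrightarrow> laurent p \<in> N" "\<And>u. u \<in> U \<Longrightarrow> \<exists>c. c \<noteq> 0 \<and> residue (laurent u) c"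
  obtains w :: "real ^ 'n" where "\<And>p. p \<in> P \<Longrightarrow> w \<bullet> real_vec p > 0" "\<And>u. u \<in> U \<Longrightarrow> w \<bullet> real_vec u = 0"
proof (rule exists_separating_form[OF assms(1,2)])
  fix a b :: "('n \<Rightarrow> int) \<Rightarrow> int"
  assume a: "\<And>p. p \<in> P \<Longrightarrow> 0 \<le> a p" and nz: "\<exists>p\<in>P. a p \<noteq> 0"
  show "\<exists>t. (\<Sum>p\<in>P. a p * p t) \<noteq> (\<Sum>u\<in>U. b u * u t)"
  proof (rule ccontr)
    assume "\<not> ?thesis"
    then have "(\<lambda>t. \<Sum>p\<in>P. a p * p t) = (\<lambda>t. \<Sum>u\<in>U. b u * u t)" by auto
    then have eq: "(\<Prod>p\<in>P. laurent p powi a p) = (\<Prod>u\<in>U. laurent u powi b u)"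
      unfolding laurent_sum[symmetric] by simp
    have pw: "laurent p powi a p \<in> place_ring" if "p \<in> P" for p
      using residue_power[of "laurent p" 0 "nat (a p)"] assms(3)[OF that] a[OF that]
      by (auto simp: residue_0_iff power_int_def intro: place_ringI)
    obtain p0 where p0: "p0 \<in> P" "a p0 \<noteq> 0" using nz by blast
    then have pos: "0 < nat (a p0)" using a[OF p0(1)] by simp
    have "residue (laurent p0 ^ nat (a p0)) 0"
      using residue_power[of "laurent p0" 0 "nat (a p0)"] assms(3)[OF p0(1)] pos
      by (simp only: residue_0_iff zero_power)
    then have "laurent p0 powi a p0 \<in> N" using a[OF p0(1)] by (simp add: residue_0_iff power_int_def)
    moreover have "(\<Prod>p\<in>P - {p0}. laurent p powi a p) \<in> place_ring"
      using pw by (intro valuation_subring_prod[OF place_ring_valuation_subring]) auto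
    ultimately have "(\<Prod>p\<in>P - {p0}. laurent p powi a p) * laurent p0 powi a p0 \<in> N" by (intro place_ring_mult)
    then have inN: "(\<Prod>u\<in>U. laurent u powi b u) \<in> N"
      unfolding eq[symmetric] using assms(1) p0(1) by (subst prod.remove[of _ p0]) (simp_all add: mult.commute)
    have "\<forall>u\<in>U. \<exists>c. c \<noteq> 0 \<and> residue (laurent u) c" using assms(4) by blast
    from bchoice[OF this] obtain c where c: "\<forall>u\<in>U. c u \<noteq> 0 \<and> residue (laurent u) (c u)" ..
    have "residue (\<Prod>u\<in>U. laurent u powi b u) (\<Prod>u\<in>U. c u powi b u)"
      using c by (intro residue_prod residue_powi) auto
    then have "(\<Prod>u\<in>U. c u powi b u) = 0" using inN residue_unique residue_0_iff by blast
    then show False using c assms(2) by simp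
  qed
qed (rule that)

end

section \<open>Places of the fraction field of germs centred at the origin\<close>

lemma const_extension: "complex_extension (\<lambda>c. to_fract (const_germ c :: 'n :: finite germ))"
  by unfold_locales (simp_all add: const_germ_hom)

definition exponent_int :: "nat ^ 'n \<Rightarrow> 'n \<Rightarrow> int" where
  "exponent_int k t = int (vec_nth k t)"

lemma real_vec_exponent: "real_vec (\<lambda>t. exponent_int k t - exponent_int j t) = real_exponent k - real_exponent j"
  by (simp add: real_vec_def real_exponent_def exponent_int_def Finite_Cartesian_Product.vec_eq_iff)

text \<open>The condition \<open>germ_residue\<close> says that the place is centred at the origin:
  the residue of a germ is its value there.\<close>

locale germ_place = monomial_place "\<lambda>c. to_fract (const_germ c :: 'n :: finite germ)" N
    "\<lambda>t. to_fract (germ_monomial (axis t 1))" for N :: "'n :: finite germ fract set" +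
  assumes germ_residue: "\<And>f. to_fract f - to_fract (const_germ (taylor_coeff f 0)) \<in> N"
begin

lemma residue_germ: "residue (to_fract f) (taylor_coeff f 0)"
  unfolding residue_def by (rule germ_residue)

lemma laurent_exponent: "laurent (exponent_int k) = to_fract (germ_monomial k)"
proof -
  interpret tf: comm_ring_hom "to_fract :: 'n germ \<Rightarrow> 'n germ fract" by (rule to_fract_hom)
  show ?thesis
    by (simp add: laurent_def exponent_int_def germ_monomial_expansion[of k] tf.hom_prod tf.hom_power del: One_nat_def)
qed

lemma to_fract_place_ring: "to_fract f \<in> place_ring"
  using residue_germ by (rule place_ringI)

text \<open>The terms of \<open>f\<close> on the face are finitely many, and modulo the monomial of
  \<open>e0\<close> their Laurent monomials are units whose residues are evaluations at
  \<open>y\<close>. The rest of \<open>f\<close> is divisible termwise by finitely many monomials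
  that have residue \<open>0\<close> modulo that of \<open>e0\<close>, so it contributes
  nothing.\<close>

lemma residue_initial_form:
  assumes E: "finite E" "e0 \<in> E" "\<And>e. e \<in> E \<Longrightarrow> to_fract (germ_monomial e) / to_fract (germ_monomial e0) \<in> place_ring"
    and f: "\<And>k. taylor_coeff f k \<noteq> 0 \<Longrightarrow> \<exists>e\<in>E. e \<le> k"
    and D: "{k. real_exponent k \<in> D} = {e \<in> E. to_fract (germ_monomial e) / to_fract (germ_monomial e0) \<notin> N}"
    and y: "\<And>t. vec_nth y t \<noteq> 0"
      "\<And>d c. residue (laurent d) c \<Longrightarrow> c \<noteq> 0 \<Longrightarrow> c = (\<Prod>t\<in>UNIV. vec_nth y t powi d t)"
  shows "residue (to_fract f / to_fract (germ_monomial e0)) (restricted_eval f D y / (\<Prod>t\<in>UNIV. vec_nth y t ^ vec_nth e0 t))"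
proof -
  interpret tf: comm_ring_hom "to_fract :: 'n germ \<Rightarrow> 'n germ fract" by (rule to_fract_hom)
  define K where "K = {k. real_exponent k \<in> D}"
  have K: "K = {e \<in> E. to_fract (germ_monomial e) / to_fract (germ_monomial e0) \<notin> N}" unfolding K_def by (rule D)
  have finK: "finite K" using E(1) by (simp add: K)
  let ?m = "\<lambda>k. to_fract (germ_monomial k) :: 'n germ fract"
  let ?y = "\<lambda>k. \<Prod>t\<in>UNIV. vec_nth y t ^ vec_nth k t"
  define f1 where "f1 = (\<Sum>k\<in>K. const_germ (taylor_coeff f k) * germ_monomial k)"
  \<comment> \<open>Every exponent above \<open>E\<close> but outside \<open>K\<close> is either a
    generator off the face or above a generator shifted by one coordinate; the coordinates
    themselves lie in \<open>N\<close>.\<close>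
  define E' where "E' = (E - K) \<union> (\<lambda>(e, t). e + axis t 1) ` (E \<times> UNIV)"
  have f1: "taylor_coeff f1 k = (if k \<in> K then taylor_coeff f k else 0)" for k
  proof -
    have "taylor_coeff f1 k = (\<Sum>j\<in>K. if k = j then taylor_coeff f k else 0)"
      unfolding f1_def taylor_coeff_sum by (intro sum.cong refl) (simp add: taylor_coeff_monomial)
    then show ?thesis using finK by (simp add: sum.delta)
  qed
  have supp: "\<exists>e\<in>E'. e \<le> k" if nz: "taylor_coeff (f - f1) k \<noteq> 0" for k
  proof -
    have k: "taylor_coeff f k \<noteq> 0" "k \<notin> K" using nz by (auto simp: f1 split: if_splits)
    from f[OF k(1)] obtain e where e: "e \<in> E" "e \<le> k" ..
    show ?thesis
    proof (cases "e = k")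
      case True
      then show ?thesis using e(1) k(2) by (intro bexI[of _ k]) (auto simp: E'_def)
    next
      case False
      then obtain t where t: "vec_nth e t \<noteq> vec_nth k t" by (auto simp: Finite_Cartesian_Product.vec_eq_iff)
      have "vec_nth (e + axis t 1) s \<le> vec_nth k s" for s
        using e(2)[unfolded exponent_le_iff, THEN spec, of s] t by (cases "s = t") (auto simp: axis_def)
      then have "e + axis t 1 \<le> k" by (simp add: exponent_le_iff)
      moreover have "e + axis t 1 \<in> E'" using e(1) by (force simp: E'_def)
      ultimately show ?thesis by (rule bexI)
    qed
  qed
  have "finite E'" using E(1) by (simp add: E'_def)
  then obtain q where q: "f - f1 = (\<Sum>e\<in>E'. q e * germ_monomial e)"
    using germ_in_monomial_ideal[OF _ supp] by metis
  have "?m e / ?m e0 \<in> N" if e: "e \<in> E'" for e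
  proof -
    have "e \<in> E - K \<or> (\<exists>e1 t. e1 \<in> E \<and> e = e1 + axis t 1)"
      using e by (auto simp: E'_def image_iff simp del: One_nat_def)
    then consider "e \<in> E - K" | e1 t where "e1 \<in> E" "e = e1 + axis t 1" by blast
    then show ?thesis
    proof cases
      case 1
      then show ?thesis using K by auto
    next
      case 2
      have "(?m e1 / ?m e0) * ?m (axis t 1) \<in> N" by (intro place_ring_mult E(3) x_N 2(1))
      then show ?thesis by (simp add: 2(2) germ_monomial_add)
    qed
  qed
  then have "residue (\<Sum>e\<in>E'. to_fract (q e) * (?m e / ?m e0)) (\<Sum>e\<in>E'. 0)"
    by (intro residue_sum) (simp only: residue_0_iff place_ring_mult[OF to_fract_place_ring])
  then have r2: "residue (to_fract (f - f1) / ?m e0) 0"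
    unfolding q by (simp add: tf.hom_sum sum_divide_distrib)
  have unit: "residue (?m k / ?m e0) (?y k / ?y e0)" if "k \<in> K" for k
  proof -
    have k: "k \<in> E" "?m k / ?m e0 \<notin> N" using that K by auto
    have laurent: "?m k / ?m e0 = laurent (\<lambda>t. exponent_int k t - exponent_int e0 t)"
      by (simp add: laurent_diff laurent_exponent del: One_nat_def)
    obtain c where c: "c \<noteq> 0" "residue (?m k / ?m e0) c"
      using place_ring_cases[OF E(3)[OF k(1)]] k(2) by metis
    have "c = (\<Prod>t\<in>UNIV. vec_nth y t powi (exponent_int k t - exponent_int e0 t))"
      using c unfolding laurent by (intro y(2))
    also have "\<dots> = ?y k / ?y e0"
      using y(1) by (simp add: power_int_diff exponent_int_def prod_dividef)
    finally show ?thesis using c(2) by simp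
  qed
  have "residue (\<Sum>k\<in>K. to_fract (const_germ (taylor_coeff f k)) * (?m k / ?m e0)) (\<Sum>k\<in>K. taylor_coeff f k * (?y k / ?y e0))"
    by (intro residue_sum residue_mult residue_const unit)
  moreover have "(\<Sum>k\<in>K. to_fract (const_germ (taylor_coeff f k)) * (?m k / ?m e0)) = to_fract f1 / ?m e0"
    by (simp add: f1_def tf.hom_sum sum_divide_distrib)
  moreover have "(\<Sum>k\<in>K. taylor_coeff f k * (?y k / ?y e0)) = restricted_eval f D y / ?y e0"
    by (simp add: restricted_eval_def K_def sum_divide_distrib)
  ultimately have r1: "residue (to_fract f1 / ?m e0) (restricted_eval f D y / ?y e0)" by simp
  have "to_fract f / ?m e0 = to_fract f1 / ?m e0 + to_fract (f - f1) / ?m e0"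
    by (simp add: add_divide_distrib[symmetric] flip: tf.hom_add)
  then show ?thesis using residue_add[OF r1 r2] by simp
qed

end

text \<open>
  A counterexample \<open>V\<close> with maximal ideal \<open>m\<close> yields a place centred at the origin at which all quotients of
  minors by the monomial have residue \<open>0\<close>, because \<open>m + m\<^sub>R\<close> is a proper nonunital subalgebra.
\<close>

lemma nondegenerate_minor_dominates:
  fixes a :: "nat \<Rightarrow> nat \<Rightarrow> 'n :: finite germ" and I :: "nat \<Rightarrow> 'n germ set"
  assumes aI: "\<And>i j. i < r \<Longrightarrow> j < m \<Longrightarrow> a i j \<in> I i"
    and nondeg: "\<And>D y. (\<And>i. i < r \<Longrightarrow> D i \<in> compact_faces (newton_polyhedron (I i))) \<Longrightarrow>
      (\<Sum>i<r. D i) \<in> compact_faces (\<Sum>i<r. newton_polyhedron (I i)) \<Longrightarrow> (\<And>t. vec_nth y t \<noteq> 0) \<Longrightarrow>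
      \<exists>g. (\<forall>b<r. g b < m) \<and> fun_det r (\<lambda>i b. restricted_eval (a i (g b)) (D i) y) \<noteq> 0"
    and V: "V \<in> intermediate_rings" and k: "\<And>i. i < r \<Longrightarrow> real_exponent (k i) \<in> newton_polyhedron (I i)"
  shows "\<exists>g. (\<forall>b<r. g b < m) \<and> fun_det r (\<lambda>i b. a i (g b)) \<noteq> 0 \<and>
    to_fract (germ_monomial (\<Sum>i<r. k i)) / to_fract (fun_det r (\<lambda>i b. a i (g b))) \<in> V"
proof (rule ccontr)
  assume contra: "\<not> ?thesis"
  interpret ce: complex_extension "\<lambda>c. to_fract (const_germ c :: 'n germ)" by (rule const_extension)
  interpret tf: comm_ring_hom "to_fract :: 'n germ \<Rightarrow> 'n germ fract" by (rule to_fract_hom)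
  let ?m = "\<lambda>k. to_fract (germ_monomial k) :: 'n germ fract"
  let ?K = "\<Sum>i<r. k i"
  note VV = intermediate_ringsD[OF V]
  note VC = valuation_subring_closed[OF VV(1)]
  define M where "M = {x \<in> V. x = 0 \<or> inverse x \<notin> V}"
  have M_mult: "x * z \<in> M" if "x \<in> V" "z \<in> M" for x z
  proof (cases "x * z = 0")
    case False
    have "inverse (x * z) \<notin> V"
    proof
      assume "inverse (x * z) \<in> V"
      then have "x * inverse (x * z) \<in> V" using that(1) by (intro VC(6))
      moreover have eq: "x * inverse (x * z) = inverse z" using False by simp
      ultimately have "inverse z \<in> V" unfolding eq by simp
      then show False using that(2) False by (auto simp: M_def)
    qed
    then show ?thesis using that by (simp add: M_def VC(6))
  next
    case True
    show ?thesis unfolding True by (simp add: M_def VC(2))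
  qed
  have M_add: "x + z \<in> M" if xz: "x \<in> M" "z \<in> M" for x z
  proof (cases "x = 0 \<or> z = 0")
    case True
    then show ?thesis using xz by auto
  next
    case False
    consider "x / z \<in> V" | "z / x \<in> V" using VC(7)[of "x / z"] by auto
    then show ?thesis
    proof cases
      case 1
      then have "(x / z + 1) * z \<in> M" using xz by (intro M_mult VC(3) VC(1))
      then show ?thesis using False by (simp add: distrib_right)
    next
      case 2
      then have "(1 + z / x) * x \<in> M" using xz by (intro M_mult VC(3) VC(1))
      then show ?thesis using False by (simp add: distrib_right)
    qed
  qed
  have M_V: "x \<in> V" if "x \<in> M" for x using that by (simp add: M_def)
  define S where "S = {to_fract f + x | f x. taylor_coeff f 0 = 0 \<and> x \<in> M}"
  have SI: "to_fract f + x \<in> S" if "taylor_coeff f 0 = 0" "x \<in> M" for f x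
    unfolding S_def using that by blast
  have zM: "0 \<in> M" by (simp add: M_def VC(2))
  have nonun: "ce.nonunital_subalgebra S"
    unfolding ce.nonunital_subalgebra_def
  proof (intro conjI ballI allI)
    show "0 \<in> S" using SI[of 0 0] zM by simp
  next
    fix u v assume "u \<in> S" "v \<in> S"
    then obtain f x g z where u: "u = to_fract f + x" "taylor_coeff f 0 = 0" "x \<in> M"
      and v: "v = to_fract g + z" "taylor_coeff g 0 = 0" "z \<in> M"
      unfolding S_def by (elim CollectE exE conjE)
    have "to_fract (f + g) + (x + z) \<in> S" using u v by (intro SI M_add) simp_all
    then show "u + v \<in> S" by (simp add: u v algebra_simps)
    have "to_fract (f * g) + (to_fract f * z + (to_fract g * x + x * z)) \<in> S"
      using u v by (intro SI M_add M_mult M_V VV(2)) (simp_all add: taylor_coeff_mult_0)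
    then show "u * v \<in> S" by (simp add: u v algebra_simps)
  next
    fix c u assume "u \<in> S"
    then obtain f x where u: "u = to_fract f + x" "taylor_coeff f 0 = 0" "x \<in> M"
      unfolding S_def by (elim CollectE exE conjE)
    have "to_fract (const_germ c * f) + to_fract (const_germ c) * x \<in> S"
      using u by (intro SI M_mult VV(2)) simp_all
    then show "to_fract (const_germ c) * u \<in> S" by (simp add: u algebra_simps)
  qed
  \<comment> \<open>Here the germs must form a local ring: \<open>x = 1 - f\<close> would be a unit
    among the germs, hence a unit of \<open>V\<close>, although it lies in the maximal ideal of
    \<open>V\<close>.\<close>
  have oneS: "1 \<notin> S"
  proof
    assume "1 \<in> S"
    then obtain f x where u: "1 = to_fract f + x" "taylor_coeff f 0 = 0" "x \<in> M"
      unfolding S_def by (elim CollectE exE conjE)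
    then have x: "x = to_fract (1 - f)" by (simp add: algebra_simps)
    have "taylor_coeff (1 - f) 0 \<noteq> 0" using u(2) by (simp add: taylor_coeff_1)
    then have "(1 - f) dvd 1" by (rule germ_unit)
    then obtain g where "1 = (1 - f) * g" by (elim dvdE)
    then have "x * to_fract g = 1" unfolding x using tf.hom_mult[of "1 - f" g] by simp
    then have "inverse x = to_fract g" by (rule inverse_unique)
    then have "inverse x \<in> V" using VV(2) by simp
    moreover have "x \<noteq> 0" using \<open>x * to_fract g = 1\<close> by auto
    ultimately show False using u(3) by (simp add: M_def)
  qed
  obtain N where N: "S \<subseteq> N" "ce.nonunital_subalgebra N" "1 \<notin> N"
    "\<And>x. (\<exists>c. x - to_fract (const_germ c) \<in> N) \<or> (x \<noteq> 0 \<and> inverse x \<in> N)"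
    by (rule ce.exists_place[OF nonun oneS], rule that)
  have germ_N: "to_fract f \<in> N" if "taylor_coeff f 0 = 0" for f using SI[OF that zM] N(1) by auto
  have M_N: "x \<in> N" if "x \<in> M" for x using SI[of 0 x] that N(1) by auto

  have axis_ne: "axis t (1 :: nat) \<noteq> 0" for t :: 'n by (simp add: Finite_Cartesian_Product.vec_eq_iff axis_def)
  interpret gp: germ_place N
  proof unfold_locales
    show "ce.nonunital_subalgebra N" "1 \<notin> N" by (rule N)+
    show "(\<exists>c. x - to_fract (const_germ c) \<in> N) \<or> (x \<noteq> 0 \<and> inverse x \<in> N)" for x by (rule N(4))
    show "to_fract (germ_monomial (axis t 1) :: 'n germ) \<noteq> 0" for t by simp
    show "to_fract (germ_monomial (axis t 1) :: 'n germ) \<in> N" for t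
      using axis_ne[of t] by (intro germ_N) (simp add: taylor_coeff_monomial)
    show "to_fract f - to_fract (const_germ (taylor_coeff f 0)) \<in> N" for f
    proof -
      have "to_fract (f - const_germ (taylor_coeff f 0)) \<in> N" by (intro germ_N) (simp add: taylor_coeff_simps taylor_coeff_const_germ)
      then show ?thesis by simp
    qed
  qed
  \<comment> \<open>By the negated claim the inverse of the quotient is not in \<open>V\<close>. So
    the quotient lies in the maximal ideal of \<open>V\<close>, and with it in \<open>N\<close>, for
    every choice of columns.\<close>
  have quot_N: "to_fract (fun_det r (\<lambda>i b. a i (g b))) / ?m ?K \<in> N" if g: "\<forall>b<r. g b < m" for g
  proof (cases "fun_det r (\<lambda>i b. a i (g b)) = 0")
    case True
    then show ?thesis using M_N[OF zM] by simp
  next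
    case False
    let ?x = "to_fract (fun_det r (\<lambda>i b. a i (g b))) / ?m ?K"
    have "inverse ?x \<notin> V"
    proof
      assume "inverse ?x \<in> V"
      then have "?m ?K / to_fract (fun_det r (\<lambda>i b. a i (g b))) \<in> V" by (simp add: divide_inverse mult.commute)
      with contra g False show False by blast
    qed
    then have "?x \<in> M" using VC(7)[of ?x] by (simp add: M_def)
    then show ?thesis by (rule M_N)
  qed
  have "\<exists>E. \<forall>i. finite (E i) \<and> newton_polyhedron (I i) = orthant_hull (real_exponent ` E i) \<and>
      (\<forall>k. real_exponent k \<in> newton_polyhedron (I i) \<longleftrightarrow> (\<exists>e\<in>E i. e \<le> k))"
    by (rule choice, rule allI, rule newton_generators) blast
  then obtain E where E: "\<And>i. finite (E i)" "\<And>i. newton_polyhedron (I i) = orthant_hull (real_exponent ` E i)"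
    "\<And>i k. real_exponent k \<in> newton_polyhedron (I i) \<longleftrightarrow> (\<exists>e\<in>E i. e \<le> k)"
    by metis
  \<comment> \<open>The minimal monomials are taken with respect to the place, which is finer than
    \<open>V\<close>; only their quotients have residues.\<close>
  have "\<forall>i\<in>{..<r}. \<exists>e. e \<in> E i \<and> (\<forall>e'\<in>E i. ?m e' / ?m e \<in> gp.place_ring)"
  proof
    fix i assume "i \<in> {..<r}"
    then have "E i \<noteq> {}" using k[of i] E(3)[of "k i" i] by auto
    then have "\<exists>y\<in>?m ` E i. \<forall>x\<in>?m ` E i. x / y \<in> gp.place_ring"
      using E(1) by (intro valuation_minimal[OF gp.place_ring_valuation_subring]) auto
    then show "\<exists>e. e \<in> E i \<and> (\<forall>e'\<in>E i. ?m e' / ?m e \<in> gp.place_ring)" by blast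
  qed
  from bchoice[OF this] obtain e0 where e0: "\<forall>i\<in>{..<r}. e0 i \<in> E i \<and> (\<forall>e'\<in>E i. ?m e' / ?m (e0 i) \<in> gp.place_ring)" ..
  define dif where "dif i e = (\<lambda>t. exponent_int e t - exponent_int (e0 i) t)" for i e
  have mon_dif: "gp.laurent (dif i e) = ?m e / ?m (e0 i)" for i e
    by (simp add: dif_def gp.laurent_diff gp.laurent_exponent del: One_nat_def)
  \<comment> \<open>The unit vectors are included because the coordinates lie in \<open>N\<close> as
    well; they make the weight positive, hence the exposed faces compact.\<close>
  define P where "P = (\<Union>i<r. dif i ` {e \<in> E i. ?m e / ?m (e0 i) \<in> N}) \<union> (\<lambda>t s. if s = t then 1 else 0) ` UNIV"
  define U where "U = (\<Union>i<r. dif i ` {e \<in> E i. ?m e / ?m (e0 i) \<notin> N})"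
  obtain w where w: "\<And>p. p \<in> P \<Longrightarrow> w \<bullet> real_vec p > 0" "\<And>u. u \<in> U \<Longrightarrow> w \<bullet> real_vec u = 0"
  proof (rule gp.exists_weight[of P U])
    show "finite P" "finite U" using E(1) by (auto simp: P_def U_def)
    show "gp.laurent p \<in> N" if p: "p \<in> P" for p
    proof -
      consider i e where "i < r" "p = dif i e" "?m e / ?m (e0 i) \<in> N" | t where "p = (\<lambda>s. if s = t then 1 else 0)"
        using p by (auto simp: P_def)
      then show ?thesis
      proof cases
        case 1
        then show ?thesis by (simp only: mon_dif)
      next
        case 2
        show ?thesis unfolding 2 gp.laurent_unit by (rule gp.x_N)
      qed
    qed
    show "\<exists>c. c \<noteq> 0 \<and> gp.residue (gp.laurent u) c" if u: "u \<in> U" for u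
    proof -
      obtain i e where e: "i < r" "u = dif i e" "e \<in> E i" "?m e / ?m (e0 i) \<notin> N" using u by (auto simp: U_def)
      have "?m e / ?m (e0 i) \<in> gp.place_ring" using e0 e by auto
      then show ?thesis unfolding e(2) mon_dif using gp.place_ring_cases e(4) by metis
    qed
  qed (rule that)
  have wpos: "vec_nth w t > 0" for t
  proof -
    have "w \<bullet> real_vec (\<lambda>s. if s = t then 1 else 0) = vec_nth w t"
      by (simp add: inner_real_vec if_distrib[of of_int] if_distrib[of "\<lambda>x. _ * x"] cong: if_cong)
    moreover have "(\<lambda>s. if s = t then 1 else 0) \<in> P" by (auto simp: P_def)
    ultimately show ?thesis using w(1) by metis
  qed
  define \<mu> where "\<mu> i = w \<bullet> real_exponent (e0 i)" for i
  have wdif: "w \<bullet> real_vec (dif i e) = w \<bullet> real_exponent e - \<mu> i" for i e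
    by (simp add: dif_def real_vec_exponent inner_diff_right \<mu>_def)
  have wN: "\<mu> i < w \<bullet> real_exponent e" if "i < r" "e \<in> E i" "?m e / ?m (e0 i) \<in> N" for i e
  proof -
    have "dif i e \<in> P" using that by (auto simp: P_def)
    from w(1)[OF this] show ?thesis by (simp add: wdif)
  qed
  have wU: "\<mu> i = w \<bullet> real_exponent e" if "i < r" "e \<in> E i" "?m e / ?m (e0 i) \<notin> N" for i e
  proof -
    have "dif i e \<in> U" using that by (auto simp: U_def)
    from w(2)[OF this] show ?thesis by (simp add: wdif)
  qed
  have wE: "\<mu> i \<le> w \<bullet> real_exponent e" if "i < r" "e \<in> E i" for i e
    using wN[OF that] wU[OF that] by fastforce
  define D where "D i = {z \<in> newton_polyhedron (I i). w \<bullet> z = \<mu> i}" for i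
  have Dcf: "D i \<in> compact_faces (newton_polyhedron (I i))" if i: "i < r" for i
    unfolding D_def E(2)
  proof (rule supporting_face(1))
    show "vec_nth w t > 0" for t by (rule wpos)
    show "finite (real_exponent ` E i)" using E(1) by simp
    show "real_exponent (e0 i) \<in> real_exponent ` E i" using e0 i by auto
    show "w \<bullet> real_exponent (e0 i) = \<mu> i" by (simp add: \<mu>_def)
    show "\<mu> i \<le> w \<bullet> e" if "e \<in> real_exponent ` E i" for e using that wE[OF i] by auto
  qed
  have wP: "\<mu> i \<le> w \<bullet> z" if i: "i < r" and z: "z \<in> newton_polyhedron (I i)" for i z
  proof (rule orthant_hull_ge)
    show "z \<in> orthant_hull (real_exponent ` E i)" using z unfolding E(2) .
    show "0 \<le> vec_nth w t" for t using wpos[of t] by simp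
    show "\<mu> i \<le> w \<bullet> e" if "e \<in> real_exponent ` E i" for e using that wE[OF i] by auto
  qed
  have sumD: "(\<Sum>i<r. D i) \<in> compact_faces (\<Sum>i<r. newton_polyhedron (I i))"
  proof (rule sum_supporting_faces[where w = w and m = \<mu>])
    show "D i = {z \<in> newton_polyhedron (I i). w \<bullet> z = \<mu> i}" for i by (simp only: D_def)
    show "D i \<in> compact_faces (newton_polyhedron (I i))" if "i < r" for i using that by (rule Dcf)
    show "convex (newton_polyhedron (I i))" for i unfolding newton_polyhedron_eq by (rule convex_orthant_hull)
    show "\<mu> i \<le> w \<bullet> z" if "i < r" "z \<in> newton_polyhedron (I i)" for i z using that by (rule wP)
  qed
  \<comment> \<open>Positive weights keep proper multiples of generators off the face, so its
    lattice points are precisely the generators that are units relative to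
    \<open>e0 i\<close>.\<close>
  have DK: "{k. real_exponent k \<in> D i} = {e \<in> E i. ?m e / ?m (e0 i) \<notin> N}" if i: "i < r" for i
  proof (intro equalityI subsetI)
    fix j assume "j \<in> {k. real_exponent k \<in> D i}"
    then have j: "real_exponent j \<in> newton_polyhedron (I i)" "w \<bullet> real_exponent j = \<mu> i" by (auto simp: D_def)
    then obtain e where e: "e \<in> E i" "e \<le> j" using E(3) by blast
    from e(2) obtain l where l: "real_exponent j = real_exponent e + real_exponent l" "j = l + e" by (rule real_exponent_le)
    have "w \<bullet> real_exponent l \<le> 0" using j(2) wE[OF i e(1)] unfolding l(1) inner_add_right by linarith
    then have "real_exponent l = 0" using inner_orthant_pos[OF wpos real_exponent_orthant, of l] by (cases "real_exponent l = 0") simp_all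
    then have "l = 0" by (simp add: real_exponent_def Finite_Cartesian_Product.vec_eq_iff)
    then have "j = e" using l(2) by simp
    then show "j \<in> {e \<in> E i. ?m e / ?m (e0 i) \<notin> N}" using e(1) wN[OF i e(1)] j(2) by fastforce
  next
    fix e assume "e \<in> {e \<in> E i. ?m e / ?m (e0 i) \<notin> N}"
    then have e: "e \<in> E i" "?m e / ?m (e0 i) \<notin> N" by auto
    have "real_exponent e \<in> newton_polyhedron (I i)" using E(3)[of e i] e(1) by auto
    then show "e \<in> {k. real_exponent k \<in> D i}" using wU[OF i e] by (simp add: D_def)
  qed
  obtain y0 where y0: "\<And>t. y0 t \<noteq> 0" "\<And>d c. gp.residue (gp.laurent d) c \<Longrightarrow> c \<noteq> 0 \<Longrightarrow> c = (\<Prod>t\<in>UNIV. y0 t powi d t)"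
    by (rule gp.exists_residue_point, rule that)
  define y where "y = vec_lambda y0"
  have yy: "vec_nth y t = y0 t" for t by (simp add: y_def)
  have ynz: "vec_nth y t \<noteq> 0" for t unfolding yy by (rule y0(1))
  have "\<exists>g. (\<forall>b<r. g b < m) \<and> fun_det r (\<lambda>i b. restricted_eval (a i (g b)) (D i) y) \<noteq> 0"
    by (rule nondeg[OF Dcf sumD ynz])
  then obtain g where g: "\<forall>b<r. g b < m" "fun_det r (\<lambda>i b. restricted_eval (a i (g b)) (D i) y) \<noteq> 0" by (elim exE conjE)
  let ?y = "\<lambda>k. \<Prod>t\<in>UNIV. vec_nth y t ^ vec_nth k t"
  let ?Y = "\<Prod>i<r. ?y (e0 i)" and ?X = "\<Prod>i<r. ?m (e0 i)"
  have entry: "gp.residue (inverse (?m (e0 i)) * to_fract (a i (g b))) (inverse (?y (e0 i)) * restricted_eval (a i (g b)) (D i) y)"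
    if ib: "i < r" "b < r" for i b
  proof -
    have "gp.residue (to_fract (a i (g b)) / ?m (e0 i)) (restricted_eval (a i (g b)) (D i) y / ?y (e0 i))"
    proof (rule gp.residue_initial_form)
      show "finite (E i)" by (rule E(1))
      show "e0 i \<in> E i" "\<And>e. e \<in> E i \<Longrightarrow> ?m e / ?m (e0 i) \<in> gp.place_ring" using e0 ib(1) by auto
      show "\<exists>e\<in>E i. e \<le> j" if "taylor_coeff (a i (g b)) j \<noteq> 0" for j
        using support_in_newton_polyhedron[OF aI that] ib g(1) E(3)[of j i] by simp
      show "{k. real_exponent k \<in> D i} = {e \<in> E i. ?m e / ?m (e0 i) \<notin> N}" by (rule DK[OF ib(1)])
      show "vec_nth y t \<noteq> 0" for t by (rule ynz)
      show "c = (\<Prod>t\<in>UNIV. vec_nth y t powi d t)" if "gp.residue (gp.laurent d) c" "c \<noteq> 0" for d c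
        unfolding yy using that by (rule y0(2))
    qed
    then show ?thesis by (simp add: divide_inverse mult.commute)
  qed
  have "gp.residue (fun_det r (\<lambda>i b. inverse (?m (e0 i)) * to_fract (a i (g b))))
      (fun_det r (\<lambda>i b. inverse (?y (e0 i)) * restricted_eval (a i (g b)) (D i) y))"
    by (rule gp.residue_fun_det[OF entry])
  then have res: "gp.residue ((\<Prod>i<r. inverse (?m (e0 i))) * to_fract (fun_det r (\<lambda>i b. a i (g b))))
      ((\<Prod>i<r. inverse (?y (e0 i))) * fun_det r (\<lambda>i b. restricted_eval (a i (g b)) (D i) y))"
    unfolding fun_det_scale_rows fun_det_hom[OF to_fract_hom] .
  have nz: "(\<Prod>i<r. inverse (?y (e0 i))) * fun_det r (\<lambda>i b. restricted_eval (a i (g b)) (D i) y) \<noteq> 0"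
    using g(2) ynz by simp
  \<comment> \<open>The assumption concerns the given exponents \<open>k\<close>, the residues
    concern the minimal exponents \<open>e0\<close>. As the monomials of \<open>k\<close> are
    multiples of those of \<open>e0\<close> at the place, the minor divided by the latter also lies
    in \<open>N\<close>.\<close>
  have "\<forall>i\<in>{..<r}. ?m (k i) / ?m (e0 i) \<in> gp.place_ring"
  proof
    fix i assume i: "i \<in> {..<r}"
    then obtain e where e: "e \<in> E i" "e \<le> k i" using k[of i] E(3)[of "k i" i] by auto
    have "k i = (k i - e) + e" using exponent_diff_add[OF e(2)] by simp
    then have "?m (k i) = ?m (k i - e) * ?m e" using germ_monomial_add[of "k i - e" e] tf.hom_mult by metis
    then have "?m (k i) / ?m (e0 i) = ?m (k i - e) * (?m e / ?m (e0 i))" by simp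
    also have "\<dots> \<in> gp.place_ring" using e0 i e(1)
      by (intro valuation_subring_closed(6)[OF gp.place_ring_valuation_subring] gp.to_fract_place_ring) auto
    finally show "?m (k i) / ?m (e0 i) \<in> gp.place_ring" .
  qed
  then have "(\<Prod>i<r. ?m (k i) / ?m (e0 i)) \<in> gp.place_ring"
    by (intro valuation_subring_prod[OF gp.place_ring_valuation_subring]) blast
  then have "(\<Prod>i<r. ?m (k i) / ?m (e0 i)) * (to_fract (fun_det r (\<lambda>i b. a i (g b))) / ?m ?K) \<in> N"
    by (rule gp.place_ring_mult[OF _ quot_N[OF g(1)]])
  moreover have "(\<Prod>i<r. ?m (k i) / ?m (e0 i)) * (to_fract (fun_det r (\<lambda>i b. a i (g b))) / ?m ?K) =
      (\<Prod>i<r. inverse (?m (e0 i))) * to_fract (fun_det r (\<lambda>i b. a i (g b)))"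
  proof -
    have "?m ?K = (\<Prod>i<r. ?m (k i))" by (simp add: germ_monomial_sum tf.hom_prod)
    moreover have "(\<Prod>i<r. ?m (k i)) \<noteq> 0" by simp
    ultimately show ?thesis by (simp add: prod_dividef divide_inverse prod_inversef)
  qed
  ultimately have "gp.residue ((\<Prod>i<r. inverse (?m (e0 i))) * to_fract (fun_det r (\<lambda>i b. a i (g b)))) 0"
    by (simp add: gp.residue_0_iff)
  from gp.residue_unique[OF res this] nz show False by simp
qed

text \<open>
  The substitution \<open>x\<^sub>t \<mapsto> X\<^bsup>w t\<^esup> * (y\<^sub>t + X * x\<^sub>t)\<close> turns a common zero \<open>y\<close> of the restricted minors into
  a discrete valuation in which all minors are too small.
\<close>

lemma minor_dominates_nondegenerate:
  fixes a :: "nat \<Rightarrow> nat \<Rightarrow> 'n :: finite germ" and I :: "nat \<Rightarrow> 'n germ set"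
  assumes r: "r > 0" and aI: "\<And>i j. i < r \<Longrightarrow> j < m \<Longrightarrow> a i j \<in> I i"
    and dom: "\<And>V k. V \<in> intermediate_rings \<Longrightarrow> (\<And>i. i < r \<Longrightarrow> real_exponent (k i) \<in> newton_polyhedron (I i)) \<Longrightarrow>
      \<exists>g. (\<forall>b<r. g b < m) \<and> fun_det r (\<lambda>i b. a i (g b)) \<noteq> 0 \<and>
        to_fract (germ_monomial (\<Sum>i<r. k i)) / to_fract (fun_det r (\<lambda>i b. a i (g b))) \<in> V"
    and D: "\<And>i. i < r \<Longrightarrow> D i \<in> compact_faces (newton_polyhedron (I i))"
      "(\<Sum>i<r. D i) \<in> compact_faces (\<Sum>i<r. newton_polyhedron (I i))"
    and y: "\<And>t. vec_nth y t \<noteq> 0"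
  shows "\<exists>g. (\<forall>b<r. g b < m) \<and> fun_det r (\<lambda>i b. restricted_eval (a i (g b)) (D i) y) \<noteq> 0"
proof (rule ccontr)
  assume contra: "\<not> ?thesis"
  obtain w :: "'n \<Rightarrow> nat" and d where w: "\<And>t. w t > 0"
    and d: "\<And>i. i < r \<Longrightarrow> real_exponent (d i) \<in> D i" "\<And>i. i < r \<Longrightarrow> D i \<subseteq> newton_polyhedron (I i)"
      "\<And>i k. i < r \<Longrightarrow> real_exponent k \<in> newton_polyhedron (I i) \<Longrightarrow> weighted_degree w (d i) \<le> weighted_degree w k"
      "\<And>i k. i < r \<Longrightarrow> real_exponent k \<in> newton_polyhedron (I i) \<Longrightarrow>
        weighted_degree w k = weighted_degree w (d i) \<longleftrightarrow> real_exponent k \<in> D i"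
  proof (rule expose_newton_faces[of r D I])
    show "0 < r" by (rule r)
    show "D i \<in> compact_faces (newton_polyhedron (I i))" if "i < r" for i using that by (rule D(1))
    show "(\<Sum>i<r. D i) \<in> compact_faces (\<Sum>i<r. newton_polyhedron (I i))" by (rule D(2))
  qed (rule that)
  interpret ws: weighted_substitution w "vec_nth y" "Suc 0" by unfold_locales (rule w)
  have f0: "fps_nth (ws.factor t) 0 = const_germ (vec_nth y t)" for t by (simp add: ws.factor_def)
  have f0nz: "fps_nth (ws.factor t) 0 \<noteq> 0" for t
  proof
    assume "fps_nth (ws.factor t) 0 = 0"
    then have "taylor_coeff (const_germ (vec_nth y t) :: 'n germ) 0 = 0" unfolding f0 by (simp add: taylor_coeff_simps)
    then show False using y by (simp add: taylor_coeff_const_germ)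
  qed
  \<comment> \<open>Any coordinate witnesses that the valuation is nontrivial;
    \<open>undefined\<close> names one, index types being inhabited.\<close>
  obtain V :: "'n germ fract set" where V: "V \<in> intermediate_rings"
    "\<And>a b. a \<noteq> 0 \<Longrightarrow> b \<noteq> 0 \<Longrightarrow> Fract a b \<in> V \<longleftrightarrow> ws.val b \<le> ws.val a"
  proof (rule exists_discrete_valuation_ring[of ws.val "germ_monomial (axis (undefined :: 'n) 1)"])
    show "ws.val (a * b) = ws.val a + ws.val b" if "a \<noteq> 0" "b \<noteq> 0" for a b using that by (rule ws.val_mult)
    show "min (ws.val a) (ws.val b) \<le> ws.val (a + b)" if "a + b \<noteq> 0" for a b using that by (rule ws.val_add)
    show "germ_monomial (axis (undefined :: 'n) 1) \<noteq> (0 :: 'n germ)" by (rule germ_monomial_nonzero)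
    show "0 < ws.val (germ_monomial (axis (undefined :: 'n) 1))"
      unfolding ws.val_monomial[OF f0nz] weighted_degree_axis using w by simp
  qed (rule that)
  have dP: "real_exponent (d i) \<in> newton_polyhedron (I i)" if "i < r" for i using d(1,2)[OF that] by blast
  obtain g where g: "\<forall>b<r. g b < m" "fun_det r (\<lambda>i b. a i (g b)) \<noteq> 0"
    "to_fract (germ_monomial (\<Sum>i<r. d i)) / to_fract (fun_det r (\<lambda>i b. a i (g b))) \<in> V"
    using dom[OF V(1), of d] dP by blast
  let ?l = "\<lambda>i. weighted_degree w (d i)" and ?det = "fun_det r (\<lambda>i b. a i (g b))"
  have "Fract (germ_monomial (\<Sum>i<r. d i)) ?det \<in> V"
    using g(3) by (simp add: to_fract_def divide_fract)
  then have "ws.val ?det \<le> ws.val (germ_monomial (\<Sum>i<r. d i))"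
    using V(2)[OF germ_monomial_nonzero g(2)] by simp
  then have le: "ws.val ?det \<le> (\<Sum>i<r. ?l i)"
    unfolding ws.val_monomial[OF f0nz] weighted_degree_sum .
  \<comment> \<open>Row \<open>i\<close> starts in degree \<open>?l i\<close>. After that power of
    \<open>X\<close> is removed, the constant term of an entry is its restriction to the face,
    evaluated at \<open>y\<close>.\<close>
  define B where "B i b = fps_shift (?l i) (ws.subst (a i (g b)))" for i b
  have low: "?l i \<le> weighted_degree w k" if ib: "i < r" "b < r" and nz: "taylor_coeff (a i (g b)) k \<noteq> 0" for i b k
    using d(3)[OF ib(1) support_in_newton_polyhedron[OF aI nz]] ib g(1) by simp
  have Beq: "ws.subst (a i (g b)) = fps_X ^ ?l i * B i b" if ib: "i < r" "b < r" for i b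
  proof (rule fps_ext)
    fix n :: nat
    show "fps_nth (ws.subst (a i (g b))) n = fps_nth (fps_X ^ ?l i * B i b) n"
      using ws.subst_nth_less[OF low[OF ib], where b = n] by (simp add: B_def fps_X_power_mult_nth)
  qed
  have B0: "fps_nth (B i b) 0 = const_germ (restricted_eval (a i (g b)) (D i) y)" if ib: "i < r" "b < r" for i b
  proof -
    let ?f = "a i (g b)"
    have "fps_nth (B i b) 0 = (\<Sum>k | weighted_degree w k = ?l i.
        const_germ (taylor_coeff ?f k) * (\<Prod>t\<in>UNIV. fps_nth (ws.factor t) 0 ^ vec_nth k t))"
      unfolding B_def using ws.subst_nth_initial[OF low[OF ib]] by simp
    also have "\<dots> = const_germ (\<Sum>k | weighted_degree w k = ?l i. taylor_coeff ?f k * (\<Prod>t\<in>UNIV. vec_nth y t ^ vec_nth k t))"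
      by (simp add: f0 const_germ_sum const_germ_hom const_germ_prod const_germ_power)
    also have "(\<Sum>k | weighted_degree w k = ?l i. taylor_coeff ?f k * (\<Prod>t\<in>UNIV. vec_nth y t ^ vec_nth k t)) =
        restricted_eval ?f (D i) y"
      unfolding restricted_eval_def
    proof (rule sum.mono_neutral_right)
      show "finite {k. weighted_degree w k = ?l i}"
        by (rule finite_subset[OF _ ws.finite_weighted_degree_le[of "?l i"]]) auto
      show "{k. real_exponent k \<in> D i} \<subseteq> {k. weighted_degree w k = ?l i}"
        using d(2,4) ib(1) by blast
      show "\<forall>k\<in>{k. weighted_degree w k = ?l i} - {k. real_exponent k \<in> D i}.
          taylor_coeff ?f k * (\<Prod>t\<in>UNIV. vec_nth y t ^ vec_nth k t) = 0"
      proof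
        fix k assume k: "k \<in> {k. weighted_degree w k = ?l i} - {k. real_exponent k \<in> D i}"
        have "taylor_coeff ?f k = 0"
        proof (rule ccontr)
          assume nz: "taylor_coeff ?f k \<noteq> 0"
          have "?f \<in> I i" using aI ib g(1) by simp
          from support_in_newton_polyhedron[OF this nz] k d(4)[OF ib(1)] show False by simp
        qed
        then show "taylor_coeff ?f k * (\<Prod>t\<in>UNIV. vec_nth y t ^ vec_nth k t) = 0" by simp
      qed
    qed
    finally show ?thesis .
  qed
  have hom: "comm_ring_hom ws.subst"
  proof unfold_locales
    show "ws.subst 0 = 0" using ws.subst_add[of 0 0] by (simp only: add_0_left add_cancel_right_right)
  qed (simp_all add: ws.subst_add ws.subst_mult ws.subst_1)
  have hom0: "comm_ring_hom (\<lambda>F :: 'n germ fps. fps_nth F 0)" by unfold_locales simp_all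
  have homc: "comm_ring_hom (const_germ :: complex \<Rightarrow> 'n germ)" by unfold_locales (simp_all add: const_germ_hom)
  have "ws.subst ?det = fun_det r (\<lambda>i b. ws.subst (a i (g b)))" by (rule fun_det_hom[OF hom, symmetric])
  also have "\<dots> = fun_det r (\<lambda>i b. fps_X ^ ?l i * B i b)" by (rule fun_det_cong) (rule Beq)
  also have "\<dots> = (\<Prod>i<r. fps_X ^ ?l i) * fun_det r B" by (rule fun_det_scale_rows)
  also have "(\<Prod>i<r. fps_X ^ ?l i) = (fps_X ^ (\<Sum>i<r. ?l i) :: 'n germ fps)" by (simp add: power_sum)
  finally have eq: "ws.subst ?det = fps_X ^ (\<Sum>i<r. ?l i) * fun_det r B" .
  have "fps_nth (fun_det r B) 0 = fun_det r (\<lambda>i b. fps_nth (B i b) 0)" by (rule fun_det_hom[OF hom0, symmetric])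
  also have "\<dots> = fun_det r (\<lambda>i b. const_germ (restricted_eval (a i (g b)) (D i) y))"
    by (rule fun_det_cong) (rule B0)
  also have "\<dots> = const_germ (fun_det r (\<lambda>i b. restricted_eval (a i (g b)) (D i) y))" by (rule fun_det_hom[OF homc])
  also have "fun_det r (\<lambda>i b. restricted_eval (a i (g b)) (D i) y) = 0" using contra g(1) by blast
  also have "const_germ 0 = (0 :: 'n germ)" by (rule const_germ_hom)
  \<comment> \<open>The order of the minor therefore exceeds the sum of the row degrees, which is
    the order of the product of the chosen row monomials.\<close>
  finally have zero: "fps_nth (fun_det r B) 0 = 0" .
  have nz: "fun_det r B \<noteq> 0" using ws.subst_nonzero[OF g(2)] unfolding eq by auto
  have "ws.val ?det = (\<Sum>i<r. ?l i) + subdegree (fun_det r B)"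
    unfolding ws.val_def eq using nz by (subst subdegree_mult) simp_all
  moreover have "subdegree (fun_det r B) \<noteq> 0" using zero nz by (simp add: subdegree_eq_0_iff)
  ultimately show False using le by linarith
qed

section \<open>The monomial closure of an ideal\<close>

text \<open>A germ supported in the polyhedron may have infinitely many terms. Finitely many
  monomials of the polyhedron divide all of them, and division with convergent quotients then shows
  that it belongs to the ideal.\<close>

lemma monomial_closure_iff:
  fixes I :: "'n :: finite germ set"
  shows "f \<in> monomial_closure I \<longleftrightarrow> (\<forall>k. taylor_coeff f k \<noteq> 0 \<longrightarrow> real_exponent k \<in> newton_polyhedron I)"
proof
  assume "f \<in> monomial_closure I"
  then show "\<forall>k. taylor_coeff f k \<noteq> 0 \<longrightarrow> real_exponent k \<in> newton_polyhedron I"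
    unfolding monomial_closure_def
  proof (rule generated_ideal_induct)
    fix c x and y :: "'n germ"
    assume "x \<in> {germ_monomial k | k. real_exponent k \<in> newton_polyhedron I}"
    then obtain j where j: "x = germ_monomial j" "real_exponent j \<in> newton_polyhedron I" by auto
    assume y: "\<forall>k. taylor_coeff y k \<noteq> 0 \<longrightarrow> real_exponent k \<in> newton_polyhedron I"
    show "\<forall>k. taylor_coeff (c * x + y) k \<noteq> 0 \<longrightarrow> real_exponent k \<in> newton_polyhedron I"
    proof (intro allI impI)
      fix k assume nz: "taylor_coeff (c * x + y) k \<noteq> 0"
      show "real_exponent k \<in> newton_polyhedron I"
      proof (cases "j \<le> k")
        case True
        then show ?thesis by (rule newton_polyhedron_up[OF j(2)])
      next
        case False
        then have "taylor_coeff y k \<noteq> 0" using nz by (simp add: j(1) taylor_coeff_mult_monomial)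
        then show ?thesis using y by blast
      qed
    qed
  qed simp
next
  assume supp: "\<forall>k. taylor_coeff f k \<noteq> 0 \<longrightarrow> real_exponent k \<in> newton_polyhedron I"
  obtain E where E: "finite E" "newton_polyhedron I = orthant_hull (real_exponent ` E)"
    "\<And>k. real_exponent k \<in> newton_polyhedron I \<longleftrightarrow> (\<exists>e\<in>E. e \<le> k)"
    by (rule newton_generators, rule that)
  obtain q where q: "f = (\<Sum>e\<in>E. q e * germ_monomial e)"
  proof (rule germ_in_monomial_ideal[of E f])
    show "finite E" by (rule E(1))
    show "\<exists>e\<in>E. e \<le> k" if "taylor_coeff f k \<noteq> 0" for k using supp that E(3)[of k] by blast
  qed (rule that)
  have "real_exponent e \<in> newton_polyhedron I" if "e \<in> E" for e using that E(3)[of e] by blast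
  then show "f \<in> monomial_closure I"
    unfolding q monomial_closure_def by (intro generated_ideal_sum generated_ideal_closed(3) generated_ideal_base) blast
qed

lemma monomial_closure_inc: "I \<subseteq> monomial_closure I"
  by (auto simp: monomial_closure_iff intro: support_in_newton_polyhedron)

lemma monomial_closure_0: "0 \<in> monomial_closure I"
  by (simp add: monomial_closure_iff)

lemma germ_monomial_in_closure: "real_exponent k \<in> newton_polyhedron I \<Longrightarrow> germ_monomial k \<in> monomial_closure I"
  by (simp add: monomial_closure_iff taylor_coeff_monomial)

text \<open>
  If \<open>x^k\<close> occurs in \<open>f\<close> and \<open>k\<close> lies outside the polyhedron, a monomial valuation separates \<open>f\<close> from the
  monomials of the polyhedron.
\<close>

lemma monomial_closure_integrally_closed:
  fixes f :: "'n :: finite germ"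
  assumes dom: "\<And>V. V \<in> intermediate_rings \<Longrightarrow>
    dominated V {germ_monomial k | k. real_exponent k \<in> newton_polyhedron I} f"
  shows "f \<in> monomial_closure I"
proof (rule ccontr)
  assume "f \<notin> monomial_closure I"
  then obtain k where k: "taylor_coeff f k \<noteq> 0" "real_exponent k \<notin> newton_polyhedron I"
    by (auto simp: monomial_closure_iff)
  then have f: "f \<noteq> 0" by auto
  obtain w :: "'n \<Rightarrow> nat" where w: "\<And>t. w t > 0"
    "\<And>j. real_exponent j \<in> newton_polyhedron I \<Longrightarrow> weighted_degree w k < weighted_degree w j"
    by (rule separating_weights[OF k(2)], rule that)
  \<comment> \<open>The choice \<open>c = 0\<close>, \<open>s = 0\<close> gives
    \<open>x\<^sub>t \<mapsto> X^(w t) * x\<^sub>t\<close>, whose order in \<open>X\<close> is the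
    pure monomial valuation.\<close>
  interpret ws: weighted_substitution w "\<lambda>_. 0" 0 by unfold_locales (rule w)
  have f0: "fps_nth (ws.factor t) 0 = germ_monomial (axis t 1)" for t by (simp add: ws.factor_def const_germ_hom)
  have f0nz: "fps_nth (ws.factor t) 0 \<noteq> 0" for t unfolding f0 by (rule germ_monomial_nonzero)
  obtain V :: "'n germ fract set" where V: "V \<in> intermediate_rings"
    "\<And>a b. a \<noteq> 0 \<Longrightarrow> b \<noteq> 0 \<Longrightarrow> Fract a b \<in> V \<longleftrightarrow> ws.val b \<le> ws.val a"
  proof (rule exists_discrete_valuation_ring[of ws.val "germ_monomial (axis (undefined :: 'n) 1)"])
    show "ws.val (a * b) = ws.val a + ws.val b" if "a \<noteq> 0" "b \<noteq> 0" for a b using that by (rule ws.val_mult)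
    show "min (ws.val a) (ws.val b) \<le> ws.val (a + b)" if "a + b \<noteq> 0" for a b using that by (rule ws.val_add)
    show "germ_monomial (axis (undefined :: 'n) 1) \<noteq> (0 :: 'n germ)" by (rule germ_monomial_nonzero)
    show "0 < ws.val (germ_monomial (axis (undefined :: 'n) 1))"
      unfolding ws.val_monomial[OF f0nz] weighted_degree_axis using w(1) by simp
  qed (rule that)
  define P where "P m \<longleftrightarrow> (\<exists>j. taylor_coeff f j \<noteq> 0 \<and> weighted_degree w j = m)" for m
  define m where "m = (LEAST m. P m)"
  have Pk: "P (weighted_degree w k)" unfolding P_def using k(1) by blast
  then have "P m" unfolding m_def by (rule LeastI)
  then obtain j where j: "taylor_coeff f j \<noteq> 0" "weighted_degree w j = m" unfolding P_def by blast
  have min: "m \<le> weighted_degree w i" if "taylor_coeff f i \<noteq> 0" for i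
    unfolding m_def by (rule Least_le) (use that in \<open>auto simp: P_def\<close>)
  have fin: "finite {i. weighted_degree w i = m}"
    by (rule finite_subset[OF _ ws.finite_weighted_degree_le[of m]]) auto
  \<comment> \<open>The coefficient of \<open>X ^ m\<close> is the initial form of \<open>f\<close>
    as a germ. Its monomials remain distinct and cannot cancel, so the order of \<open>f\<close> is
    at most \<open>m\<close>.\<close>
  have "fps_nth (ws.subst f) m =
      (\<Sum>i | weighted_degree w i = m. const_germ (taylor_coeff f i) * (\<Prod>t\<in>UNIV. fps_nth (ws.factor t) 0 ^ vec_nth i t))"
    by (rule ws.subst_nth_initial[OF min])
  also have "\<dots> = (\<Sum>i | weighted_degree w i = m. const_germ (taylor_coeff f i) * germ_monomial i)"
    by (intro sum.cong refl arg_cong2[of _ _ _ _ "(*)"]) (simp only: f0 germ_monomial_expansion[symmetric])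
  finally have "taylor_coeff (fps_nth (ws.subst f) m) j =
      (\<Sum>i | weighted_degree w i = m. if j = i then taylor_coeff f j else 0)"
    by (simp only: taylor_coeff_sum) (intro sum.cong refl, simp add: taylor_coeff_monomial)
  also have "\<dots> = taylor_coeff f j" using fin j(2) by (simp add: sum.delta)
  finally have "fps_nth (ws.subst f) m \<noteq> 0" using j(1) by auto
  then have "ws.val f \<le> m" unfolding ws.val_def by (rule subdegree_leI)
  also have "m \<le> weighted_degree w k" by (rule min[OF k(1)])
  finally have le: "ws.val f \<le> weighted_degree w k" .
  from dom[OF V(1)] f obtain i where i: "real_exponent i \<in> newton_polyhedron I"
    "to_fract f / to_fract (germ_monomial i) \<in> V"
    unfolding dominated_def by blast
  have "Fract f (germ_monomial i) \<in> V" using i(2) by (simp add: to_fract_def divide_fract)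
  then have "weighted_degree w i \<le> ws.val f"
    using V(2)[OF f germ_monomial_nonzero] ws.val_monomial[OF f0nz] by simp
  then show False using le w(2)[OF i(1)] by simp
qed

text \<open>Over \<open>V\<close> the monomial closure becomes a principal ideal generated by a
  monomial: finitely many monomials generate it, and one of them has least valuation.\<close>

lemma minimal_exponent:
  fixes I :: "'n :: finite germ set"
  assumes V: "V \<in> intermediate_rings" and ne: "real_exponent k0 \<in> newton_polyhedron I"
  obtains e where "real_exponent e \<in> newton_polyhedron I"
    "\<And>f. f \<in> monomial_closure I \<Longrightarrow> to_fract f / to_fract (germ_monomial e) \<in> V"
proof -
  note VV = intermediate_ringsD[OF V]
  obtain E where E: "finite E" "newton_polyhedron I = orthant_hull (real_exponent ` E)"
    "\<And>k. real_exponent k \<in> newton_polyhedron I \<longleftrightarrow> (\<exists>e\<in>E. e \<le> k)"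
    by (rule newton_generators, rule that)
  let ?m = "\<lambda>k. to_fract (germ_monomial k) :: 'n germ fract"
  have "E \<noteq> {}" using ne E(3)[of k0] by blast
  then have "\<exists>y\<in>?m ` E. \<forall>x\<in>?m ` E. x / y \<in> V"
    using E(1) by (intro valuation_minimal[OF VV(1)]) auto
  then obtain e where e: "e \<in> E" "\<forall>x\<in>?m ` E. x / ?m e \<in> V" by blast
  show ?thesis
  proof (rule that[of e])
    show "real_exponent e \<in> newton_polyhedron I" using E(3)[of e] e(1) by blast
    fix f assume "f \<in> monomial_closure I"
    then have supp: "\<exists>e\<in>E. e \<le> k" if "taylor_coeff f k \<noteq> 0" for k
      using that E(3)[of k] by (simp add: monomial_closure_iff)
    obtain q where q: "f = (\<Sum>e\<in>E. q e * germ_monomial e)"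
      by (rule germ_in_monomial_ideal[OF E(1) supp], assumption, rule that)
    interpret tf: comm_ring_hom "to_fract :: 'n germ \<Rightarrow> 'n germ fract" by (rule to_fract_hom)
    have "to_fract f / ?m e = (\<Sum>i\<in>E. to_fract (q i) * (?m i / ?m e))"
      unfolding q by (simp add: tf.hom_sum sum_divide_distrib)
    also have "\<dots> \<in> V"
      using e(2) by (intro valuation_subring_sum[OF VV(1)] valuation_subring_closed(6)[OF VV(1)] VV(2)) auto
    finally show "to_fract f / ?m e \<in> V" .
  qed
qed

section \<open>Submodules and generating matrices\<close>

lemma module_vec_class_ring: "Module.module (class_ring :: 'a :: comm_ring_1 ring) (module_vec TYPE('a) n)"
  by unfold_locales
    (auto simp: module_vec_simps class_ring_simps Units_def add_smult_distrib_vec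
      smult_add_distrib_vec intro!: bexI[of _ "- _"])

lemma is_submodule_iff:
  "is_submodule p M \<longleftrightarrow> M \<subseteq> carrier_vec p \<and> 0\<^sub>v p \<in> M \<and> (\<forall>v\<in>M. \<forall>w\<in>M. v + w \<in> M) \<and> (\<forall>c. \<forall>v\<in>M. c \<cdot>\<^sub>v v \<in> M)"
  unfolding is_submodule_def submodule_def
  by (auto simp: module_vec_class_ring module_vec_simps class_ring_simps)

lemma submoduleD:
  assumes "is_submodule p M"
  shows "v \<in> M \<Longrightarrow> v \<in> carrier_vec p" "0\<^sub>v p \<in> M" "v \<in> M \<Longrightarrow> w \<in> M \<Longrightarrow> v + w \<in> M" "v \<in> M \<Longrightarrow> c \<cdot>\<^sub>v v \<in> M"
  using assms unfolding is_submodule_iff by blast+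

lemma submodule_combination:
  assumes M: "is_submodule p M" and v: "\<And>j. j \<in> J \<Longrightarrow> v j \<in> M"
  shows "Matrix.vec p (\<lambda>i. \<Sum>j\<in>J. c j * v j $ i) \<in> M"
  using v
proof (induction J rule: infinite_finite_induct)
  case (insert x J)
  have "c x \<cdot>\<^sub>v v x + Matrix.vec p (\<lambda>i. \<Sum>j\<in>J. c j * v j $ i) \<in> M"
  proof (intro submoduleD(3,4)[OF M])
    show "v x \<in> M" by (rule insert.prems) simp
    show "Matrix.vec p (\<lambda>i. \<Sum>j\<in>J. c j * v j $ i) \<in> M" by (rule insert.IH, rule insert.prems) simp
  qed
  moreover have "c x \<cdot>\<^sub>v v x + Matrix.vec p (\<lambda>i. \<Sum>j\<in>J. c j * v j $ i) = Matrix.vec p (\<lambda>i. \<Sum>j\<in>insert x J. c j * v j $ i)"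
    using insert.hyps submoduleD(1)[OF M insert.prems[OF insertI1]] by (intro eq_vecI) auto
  ultimately show ?case by simp
next
  case (infinite J)
  then show ?case using submoduleD(2)[OF M] by (simp add: zero_vec_def)
next
  case empty
  then show ?case using submoduleD(2)[OF M] by (simp add: zero_vec_def)
qed

definition generated_by :: "nat \<Rightarrow> 'a :: comm_ring_1 vec set \<Rightarrow> 'a vec \<Rightarrow> bool" where
  "generated_by p S h \<longleftrightarrow> (\<exists>c. \<forall>i<p. h $ i = (\<Sum>s\<in>S. c s * s $ i))"

lemma generated_by_mono:
  assumes "generated_by p S h" "S \<subseteq> T" "finite T"
  shows "generated_by p T h"
proof -
  from assms(1) obtain c where c: "\<forall>i<p. h $ i = (\<Sum>s\<in>S. c s * s $ i)" unfolding generated_by_def ..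
  have "(\<Sum>s\<in>S. c s * s $ i) = (\<Sum>s\<in>T. (if s \<in> S then c s else 0) * s $ i)" for i
    using assms(2,3) by (intro sum.mono_neutral_cong_left) auto
  then show ?thesis unfolding generated_by_def using c by (intro exI[of _ "\<lambda>s. if s \<in> S then c s else 0"]) simp
qed

lemma generated_by_add:
  assumes "generated_by p S g" "generated_by p S h" "\<And>i. i < p \<Longrightarrow> f $ i = g $ i + h $ i"
  shows "generated_by p S f"
proof -
  from assms(1,2) obtain c d where "\<forall>i<p. g $ i = (\<Sum>s\<in>S. c s * s $ i)" "\<forall>i<p. h $ i = (\<Sum>s\<in>S. d s * s $ i)"
    unfolding generated_by_def by blast
  then show ?thesis unfolding generated_by_def
    by (intro exI[of _ "\<lambda>s. c s + d s"]) (simp add: assms(3) distrib_right sum.distrib)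
qed

text \<open>Induction on the number \<open>q\<close> of leading coordinates that may be nonzero. The
  \<open>q\<close>-th coordinates of the members with zeros after position \<open>q\<close> form an
  ideal; subtracting a combination of lifts of its generators clears that coordinate and leaves a
  case of the induction hypothesis.\<close>

lemma germ_submodule_finitely_generated:
  fixes M :: "'n :: finite germ vec set"
  assumes M: "is_submodule p M"
  obtains S where "finite S" "S \<subseteq> M" "\<And>h. h \<in> M \<Longrightarrow> generated_by p S h"
proof -
  have "\<exists>S. finite S \<and> S \<subseteq> M \<and> (\<forall>h\<in>M. (\<forall>i<p. q \<le> i \<longrightarrow> h $ i = 0) \<longrightarrow> generated_by p S h)" if "q \<le> p" for q
    using that
  proof (induction q)
    case 0
    show ?case by (intro exI[of _ "{}"]) (auto simp: generated_by_def)
  next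
    case (Suc q)
    then have q: "q < p" by simp
    from Suc.IH[OF less_imp_le[OF q]] obtain S where S: "finite S" "S \<subseteq> M"
      "\<forall>h\<in>M. (\<forall>i<p. q \<le> i \<longrightarrow> h $ i = 0) \<longrightarrow> generated_by p S h" by (elim exE conjE)
    define M' where "M' = {h \<in> M. \<forall>i<p. Suc q \<le> i \<longrightarrow> h $ i = 0}"
    define I where "I = (\<lambda>h. h $ q) ` M'"
    have I: "h $ q \<in> I" if "h \<in> M'" for h using that by (auto simp: I_def)
    obtain T where T: "finite T" "T \<subseteq> I" "\<And>f. f \<in> I \<Longrightarrow> \<exists>c. f = (\<Sum>g\<in>T. c g * g)"
    proof (rule germ_ideal_finitely_generated[of I])
      have "0\<^sub>v p \<in> M'" using submoduleD(2)[OF M] by (simp add: M'_def)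
      from I[OF this] show "0 \<in> I" using q by simp
    next
      fix f g assume "f \<in> I" "g \<in> I"
      then obtain v w where vw: "v \<in> M'" "w \<in> M'" "f = v $ q" "g = w $ q" by (auto simp: I_def)
      then have dim: "v \<in> carrier_vec p" "w \<in> carrier_vec p" using submoduleD(1)[OF M] by (auto simp: M'_def)
      have "v + w \<in> M'" using vw dim submoduleD(3)[OF M] by (auto simp: M'_def)
      from I[OF this] show "f + g \<in> I" using vw dim q by simp
    next
      fix f g assume "f \<in> I"
      then obtain v where v: "v \<in> M'" "f = v $ q" by (auto simp: I_def)
      then have dim: "v \<in> carrier_vec p" using submoduleD(1)[OF M] by (auto simp: M'_def)
      have "g \<cdot>\<^sub>v v \<in> M'" using v dim submoduleD(4)[OF M] by (auto simp: M'_def)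
      from I[OF this] show "g * f \<in> I" using v dim q by simp
    qed (rule that)
    have "\<forall>t\<in>T. \<exists>v. v \<in> M' \<and> v $ q = t" using T(2) by (auto simp: I_def)
    from bchoice[OF this] obtain v where v: "\<forall>t\<in>T. v t \<in> M' \<and> v t $ q = t" ..
    have vM: "v t \<in> M" "\<And>i. i < p \<Longrightarrow> Suc q \<le> i \<Longrightarrow> v t $ i = 0" if "t \<in> T" for t
      using v that by (auto simp: M'_def)
    have inj: "inj_on v T" using v by (metis inj_onI)
    let ?S = "S \<union> v ` T"
    have finS: "finite ?S" using S(1) T(1) by simp
    have "generated_by p ?S h" if h: "h \<in> M" "\<forall>i<p. Suc q \<le> i \<longrightarrow> h $ i = 0" for h
    proof -
      have "h $ q \<in> I" using h by (intro I) (simp add: M'_def)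
      from T(3)[OF this] obtain c where c: "h $ q = (\<Sum>g\<in>T. c g * g)" ..
      define h1 where "h1 = Matrix.vec p (\<lambda>i. \<Sum>t\<in>T. c t * v t $ i)"
      have h1M: "h1 \<in> M" unfolding h1_def by (rule submodule_combination[OF M vM(1)])
      have dim: "h \<in> carrier_vec p" "h1 \<in> carrier_vec p" using submoduleD(1)[OF M] h(1) h1M by auto
      have "h + (- 1) \<cdot>\<^sub>v h1 \<in> M" by (intro submoduleD(3,4)[OF M] h(1) h1M)
      moreover have "(h + (- 1) \<cdot>\<^sub>v h1) $ i = 0" if i: "i < p" "q \<le> i" for i
      proof (cases "i = q")
        case True
        have "h1 $ q = h $ q" unfolding c h1_def using v q by simp
        then show ?thesis using dim q by (simp add: True)
      next
        case False
        then have "h $ i = 0" "h1 $ i = 0" using h(2) vM(2) i by (simp_all add: h1_def)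
        then show ?thesis using dim i by simp
      qed
      ultimately have "generated_by p S (h + (- 1) \<cdot>\<^sub>v h1)" using S(3) by blast
      then have g1: "generated_by p ?S (h + (- 1) \<cdot>\<^sub>v h1)" by (rule generated_by_mono) (use finS in auto)
      have "h1 $ i = (\<Sum>s\<in>v ` T. c (inv_into T v s) * s $ i)" if "i < p" for i
        using that inj by (simp add: h1_def sum.reindex)
      then have "generated_by p (v ` T) h1" unfolding generated_by_def
        by (intro exI[of _ "\<lambda>s. c (inv_into T v s)"]) simp
      then have g2: "generated_by p ?S h1" by (rule generated_by_mono) (use finS in auto)
      show ?thesis by (rule generated_by_add[OF g1 g2]) (use dim in simp)
    qed
    then show ?case using finS S(2) vM(1) by (intro exI[of _ ?S]) auto
  qed
  from this[OF order_refl] obtain S where "finite S" "S \<subseteq> M"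
    "\<forall>h\<in>M. (\<forall>i<p. p \<le> i \<longrightarrow> h $ i = 0) \<longrightarrow> generated_by p S h" by (elim exE conjE)
  then show ?thesis by (intro that[of S]) auto
qed

section \<open>Generating matrices\<close>

lemma generating_matrixI:
  assumes M: "is_submodule p M" and v: "\<And>j. j < m \<Longrightarrow> v j \<in> M" and S: "S \<subseteq> v ` {..<m}" "\<And>h. h \<in> M \<Longrightarrow> generated_by p S h"
    and m: "p \<le> m"
  shows "Matrix.mat p m (\<lambda>(i, j). v j $ i) \<in> generating_matrices p M"
proof -
  let ?A = "Matrix.mat p m (\<lambda>(i, j). v j $ i)"
  have Ac: "?A *\<^sub>v c = Matrix.vec p (\<lambda>i. \<Sum>j<m. c $ j * v j $ i)" if "c \<in> carrier_vec m" for c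
    using that by (intro eq_vecI) (auto simp: Matrix.scalar_prod_def lessThan_atLeast0 mult.commute intro!: sum.cong)
  have "M = {?A *\<^sub>v c | c. c \<in> carrier_vec m}"
  proof (intro equalityI subsetI)
    fix h assume h: "h \<in> M"
    have "generated_by p (v ` {..<m}) h" by (rule generated_by_mono[OF S(2)[OF h] S(1)]) simp
    then obtain c where c: "\<forall>i<p. h $ i = (\<Sum>s\<in>v ` {..<m}. c s * s $ i)" unfolding generated_by_def ..
    \<comment> \<open>Columns may coincide; each generating vector uses one selected column, and the
      other copies get coefficient \<open>0\<close>.\<close>
    have "\<forall>s\<in>v ` {..<m}. \<exists>j. j < m \<and> v j = s" by auto
    from bchoice[OF this] obtain k where k: "\<forall>s\<in>v ` {..<m}. k s < m \<and> v (k s) = s" ..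
    define d where "d = Matrix.vec m (\<lambda>j. if k (v j) = j then c (v j) else 0)"
    have "(\<Sum>j<m. d $ j * v j $ i) = (\<Sum>s\<in>v ` {..<m}. c s * s $ i)" for i
    proof -
      have "(\<Sum>j<m. d $ j * v j $ i) = (\<Sum>j\<in>k ` v ` {..<m}. c (v j) * v j $ i)"
      proof (rule sum.mono_neutral_cong_right)
        show "k ` v ` {..<m} \<subseteq> {..<m}" using k by auto
        show "\<forall>j\<in>{..<m} - k ` v ` {..<m}. d $ j * v j $ i = 0"
        proof
          fix j assume j: "j \<in> {..<m} - k ` v ` {..<m}"
          then have "k (v j) \<in> k ` v ` {..<m}" by simp
          then have "k (v j) \<noteq> j" using j by force
          then show "d $ j * v j $ i = 0" using j by (simp add: d_def)
        qed
        fix j assume "j \<in> k ` v ` {..<m}"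
        then obtain s where s: "s \<in> v ` {..<m}" "j = k s" by blast
        then have "j < m" "v j = s" using k by auto
        then show "d $ j * v j $ i = c (v j) * v j $ i" using s(2) by (simp add: d_def)
      qed simp
      also have "\<dots> = (\<Sum>s\<in>v ` {..<m}. c s * s $ i)"
        using k by (subst sum.reindex) (auto intro!: inj_on_inverseI[of _ v] sum.cong)
      finally show ?thesis .
    qed
    then have "?A *\<^sub>v d = h" using submoduleD(1)[OF M h] c by (subst Ac) (auto simp: d_def)
    then show "h \<in> {?A *\<^sub>v c | c. c \<in> carrier_vec m}" by (intro CollectI exI[of _ d]) (simp add: d_def)
  next
    fix h assume "h \<in> {?A *\<^sub>v c | c. c \<in> carrier_vec m}"
    then obtain c where c: "c \<in> carrier_vec m" "h = ?A *\<^sub>v c" by blast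
    show "h \<in> M" unfolding c(2) Ac[OF c(1)] by (rule submodule_combination[OF M]) (simp add: v)
  qed
  then show ?thesis using m by (simp add: generating_matrices_def)
qed

lemma exists_generating_matrix:
  fixes M :: "'n :: finite germ vec set"
  assumes M: "is_submodule p M" and h: "\<And>b. b < s \<Longrightarrow> h b \<in> M"
  obtains A where "A \<in> generating_matrices p M" "s \<le> dim_col A" "\<And>i b. i < p \<Longrightarrow> b < s \<Longrightarrow> A $$ (i, b) = h b $ i"
proof -
  obtain S where S: "finite S" "S \<subseteq> M" "\<And>h. h \<in> M \<Longrightarrow> generated_by p S h"
    by (rule germ_submodule_finitely_generated[OF M], rule that)
  obtain f where f: "bij_betw f {0..<card S} S" using ex_bij_betw_nat_finite[OF S(1)] ..
  \<comment> \<open>The prescribed vectors come first, then generators, then \<open>p\<close> zero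
    columns, which secure the required \<open>p \<le> dim_col A\<close>.\<close>
  define m where "m = s + card S + p"
  define v where "v j = (if j < s then h j else if j < s + card S then f (j - s) else 0\<^sub>v p)" for j
  have fS: "f j \<in> S" if "j < card S" for j using bij_betwE[OF f] that by simp
  show ?thesis
  proof (rule that[of "Matrix.mat p m (\<lambda>(i, j). v j $ i)"])
    show "Matrix.mat p m (\<lambda>(i, j). v j $ i) \<in> generating_matrices p M"
    proof (rule generating_matrixI[OF M _ _ S(3)])
      have "f (j - s) \<in> M" if "\<not> j < s" "j < s + card S" for j using fS[of "j - s"] S(2) that by auto
      then show "v j \<in> M" for j using h[of j] submoduleD(2)[OF M] by (simp add: v_def)
      show "S \<subseteq> v ` {..<m}"
      proof
        fix x assume "x \<in> S"
        then have "x \<in> f ` {0..<card S}" using f by (simp add: bij_betw_def)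
        then obtain j where j: "j < card S" "x = f j" by auto
        then have "x = v (j + s)" "j + s \<in> {..<m}" by (auto simp: v_def m_def)
        then show "x \<in> v ` {..<m}" by (rule image_eqI)
      qed
    qed (simp_all add: m_def)
  qed (auto simp: m_def v_def)
qed

lemma generating_matrixD:
  assumes "A \<in> generating_matrices p M"
  shows "A \<in> carrier_mat p (dim_col A)" "M = {A *\<^sub>v c | c. c \<in> carrier_vec (dim_col A)}" "dim_row A = p"
  using assms unfolding generating_matrices_def by auto

lemma generating_matrix_col:
  assumes A: "A \<in> generating_matrices p M" and j: "j < dim_col A"
  shows "col A j \<in> M"
proof -
  note AD = generating_matrixD[OF A]
  have "A *\<^sub>v unit_vec (dim_col A) j = col A j" using AD(3) j by (intro eq_vecI) auto
  then show ?thesis by (subst AD(2)) (intro CollectI exI[of _ "unit_vec (dim_col A) j"], simp)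
qed

lemma generating_matrix_entry:
  assumes A: "A \<in> generating_matrices p M" and ij: "i < p" "j < dim_col A"
  shows "A $$ (i, j) \<in> component M i"
proof -
  have "A $$ (i, j) = col A j $ i" using generating_matrixD(3)[OF A] ij by simp
  then show ?thesis unfolding component_def using generating_matrix_col[OF A ij(2)] by (rule image_eqI)
qed

lemma generating_matrix_span:
  assumes V: "V \<in> intermediate_rings" and A: "A \<in> generating_matrices r N"
  shows "w \<in> extended_submodule V r N \<longleftrightarrow> w \<in> carrier_vec r \<and>
    in_col_span V r (dim_col A) (\<lambda>i j. to_fract (A $$ (i, j))) (\<lambda>i. w $ i)"
  by (rule extended_submodule_iff[OF intermediate_ringsD[OF V] generating_matrixD(1,2)[OF A]])

lemma submatrix_det:
  assumes A: "A \<in> carrier_mat p m" and I: "I \<subseteq> {..<p}" "card I = s" and J: "J \<subseteq> {..<m}" "card J = s"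
  shows "Determinant.det (submatrix A I J) = fun_det s (\<lambda>a b. A $$ (pick I a, pick J b))"
proof -
  have *: "{i. i < dim_row A \<and> i \<in> I} = I" "{j. j < dim_col A \<and> j \<in> J} = J" using A I J by auto
  have "submatrix A I J = Matrix.mat s s (\<lambda>(a, b). A $$ (pick I a, pick J b))"
    by (rule eq_matI) (simp_all add: dim_submatrix submatrix_index * I J)
  then show ?thesis by simp
qed

lemma pick_lessThan: "j < n \<Longrightarrow> pick {..<n} j = j"
proof -
  assume j: "j < n"
  have "pick {..<n} (card {a \<in> {..<n}. a < j}) = j" using j by (intro pick_card_in_set) simp
  moreover have "{a \<in> {..<n}. a < j} = {..<j}" using j by auto
  ultimately show ?thesis by simp
qed

lemma extended_submoduleI:
  fixes f :: "'x \<Rightarrow> 'a :: idom vec"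
  assumes V: "valuation_subring V" and X: "finite X" "\<And>x. x \<in> X \<Longrightarrow> f x \<in> N" "\<And>x. x \<in> X \<Longrightarrow> c x \<in> V"
    and w: "w \<in> carrier_vec r" "\<And>i. i < r \<Longrightarrow> w $ i = (\<Sum>x\<in>X. c x * to_fract (f x $ i))"
  shows "w \<in> extended_submodule V r N"
proof -
  define c' where "c' v = (\<Sum>x\<in>{x\<in>X. f x = v}. c x)" for v
  have "c' ` f ` X \<subseteq> V" unfolding c'_def using X(3) by (auto intro!: valuation_subring_sum[OF V])
  moreover have "\<forall>i<r. w $ i = (\<Sum>v\<in>f ` X. c' v * to_fract (v $ i))"
  proof (intro allI impI)
    fix i assume i: "i < r"
    have "w $ i = (\<Sum>v\<in>f ` X. \<Sum>x\<in>{x\<in>X. f x = v}. c x * to_fract (f x $ i))"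
      unfolding w(2)[OF i] by (rule sum.image_gen[OF X(1)])
    also have "\<dots> = (\<Sum>v\<in>f ` X. c' v * to_fract (v $ i))"
      unfolding c'_def sum_distrib_right by (intro sum.cong refl) auto
    finally show "w $ i = (\<Sum>v\<in>f ` X. c' v * to_fract (v $ i))" .
  qed
  ultimately show ?thesis unfolding extended_submodule_def using X w(1)
    by (intro CollectI conjI exI[of _ "f ` X"] exI[of _ c']) auto
qed

lemma extended_submodule_trans:
  fixes f :: "'x \<Rightarrow> 'a :: idom fract vec"
  assumes V: "V \<in> intermediate_rings" and A: "A \<in> generating_matrices r N"
    and X: "finite X" "\<And>x. x \<in> X \<Longrightarrow> f x \<in> extended_submodule V r N" "\<And>x. x \<in> X \<Longrightarrow> c x \<in> V"
    and w: "w \<in> carrier_vec r" "\<And>i. i < r \<Longrightarrow> w $ i = (\<Sum>x\<in>X. c x * f x $ i)"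
  shows "w \<in> extended_submodule V r N"
proof -
  note VV = intermediate_ringsD[OF V]
  let ?a = "\<lambda>i j. to_fract (A $$ (i, j))"
  have "\<forall>x\<in>X. \<exists>d. (\<forall>j<dim_col A. d j \<in> V) \<and> (\<forall>i<r. (\<Sum>j<dim_col A. ?a i j * d j) = f x $ i)"
    using X(2) unfolding generating_matrix_span[OF V A] in_col_span_def[OF VV(1)] by blast
  from bchoice[OF this] obtain d where
    d: "\<forall>x\<in>X. (\<forall>j<dim_col A. d x j \<in> V) \<and> (\<forall>i<r. (\<Sum>j<dim_col A. ?a i j * d x j) = f x $ i)" ..
  have "in_col_span V r (dim_col A) ?a (\<lambda>i. w $ i)"
  proof (rule in_col_spanI[OF VV(1), of _ "\<lambda>j. \<Sum>x\<in>X. c x * d x j"])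
    show "(\<Sum>x\<in>X. c x * d x j) \<in> V" if "j < dim_col A" for j
      using d X(3) that by (intro valuation_subring_sum[OF VV(1)] valuation_subring_closed(6)[OF VV(1)]) auto
    fix i assume i: "i < r"
    have "(\<Sum>j<dim_col A. ?a i j * (\<Sum>x\<in>X. c x * d x j)) = (\<Sum>x\<in>X. c x * (\<Sum>j<dim_col A. ?a i j * d x j))"
      unfolding sum_distrib_left by (subst sum.swap) (simp add: mult_ac)
    also have "\<dots> = w $ i" unfolding w(2)[OF i] using d i by (intro sum.cong) auto
    finally show "(\<Sum>j<dim_col A. ?a i j * (\<Sum>x\<in>X. c x * d x j)) = w $ i" .
  qed
  then show ?thesis using w(1) by (simp add: generating_matrix_span[OF V A])
qed

section \<open>Modules of maximal rank\<close>

text \<open>This is condition (Q). It mentions no generating matrix, so it links conditions that are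
  stated with different matrices.\<close>

definition monomially_integral :: "nat \<Rightarrow> ('n :: finite) germ vec set \<Rightarrow> bool" where
  "monomially_integral r N \<longleftrightarrow> (\<forall>V\<in>intermediate_rings. \<forall>i<r. \<forall>k. real_exponent k \<in> newton_polyhedron (component N i) \<longrightarrow>
     Matrix.vec r (\<lambda>l. if l = i then to_fract (germ_monomial k) else 0) \<in> extended_submodule V r N)"

text \<open>The form of (Q) in terms of the maximal minors of one fixed matrix. The minor may depend
  on \<open>V\<close> and on the exponents.\<close>

definition minors_dominate :: "nat \<Rightarrow> ('n :: finite) germ mat \<Rightarrow> 'n germ vec set \<Rightarrow> bool" where
  "minors_dominate r A N \<longleftrightarrow> (\<forall>V\<in>intermediate_rings. \<forall>k. (\<forall>i<r. real_exponent (k i) \<in> newton_polyhedron (component N i)) \<longrightarrow>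
     (\<exists>g. (\<forall>b<r. g b < dim_col A) \<and> fun_det r (\<lambda>i b. A $$ (i, g b)) \<noteq> 0 \<and>
       to_fract (germ_monomial (\<Sum>i<r. k i)) / to_fract (fun_det r (\<lambda>i b. A $$ (i, g b))) \<in> V))"

lemma fun_det_diagonal: "fun_det r (\<lambda>l i. if l = i then d i else 0) = (\<Prod>i<r. d i)"
proof -
  have "fun_det r (\<lambda>l i. if l = i then d i else 0) = fun_det r (\<lambda>l i. d l * (if l = i then 1 else 0))"
    by (rule fun_det_cong) auto
  also have "\<dots> = (\<Prod>i<r. d i) * fun_det r (\<lambda>l i. if l = i then 1 else 0)" by (rule fun_det_scale_rows)
  also have "Matrix.mat r r (\<lambda>(l, i). if l = i then 1 else 0) = (1\<^sub>m r :: 'a mat)" by (rule eq_matI) auto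
  finally show ?thesis by simp
qed

text \<open>Maximal rank is expressed by \<open>r\<close> members with nonzero determinant; the
  projections to row sets \<open>L\<close> inherit such members directly from a nonzero minor of
  \<open>M\<close>.\<close>

locale full_rank_module =
  fixes r :: nat and N :: "('n :: finite) germ vec set" and h :: "nat \<Rightarrow> 'n germ vec"
  assumes submodule: "is_submodule r N" and r: "0 < r"
    and h: "\<And>b. b < r \<Longrightarrow> h b \<in> N" and h_det: "fun_det r (\<lambda>i b. h b $ i) \<noteq> 0"
begin

lemma nonzero_component:
  assumes i: "i < r"
  obtains f where "f \<in> component N i" "f \<noteq> 0"
proof -
  have "\<exists>b<r. h b $ i \<noteq> 0"
  proof (rule ccontr)
    assume *: "\<not> ?thesis"
    have "fun_det r (\<lambda>i b. h b $ i) = fun_det r (\<lambda>l b. (if l = i then 0 else 1) * h b $ l)"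
      by (rule fun_det_cong) (use * in auto)
    also have "\<dots> = (\<Prod>l<r. if l = i then 0 else 1) * fun_det r (\<lambda>i b. h b $ i)" by (rule fun_det_scale_rows)
    also have "(\<Prod>l<r. if l = i then 0 else 1 :: 'n germ) = 0" using i by (intro prod_zero) auto
    finally show False using h_det by simp
  qed
  then obtain b where b: "b < r" "h b $ i \<noteq> 0" by blast
  show ?thesis
  proof (rule that)
    show "h b $ i \<in> component N i" unfolding component_def using h[OF b(1)] by (rule imageI)
  qed (rule b(2))
qed

lemma polyhedron_nonempty:
  assumes "i < r"
  obtains k where "real_exponent k \<in> newton_polyhedron (component N i)"
  by (rule nonzero_component[OF assms], rule newton_polyhedron_nonempty, assumption, assumption, rule that)

lemma minimal_exponents:
  assumes V: "V \<in> intermediate_rings"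
  obtains e where "\<And>i. i < r \<Longrightarrow> real_exponent (e i) \<in> newton_polyhedron (component N i)"
    "\<And>i f. i < r \<Longrightarrow> f \<in> monomial_closure (component N i) \<Longrightarrow> to_fract f / to_fract (germ_monomial (e i)) \<in> V"
proof -
  have "\<forall>i\<in>{..<r}. \<exists>e. real_exponent e \<in> newton_polyhedron (component N i) \<and>
      (\<forall>f\<in>monomial_closure (component N i). to_fract f / to_fract (germ_monomial e) \<in> V)"
  proof
    fix i assume "i \<in> {..<r}"
    then have i: "i < r" by simp
    obtain k where k: "real_exponent k \<in> newton_polyhedron (component N i)" by (rule polyhedron_nonempty[OF i], rule that)
    obtain e where e: "real_exponent e \<in> newton_polyhedron (component N i)"
      "\<And>f. f \<in> monomial_closure (component N i) \<Longrightarrow> to_fract f / to_fract (germ_monomial e) \<in> V"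
      by (rule minimal_exponent[OF V k], rule that)
    show "\<exists>e. real_exponent e \<in> newton_polyhedron (component N i) \<and>
      (\<forall>f\<in>monomial_closure (component N i). to_fract f / to_fract (germ_monomial e) \<in> V)"
      by (intro exI[of _ e] conjI ballI e)
  qed
  from bchoice[OF this] obtain e where "\<forall>i\<in>{..<r}. real_exponent (e i) \<in> newton_polyhedron (component N i) \<and>
      (\<forall>f\<in>monomial_closure (component N i). to_fract f / to_fract (germ_monomial (e i)) \<in> V)" ..
  then show ?thesis by (intro that[of e]) simp_all
qed

lemma nonzero_minor_matrix:
  obtains A where "A \<in> generating_matrices r N" "r \<le> dim_col A" "fun_det r (\<lambda>i b. A $$ (i, b)) \<noteq> 0"
proof (rule exists_generating_matrix[OF submodule, of r h])
  show "h b \<in> N" if "b < r" for b using that by (rule h)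
  fix A assume A: "A \<in> generating_matrices r N" "r \<le> dim_col A" "\<And>i b. i < r \<Longrightarrow> b < r \<Longrightarrow> A $$ (i, b) = h b $ i"
  have "fun_det r (\<lambda>i b. A $$ (i, b)) = fun_det r (\<lambda>i b. h b $ i)" by (rule fun_det_cong) (rule A(3))
  then show thesis using A(1,2) h_det by (intro that[of A]) simp_all
qed

lemma monomials_prod_quotient:
  assumes V: "V \<in> intermediate_rings" and f: "\<And>i. i < r \<Longrightarrow> to_fract (f i) / to_fract (germ_monomial (e i)) \<in> V"
  shows "to_fract (\<Prod>i<r. f i) / to_fract (germ_monomial (\<Sum>i<r. e i) :: 'n germ) \<in> V"
proof -
  interpret tf: comm_ring_hom "to_fract :: 'n germ \<Rightarrow> 'n germ fract" by (rule to_fract_hom)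
  have "(\<Prod>i<r. to_fract (f i) / to_fract (germ_monomial (e i))) \<in> V"
    by (intro valuation_subring_prod[OF intermediate_ringsD(1)[OF V]]) (simp add: f)
  then show ?thesis by (simp add: tf.hom_prod germ_monomial_sum prod_dividef)
qed

text \<open>Over \<open>V\<close> all columns of \<open>A\<close> lie in the span of the columns of
  a minor of least valuation. By (Q) so do the columns of the diagonal matrix with the given
  monomials, and taking determinants makes their product a \<open>V\<close>-multiple of that
  minor.\<close>

lemma integral_imp_minors_dominate:
  assumes Q: "monomially_integral r N" and A: "A \<in> generating_matrices r N"
    and g0: "\<And>b. b < r \<Longrightarrow> g0 b < dim_col A" "fun_det r (\<lambda>i b. A $$ (i, g0 b)) \<noteq> 0"
  shows "minors_dominate r A N"
  unfolding minors_dominate_def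
proof (intro ballI allI impI)
  fix V :: "'n germ fract set" and k :: "nat \<Rightarrow> nat ^ 'n"
  assume V: "V \<in> intermediate_rings" and k: "\<forall>i<r. real_exponent (k i) \<in> newton_polyhedron (component N i)"
  note VV = intermediate_ringsD[OF V]
  interpret tf: comm_ring_hom "to_fract :: 'n germ \<Rightarrow> 'n germ fract" by (rule to_fract_hom)
  let ?a = "\<lambda>i j. to_fract (A $$ (i, j))"
  have nz: "fun_det r (\<lambda>i b. ?a i (g0 b)) \<noteq> 0" unfolding fun_det_hom[OF to_fract_hom] using g0(2) by simp
  obtain g where g: "\<And>b. b < r \<Longrightarrow> g b < dim_col A" "fun_det r (\<lambda>i b. ?a i (g b)) \<noteq> 0"
    "\<And>j. j < dim_col A \<Longrightarrow> in_col_span V r r (\<lambda>i b. ?a i (g b)) (\<lambda>i. ?a i j)"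
  proof (rule minimal_minor[OF VV(1), of r g0 "dim_col A" ?a])
    show "g0 b < dim_col A" if "b < r" for b using that by (rule g0(1))
    show "fun_det r (\<lambda>i b. ?a i (g0 b)) \<noteq> 0" by (rule nz)
  qed (rule that)
  obtain d where d: "d \<in> V"
    "fun_det r (\<lambda>l i. if l = i then to_fract (germ_monomial (k i)) else 0) = fun_det r (\<lambda>i b. ?a i (g b)) * d"
  proof (rule fun_det_in_span[OF VV(1)])
    fix i assume i: "i < r"
    have "Matrix.vec r (\<lambda>l. if l = i then to_fract (germ_monomial (k i)) else 0) \<in> extended_submodule V r N"
      using Q V i k unfolding monomially_integral_def by blast
    then have "in_col_span V r (dim_col A) ?a (\<lambda>l. Matrix.vec r (\<lambda>l. if l = i then to_fract (germ_monomial (k i)) else 0) $ l)"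
      unfolding generating_matrix_span[OF V A] by (rule conjunct2)
    then have "in_col_span V r (dim_col A) ?a (\<lambda>l. if l = i then to_fract (germ_monomial (k i)) else 0)"
      unfolding in_col_span_def[OF VV(1)] by simp
    then show "in_col_span V r r (\<lambda>i b. ?a i (g b)) (\<lambda>l. if l = i then to_fract (germ_monomial (k i)) else 0)"
      by (rule in_col_span_trans[OF VV(1)]) (rule g(3))
  qed (rule that)
  have det: "fun_det r (\<lambda>i b. ?a i (g b)) = to_fract (fun_det r (\<lambda>i b. A $$ (i, g b)))" by (rule fun_det_hom[OF to_fract_hom])
  have "to_fract (germ_monomial (\<Sum>i<r. k i)) = to_fract (fun_det r (\<lambda>i b. A $$ (i, g b))) * d"
    using d(2) unfolding fun_det_diagonal det by (simp add: germ_monomial_sum tf.hom_prod)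
  moreover have "to_fract (fun_det r (\<lambda>i b. A $$ (i, g b))) \<noteq> 0" using g(2) unfolding det .
  ultimately show "\<exists>g. (\<forall>b<r. g b < dim_col A) \<and> fun_det r (\<lambda>i b. A $$ (i, g b)) \<noteq> 0 \<and>
       to_fract (germ_monomial (\<Sum>i<r. k i)) / to_fract (fun_det r (\<lambda>i b. A $$ (i, g b))) \<in> V"
    using g(1) d(1) by (intro exI[of _ g]) auto
qed

text \<open>
  Cramer's rule after dividing row \<open>i\<close> by its monomial of minimal valuation.
\<close>

lemma minors_dominate_imp_span:
  assumes dom: "minors_dominate r A N" and A: "A \<in> generating_matrices r N" and V: "V \<in> intermediate_rings"
    and w: "w \<in> carrier_vec r" "\<And>i. i < r \<Longrightarrow> \<exists>k. real_exponent k \<in> newton_polyhedron (component N i) \<and> w $ i / to_fract (germ_monomial k) \<in> V"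
  shows "w \<in> extended_submodule V r N"
proof -
  note VV = intermediate_ringsD[OF V]
  interpret tf: comm_ring_hom "to_fract :: 'n germ \<Rightarrow> 'n germ fract" by (rule to_fract_hom)
  let ?a = "\<lambda>i j. to_fract (A $$ (i, j))" and ?m = "\<lambda>k. to_fract (germ_monomial k) :: 'n germ fract"
  obtain e where e: "\<And>i. i < r \<Longrightarrow> real_exponent (e i) \<in> newton_polyhedron (component N i)"
    "\<And>i f. i < r \<Longrightarrow> f \<in> monomial_closure (component N i) \<Longrightarrow> to_fract f / ?m (e i) \<in> V"
    by (rule minimal_exponents[OF V], rule that)
  have "\<forall>i<r. real_exponent (e i) \<in> newton_polyhedron (component N i)" using e(1) by simp
  then obtain g where g: "\<forall>b<r. g b < dim_col A" "fun_det r (\<lambda>i b. A $$ (i, g b)) \<noteq> 0"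
    "?m (\<Sum>i<r. e i) / to_fract (fun_det r (\<lambda>i b. A $$ (i, g b))) \<in> V"
    using dom V unfolding minors_dominate_def by blast
  let ?F = "\<lambda>i b. ?a i (g b)"
  have det: "fun_det r ?F = to_fract (fun_det r (\<lambda>i b. A $$ (i, g b)))" by (rule fun_det_hom[OF to_fract_hom])
  have nz: "fun_det r ?F \<noteq> 0" unfolding det using g(2) by simp
  have m_sum: "?m (\<Sum>i<r. e i) = (\<Prod>i<r. ?m (e i))" by (simp add: germ_monomial_sum tf.hom_prod)
  obtain c where c: "\<And>i. i < r \<Longrightarrow> (\<Sum>j<r. ?F i j * c j) = w $ i"
    by (rule fun_det_solve[OF nz], rule that)
  have aV: "?a i j / ?m (e i) \<in> V" if "i < r" "j < dim_col A" for i j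
    by (rule e(2)[OF that(1)], rule subsetD[OF monomial_closure_inc], rule generating_matrix_entry[OF A that])
  have wV: "w $ i / ?m (e i) \<in> V" if i: "i < r" for i
  proof -
    from w(2)[OF i] obtain k where k: "real_exponent k \<in> newton_polyhedron (component N i)" "w $ i / ?m k \<in> V" by blast
    have "?m k / ?m (e i) \<in> V" by (rule e(2)[OF i germ_monomial_in_closure[OF k(1)]])
    from valuation_divide_trans[OF VV(1) k(2) this] show ?thesis by simp
  qed
  have "c b \<in> V" if b: "b < r" for b
  proof -
    let ?G = "\<lambda>i j. if j = b then w $ i else ?F i j"
    have "c b * fun_det r ?F = fun_det r ?G" by (rule fun_det_cramer[OF c b, symmetric])
    also have "\<dots> = fun_det r (\<lambda>i j. ?m (e i) * (?G i j / ?m (e i)))" by (rule fun_det_cong) simp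
    also have "\<dots> = ?m (\<Sum>i<r. e i) * fun_det r (\<lambda>i j. ?G i j / ?m (e i))" unfolding m_sum by (rule fun_det_scale_rows)
    finally have "c b = (?m (\<Sum>i<r. e i) / fun_det r ?F) * fun_det r (\<lambda>i j. ?G i j / ?m (e i))"
      using nz by (simp add: field_simps)
    also have "\<dots> \<in> V"
    proof (rule valuation_subring_closed(6)[OF VV(1)])
      show "?m (\<Sum>i<r. e i) / fun_det r ?F \<in> V" unfolding det by (rule g(3))
      show "fun_det r (\<lambda>i j. ?G i j / ?m (e i)) \<in> V"
      proof (rule valuation_subring_fun_det[OF VV(1)])
        fix i j assume "i < r" "j < r"
        then show "?G i j / ?m (e i) \<in> V" using wV[of i] aV[of i "g j"] g(1) by simp
      qed
    qed
    finally show ?thesis .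
  qed
  then have "in_col_span V r r ?F (\<lambda>i. w $ i)" by (rule in_col_spanI[OF VV(1) _ c])
  then have "in_col_span V r (dim_col A) ?a (\<lambda>i. w $ i)"
  proof (rule in_col_span_trans[OF VV(1)])
    fix j assume "j < r"
    then have "g j < dim_col A" using g(1) by simp
    then show "in_col_span V r (dim_col A) ?a (\<lambda>i. ?a i (g j))" by (rule in_col_span_col[OF VV(1)])
  qed
  then show ?thesis using w(1) by (simp add: generating_matrix_span[OF V A])
qed

lemma minors_dominate_imp_integral:
  assumes dom: "minors_dominate r A N" and A: "A \<in> generating_matrices r N"
  shows "monomially_integral r N"
  unfolding monomially_integral_def
proof (intro ballI allI impI)
  fix V :: "'n germ fract set" and i and k :: "nat ^ 'n"
  assume V: "V \<in> intermediate_rings" and i: "i < r" and k: "real_exponent k \<in> newton_polyhedron (component N i)"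
  note VV = intermediate_ringsD[OF V]
  show "Matrix.vec r (\<lambda>l. if l = i then to_fract (germ_monomial k) else 0) \<in> extended_submodule V r N"
  proof (rule minors_dominate_imp_span[OF dom A V])
    fix l assume l: "l < r"
    show "\<exists>k'. real_exponent k' \<in> newton_polyhedron (component N l) \<and>
        Matrix.vec r (\<lambda>l. if l = i then to_fract (germ_monomial k) else 0) $ l / to_fract (germ_monomial k') \<in> V"
    proof (cases "l = i")
      case True
      then show ?thesis using k i valuation_subring_closed(1)[OF VV(1)] by (intro exI[of _ k]) simp
    next
      case False
      obtain k' where "real_exponent k' \<in> newton_polyhedron (component N l)" by (rule polyhedron_nonempty[OF l], rule that)
      then show ?thesis using False l valuation_subring_closed(2)[OF VV(1)] by (intro exI[of _ k']) simp
    qed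
  qed simp
qed

lemma minors_dominate_iff:
  assumes "A \<in> generating_matrices r N" "\<And>b. b < r \<Longrightarrow> g0 b < dim_col A" "fun_det r (\<lambda>i b. A $$ (i, g0 b)) \<noteq> 0"
  shows "minors_dominate r A N \<longleftrightarrow> monomially_integral r N"
  using minors_dominate_imp_integral[OF _ assms(1)] integral_imp_minors_dominate[OF _ assms] by (rule iffI)

text \<open>Row by row: an entry of an integral vector is a \<open>V\<close>-combination of entries
  of that row, hence a \<open>V\<close>-multiple of its minimal monomial, and the monomial closure
  of the row ideal is integrally closed.\<close>

lemma integral_closure_subset:
  "integral_closure r N \<subseteq> direct_sum r (\<lambda>i. monomial_closure (component N i))"
proof
  fix x assume x: "x \<in> integral_closure r N"
  then have dim: "x \<in> carrier_vec r" by (simp add: integral_closure_def)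
  have "x $ i \<in> monomial_closure (component N i)" if i: "i < r" for i
  proof (rule monomial_closure_integrally_closed)
    fix V :: "'n germ fract set" assume V: "V \<in> intermediate_rings"
    note VV = intermediate_ringsD[OF V]
    obtain e where e: "\<And>i. i < r \<Longrightarrow> real_exponent (e i) \<in> newton_polyhedron (component N i)"
      "\<And>i f. i < r \<Longrightarrow> f \<in> monomial_closure (component N i) \<Longrightarrow> to_fract f / to_fract (germ_monomial (e i)) \<in> V"
      by (rule minimal_exponents[OF V], rule that)
    have "map_vec to_fract x \<in> extended_submodule V r N" using x V by (simp add: integral_closure_def)
    then obtain S c where S: "finite S" "S \<subseteq> N" "c ` S \<subseteq> V"
      "\<forall>i<r. map_vec to_fract x $ i = (\<Sum>m\<in>S. c m * to_fract (m $ i))"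
      unfolding extended_submodule_def by (elim CollectE conjE exE)
    have "to_fract (x $ i) = (\<Sum>m\<in>S. c m * to_fract (m $ i))" using S(4) i dim by simp
    then have "to_fract (x $ i) / to_fract (germ_monomial (e i)) =
        (\<Sum>m\<in>S. c m * (to_fract (m $ i) / to_fract (germ_monomial (e i))))"
      by (simp add: sum_divide_distrib)
    also have "\<dots> \<in> V"
    proof (intro valuation_subring_sum[OF VV(1)] valuation_subring_closed(6)[OF VV(1)] e(2) i subsetD[OF monomial_closure_inc])
      fix m assume "m \<in> S"
      then show "c m \<in> V" "m $ i \<in> component N i" using S(2,3) by (auto simp: component_def)
    qed
    finally show "dominated V {germ_monomial k | k. real_exponent k \<in> newton_polyhedron (component N i)} (x $ i)"
      unfolding dominated_def using e(1)[OF i] germ_monomial_nonzero by blast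
  qed
  with dim show "x \<in> direct_sum r (\<lambda>i. monomial_closure (component N i))" by (simp add: direct_sum_def)
qed

text \<open>One inclusion always holds. Equality gives (Q) on the vectors with a single monomial
  entry; conversely (Q) bounds the minors, which suffices for every vector whose entries are
  \<open>V\<close>-multiples of row monomials, in particular for those with entries in the monomial
  closures.\<close>

lemma integral_closure_eq_iff:
  "integral_closure r N = direct_sum r (\<lambda>i. monomial_closure (component N i)) \<longleftrightarrow> monomially_integral r N"
proof
  assume eq: "integral_closure r N = direct_sum r (\<lambda>i. monomial_closure (component N i))"
  show "monomially_integral r N"
    unfolding monomially_integral_def
  proof (intro ballI allI impI)
    fix V :: "'n germ fract set" and i k
    assume V: "V \<in> intermediate_rings" and i: "i < r" and k: "real_exponent k \<in> newton_polyhedron (component N i)"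
    let ?v = "Matrix.vec r (\<lambda>l. if l = i then germ_monomial k else 0) :: 'n germ vec"
    have "?v \<in> direct_sum r (\<lambda>i. monomial_closure (component N i))"
      using germ_monomial_in_closure[OF k] by (auto simp: direct_sum_def monomial_closure_0)
    then have "map_vec to_fract ?v \<in> extended_submodule V r N"
      unfolding eq[symmetric] using V by (simp add: integral_closure_def)
    moreover have "map_vec to_fract ?v = Matrix.vec r (\<lambda>l. if l = i then to_fract (germ_monomial k) else 0)"
      by (intro eq_vecI) auto
    ultimately show "Matrix.vec r (\<lambda>l. if l = i then to_fract (germ_monomial k) else 0) \<in> extended_submodule V r N" by simp
  qed
next
  assume Q: "monomially_integral r N"
  obtain A where A: "A \<in> generating_matrices r N" "r \<le> dim_col A" "fun_det r (\<lambda>i b. A $$ (i, b)) \<noteq> 0"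
    by (rule nonzero_minor_matrix, rule that)
  have dom: "minors_dominate r A N"
    by (rule integral_imp_minors_dominate[OF Q A(1), of "\<lambda>b. b"]) (use A(2,3) in auto)
  have "direct_sum r (\<lambda>i. monomial_closure (component N i)) \<subseteq> integral_closure r N"
  proof
    fix x assume x: "x \<in> direct_sum r (\<lambda>i. monomial_closure (component N i))"
    then have dim: "x \<in> carrier_vec r" by (simp add: direct_sum_def)
    have "map_vec to_fract x \<in> extended_submodule V r N" if V: "V \<in> intermediate_rings" for V
    proof (rule minors_dominate_imp_span[OF dom A(1) V])
      show "map_vec to_fract x \<in> carrier_vec r" using dim by simp
      fix i assume i: "i < r"
      obtain e where e: "\<And>i. i < r \<Longrightarrow> real_exponent (e i) \<in> newton_polyhedron (component N i)"
        "\<And>i f. i < r \<Longrightarrow> f \<in> monomial_closure (component N i) \<Longrightarrow> to_fract f / to_fract (germ_monomial (e i)) \<in> V"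
        by (rule minimal_exponents[OF V], rule that)
      have "x $ i \<in> monomial_closure (component N i)" using x i by (simp add: direct_sum_def)
      from e(2)[OF i this] e(1)[OF i] dim i
      show "\<exists>k. real_exponent k \<in> newton_polyhedron (component N i) \<and> map_vec to_fract x $ i / to_fract (germ_monomial k) \<in> V"
        by (intro exI[of _ "e i"]) simp
    qed
    with dim show "x \<in> integral_closure r N" by (simp add: integral_closure_def)
  qed
  then show "integral_closure r N = direct_sum r (\<lambda>i. monomial_closure (component N i))"
    using integral_closure_subset by (rule equalityI[rotated])
qed

text \<open>Both ideals are compared through their generators, by domination over each
  \<open>V\<close>. The products of row germs always dominate the minors; that the minors dominate
  these products is the condition on the minors of one matrix.\<close>

lemma minors_ideal_closure_iff:
  "ideal_integral_closure (minors_ideal r r N) =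
    ideal_integral_closure (generated_ideal {\<Prod>i<r. f i | f. \<forall>i<r. f i \<in> monomial_closure (component N i)}) \<longleftrightarrow>
    monomially_integral r N"
proof -
  define S where "S = {Determinant.det (submatrix A I J) | A I J. A \<in> generating_matrices r N \<and>
        I \<subseteq> {..<dim_row A} \<and> J \<subseteq> {..<dim_col A} \<and> card I = r \<and> card J = r}"
  define T where "T = {\<Prod>i<r. f i | f. \<forall>i<r. f i \<in> monomial_closure (component N i)}"
  interpret tf: comm_ring_hom "to_fract :: 'n germ \<Rightarrow> 'n germ fract" by (rule to_fract_hom)
  let ?m = "\<lambda>k. to_fract (germ_monomial k) :: 'n germ fract"
  obtain A where A: "A \<in> generating_matrices r N" "r \<le> dim_col A" "fun_det r (\<lambda>i b. A $$ (i, b)) \<noteq> 0"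
    by (rule nonzero_minor_matrix, rule that)
  have S_minor: "fun_det r (\<lambda>i b. B $$ (i, pick J b)) \<in> S"
    if B: "B \<in> generating_matrices r N" "J \<subseteq> {..<dim_col B}" "card J = r" for B J
  proof -
    have "Determinant.det (submatrix B {..<r} J) = fun_det r (\<lambda>i b. B $$ (pick {..<r} i, pick J b))"
      by (rule submatrix_det[OF generating_matrixD(1)[OF B(1)]]) (use B in auto)
    also have "\<dots> = fun_det r (\<lambda>i b. B $$ (i, pick J b))" by (rule fun_det_cong) (simp add: pick_lessThan)
    finally show ?thesis unfolding S_def using B generating_matrixD(3)[OF B(1)]
      by (intro CollectI exI[of _ B] exI[of _ "{..<r}"] exI[of _ J]) auto
  qed
  have S_cases: "\<exists>B J. B \<in> generating_matrices r N \<and> J \<subseteq> {..<dim_col B} \<and> card J = r \<and>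
      x = fun_det r (\<lambda>i b. B $$ (i, pick J b))" if "x \<in> S" for x
  proof -
    from that obtain B I J where B: "x = Determinant.det (submatrix B I J)" "B \<in> generating_matrices r N"
      "I \<subseteq> {..<dim_row B}" "J \<subseteq> {..<dim_col B}" "card I = r" "card J = r" unfolding S_def by blast
    note BD = generating_matrixD(1,3)[OF B(2)]
    have I: "I = {..<r}" using B(3,5) BD(2) by (intro card_subset_eq) auto
    have "x = fun_det r (\<lambda>i b. B $$ (pick I i, pick J b))"
      unfolding B(1) by (rule submatrix_det[OF BD(1)]) (use B(3-6) BD(2) in auto)
    also have "\<dots> = fun_det r (\<lambda>i b. B $$ (i, pick J b))" unfolding I by (rule fun_det_cong) (simp add: pick_lessThan)
    finally show ?thesis using B by (intro exI[of _ B] exI[of _ J]) auto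
  qed
  have pickJ: "pick J b \<in> J" if "J \<subseteq> {..<m :: nat}" "card J = r" "b < r" for J m b
  proof -
    have "finite J" using that(1) by (rule finite_subset) simp
    moreover have "pick J b \<in> pick J ` {..<card J}" using that(2,3) by simp
    ultimately show ?thesis using pick_bij(2) by blast
  qed
  have T_monomial: "germ_monomial (\<Sum>i<r. k i) \<in> T"
    if "\<forall>i<r. real_exponent (k i) \<in> newton_polyhedron (component N i)" for k
    unfolding T_def germ_monomial_sum using that
    by (intro CollectI exI[of _ "\<lambda>i. germ_monomial (k i)"] conjI allI impI refl germ_monomial_in_closure) simp
  \<comment> \<open>Dividing row \<open>i\<close> by its monomial of least valuation leaves entries
    in \<open>V\<close>, so every minor is a \<open>V\<close>-multiple of the product of these
    monomials.\<close>
  have ST: "dominated V T x" if V: "V \<in> intermediate_rings" and x: "x \<in> S" for V x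
  proof -
    note VV = intermediate_ringsD[OF V]
    from S_cases[OF x] obtain B J where B: "B \<in> generating_matrices r N" "J \<subseteq> {..<dim_col B}" "card J = r"
      "x = fun_det r (\<lambda>i b. B $$ (i, pick J b))" by (elim exE conjE)
    obtain e where e: "\<And>i. i < r \<Longrightarrow> real_exponent (e i) \<in> newton_polyhedron (component N i)"
      "\<And>i f. i < r \<Longrightarrow> f \<in> monomial_closure (component N i) \<Longrightarrow> to_fract f / ?m (e i) \<in> V"
      by (rule minimal_exponents[OF V], rule that)
    have "to_fract x = fun_det r (\<lambda>i b. to_fract (B $$ (i, pick J b)))" unfolding B(4) by (rule fun_det_hom[OF to_fract_hom, symmetric])
    also have "\<dots> = fun_det r (\<lambda>i b. ?m (e i) * (to_fract (B $$ (i, pick J b)) / ?m (e i)))" by (rule fun_det_cong) simp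
    also have "\<dots> = (\<Prod>i<r. ?m (e i)) * fun_det r (\<lambda>i b. to_fract (B $$ (i, pick J b)) / ?m (e i))"
      by (rule fun_det_scale_rows)
    also have "(\<Prod>i<r. ?m (e i)) = ?m (\<Sum>i<r. e i)" by (simp add: germ_monomial_sum tf.hom_prod)
    finally have "to_fract x / ?m (\<Sum>i<r. e i) = fun_det r (\<lambda>i b. to_fract (B $$ (i, pick J b)) / ?m (e i))" by simp
    also have "\<dots> \<in> V"
    proof (rule valuation_subring_fun_det[OF VV(1)])
      fix i b assume ib: "i < r" "b < r"
      have "pick J b < dim_col B" using pickJ[OF B(2,3) ib(2)] B(2) by blast
      then have "B $$ (i, pick J b) \<in> component N i" by (rule generating_matrix_entry[OF B(1) ib(1)])
      then have "B $$ (i, pick J b) \<in> monomial_closure (component N i)" by (rule subsetD[OF monomial_closure_inc])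
      then show "to_fract (B $$ (i, pick J b)) / ?m (e i) \<in> V" by (rule e(2)[OF ib(1)])
    qed
    finally have "to_fract x / ?m (\<Sum>i<r. e i) \<in> V" .
    moreover have "germ_monomial (\<Sum>i<r. e i) \<in> T" using e(1) by (intro T_monomial) simp
    ultimately show ?thesis unfolding dominated_def using germ_monomial_nonzero by blast
  qed
  have "(\<forall>V\<in>intermediate_rings. (\<forall>x\<in>S. dominated V T x) \<and> (\<forall>x\<in>T. dominated V S x)) \<longleftrightarrow> minors_dominate r A N"
  proof
    assume *: "\<forall>V\<in>intermediate_rings. (\<forall>x\<in>S. dominated V T x) \<and> (\<forall>x\<in>T. dominated V S x)"
    show "minors_dominate r A N"
      unfolding minors_dominate_def
    proof (intro ballI allI impI)
      fix V :: "'n germ fract set" and k :: "nat \<Rightarrow> nat ^ 'n"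
      assume V: "V \<in> intermediate_rings" and k: "\<forall>i<r. real_exponent (k i) \<in> newton_polyhedron (component N i)"
      note VV = intermediate_ringsD[OF V]
      let ?a = "\<lambda>i j. to_fract (A $$ (i, j))"
      have "dominated V S (germ_monomial (\<Sum>i<r. k i))" using * V T_monomial[OF k] by blast
      then obtain x where x: "x \<in> S" "x \<noteq> 0" "?m (\<Sum>i<r. k i) / to_fract x \<in> V"
        by (auto simp: dominated_def)
      from S_cases[OF x(1)] obtain B J where B: "B \<in> generating_matrices r N" "J \<subseteq> {..<dim_col B}" "card J = r"
        "x = fun_det r (\<lambda>i b. B $$ (i, pick J b))" by (elim exE conjE)
      have nz: "fun_det r (\<lambda>i b. ?a i b) \<noteq> 0" unfolding fun_det_hom[OF to_fract_hom] using A(3) by simp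
      \<comment> \<open>The dominating minor may belong to any generating matrix \<open>B\<close>.
        Its columns lie in the module, so over \<open>V\<close> it is a multiple of the minimal
        minor of \<open>A\<close>, which dominates as well.\<close>
      obtain g where g: "\<And>b. b < r \<Longrightarrow> g b < dim_col A" "fun_det r (\<lambda>i b. ?a i (g b)) \<noteq> 0"
        "\<And>j. j < dim_col A \<Longrightarrow> in_col_span V r r (\<lambda>i b. ?a i (g b)) (\<lambda>i. ?a i j)"
      proof (rule minimal_minor[OF VV(1), of r "\<lambda>b. b" "dim_col A" ?a])
        show "b < dim_col A" if "b < r" for b using that A(2) by simp
        show "fun_det r (\<lambda>i b. ?a i b) \<noteq> 0" by (rule nz)
      qed (rule that)
      obtain d where d: "d \<in> V" "fun_det r (\<lambda>i b. to_fract (B $$ (i, pick J b))) = fun_det r (\<lambda>i b. ?a i (g b)) * d"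
      proof (rule fun_det_in_span[OF VV(1), of r "\<lambda>i b. ?a i (g b)" "\<lambda>i b. to_fract (B $$ (i, pick J b))"])
        fix b assume b: "b < r"
        have pb: "pick J b < dim_col B" using pickJ[OF B(2,3) b] B(2) by blast
        have "map_vec to_fract (col B (pick J b)) \<in> extended_submodule V r N"
        proof (rule extended_submoduleI[OF VV(1), of "{()}" "\<lambda>_. col B (pick J b)" _ "\<lambda>_. 1"])
          show "col B (pick J b) \<in> N" by (rule generating_matrix_col[OF B(1) pb])
          show "1 \<in> V" by (rule valuation_subring_closed(1)[OF VV(1)])
          show "map_vec to_fract (col B (pick J b)) \<in> carrier_vec r"
            using generating_matrixD(3)[OF B(1)] by (intro carrier_vecI) simp
          show "map_vec to_fract (col B (pick J b)) $ i = (\<Sum>x\<in>{()}. 1 * to_fract (col B (pick J b) $ i))" if "i < r" for i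
            using that generating_matrixD(3)[OF B(1)] by simp
        qed simp
        then have "in_col_span V r (dim_col A) ?a (\<lambda>i. map_vec to_fract (col B (pick J b)) $ i)"
          unfolding generating_matrix_span[OF V A(1)] by (rule conjunct2)
        then have "in_col_span V r (dim_col A) ?a (\<lambda>i. to_fract (B $$ (i, pick J b)))"
          unfolding in_col_span_def[OF VV(1)] using generating_matrixD(3)[OF B(1)] pb by simp
        then show "in_col_span V r r (\<lambda>i b. ?a i (g b)) (\<lambda>i. to_fract (B $$ (i, pick J b)))"
          by (rule in_col_span_trans[OF VV(1)]) (rule g(3))
      qed (rule that)
      have det: "fun_det r (\<lambda>i b. ?a i (g b)) = to_fract (fun_det r (\<lambda>i b. A $$ (i, g b)))" by (rule fun_det_hom[OF to_fract_hom])
      have "to_fract x = to_fract (fun_det r (\<lambda>i b. A $$ (i, g b))) * d"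
        using d(2) unfolding B(4) det fun_det_hom[OF to_fract_hom] .
      then have "to_fract x / to_fract (fun_det r (\<lambda>i b. A $$ (i, g b))) \<in> V" using g(2) d(1) unfolding det by simp
      then have "?m (\<Sum>i<r. k i) / to_fract (fun_det r (\<lambda>i b. A $$ (i, g b))) \<in> V"
        by (rule valuation_divide_trans[OF VV(1) x(3)]) (use x(2) in simp)
      then show "\<exists>g. (\<forall>b<r. g b < dim_col A) \<and> fun_det r (\<lambda>i b. A $$ (i, g b)) \<noteq> 0 \<and>
         ?m (\<Sum>i<r. k i) / to_fract (fun_det r (\<lambda>i b. A $$ (i, g b))) \<in> V"
        using g(1,2) unfolding det by (intro exI[of _ g]) auto
    qed
  next
    assume dom: "minors_dominate r A N"
    have "dominated V S x" if V: "V \<in> intermediate_rings" and x: "x \<in> T" for V x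
    proof -
      note VV = intermediate_ringsD[OF V]
      let ?a = "\<lambda>i j. to_fract (A $$ (i, j))"
      from x obtain f where f: "x = (\<Prod>i<r. f i)" "\<forall>i<r. f i \<in> monomial_closure (component N i)" unfolding T_def by blast
      obtain e where e: "\<And>i. i < r \<Longrightarrow> real_exponent (e i) \<in> newton_polyhedron (component N i)"
        "\<And>i f. i < r \<Longrightarrow> f \<in> monomial_closure (component N i) \<Longrightarrow> to_fract f / ?m (e i) \<in> V"
        by (rule minimal_exponents[OF V], rule that)
      have xV: "to_fract x / ?m (\<Sum>i<r. e i) \<in> V" unfolding f(1)
        by (rule monomials_prod_quotient[OF V]) (rule e(2), assumption, use f(2) in blast)
      have "\<forall>i<r. real_exponent (e i) \<in> newton_polyhedron (component N i)" using e(1) by simp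
      then obtain g where g: "\<forall>b<r. g b < dim_col A" "fun_det r (\<lambda>i b. A $$ (i, g b)) \<noteq> 0"
        "?m (\<Sum>i<r. e i) / to_fract (fun_det r (\<lambda>i b. A $$ (i, g b))) \<in> V"
        using dom V unfolding minors_dominate_def by blast
      \<comment> \<open>The generators of the minors ideal list their columns in increasing order;
        the minor for \<open>g\<close> is a \<open>V\<close>-multiple of the one with the same
        columns sorted.\<close>
      define J where "J = g ` {..<r}"
      have nz: "fun_det r (\<lambda>i b. ?a i (g b)) \<noteq> 0" unfolding fun_det_hom[OF to_fract_hom] using g(2) by simp
      have "inj_on g {..<r}" using fun_det_nonzero_inj(2)[of r "\<lambda>i j. ?a i j" "\<lambda>i. i" g] nz by simp
      then have J: "J \<subseteq> {..<dim_col A}" "card J = r" using g(1) by (auto simp: J_def card_image)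
      let ?x = "fun_det r (\<lambda>i b. A $$ (i, pick J b))"
      obtain d where d: "d \<in> V" "fun_det r (\<lambda>i b. ?a i (g b)) = fun_det r (\<lambda>i b. ?a i (pick J b)) * d"
      proof (rule fun_det_in_span[OF VV(1), of r "\<lambda>i b. ?a i (pick J b)" "\<lambda>i b. ?a i (g b)"])
        fix b assume b: "b < r"
        have "pick J ` {..<r} = J" using pick_bij(2)[of J] J by (simp add: J_def)
        moreover have "g b \<in> J" using b by (simp add: J_def)
        ultimately obtain b' where b': "b' < r" "g b = pick J b'" by blast
        have "in_col_span V r r (\<lambda>i b. ?a i (pick J b)) (\<lambda>i. ?a i (pick J b'))"
          by (rule in_col_span_col[OF VV(1) b'(1)])
        then show "in_col_span V r r (\<lambda>i b. ?a i (pick J b)) (\<lambda>i. ?a i (g b))" by (simp add: b'(2))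
      qed (rule that)
      have eq: "to_fract (fun_det r (\<lambda>i b. A $$ (i, g b))) = to_fract ?x * d"
        using d(2) unfolding fun_det_hom[OF to_fract_hom] .
      have nzx: "?x \<noteq> 0"
      proof
        assume "?x = 0"
        then show False using eq g(2) by simp
      qed
      have "to_fract (fun_det r (\<lambda>i b. A $$ (i, g b))) / to_fract ?x \<in> V" unfolding eq using nzx d(1) by simp
      then have "?m (\<Sum>i<r. e i) / to_fract ?x \<in> V"
        by (rule valuation_divide_trans[OF VV(1) g(3)]) (use g(2) in simp)
      then have "to_fract x / to_fract ?x \<in> V"
        by (rule valuation_divide_trans[OF VV(1) xV]) simp
      then show ?thesis unfolding dominated_def using S_minor[OF A(1) J] nzx by blast
    qed
    then show "\<forall>V\<in>intermediate_rings. (\<forall>x\<in>S. dominated V T x) \<and> (\<forall>x\<in>T. dominated V S x)" by (intro ballI conjI ST)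
  qed
  moreover have "minors_dominate r A N \<longleftrightarrow> monomially_integral r N"
    by (rule minors_dominate_iff[OF A(1), of "\<lambda>b. b"]) (use A(2,3) in auto)
  ultimately show ?thesis
    unfolding minors_ideal_def S_def[symmetric] T_def[symmetric] ideal_integral_closure_eq_iff by simp
qed

end

text \<open>The columns of a largest nonzero minor form a basis of the column space. If that minor
  had size \<open>r\<close>, its rows would be all the rows in some order, and reordering would give
  a nonzero minor of the forbidden kind.\<close>

lemma rank_less_iff:
  fixes e :: "nat \<Rightarrow> nat \<Rightarrow> 'a :: field"
  assumes r: "0 < r"
  shows "vec_space.rank r (Matrix.mat r m (\<lambda>(i, j). e i j)) < r \<longleftrightarrow>
    (\<forall>g. (\<forall>b<r. g b < m) \<longrightarrow> fun_det r (\<lambda>i b. e i (g b)) = 0)"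
proof -
  define A where "A = Matrix.mat r m (\<lambda>(i, j). e i j)"
  define W where "W = set (cols A)"
  have dim: "dim_row A = r" "dim_col A = m" by (simp_all add: A_def)
  have W: "W \<subseteq> carrier_vec r" using cols_dim[of A] by (simp add: W_def dim)
  have colW: "col A j \<in> W" if "j < m" for j
    using that nth_mem[of j "cols A"] by (simp add: W_def dim)
  have W_col: "\<exists>j. j < m \<and> v = col A j" if "v \<in> W" for v
  proof -
    from that obtain j where "j < length (cols A)" "cols A ! j = v" unfolding W_def in_set_conv_nth by blast
    then show ?thesis by (intro exI[of _ j]) (simp add: dim)
  qed
  have col: "col A j $ i = e i j" if "i < r" "j < m" for i j using that by (simp add: A_def)
  have rank: "vec_space.rank r A = vectorspace.dim class_ring (LinearCombinations.module.span_vs class_ring (module_vec TYPE('a) r) W)"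
    by (simp add: vec_space.rank_def W_def)
  have "vec_space.rank r A < r \<longleftrightarrow> (\<forall>g. (\<forall>b<r. g b < m) \<longrightarrow> fun_det r (\<lambda>i b. e i (g b)) = 0)"
  proof (intro iffI allI impI)
    fix g assume less: "vec_space.rank r A < r" and g: "\<forall>b<r. g b < m"
    show "fun_det r (\<lambda>i b. e i (g b)) = 0"
    proof (rule ccontr)
      assume nz: "fun_det r (\<lambda>i b. e i (g b)) \<noteq> 0"
      have "r \<le> vec_space.rank r A"
      proof (rule exists_maximal_minor[OF W r, of "\<lambda>b. col A (g b)" "\<lambda>i. i"])
        have "fun_det r (\<lambda>a b. col A (g b) $ a) = fun_det r (\<lambda>i b. e i (g b))"
          by (rule fun_det_cong) (rule col, assumption, use g in blast)
        then show "fun_det r (\<lambda>a b. col A (g b) $ a) \<noteq> 0" using nz by simp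
        show "col A (g b) \<in> W" if "b < r" for b using g that by (intro colW) simp
      qed (simp_all add: rank)
      then show False using less by simp
    qed
  next
    assume zero: "\<forall>g. (\<forall>b<r. g b < m) \<longrightarrow> fun_det r (\<lambda>i b. e i (g b)) = 0"
    show "vec_space.rank r A < r"
    \<comment> \<open>The growth of minors has to start from a nonzero entry, so the zero matrix is
      treated apart.\<close>
    proof (cases "\<forall>i<r. \<forall>j<m. e i j = 0")
      case True
      then have "A = 0\<^sub>m r m" by (intro eq_matI) (simp_all add: A_def)
      then show ?thesis using r by (simp add: vec_space.rank_0I)
    next
      case False
      then obtain i0 j0 where ij: "i0 < r" "j0 < m" "e i0 j0 \<noteq> 0" by blast
      obtain s f g where s: "1 \<le> s" "fun_det s (\<lambda>a b. g b $ f a) \<noteq> 0" "\<And>a. a < s \<Longrightarrow> f a < r"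
        "\<And>b. b < s \<Longrightarrow> g b \<in> W" "vec_space.rank r A = s"
      proof (rule exists_maximal_minor[OF W, of 1 "\<lambda>_. col A j0" "\<lambda>_. i0"])
        have "fun_det 1 (\<lambda>a b. col A j0 $ i0) = e i0 j0" using col[OF ij(1,2)] by (simp add: det_single)
        then show "fun_det 1 (\<lambda>a b. col A j0 $ i0) \<noteq> 0" using ij(3) by simp
        show "i0 < r" by (rule ij)
        show "col A j0 \<in> W" by (rule colW[OF ij(2)])
      qed (simp, rule that, simp_all add: rank)
      have inj: "inj_on f {..<s}" using fun_det_nonzero_inj(1)[of s "\<lambda>i v. v $ i" f g] s(2) by simp
      have sub: "f ` {..<s} \<subseteq> {..<r}" using s(3) by auto
      have "s \<le> r" using card_inj_on_le[OF inj sub] by simp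
      moreover have "s \<noteq> r"
      proof
        assume sr: "s = r"
        have onto: "f ` {..<r} = {..<r}" by (rule endo_inj_surj) (use sub inj sr in auto)
        have "\<forall>b\<in>{..<r}. \<exists>j. j < m \<and> g b = col A j" using W_col s(4) sr by blast
        from bchoice[OF this] obtain j where j: "\<forall>b\<in>{..<r}. j b < m \<and> g b = col A (j b)" ..
        have "fun_det r (\<lambda>a b. e (f a) (j b)) = fun_det r (\<lambda>a b. g b $ f a)"
        proof (rule fun_det_cong)
          fix a b assume "a < r" "b < r"
          then show "e (f a) (j b) = g b $ f a" using j col[of "f a" "j b"] s(3)[of a] sr by simp
        qed
        then have nz: "fun_det r (\<lambda>a b. e (f a) (j b)) \<noteq> 0" using s(2) sr by simp
        have injj: "inj_on j {..<r}" using fun_det_nonzero_inj(2)[of r e f j] nz by simp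
        have "fun_det r (\<lambda>a b. e a (j b)) \<noteq> 0"
        proof (rule fun_det_reindex[where F = e and f = f and f' = "\<lambda>i. i" and g = j and g' = j])
          show "f ` {..<r} = (\<lambda>i. i) ` {..<r}" using onto by simp
        qed (rule injj refl nz)+
        then show False using zero j by simp
      qed
      ultimately show ?thesis unfolding s(5) by simp
    qed
  qed
  then show ?thesis by (simp only: A_def)
qed

text \<open>Failure of the rank condition at a point of the torus means that all restricted maximal
  minors vanish there. The two dominance theorems translate this for a fixed matrix, and the
  matrix-free (Q) removes the dependence on its choice.\<close>

lemma (in full_rank_module) nondegenerate_iff:
  "newton_nondegenerate_full_rank r N \<longleftrightarrow> monomially_integral r N"
proof -
  let ?P = "\<lambda>i. newton_polyhedron (component N i)"
  have prod0: "(\<Prod>t\<in>UNIV. vec_nth x t) = 0 \<longleftrightarrow> (\<exists>t. vec_nth x t = 0)" for x :: "complex ^ 'n" by simp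
  show ?thesis
  proof
    assume "newton_nondegenerate_full_rank r N"
    then obtain A where A: "A \<in> generating_matrices r N"
      "\<forall>\<Delta>\<in>compact_faces (module_newton_polyhedron r N). \<forall>D. (\<forall>i<r. D i \<in> compact_faces (?P i)) \<longrightarrow> \<Delta> = (\<Sum>i<r. D i) \<longrightarrow>
        {x. vec_space.rank r (Matrix.mat r (dim_col A) (\<lambda>(i, j). restricted_eval (A $$ (i, j)) (D i) x)) < r}
          \<subseteq> {x. (\<Prod>i\<in>UNIV. vec_nth x i) = 0}"
      unfolding newton_nondegenerate_full_rank_def ..
    have "minors_dominate r A N"
      unfolding minors_dominate_def
    proof (intro ballI allI impI)
      fix V :: "'n germ fract set" and k
      assume V: "V \<in> intermediate_rings" and k: "\<forall>i<r. real_exponent (k i) \<in> ?P i"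
      show "\<exists>g. (\<forall>b<r. g b < dim_col A) \<and> fun_det r (\<lambda>i b. A $$ (i, g b)) \<noteq> 0 \<and>
         to_fract (germ_monomial (\<Sum>i<r. k i)) / to_fract (fun_det r (\<lambda>i b. A $$ (i, g b))) \<in> V"
      proof (rule nondegenerate_minor_dominates[where I = "component N"])
        show "A $$ (i, j) \<in> component N i" if "i < r" "j < dim_col A" for i j
          by (rule generating_matrix_entry[OF A(1) that])
        show "real_exponent (k i) \<in> ?P i" if "i < r" for i using k that by simp
        fix D and y :: "complex ^ 'n"
        assume D: "\<And>i. i < r \<Longrightarrow> D i \<in> compact_faces (?P i)" "(\<Sum>i<r. D i) \<in> compact_faces (\<Sum>i<r. ?P i)"
          and y: "\<And>t. vec_nth y t \<noteq> 0"
        have D1: "\<forall>i<r. D i \<in> compact_faces (?P i)" by (intro allI impI D(1))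
        have D2: "(\<Sum>i<r. D i) \<in> compact_faces (module_newton_polyhedron r N)"
          unfolding module_newton_polyhedron_def by (rule D(2))
        have "y \<notin> {x. (\<Prod>i\<in>UNIV. vec_nth x i) = 0}" using y by simp
        then have "\<not> vec_space.rank r (Matrix.mat r (dim_col A) (\<lambda>(i, j). restricted_eval (A $$ (i, j)) (D i) y)) < r"
          using A(2)[rule_format, OF D2, of D] D1 by blast
        then show "\<exists>g. (\<forall>b<r. g b < dim_col A) \<and> fun_det r (\<lambda>i b. restricted_eval (A $$ (i, g b)) (D i) y) \<noteq> 0"
          unfolding rank_less_iff[OF r] by blast
      qed (rule V)
    qed
    then show "monomially_integral r N" by (rule minors_dominate_imp_integral[OF _ A(1)])
  next
    assume Q: "monomially_integral r N"
    obtain A where A: "A \<in> generating_matrices r N" "r \<le> dim_col A" "fun_det r (\<lambda>i b. A $$ (i, b)) \<noteq> 0"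
      by (rule nonzero_minor_matrix, rule that)
    have dom: "minors_dominate r A N"
      by (rule integral_imp_minors_dominate[OF Q A(1), of "\<lambda>b. b"]) (use A(2,3) in auto)
    show "newton_nondegenerate_full_rank r N"
      unfolding newton_nondegenerate_full_rank_def
    proof (intro bexI[OF _ A(1)] ballI allI impI subsetI)
      fix \<Delta> D and y :: "complex ^ 'n"
      assume \<Delta>: "\<Delta> \<in> compact_faces (module_newton_polyhedron r N)" "\<Delta> = (\<Sum>i<r. D i)"
        and D: "\<forall>i<r. D i \<in> compact_faces (?P i)"
        and y: "y \<in> {x. vec_space.rank r (Matrix.mat r (dim_col A) (\<lambda>(i, j). restricted_eval (A $$ (i, j)) (D i) x)) < r}"
      show "y \<in> {x. (\<Prod>i\<in>UNIV. vec_nth x i) = 0}"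
      proof (rule ccontr)
        assume "y \<notin> {x. (\<Prod>i\<in>UNIV. vec_nth x i) = 0}"
        then have y0: "vec_nth y t \<noteq> 0" for t unfolding mem_Collect_eq prod0 by blast
        have "\<exists>g. (\<forall>b<r. g b < dim_col A) \<and> fun_det r (\<lambda>i b. restricted_eval (A $$ (i, g b)) (D i) y) \<noteq> 0"
        proof (rule minor_dominates_nondegenerate[where I = "component N"])
          show "A $$ (i, j) \<in> component N i" if "i < r" "j < dim_col A" for i j
            by (rule generating_matrix_entry[OF A(1) that])
          fix V :: "'n germ fract set" and k
          assume V: "V \<in> intermediate_rings" and k: "\<And>i. i < r \<Longrightarrow> real_exponent (k i) \<in> ?P i"
          have "\<forall>i<r. real_exponent (k i) \<in> ?P i" by (intro allI impI k)
          then show "\<exists>g. (\<forall>b<r. g b < dim_col A) \<and> fun_det r (\<lambda>i b. A $$ (i, g b)) \<noteq> 0 \<and>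
             to_fract (germ_monomial (\<Sum>i<r. k i)) / to_fract (fun_det r (\<lambda>i b. A $$ (i, g b))) \<in> V"
            using dom V unfolding minors_dominate_def by blast
        next
          show "D i \<in> compact_faces (?P i)" if "i < r" for i using D that by simp
          show "(\<Sum>i<r. D i) \<in> compact_faces (\<Sum>i<r. ?P i)"
            using \<Delta> unfolding module_newton_polyhedron_def by simp
        qed (rule r y0)+
        then show False using y unfolding mem_Collect_eq rank_less_iff[OF r] by blast
      qed
    qed
  qed
qed

section \<open>Passage between a module and its row ideals\<close>

context full_rank_module
begin

lemma submodule_subset_closure: "N \<subseteq> integral_closure r N"
proof
  fix v assume v: "v \<in> N"
  note dim = submoduleD(1)[OF submodule v]
  have "map_vec to_fract v \<in> extended_submodule V r N" if V: "V \<in> intermediate_rings" for V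
    by (rule extended_submoduleI[OF intermediate_ringsD(1)[OF V], of "{()}" "\<lambda>_. v" _ "\<lambda>_. 1"])
      (use v dim valuation_subring_closed(1)[OF intermediate_ringsD(1)[OF V]] in auto)
  with dim show "v \<in> integral_closure r N" by (simp add: integral_closure_def)
qed

lemma component_ideal_vecs: "component (ideal_vecs I) 0 = I"
  by (auto simp: component_def ideal_vecs_def image_image)

text \<open>The \<open>i\<close>-th coordinate of a \<open>V\<close>-combination of members is a
  \<open>V\<close>-combination of elements of the \<open>i\<close>-th row ideal.\<close>

lemma integral_imp_component_integral:
  assumes Q: "monomially_integral r N" and i: "i < r"
  shows "monomially_integral 1 (ideal_vecs (component N i))"
  unfolding monomially_integral_def
proof (intro ballI allI impI)
  fix V :: "'n germ fract set" and l :: nat and k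
  assume V: "V \<in> intermediate_rings" and l: "l < 1"
    and k: "real_exponent k \<in> newton_polyhedron (component (ideal_vecs (component N i)) l)"
  have l0: "l = 0" using l by simp
  have "Matrix.vec r (\<lambda>l. if l = i then to_fract (germ_monomial k) else 0) \<in> extended_submodule V r N"
    using Q V i k unfolding monomially_integral_def l0 component_ideal_vecs by blast
  then obtain S c where S: "finite S" "S \<subseteq> N" "c ` S \<subseteq> V"
    "\<forall>j<r. Matrix.vec r (\<lambda>l. if l = i then to_fract (germ_monomial k) else 0) $ j = (\<Sum>m\<in>S. c m * to_fract (m $ j))"
    unfolding extended_submodule_def by (elim CollectE conjE exE)
  show "Matrix.vec 1 (\<lambda>j. if j = l then to_fract (germ_monomial k) else 0) \<in> extended_submodule V 1 (ideal_vecs (component N i))"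
  proof (rule extended_submoduleI[OF intermediate_ringsD(1)[OF V] S(1), of "\<lambda>m. Matrix.vec 1 (\<lambda>_. m $ i)" _ c])
    show "Matrix.vec 1 (\<lambda>_. m $ i) \<in> ideal_vecs (component N i)" "c m \<in> V" if "m \<in> S" for m
      using S(2,3) that by (auto simp: ideal_vecs_def component_def)
    show "Matrix.vec 1 (\<lambda>j. if j = l then to_fract (germ_monomial k) else 0) $ j =
        (\<Sum>m\<in>S. c m * to_fract (Matrix.vec 1 (\<lambda>_. m $ i) $ j))" if "j < 1" for j
      using that S(4)[rule_format, OF i] i by (simp add: l0)
  qed simp
qed

text \<open>Over \<open>V\<close> the monomial is a combination of germs of the \<open>i\<close>-th
  row ideal. By decomposability each such germ, placed in row \<open>i\<close> with zeros elsewhere,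
  belongs to the integral closure, hence to the \<open>V\<close>-span of \<open>N\<close>; the same
  combination then gives the monomial times a unit vector.\<close>

lemma decomposable_imp_integral:
  assumes dec: "decomposable r (integral_closure r N)"
    and Q: "\<And>i. i < r \<Longrightarrow> monomially_integral 1 (ideal_vecs (component N i))"
  shows "monomially_integral r N"
  unfolding monomially_integral_def
proof (intro ballI allI impI)
  fix V :: "'n germ fract set" and i k
  assume V: "V \<in> intermediate_rings" and i: "i < r" and k: "real_exponent k \<in> newton_polyhedron (component N i)"
  obtain A where A: "A \<in> generating_matrices r N" "r \<le> dim_col A" "fun_det r (\<lambda>i b. A $$ (i, b)) \<noteq> 0"
    by (rule nonzero_minor_matrix, rule that)
  have "\<forall>k. real_exponent k \<in> newton_polyhedron (component N i) \<longrightarrow>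
      Matrix.vec 1 (\<lambda>j. if j = 0 then to_fract (germ_monomial k) else 0) \<in> extended_submodule V 1 (ideal_vecs (component N i))"
    using Q[OF i, unfolded monomially_integral_def, rule_format, OF V, of 0] by (simp add: component_ideal_vecs)
  then have "Matrix.vec 1 (\<lambda>j. if j = 0 then to_fract (germ_monomial k) else 0) \<in> extended_submodule V 1 (ideal_vecs (component N i))"
    using k by blast
  then obtain S c where S: "finite S" "S \<subseteq> ideal_vecs (component N i)" "c ` S \<subseteq> V"
    "\<forall>j<1. Matrix.vec 1 (\<lambda>j. if j = 0 then to_fract (germ_monomial k) else 0) $ j = (\<Sum>m\<in>S. c m * to_fract (m $ j))"
    unfolding extended_submodule_def by (elim CollectE conjE exE)
  have sum: "to_fract (germ_monomial k) = (\<Sum>m\<in>S. c m * to_fract (m $ 0))" using S(4) by simp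
  let ?u = "\<lambda>m. Matrix.vec r (\<lambda>l. if l = i then m $ 0 else 0) :: 'n germ vec"
  have u: "map_vec to_fract (?u m) \<in> extended_submodule V r N" if m: "m \<in> S" for m
  proof -
    from S(2) m obtain v where v: "v \<in> N" "m $ 0 = v $ i" by (auto simp: ideal_vecs_def component_def)
    have "m $ 0 \<in> component (integral_closure r N) i"
      using v submodule_subset_closure by (auto simp: component_def)
    moreover have "0 \<in> component (integral_closure r N) l" if "l < r" for l
      unfolding component_def using submoduleD(2)[OF submodule] submodule_subset_closure that
      by (intro image_eqI[of _ _ "0\<^sub>v r"]) auto
    ultimately have "?u m \<in> direct_sum r (component (integral_closure r N))"
      by (simp add: direct_sum_def)
    then have "?u m \<in> integral_closure r N" using dec unfolding decomposable_def by blast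
    then show ?thesis using V by (simp add: integral_closure_def)
  qed
  show "Matrix.vec r (\<lambda>l. if l = i then to_fract (germ_monomial k) else 0) \<in> extended_submodule V r N"
  proof (rule extended_submodule_trans[OF V A(1) S(1) u, of "\<lambda>m. m" c])
    show "c m \<in> V" if "m \<in> S" for m using S(3) that by blast
    show "Matrix.vec r (\<lambda>l. if l = i then to_fract (germ_monomial k) else 0) $ j =
        (\<Sum>m\<in>S. c m * map_vec to_fract (?u m) $ j)" if "j < r" for j
      using that by (simp add: sum)
  qed simp_all
qed

end

section \<open>The rank and the projections of a module\<close>

lemma component_projection:
  assumes "j < card L"
  shows "component (projection L M) j = component M (pick L j)"
  using assms by (simp add: component_def projection_def image_image)

lemma pick_in: "finite L \<Longrightarrow> j < card L \<Longrightarrow> pick L j \<in> L"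
  using pick_bij(2)[of L] by blast

lemma projection_submodule:
  assumes M: "is_submodule p M" and L: "L \<subseteq> {..<p}"
  shows "is_submodule (card L) (projection L M)"
proof -
  let ?P = "\<lambda>h. Matrix.vec (card L) (\<lambda>j. h $ pick L j)"
  have fin: "finite L" using L by (rule finite_subset) simp
  have pick: "pick L j < p" if "j < card L" for j using pick_in[OF fin that] L by blast
  have zero: "?P (0\<^sub>v p) = 0\<^sub>v (card L)" using pick by (intro eq_vecI) auto
  have add: "?P v + ?P w = ?P (v + w)" if "v \<in> M" "w \<in> M" for v w
    using pick submoduleD(1)[OF M that(1)] submoduleD(1)[OF M that(2)] by (intro eq_vecI) auto
  have smult: "c \<cdot>\<^sub>v ?P v = ?P (c \<cdot>\<^sub>v v)" if "v \<in> M" for v c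
    using pick submoduleD(1)[OF M that] by (intro eq_vecI) auto
  show ?thesis
    unfolding is_submodule_iff
  proof (intro conjI ballI allI)
    show "projection L M \<subseteq> carrier_vec (card L)" by (auto simp: projection_def)
    show "0\<^sub>v (card L) \<in> projection L M"
      unfolding projection_def zero[symmetric] by (rule imageI[OF submoduleD(2)[OF M]])
  next
    fix x y assume "x \<in> projection L M" "y \<in> projection L M"
    then obtain v w where vw: "v \<in> M" "w \<in> M" "x = ?P v" "y = ?P w" unfolding projection_def by blast
    show "x + y \<in> projection L M"
      unfolding vw(3,4) add[OF vw(1,2)] projection_def by (rule imageI[OF submoduleD(3)[OF M vw(1,2)]])
  next
    fix c x assume "x \<in> projection L M"
    then obtain v where v: "v \<in> M" "x = ?P v" unfolding projection_def by blast
    show "c \<cdot>\<^sub>v x \<in> projection L M"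
      unfolding v(2) smult[OF v(1)] projection_def by (rule imageI[OF submoduleD(4)[OF M v(1)]])
  qed
qed

lemma projection_lessThan:
  assumes "is_submodule p M"
  shows "projection {..<p} M = M"
proof -
  have "Matrix.vec p (\<lambda>j. h $ pick {..<p} j) = h" if "h \<in> M" for h
    using submoduleD(1)[OF assms that] by (intro eq_vecI) (auto simp: pick_lessThan)
  then show ?thesis unfolding projection_def by simp
qed

lemma ideal_vecs_submodule:
  assumes M: "is_submodule p M" and i: "i < p"
  shows "is_submodule 1 (ideal_vecs (component M i))"
proof -
  let ?v = "\<lambda>h. Matrix.vec 1 (\<lambda>_. h $ i)"
  have eq: "ideal_vecs (component M i) = ?v ` M" by (simp add: ideal_vecs_def component_def image_image)
  have add: "?v v + ?v w = ?v (v + w)" if "v \<in> M" "w \<in> M" for v w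
    using i submoduleD(1)[OF M that(1)] submoduleD(1)[OF M that(2)] by (intro eq_vecI) auto
  have smult: "c \<cdot>\<^sub>v ?v v = ?v (c \<cdot>\<^sub>v v)" if "v \<in> M" for v c
    using i submoduleD(1)[OF M that] by (intro eq_vecI) auto
  have zero: "?v (0\<^sub>v p) = 0\<^sub>v 1" using i by (intro eq_vecI) auto
  show ?thesis
    unfolding is_submodule_iff eq
  proof (intro conjI ballI allI)
    show "?v ` M \<subseteq> carrier_vec 1" by auto
    show "0\<^sub>v 1 \<in> ?v ` M" unfolding zero[symmetric] by (rule imageI[OF submoduleD(2)[OF M]])
  next
    fix x y assume "x \<in> ?v ` M" "y \<in> ?v ` M"
    then obtain v w where vw: "v \<in> M" "w \<in> M" "x = ?v v" "y = ?v w" by blast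
    show "x + y \<in> ?v ` M" unfolding vw(3,4) add[OF vw(1,2)] by (rule imageI[OF submoduleD(3)[OF M vw(1,2)]])
  next
    fix c x assume "x \<in> ?v ` M"
    then obtain v where v: "v \<in> M" "x = ?v v" by blast
    show "c \<cdot>\<^sub>v x \<in> ?v ` M" unfolding v(2) smult[OF v(1)] by (rule imageI[OF submoduleD(4)[OF M v(1)]])
  qed
qed

text \<open>The nonzero entry in row \<open>i\<close> is a minor of size \<open>1\<close>. It grows
  to one of size \<open>module_rank p M\<close> without losing that row.\<close>

lemma nonzero_minor_rows_cover:
  fixes M :: "'n :: finite germ vec set"
  assumes M: "is_submodule p M" and h: "h \<in> M" "i < p" "h $ i \<noteq> 0"
  shows "\<exists>L\<in>nonzero_minor_rows p M. i \<in> L"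
proof -
  define W where "W = map_vec to_fract ` M"
  have dim: "v \<in> carrier_vec p" if "v \<in> M" for v using that by (rule submoduleD(1)[OF M])
  have W: "W \<subseteq> carrier_vec p" using dim by (auto simp: W_def)
  obtain s f g where s: "1 \<le> s" "fun_det s (\<lambda>a b. g b $ f a) \<noteq> 0" "\<And>a. a < s \<Longrightarrow> f a < p"
    "\<And>b. b < s \<Longrightarrow> g b \<in> W" "f 0 = i" "module_rank p M = s"
  proof (rule exists_maximal_minor[OF W, of 1 "\<lambda>_. map_vec to_fract h" "\<lambda>_. i"])
    have "map_vec to_fract h $ i = to_fract (h $ i)" using dim[OF h(1)] h(2) by simp
    then show "fun_det 1 (\<lambda>a b. map_vec to_fract h $ i) \<noteq> 0" using h(3) by (simp add: det_single)
    show "i < p" by (rule h)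
    show "map_vec to_fract h \<in> W" unfolding W_def using h(1) by (rule imageI)
  qed (simp, rule that, assumption+, simp add: module_rank_def W_def)
  have "\<forall>b\<in>{..<s}. \<exists>v. v \<in> M \<and> g b = map_vec to_fract v" using s(4) unfolding W_def by blast
  from bchoice[OF this] obtain v where v: "\<forall>b\<in>{..<s}. v b \<in> M \<and> g b = map_vec to_fract (v b)" ..
  let ?F = "\<lambda>i b. to_fract (v b $ i)"
  have "fun_det s (\<lambda>a b. ?F (f a) b) = fun_det s (\<lambda>a b. g b $ f a)"
  proof (rule fun_det_cong)
    fix a b assume ab: "a < s" "b < s"
    then have "v b \<in> carrier_vec p" using v dim by blast
    then show "?F (f a) b = g b $ f a" using v ab s(3)[OF ab(1)] by simp
  qed
  then have nz: "fun_det s (\<lambda>a b. ?F (f a) b) \<noteq> 0" using s(2) by simp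
  have inj: "inj_on f {..<s}" using fun_det_nonzero_inj(1)[of s ?F f "\<lambda>b. b"] nz by simp
  define L where "L = f ` {..<s}"
  have L: "finite L" "card L = s" "L \<subseteq> {..<p}" "i \<in> L"
    using inj s(1,3,5) by (auto simp: L_def card_image intro: image_eqI[of _ _ 0])
  have img: "f ` {..<s} = pick L ` {..<s}" using pick_bij(2)[OF L(1)] L(2) by (simp add: L_def)
  \<comment> \<open>The minor that has grown may list its rows in any order; the submatrix in
    \<open>nonzero_minor_rows\<close> takes them in increasing order.\<close>
  have nz': "fun_det s (\<lambda>a b. ?F (pick L a) b) \<noteq> 0"
    by (rule fun_det_reindex[where F = ?F and f = f and f' = "pick L" and g = "\<lambda>b. b" and g' = "\<lambda>b. b"])
      (use img nz in simp_all)
  obtain A where A: "A \<in> generating_matrices p M" "s \<le> dim_col A" "\<And>i b. i < p \<Longrightarrow> b < s \<Longrightarrow> A $$ (i, b) = v b $ i"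
  proof (rule exists_generating_matrix[OF M, of s v])
    show "v b \<in> M" if "b < s" for b using v that by simp
  qed (rule that)
  have "Determinant.det (submatrix A L {..<s}) = fun_det s (\<lambda>a b. A $$ (pick L a, pick {..<s} b))"
    by (rule submatrix_det[OF generating_matrixD(1)[OF A(1)] L(3,2)]) (use A(2) in auto)
  also have "\<dots> = fun_det s (\<lambda>a b. v b $ pick L a)"
  proof (rule fun_det_cong)
    fix a b assume ab: "a < s" "b < s"
    then have "pick L a < p" using pick_in[OF L(1), of a] L(2,3) by auto
    then show "A $$ (pick L a, pick {..<s} b) = v b $ pick L a" using A(3) ab by (simp add: pick_lessThan)
  qed
  finally have "Determinant.det (submatrix A L {..<s}) \<noteq> 0"
    using nz' unfolding fun_det_hom[OF to_fract_hom] by simp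
  then have "L \<in> nonzero_minor_rows p M"
    unfolding nonzero_minor_rows_def s(6) using A(1,2) L(2,3)
    by (intro CollectI conjI bexI[OF _ A(1)] exI[of _ "{..<s}"]) auto
  then show ?thesis using L(4) by blast
qed

lemma nonzero_submodule_entry:
  assumes M: "is_submodule p M" "M \<noteq> {0\<^sub>v p}"
  obtains h i where "h \<in> M" "i < p" "h $ i \<noteq> 0"
proof -
  obtain h where h: "h \<in> M" "h \<noteq> 0\<^sub>v p" using M(2) submoduleD(2)[OF M(1)] by blast
  have "\<exists>i<p. h $ i \<noteq> 0"
  proof (rule ccontr)
    assume *: "\<not> ?thesis"
    have "h = 0\<^sub>v p" by (rule eq_vecI) (use submoduleD(1)[OF M(1) h(1)] * in auto)
    with h(2) show False ..
  qed
  then show ?thesis using h(1) that by blast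
qed

lemma full_rank_projection:
  fixes M :: "'n :: finite germ vec set"
  assumes M: "is_submodule p M" "M \<noteq> {0\<^sub>v p}" and L: "L \<in> nonzero_minor_rows p M"
  obtains h where "full_rank_module (module_rank p M) (projection L M) h"
proof -
  let ?r = "module_rank p M"
  from L obtain A J where LA: "L \<subseteq> {..<p}" "card L = ?r" "A \<in> generating_matrices p M"
    "J \<subseteq> {..<dim_col A}" "card J = ?r" "Determinant.det (submatrix A L J) \<noteq> 0"
    unfolding nonzero_minor_rows_def by blast
  have fin: "finite L" "finite J" using LA(1,4) by (auto intro: finite_subset)
  have pick: "pick L a < p" "pick J a < dim_col A" if "a < ?r" for a
    using pick_in[OF fin(1), of a] pick_in[OF fin(2), of a] LA that by auto
  obtain h0 i where hi: "h0 \<in> M" "i < p" "h0 $ i \<noteq> 0" by (rule nonzero_submodule_entry[OF M], rule that)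
  obtain L' where L': "L' \<in> nonzero_minor_rows p M" "i \<in> L'" using nonzero_minor_rows_cover[OF M(1) hi] by blast
  have "finite L'" "card L' = ?r" using L'(1) by (auto simp: nonzero_minor_rows_def intro: finite_subset)
  \<comment> \<open>A nonzero entry lies in some admissible row set, all of which have
    \<open>module_rank p M\<close> elements; so the rank is positive.\<close>
  then have r: "0 < ?r" using L'(2) by (metis card_gt_0_iff empty_iff)
  define h where "h b = Matrix.vec (card L) (\<lambda>a. col A (pick J b) $ pick L a)" for b
  have "full_rank_module ?r (projection L M) h"
  proof
    show "is_submodule ?r (projection L M)" using projection_submodule[OF M(1) LA(1)] LA(2) by simp
    show "0 < ?r" by (rule r)
    show "h b \<in> projection L M" if "b < ?r" for b
      unfolding h_def projection_def by (rule imageI) (rule generating_matrix_col[OF LA(3) pick(2)[OF that]])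
    have "fun_det ?r (\<lambda>i b. h b $ i) = fun_det ?r (\<lambda>a b. A $$ (pick L a, pick J b))"
      by (rule fun_det_cong) (use pick LA(2) generating_matrixD(3)[OF LA(3)] in \<open>simp add: h_def\<close>)
    also have "\<dots> = Determinant.det (submatrix A L J)"
      by (rule submatrix_det[OF generating_matrixD(1)[OF LA(3)] LA(1,2,4,5), symmetric])
    finally show "fun_det ?r (\<lambda>i b. h b $ i) \<noteq> 0" using LA(6) by simp
  qed
  then show ?thesis by (rule that)
qed

text \<open>In maximal rank the only row set is \<open>{..<p}\<close>, and its projection is
  \<open>M\<close> itself, so the two cases of the definition take the same form.\<close>

lemma newton_nondegenerate_iff:
  fixes M :: "'n :: finite germ vec set"
  assumes M: "is_submodule p M" "M \<noteq> {0\<^sub>v p}"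
  shows "newton_nondegenerate p M \<longleftrightarrow> (\<forall>L\<in>nonzero_minor_rows p M. monomially_integral (module_rank p M) (projection L M))"
proof -
  let ?r = "module_rank p M"
  have iff: "newton_nondegenerate_full_rank ?r (projection L M) \<longleftrightarrow> monomially_integral ?r (projection L M)"
    if L: "L \<in> nonzero_minor_rows p M" for L
  proof -
    obtain h where "full_rank_module ?r (projection L M) h" by (rule full_rank_projection[OF M L], rule that)
    then show ?thesis by (rule full_rank_module.nondegenerate_iff)
  qed
  then have all: "(\<forall>L\<in>nonzero_minor_rows p M. newton_nondegenerate_full_rank ?r (projection L M)) \<longleftrightarrow>
      (\<forall>L\<in>nonzero_minor_rows p M. monomially_integral ?r (projection L M))"
    by (intro ball_cong refl)
  show ?thesis
  proof (cases "?r = p")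
    case True
    obtain h i where hi: "h \<in> M" "i < p" "h $ i \<noteq> 0" by (rule nonzero_submodule_entry[OF M], rule that)
    have "nonzero_minor_rows p M \<noteq> {}" using nonzero_minor_rows_cover[OF M(1) hi] by blast
    moreover have "L = {..<p}" if "L \<in> nonzero_minor_rows p M" for L
      using that True by (intro card_subset_eq) (auto simp: nonzero_minor_rows_def)
    ultimately have "nonzero_minor_rows p M = {{..<p}}" by blast
    then have "(\<forall>L\<in>nonzero_minor_rows p M. newton_nondegenerate_full_rank ?r (projection L M)) \<longleftrightarrow>
        newton_nondegenerate_full_rank p M"
      using projection_lessThan[OF M(1)] True by simp
    then show ?thesis unfolding all[symmetric] newton_nondegenerate_def using M(2) True by simp
  next
    case False
    then show ?thesis unfolding all[symmetric] newton_nondegenerate_def using M(2) by simp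
  qed
qed

text \<open>A nonzero ideal has rank \<open>1\<close>, and its only row set is the single row, so
  the general characterisation specialises to the ideal itself.\<close>

lemma ideal_newton_nondegenerate_iff:
  fixes M :: "'n :: finite germ vec set"
  assumes M: "is_submodule p M" and i: "i < p" and f: "f \<in> component M i" "f \<noteq> 0"
  shows "newton_nondegenerate 1 (ideal_vecs (component M i)) \<longleftrightarrow> monomially_integral 1 (ideal_vecs (component M i))"
proof -
  let ?J = "ideal_vecs (component M i)"
  note J = ideal_vecs_submodule[OF M i]
  have fJ: "Matrix.vec 1 (\<lambda>_. f) \<in> ?J" unfolding ideal_vecs_def using f(1) by (rule imageI)
  have f0: "Matrix.vec 1 (\<lambda>_. f) $ 0 \<noteq> 0" using f(2) by simp
  have J0: "?J \<noteq> {0\<^sub>v 1}"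
  proof
    assume "?J = {0\<^sub>v 1}"
    then have "Matrix.vec 1 (\<lambda>_. f) = 0\<^sub>v 1" using fJ by simp
    then show False using f0 by simp
  qed
  obtain L where L: "L \<in> nonzero_minor_rows 1 ?J" "0 \<in> L"
    using nonzero_minor_rows_cover[OF J fJ _ f0] by auto
  have rows: "L' = {..<1}" if "L' \<in> nonzero_minor_rows 1 ?J" "module_rank 1 ?J = 1" for L'
    using that by (intro card_subset_eq) (auto simp: nonzero_minor_rows_def)
  have "L \<subseteq> {..<1}" "card L = module_rank 1 ?J" using L(1) by (simp_all add: nonzero_minor_rows_def)
  moreover from this(1) L(2) have "L = {..<1}" by auto
  ultimately have rank: "module_rank 1 ?J = 1" by simp
  have "nonzero_minor_rows 1 ?J = {{..<1}}" using rows[OF _ rank] L(1) by blast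
  then show ?thesis unfolding newton_nondegenerate_iff[OF J J0] rank using projection_lessThan[OF J] by simp
qed

lemma ideal_product_pick:
  assumes L: "finite L" "card L = r"
  shows "ideal_product L I = generated_ideal {\<Prod>j<r. f j | f. \<forall>j<r. f j \<in> I (pick L j)}"
proof -
  note b = pick_bij[OF L(1), unfolded L(2)]
  have bij: "bij_betw (pick L) {..<r} L" using b by (simp add: bij_betw_def)
  have "{\<Prod>i\<in>L. f i | f. \<forall>i\<in>L. f i \<in> I i} = {\<Prod>j<r. f j | f. \<forall>j<r. f j \<in> I (pick L j)}"
  proof (intro equalityI subsetI)
    fix x assume "x \<in> {\<Prod>i\<in>L. f i | f. \<forall>i\<in>L. f i \<in> I i}"
    then obtain f where f: "x = (\<Prod>i\<in>L. f i)" "\<forall>i\<in>L. f i \<in> I i" by blast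
    have "x = (\<Prod>j<r. f (pick L j))" unfolding f(1) by (rule prod.reindex_bij_betw[OF bij, symmetric])
    moreover have "\<forall>j<r. f (pick L j) \<in> I (pick L j)" using f(2) pick_in[OF L(1)] L(2) by simp
    ultimately show "x \<in> {\<Prod>j<r. f j | f. \<forall>j<r. f j \<in> I (pick L j)}" by blast
  next
    fix x assume "x \<in> {\<Prod>j<r. f j | f. \<forall>j<r. f j \<in> I (pick L j)}"
    then obtain f where f: "x = (\<Prod>j<r. f j)" "\<forall>j<r. f j \<in> I (pick L j)" by blast
    let ?g = "\<lambda>i. f (inv_into {..<r} (pick L) i)"
    have g: "?g (pick L j) = f j" if "j < r" for j using that b(1) by simp
    have "(\<Prod>i\<in>L. ?g i) = (\<Prod>j<r. ?g (pick L j))" by (rule prod.reindex_bij_betw[OF bij, symmetric])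
    then have "x = (\<Prod>i\<in>L. ?g i)" unfolding f(1) using g by simp
    moreover have "\<forall>i\<in>L. ?g i \<in> I i"
    proof
      fix i assume "i \<in> L"
      then obtain j where "j < r" "i = pick L j" using b(2) by auto
      then show "?g i \<in> I i" using f(2) g by simp
    qed
    ultimately show "x \<in> {\<Prod>i\<in>L. f i | f. \<forall>i\<in>L. f i \<in> I i}"
      by (intro CollectI exI[of _ ?g]) simp
  qed
  then show ?thesis unfolding ideal_product_def by simp
qed

lemma direct_sum_cong: "(\<And>j. j < q \<Longrightarrow> N j = N' j) \<Longrightarrow> direct_sum q N = direct_sum q N'"
  by (auto simp: direct_sum_def)

lemma direct_sum_decomposable:
  assumes "\<And>j. j < q \<Longrightarrow> (0 :: 'a :: zero) \<in> C j"
  shows "decomposable q (direct_sum q C)"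
proof -
  have "component (direct_sum q C) j = C j" if j: "j < q" for j
  proof (intro equalityI subsetI)
    fix x assume "x \<in> C j"
    then have "Matrix.vec q (\<lambda>l. if l = j then x else 0) \<in> direct_sum q C"
      using assms by (simp add: direct_sum_def)
    then show "x \<in> component (direct_sum q C) j"
      unfolding component_def using j by (intro image_eqI[of _ _ "Matrix.vec q (\<lambda>l. if l = j then x else 0)"]) simp_all
  qed (use j in \<open>auto simp: component_def direct_sum_def\<close>)
  then show ?thesis unfolding decomposable_def by (rule direct_sum_cong[OF sym])
qed

theorem corollary4p17:
  fixes M :: "'n::finite germ vec set" and p :: nat
  assumes "is_submodule p M" and "M \<noteq> {0\<^sub>v p}"
  shows "(newton_nondegenerate p M
     \<longleftrightarrow>
      (\<forall>L\<in>nonzero_minor_rows p M.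
         ideal_integral_closure (minors_ideal (module_rank p M) (module_rank p M) (projection L M)) =
         ideal_integral_closure (ideal_product L (\<lambda>i. monomial_closure (component M i)))))
    \<and>
     ((\<forall>L\<in>nonzero_minor_rows p M.
         ideal_integral_closure (minors_ideal (module_rank p M) (module_rank p M) (projection L M)) =
         ideal_integral_closure (ideal_product L (\<lambda>i. monomial_closure (component M i))))
     \<longleftrightarrow>
      (\<forall>L\<in>nonzero_minor_rows p M.
         integral_closure (module_rank p M) (projection L M) =
         direct_sum (module_rank p M) (\<lambda>j. monomial_closure (component M (pick L j)))))
    \<and>
     ((\<forall>L\<in>nonzero_minor_rows p M.
         integral_closure (module_rank p M) (projection L M) =
         direct_sum (module_rank p M) (\<lambda>j. monomial_closure (component M (pick L j))))
     \<longleftrightarrow>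
      (integrally_decomposable p M \<and>
       (\<forall>i<p. newton_nondegenerate 1 (ideal_vecs (component M i)))))"
proof -
  let ?r = "module_rank p M"
  let ?Q = "\<lambda>L. monomially_integral ?r (projection L M)"
  have L: "L \<subseteq> {..<p}" "card L = ?r" "finite L" if "L \<in> nonzero_minor_rows p M" for L
    using that by (auto simp: nonzero_minor_rows_def intro: finite_subset)
  have full: "\<exists>h. full_rank_module ?r (projection L M) h" if "L \<in> nonzero_minor_rows p M" for L
    by (rule full_rank_projection[OF assms that], rule exI)
  have ds: "direct_sum ?r (\<lambda>j. monomial_closure (component M (pick L j))) =
      direct_sum ?r (\<lambda>j. monomial_closure (component (projection L M) j))" if "L \<in> nonzero_minor_rows p M" for L
    by (rule direct_sum_cong) (simp add: component_projection L(2)[OF that])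
  have P2: "ideal_integral_closure (minors_ideal ?r ?r (projection L M)) =
      ideal_integral_closure (ideal_product L (\<lambda>i. monomial_closure (component M i))) \<longleftrightarrow> ?Q L"
    if LM: "L \<in> nonzero_minor_rows p M" for L
  proof -
    from full[OF LM] obtain h where "full_rank_module ?r (projection L M) h" ..
    from full_rank_module.minors_ideal_closure_iff[OF this]
    show ?thesis unfolding ideal_product_pick[OF L(3,2)[OF LM]] using component_projection[of _ L M] L(2)[OF LM] by (simp cong: conj_cong)
  qed
  have P3: "integral_closure ?r (projection L M) = direct_sum ?r (\<lambda>j. monomial_closure (component M (pick L j))) \<longleftrightarrow> ?Q L"
    if LM: "L \<in> nonzero_minor_rows p M" for L
  proof -
    from full[OF LM] obtain h where "full_rank_module ?r (projection L M) h" ..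
    from full_rank_module.integral_closure_eq_iff[OF this] show ?thesis unfolding ds[OF LM] .
  qed
  \<comment> \<open>Conditions (2) and (3) match (Q) for each \<open>L\<close> separately. Condition
    (4) does so only jointly, since it concerns every row of \<open>M\<close>.\<close>
  have P4: "(\<forall>L\<in>nonzero_minor_rows p M. ?Q L) \<longleftrightarrow>
      integrally_decomposable p M \<and> (\<forall>i<p. newton_nondegenerate 1 (ideal_vecs (component M i)))"
  proof (intro iffI conjI allI impI)
    assume Q: "\<forall>L\<in>nonzero_minor_rows p M. ?Q L"
    show "integrally_decomposable p M"
      unfolding integrally_decomposable_def
    proof
      fix L assume LM: "L \<in> nonzero_minor_rows p M"
      have "integral_closure ?r (projection L M) = direct_sum ?r (\<lambda>j. monomial_closure (component M (pick L j)))"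
        using P3[OF LM] Q LM by blast
      then show "decomposable (card L) (integral_closure (card L) (projection L M))"
        unfolding L(2)[OF LM] using direct_sum_decomposable[OF monomial_closure_0] by simp
    qed
    fix i assume i: "i < p"
    show "newton_nondegenerate 1 (ideal_vecs (component M i))"
    proof (cases "\<exists>h\<in>M. h $ i \<noteq> 0")
      case True
      then obtain h where h: "h \<in> M" "h $ i \<noteq> 0" by blast
      \<comment> \<open>Every nonzero row belongs to some admissible row set and inherits (Q) from
        that projection.\<close>
      obtain L0 where L0: "L0 \<in> nonzero_minor_rows p M" "i \<in> L0" using nonzero_minor_rows_cover[OF assms(1) h(1) i h(2)] by blast
      have "i \<in> pick L0 ` {..<?r}" using pick_bij(2)[OF L(3)[OF L0(1)]] L(2)[OF L0(1)] L0(2) by simp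
      then obtain j where j: "j < ?r" "i = pick L0 j" by blast
      from full[OF L0(1)] obtain h' where fr: "full_rank_module ?r (projection L0 M) h'" ..
      have "?Q L0" using Q L0(1) by blast
      from full_rank_module.integral_imp_component_integral[OF fr this j(1)]
      have "monomially_integral 1 (ideal_vecs (component M i))"
        using component_projection[of j L0 M] L(2)[OF L0(1)] j by simp
      moreover have "h $ i \<in> component M i" unfolding component_def using h(1) by (rule imageI)
      ultimately show ?thesis using ideal_newton_nondegenerate_iff[OF assms(1) i _ h(2)] by blast
    next
      case False
      \<comment> \<open>A zero row lies in no admissible row set; its ideal is zero and
        non-degenerate by convention.\<close>
      then have "component M i = {0}" using submoduleD(2)[OF assms(1)] i by (force simp: component_def)
      then have "ideal_vecs (component M i) = {0\<^sub>v 1}" by (simp add: ideal_vecs_def zero_vec_def)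
      then show ?thesis by (simp add: newton_nondegenerate_def)
    qed
  next
    assume R: "integrally_decomposable p M \<and> (\<forall>i<p. newton_nondegenerate 1 (ideal_vecs (component M i)))"
    show "\<forall>L\<in>nonzero_minor_rows p M. ?Q L"
    proof
      fix L0 assume L0: "L0 \<in> nonzero_minor_rows p M"
      from full[OF L0] obtain h where fr: "full_rank_module ?r (projection L0 M) h" ..
      show "?Q L0"
      proof (rule full_rank_module.decomposable_imp_integral[OF fr])
        have "decomposable (card L0) (integral_closure (card L0) (projection L0 M))"
          using R L0 unfolding integrally_decomposable_def by blast
        then show "decomposable ?r (integral_closure ?r (projection L0 M))" unfolding L(2)[OF L0] .
        fix j assume j: "j < ?r"
        have cp: "component (projection L0 M) j = component M (pick L0 j)"
          using j L(2)[OF L0] by (simp add: component_projection)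
        have i: "pick L0 j < p" using pick_in[OF L(3)[OF L0], of j] L(1,2)[OF L0] j by auto
        obtain f where f: "f \<in> component M (pick L0 j)" "f \<noteq> 0"
          using full_rank_module.nonzero_component[OF fr j] unfolding cp by blast
        show "monomially_integral 1 (ideal_vecs (component (projection L0 M) j))"
          unfolding cp using ideal_newton_nondegenerate_iff[OF assms(1) i f] R i by blast
      qed
    qed
  qed
  have eq2: "(\<forall>L\<in>nonzero_minor_rows p M. ideal_integral_closure (minors_ideal ?r ?r (projection L M)) =
      ideal_integral_closure (ideal_product L (\<lambda>i. monomial_closure (component M i)))) \<longleftrightarrow> (\<forall>L\<in>nonzero_minor_rows p M. ?Q L)"
    by (rule ball_cong[OF refl P2])
  have eq3: "(\<forall>L\<in>nonzero_minor_rows p M. integral_closure ?r (projection L M) =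
      direct_sum ?r (\<lambda>j. monomial_closure (component M (pick L j)))) \<longleftrightarrow> (\<forall>L\<in>nonzero_minor_rows p M. ?Q L)"
    by (rule ball_cong[OF refl P3])
  show ?thesis unfolding eq2 eq3 newton_nondegenerate_iff[OF assms] P4[symmetric] by simp
qed

end
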